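(* The following decision problem is \textup{NP}-complete: given a finite region $\Gamma\subset\mathbb{Z}^3$, decide whether $\Gamma$ admits a tiling by slabs, i.e.\ by copies of the $2\times 2\times 1$ brick (rotations and reflections allowed).
   Context: Identify $\mathbb{Z}^3$ with the set of closed unit cubes in $\mathbb{R}^3$ centered at integer lattice points (elements of $\mathbb{Z}^3$ are called cubes). A region is a finite subset of $\mathbb{Z}^3$. A tiling of a region $\Gamma$ by a tile $T$ (here a $2\times2\times1$ box of cubes) is a partition of $\Gamma$ into pairwise disjoint subsets, each of which is an image of $T$ under an isometry of $\mathbb{Z}^3$ (translations, rotations and reflections allowed). *)

theory Defs
  imports
    "HOL-Library.Disjoint_Sets"
    "HOL-Computational_Algebra.Polynomial"
    "HOL-Analysis.Product_Vector"
begin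

section \<open>Tilings of regions\<close>

type_synonym cube = "int \<times> int \<times> int"

definition centre :: "cube \<Rightarrow> real \<times> real \<times> real" where
  "centre = (\<lambda>(x, y, z). (of_int x, of_int y, of_int z))"

definition lattice_isometry :: "(cube \<Rightarrow> cube) \<Rightarrow> bool" where
  "lattice_isometry \<phi> \<longleftrightarrow>
     bij \<phi> \<and> (\<forall>u v. dist (centre (\<phi> u)) (centre (\<phi> v)) = dist (centre u) (centre v))"

definition is_tiling :: "cube set \<Rightarrow> cube set \<Rightarrow> cube set set \<Rightarrow> bool" where
  "is_tiling T \<Gamma> P \<longleftrightarrow>
     partition_on \<Gamma> P \<and> (\<forall>B\<in>P. \<exists>\<phi>. lattice_isometry \<phi> \<and> B = \<phi> ` T)"

definition admits_tiling :: "cube set \<Rightarrow> cube set \<Rightarrow> bool" where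
  "admits_tiling \<Gamma> T \<longleftrightarrow> (\<exists>P. is_tiling T \<Gamma> P)"

definition slab :: "cube set" where
  "slab = {0, 1} \<times> {0, 1} \<times> {0}"


section \<open>Multi-tape Turing machines\<close>

text \<open>
  States and tape symbols are natural numbers; only finitely many of them are relevant to a machine
  because its set of instructions is finite.  An instruction \<open>(q, ss, q', as)\<close> applies in
  state \<open>q\<close> when the \<open>i\<close>-th head scans \<open>ss ! i\<close>; it enters state \<open>q'\<close>, and on the \<open>i\<close>-th tape it
  writes the symbol and performs the move given by \<open>as ! i\<close>.  Several instructions may apply to
  the same configuration, so machines are nondeterministic unless stated otherwise; a machine
  halts when no instruction applies.
\<close>

datatype move = Left | Stay | Right

record tm =
  tapes :: nat
  start :: nat
  accept :: nat
  instructions :: "(nat \<times> nat list \<times> nat \<times> (nat \<times> move) list) set"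

definition wf_tm :: "tm \<Rightarrow> bool" where
  "wf_tm M \<longleftrightarrow>
     tapes M \<ge> 1 \<and> finite (instructions M) \<and>
     (\<forall>(q, ss, q', as) \<in> instructions M.
        q \<noteq> accept M \<and> length ss = tapes M \<and> length as = tapes M)"

definition deterministic :: "tm \<Rightarrow> bool" where
  "deterministic M \<longleftrightarrow>
     (\<forall>q ss q1 as1 q2 as2.
        (q, ss, q1, as1) \<in> instructions M \<and> (q, ss, q2, as2) \<in> instructions M \<longrightarrow>
        q1 = q2 \<and> as1 = as2)"

text \<open>A tape is two-way infinite and consists of its contents and the position of the head.\<close>

type_synonym tape = "(int \<Rightarrow> nat) \<times> int"
type_synonym config = "nat \<times> tape list"

fun scanned :: "tape \<Rightarrow> nat" where
  "scanned (t, i) = t i"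

fun offset :: "move \<Rightarrow> int" where
  "offset Left = -1"
| "offset Stay = 0"
| "offset Right = 1"

fun act :: "tape \<Rightarrow> nat \<times> move \<Rightarrow> tape" where
  "act (t, i) (s, m) = (t(i := s), i + offset m)"

fun step :: "tm \<Rightarrow> config \<Rightarrow> config \<Rightarrow> bool" where
  "step M (q, ts) (q', ts') \<longleftrightarrow>
     (\<exists>as. (q, map scanned ts, q', as) \<in> instructions M \<and> ts' = map2 act ts as)"

definition halted :: "tm \<Rightarrow> config \<Rightarrow> bool" where
  "halted M c \<longleftrightarrow> (\<nexists>c'. step M c c')"

text \<open>Symbol 0 is the blank; the bits \<open>False\<close> and \<open>True\<close> are the symbols 1 and 2.\<close>

definition written :: "bool list \<Rightarrow> int \<Rightarrow> nat" where
  "written w i =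
     (if 0 \<le> i \<and> i < int (length w) then (if w ! nat i then 2 else 1) else 0)"

definition initial :: "tm \<Rightarrow> bool list \<Rightarrow> config" where
  "initial M w = (start M, (written w, 0) # replicate (tapes M - 1) (written [], 0))"


section \<open>NP-completeness\<close>

type_synonym language = "bool list set"

definition runs_in_time :: "tm \<Rightarrow> nat poly \<Rightarrow> bool" where
  "runs_in_time M p \<longleftrightarrow>
     (\<forall>w n c. (step M ^^ n) (initial M w) c \<longrightarrow> n \<le> poly p (length w))"

definition accepts :: "tm \<Rightarrow> bool list \<Rightarrow> bool" where
  "accepts M w \<longleftrightarrow> (\<exists>c. (step M)\<^sup>*\<^sup>* (initial M w) c \<and> fst c = accept M)"

definition NP :: "language set" where
  "NP = {L. \<exists>M p. wf_tm M \<and> runs_in_time M p \<and> (\<forall>w. w \<in> L \<longleftrightarrow> accepts M w)}"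

text \<open>The output of a halting computation is read off the last tape.\<close>

definition computes :: "tm \<Rightarrow> (bool list \<Rightarrow> bool list) \<Rightarrow> bool" where
  "computes M f \<longleftrightarrow>
     (\<forall>w. \<exists>c. (step M)\<^sup>*\<^sup>* (initial M w) c \<and> halted M c \<and> fst (last (snd c)) = written (f w))"

definition polytime_computable :: "(bool list \<Rightarrow> bool list) \<Rightarrow> bool" where
  "polytime_computable f \<longleftrightarrow>
     (\<exists>M p. wf_tm M \<and> deterministic M \<and> runs_in_time M p \<and> computes M f)"

definition polytime_reducible :: "language \<Rightarrow> language \<Rightarrow> bool" where
  "polytime_reducible L L' \<longleftrightarrow>
     (\<exists>f. polytime_computable f \<and> (\<forall>w. w \<in> L \<longleftrightarrow> f w \<in> L'))"

definition NP_hard :: "language \<Rightarrow> bool" where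
  "NP_hard L \<longleftrightarrow> (\<forall>L'\<in>NP. polytime_reducible L' L)"

definition NP_complete :: "language \<Rightarrow> bool" where
  "NP_complete L \<longleftrightarrow> L \<in> NP \<and> NP_hard L"


section \<open>Encoding of regions\<close>

fun nat_bits :: "nat \<Rightarrow> bool list" where
  "nat_bits n = (if n = 0 then [] else odd n # nat_bits (n div 2))"

declare nat_bits.simps [simp del]

definition int_bits :: "int \<Rightarrow> bool list" where
  "int_bits k = (k < 0) # nat_bits (nat \<bar>k\<bar>)"

text \<open>Self-delimiting form: each bit is preceded by \<open>True\<close>, and \<open>False\<close> marks the end.\<close>

definition delimited :: "bool list \<Rightarrow> bool list" where
  "delimited bs = concat (map (\<lambda>b. [True, b]) bs) @ [False]"

definition cube_code :: "cube \<Rightarrow> bool list" where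
  "cube_code = (\<lambda>(x, y, z).
     delimited (int_bits x) @ delimited (int_bits y) @ delimited (int_bits z))"

text \<open>A region is presented by any list with this set of cubes, in any order and possibly with repetitions.\<close>

definition encodes_region :: "bool list \<Rightarrow> cube set \<Rightarrow> bool" where
  "encodes_region w \<Gamma> \<longleftrightarrow> (\<exists>cs. set cs = \<Gamma> \<and> w = concat (map cube_code cs))"

lemma nat_bits_inject: "nat_bits m = nat_bits n \<longleftrightarrow> m = n"
proof (induction m arbitrary: n rule: less_induct)
  case (less m)
  show ?case
  proof (cases "m = 0 \<or> n = 0")
    case True
    then show ?thesis
      using nat_bits.simps[of m] nat_bits.simps[of n] by auto
  next
    case False
    then have "nat_bits m = nat_bits n \<longleftrightarrow> odd m = odd n \<and> m div 2 = n div 2"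
      using less[of "m div 2" "n div 2"] nat_bits.simps[of m] nat_bits.simps[of n] by auto
    also have "\<dots> \<longleftrightarrow> m = n"
      by presburger
    finally show ?thesis .
  qed
qed

lemma int_bits_inject: "int_bits k = int_bits l \<longleftrightarrow> k = l"
  by (auto simp: int_bits_def nat_bits_inject)

lemma delimited_append_inject:
  "delimited bs @ u = delimited bs' @ u' \<longleftrightarrow> bs = bs' \<and> u = u'"
proof (induction bs arbitrary: bs')
  case Nil
  then show ?case by (cases bs') (auto simp: delimited_def)
next
  case (Cons b bs)
  then show ?case by (cases bs') (auto simp: delimited_def)
qed

lemma cube_code_append_inject:
  "cube_code c @ u = cube_code c' @ u' \<longleftrightarrow> c = c' \<and> u = u'"
  by (auto simp: cube_code_def delimited_append_inject int_bits_inject split: prod.splits)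

lemma cube_code_nonempty: "cube_code c \<noteq> []"
  by (auto simp: cube_code_def delimited_def split: prod.splits)

lemma concat_cube_code_inject:
  "concat (map cube_code cs) = concat (map cube_code cs') \<longleftrightarrow> cs = cs'"
proof (induction cs arbitrary: cs')
  case Nil
  then show ?case by (cases cs') (auto simp: cube_code_nonempty)
next
  case (Cons c cs)
  then show ?case by (cases cs') (auto simp: cube_code_nonempty cube_code_append_inject)
qed

lemma encodes_region_unique:
  "encodes_region w \<Gamma> \<Longrightarrow> encodes_region w \<Gamma>' \<Longrightarrow> \<Gamma> = \<Gamma>'"
  by (auto simp: encodes_region_def concat_cube_code_inject)

end

theory Submission imports Defs
begin

text \<open>
  A tiling by slabs amounts to assigning to every cube the position of its slab relative to that
  cube.  Such an assignment has at most as many entries as the encoding has bits and can be checked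
  by comparing the cubes pairwise, which puts the problem in NP.

  For hardness, a computation tableau of a nondeterministic machine is turned into a constraint
  problem on a line of cells: every cell holds a value and satisfies one term out of a finite list
  that depends on the label of the cell.  The region contains a column for every pair of a cell and
  a value, and a row for every term of every cell.  A column is a closed band of cubes with exactly
  two tilings, which tell whether the cell has the value.  The rows of one cell join two common side
  walls, and tiling these walls switches on at least one of the rows; the crossings are shaped so
  that a row that is switched on forces the columns it mentions to be on or off.  The verifier and the reduction are written in a
  small language of stack programs that is compiled to multi-tape Turing machines.
\<close>

section \<open>A stack language and its compilation to Turing machines\<close>

text \<open>Rigid boxes carry truth values through parity. In a band two cubes thick and one wide
  every slab has to span the thickness, so a closed band is tiled like an even cycle by dominoes,
  and its two tilings are the two perfect matchings. A wire crosses the band at heights 0 and 1. If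
  it is on, its slabs straddle both faces of the band and take away the four cubes at these heights;
  the rest of the band then fits only the matching that joins the two heights. Which matching this
  is depends on whether the path descends or climbs there, so a dip meets the wire in one leg or the
  other. A side wall has odd length, with its junctions at even distances from the ends: alone it
  cannot be tiled, and releasing any one junction leaves two even pieces. Blocks measure 4 by 8
  cubes: even, to keep these parities, and powers of two, so that the code of a coordinate is that
  of its block number behind fixed low bits. In the tableau the tapes are stored relative to their
  heads: the heads stay in one column and a move shifts a tape, so local windows suffice although
  the heads of several tapes drift apart.\<close>

datatype stack_op = Nop | Pop | Push nat | Repl nat

type_synonym stacks = "nat \<Rightarrow> nat list"

fun peek :: "nat list \<Rightarrow> nat" where
  "peek [] = 0"
| "peek (a # _) = a"

text \<open>Symbol 0 is the blank and is what \<open>peek\<close> reports at the bottom, so it can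
  never be stored: pushing or writing 0 has no effect, and an empty stack stays empty under
  \<open>Repl\<close>.\<close>

fun app_op :: "stack_op \<Rightarrow> nat list \<Rightarrow> nat list" where
  "app_op Nop xs = xs"
| "app_op Pop xs = tl xs"
| "app_op (Push s) xs = (if s = 0 then xs else s # xs)"
| "app_op (Repl s) xs = (if s = 0 \<or> xs = [] then xs else s # tl xs)"

definition peeks :: "stacks \<Rightarrow> nat \<Rightarrow> nat" where
  "peeks \<sigma> = (\<lambda>i. peek (\<sigma> i))"

lemma peeks_apply [simp]: "peeks \<sigma> i = peek (\<sigma> i)"
  by (simp add: peeks_def)

text \<open>Operations and tests are arbitrary functions of the tuple of top symbols. A machine can
  look them up in its instruction table, because only finitely many tuples occur.\<close>

datatype com =
    Basic "(nat \<Rightarrow> nat) \<Rightarrow> nat \<Rightarrow> stack_op"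
  | Seq com com
  | Cond "(nat \<Rightarrow> nat) \<Rightarrow> bool" com com
  | While "(nat \<Rightarrow> nat) \<Rightarrow> bool" com

fun ctl :: "com list \<Rightarrow> (nat \<Rightarrow> nat) \<Rightarrow> com list" where
  "ctl [] a = []"
| "ctl (Basic f # K) a = K"
| "ctl (Seq c d # K) a = c # d # K"
| "ctl (Cond P c d # K) a = (if P a then c else d) # K"
| "ctl (While P c # K) a = (if P a then c # While P c # K else K)"

fun ops :: "com list \<Rightarrow> (nat \<Rightarrow> nat) \<Rightarrow> nat \<Rightarrow> stack_op" where
  "ops (Basic f # K) a = f a"
| "ops K a = (\<lambda>_. Nop)"

definition nxt :: "com list \<times> stacks \<Rightarrow> com list \<times> stacks" where
  "nxt = (\<lambda>(K, \<sigma>). (ctl K (peeks \<sigma>), \<lambda>i. app_op (ops K (peeks \<sigma>) i) (\<sigma> i)))"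

text \<open>Quantifying over all continuations \<open>K\<close> expresses that a command never
  depends on what follows it; this makes the rules for sequence, test and loop compositional. The
  number \<open>n\<close> is only an upper bound on the steps.\<close>

definition runs :: "com \<Rightarrow> stacks \<Rightarrow> nat \<Rightarrow> stacks \<Rightarrow> bool" where
  "runs c \<sigma> n \<sigma>' \<longleftrightarrow> (\<exists>m\<le>n. \<forall>K. (nxt ^^ m) (c # K, \<sigma>) = (K, \<sigma>'))"

text \<open>The nonempty continuations that can arise while the command runs. There are finitely
  many of them, so they can serve as control states of the compiled machine.\<close>

fun conts :: "com \<Rightarrow> com list set" where
  "conts (Basic f) = {[Basic f]}"
| "conts (Seq c d) = {[Seq c d]} \<union> (\<lambda>k. k @ [d]) ` conts c \<union> conts d"
| "conts (Cond P c d) = {[Cond P c d]} \<union> conts c \<union> conts d"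
| "conts (While P c) = {[While P c]} \<union> (\<lambda>k. k @ [While P c]) ` conts c"

lemma finite_conts: "finite (conts c)"
  by (induction c) auto

lemma self_conts: "[c] \<in> conts c"
  by (cases c) auto

lemma conts_nonempty: "k \<in> conts c \<Longrightarrow> k \<noteq> []"
  by (induction c arbitrary: k) auto

lemma ctl_append: "k \<noteq> [] \<Longrightarrow> ctl (k @ K) a = ctl k a @ K"
  by (induction k a rule: ctl.induct) auto

lemma ctl_conts: "k \<in> conts c \<Longrightarrow> ctl k a \<in> insert [] (conts c)"
proof (induction c arbitrary: k)
  case (Seq c d)
  then consider "k = [Seq c d]" | k' where "k' \<in> conts c" "k = k' @ [d]" | "k \<in> conts d" by auto
  then show ?case
  proof cases
    case 1
    then show ?thesis using self_conts[of c] by (auto simp: image_iff intro!: bexI[of _ "[c]"])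
  next
    case 2
    then have "ctl k a = ctl k' a @ [d]" by (simp add: ctl_append conts_nonempty)
    then show ?thesis using Seq.IH(1)[OF 2(1)] self_conts[of d] by auto
  next
    case 3
    then show ?thesis using Seq.IH(2) by auto
  qed
next
  case (Cond P c d)
  then show ?case using self_conts[of c] self_conts[of d] by auto
next
  case (While P c)
  then consider "k = [While P c]" | k' where "k' \<in> conts c" "k = k' @ [While P c]" by auto
  then show ?case
  proof cases
    case 1
    then show ?thesis using self_conts[of c] by (auto simp: image_iff intro!: bexI[of _ "[c]"])
  next
    case 2
    then have "ctl k a = ctl k' a @ [While P c]" by (simp add: ctl_append conts_nonempty)
    then show ?thesis using While.IH[OF 2(1)] by auto
  qed
qed auto

definition okop :: "nat \<Rightarrow> stack_op \<Rightarrow> bool" where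
  "okop S p \<longleftrightarrow> (\<forall>s. p = Push s \<or> p = Repl s \<longrightarrow> s < S)"

lemma okop_simps [simp]:
  "okop S Nop" "okop S Pop" "okop S (Push s) \<longleftrightarrow> s < S" "okop S (Repl s) \<longleftrightarrow> s < S"
  by (auto simp: okop_def)

fun okc :: "nat \<Rightarrow> nat \<Rightarrow> com \<Rightarrow> bool" where
  "okc k S (Basic f) \<longleftrightarrow>
     (\<forall>a i. (\<forall>i. a i < S) \<longrightarrow> okop S (f a i) \<and> (k \<le> i \<longrightarrow> f a i = Nop))"
| "okc k S (Seq c d) \<longleftrightarrow> okc k S c \<and> okc k S d"
| "okc k S (Cond P c d) \<longleftrightarrow> okc k S c \<and> okc k S d"
| "okc k S (While P c) \<longleftrightarrow> okc k S c"

lemma ops_append: "K \<noteq> [] \<Longrightarrow> ops (K @ K') a = ops K a"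
  by (induction K a rule: ops.induct) auto

lemma ops_conts:
  "okc k S c \<Longrightarrow> K \<in> conts c \<Longrightarrow> (\<And>i. a i < S) \<Longrightarrow>
    okop S (ops K a i) \<and> (k \<le> i \<longrightarrow> ops K a i = Nop)"
  by (induction c arbitrary: K) (auto simp: ops_append conts_nonempty)

section \<open>Control states and tapes of compiled programs\<close>

datatype ctlstate = Init | Ready "com list" | Pend "nat \<Rightarrow> stack_op" "com list" | Acc

text \<open>A machine writes on the scanned square and moves afterwards, so a push takes two steps:
  a move to the right, and a write on the new top square. Every other operation is finished in the
  first step and idles in the second.\<close>

fun phase1 :: "stack_op \<Rightarrow> nat \<Rightarrow> nat \<times> move" where
  "phase1 Nop s = (s, Stay)"
| "phase1 Pop s = (if s = 0 then (0, Stay) else (0, Left))"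
| "phase1 (Push u) s = (s, if u = 0 then Stay else Right)"
| "phase1 (Repl u) s = (if s = 0 \<or> u = 0 then s else u, Stay)"

fun phase2 :: "stack_op \<Rightarrow> nat \<Rightarrow> nat \<times> move" where
  "phase2 (Push u) s = (if u = 0 then s else u, Stay)"
| "phase2 _ s = (s, Stay)"

definition tops_of :: "nat \<Rightarrow> nat list \<Rightarrow> nat \<Rightarrow> nat" where
  "tops_of k ss = (\<lambda>i. if i < k then ss ! i else 0)"

definition words :: "nat \<Rightarrow> nat \<Rightarrow> nat list set" where
  "words k S = {ss. set ss \<subseteq> {..<S} \<and> length ss = k}"

lemma finite_words: "finite (words k S)"
  unfolding words_def by (rule finite_lists_length_eq) simp

text \<open>The bottom of the stack lies on square 0 and the head on the top symbol; for the empty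
  stack the head stands on the blank square -1. So the head always scans exactly what
  \<open>peek\<close> returns.\<close>

definition tape_of :: "nat list \<Rightarrow> tape" where
  "tape_of xs =
     (\<lambda>p. if 0 \<le> p \<and> p < int (length xs) then rev xs ! nat p else 0, int (length xs) - 1)"

lemma scanned_tape_of [simp]: "scanned (tape_of xs) = peek xs"
  by (cases xs) (auto simp: tape_of_def nth_append)

lemma tape_of_write [simp]: "(fst (tape_of xs))(int (length xs) - 1 := peek xs) = fst (tape_of xs)"
  by (rule ext) (cases xs; auto simp: tape_of_def nth_append)

lemma act_stay [simp]: "act (tape_of xs) (peek xs, Stay) = tape_of xs"
  by (cases xs) (auto simp: tape_of_def nth_append fun_eq_iff)

lemma act_two_phases:
  assumes "0 \<notin> set xs"
  shows "act (act (tape_of xs) (phase1 p (peek xs)))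
             (phase2 p (scanned (act (tape_of xs) (phase1 p (peek xs))))) = tape_of (app_op p xs)"
proof (cases p)
  case Nop
  then show ?thesis
    by (cases xs) (auto simp: tape_of_def nth_append fun_eq_iff)
next
  case Pop
  then show ?thesis using assms
    by (cases xs) (auto simp: tape_of_def nth_append fun_eq_iff)
next
  case (Push u)
  then show ?thesis using assms
    by (cases xs) (auto simp: tape_of_def nth_append fun_eq_iff nat_add_distrib)
next
  case (Repl u)
  then show ?thesis using assms
    by (cases xs) (auto simp: tape_of_def nth_append fun_eq_iff)
qed

lemma scanned_phase1:
  assumes "0 \<notin> set xs" "set xs \<subseteq> {..<S}" "0 < S" "okop S p"
  shows "scanned (act (tape_of xs) (phase1 p (peek xs))) < S"
proof -
  have "fst (tape_of xs) i < S" for i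
  proof (cases "0 \<le> i \<and> i < int (length xs)")
    case True
    then have "rev xs ! nat i \<in> set xs" using nth_mem[of "nat i" "rev xs"] by (simp add: nat_less_iff)
    then show ?thesis using True assms(2) by (auto simp: tape_of_def)
  qed (use assms(3) in \<open>auto simp: tape_of_def\<close>)
  moreover have "peek xs < S" using assms by (cases xs) auto
  moreover obtain t i where "tape_of xs = (t, i)" by force
  ultimately show ?thesis using assms(4,3) by (cases p) auto
qed

text \<open>Certifies that a run is forced: each configuration has exactly one successor until the
  machine halts. This speaks about all paths at once, as time bounds and nondeterministic acceptance
  require.\<close>

inductive only :: "tm \<Rightarrow> config \<Rightarrow> nat \<Rightarrow> config \<Rightarrow> bool" for M where
  stop: "halted M c \<Longrightarrow> only M c 0 c"
| go: "(\<And>d. step M c d \<longleftrightarrow> d = c1) \<Longrightarrow> only M c1 n cf \<Longrightarrow> only M c (Suc n) cf"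

lemma only_path: "only M c m cf \<Longrightarrow> (step M ^^ l) c d \<Longrightarrow> l \<le> m \<and> only M d (m - l) cf"
proof (induction arbitrary: l rule: only.induct)
  case (stop c)
  have "l = 0"
  proof (rule ccontr)
    assume "l \<noteq> 0"
    then obtain l' where "l = Suc l'" by (cases l) auto
    then show False using stop relpowp_Suc_D2[of l' "step M" c d] by (auto simp: halted_def)
  qed
  then show ?case using stop by (auto intro: only.stop)
next
  case (go c c1 n cf)
  show ?case
  proof (cases l)
    case 0
    then show ?thesis using go by (auto intro: only.go)
  next
    case (Suc l')
    then show ?thesis using go relpowp_Suc_D2[of l' "step M" c d] by auto
  qed
qed

lemma only_reach: "only M c m cf \<Longrightarrow> (step M)\<^sup>*\<^sup>* c cf \<and> halted M cf"
  by (induction rule: only.induct) (auto intro: converse_rtranclp_into_rtranclp)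

lemma only_halted: "only M c m cf \<Longrightarrow> halted M c \<Longrightarrow> c = cf"
  by (induction rule: only.induct) (auto simp: halted_def)

text \<open>\<open>G\<close> is the alphabet of the guesses. Before the program starts, the machine
  walks over its input and writes one symbol of \<open>G\<close> per input symbol on the second
  tape. A singleton \<open>G\<close> makes the machine deterministic and supplies the input length
  in unary.\<close>

locale machine =
  fixes c :: com and k S :: nat and G :: "nat set"
  assumes ok: "okc k S c" and k2: "2 \<le> k" and S3: "3 \<le> S" and G: "G \<subseteq> {1..<S}"
begin

text \<open>A blank under the first head ends the guessing; all heads then step left, which puts
  them on the top of a nonempty stack and on square -1 of an empty one. At the end of the program
  the machine accepts exactly when the first stack is nonempty.\<close>

definition trans :: "ctlstate \<Rightarrow> nat list \<Rightarrow> (ctlstate \<times> (nat \<times> move) list) set" where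
  "trans q ss = (case q of
     Init \<Rightarrow> if ss ! 0 \<noteq> 0
       then {(Init, (ss ! 0, Right) # (g, Right) # map (\<lambda>s. (s, Stay)) (drop 2 ss)) |g. g \<in> G}
       else {(Ready [c], map (\<lambda>s. (s, Left)) ss)}
   | Ready K \<Rightarrow> if K = [] then (if ss ! 0 \<noteq> 0 then {(Acc, map (\<lambda>s. (s, Stay)) ss)} else {})
       else {(Pend (ops K (tops_of k ss)) (ctl K (tops_of k ss)),
              map (\<lambda>i. phase1 (ops K (tops_of k ss) i) (ss ! i)) [0..<k])}
   | Pend p K \<Rightarrow> {(Ready K, map (\<lambda>i. phase2 (p i) (ss ! i)) [0..<k])}
   | Acc \<Rightarrow> {})"

definition states :: "ctlstate set" where
  "states = {Init, Acc} \<union> Ready ` insert [] (conts c) \<union>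
     (\<lambda>(K, ss). Pend (ops K (tops_of k ss)) (ctl K (tops_of k ss))) ` (insert [] (conts c) \<times> words k S)"

definition enc :: "ctlstate \<Rightarrow> nat" where
  "enc = (SOME f. inj_on f states)"

lemma enc_inj: "inj_on enc states"
proof -
  have "finite states" by (simp add: states_def finite_conts finite_words)
  then obtain f :: "ctlstate \<Rightarrow> nat" where "inj_on f states"
    using finite_imp_inj_to_nat_seg by blast
  then show ?thesis unfolding enc_def by (rule someI[of "\<lambda>f. inj_on f states"])
qed

definition tmach :: tm where
  "tmach = \<lparr>tapes = k, start = enc Init, accept = enc Acc,
     instructions = {(enc q, ss, enc q', as) |q ss q' as.
       q \<in> states \<and> ss \<in> words k S \<and> (q', as) \<in> trans q ss}\<rparr>"

lemma some_states: "Init \<in> states" "Acc \<in> states" "Ready [] \<in> states"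
  by (auto simp: states_def)

lemma enc_eqD: "enc q = enc q' \<Longrightarrow> q \<in> states \<Longrightarrow> q' \<in> states \<Longrightarrow> q = q'"
  using enc_inj by (rule inj_onD)

lemma length_trans: "ss \<in> words k S \<Longrightarrow> (q', as) \<in> trans q ss \<Longrightarrow> length as = k"
  using k2 by (auto simp: trans_def words_def split: ctlstate.splits if_splits)

lemma finite_trans: "finite (trans q ss)"
proof -
  have "finite G" using G finite_subset by blast
  then show ?thesis by (auto simp: trans_def split: ctlstate.splits)
qed

lemma wf_tmach: "wf_tm tmach"
proof -
  have "finite states" by (simp add: states_def finite_conts finite_words)
  have "instructions tmach \<subseteq> (\<Union>q\<in>states. \<Union>ss\<in>words k S.
     (\<lambda>(q', as). (enc q, ss, enc q', as)) ` trans q ss)"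
  proof
    fix x assume "x \<in> instructions tmach"
    then obtain q ss q' as where "x = (enc q, ss, enc q', as)" "q \<in> states" "ss \<in> words k S"
      "(q', as) \<in> trans q ss" by (auto simp: tmach_def)
    then show "x \<in> (\<Union>q\<in>states. \<Union>ss\<in>words k S.
      (\<lambda>(q', as). (enc q, ss, enc q', as)) ` trans q ss)" by force
  qed
  moreover have "finite (\<Union>q\<in>states. \<Union>ss\<in>words k S.
     (\<lambda>(q', as). (enc q, ss, enc q', as)) ` trans q ss)"
    using \<open>finite states\<close> finite_words finite_trans by blast
  ultimately have fin: "finite (instructions tmach)" by (rule finite_subset)
  have acc: "enc q \<noteq> enc Acc" if "q \<in> states" "x \<in> trans q ss" for q ss x
  proof
    assume "enc q = enc Acc"
    then have "q = Acc" using enc_eqD that some_states by blast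
    then show False using that by (simp add: trans_def)
  qed
  show ?thesis
    unfolding wf_tm_def
  proof (intro conjI ballI)
    show "1 \<le> tapes tmach" using k2 by (simp add: tmach_def)
    fix x assume "x \<in> instructions tmach"
    then obtain q ss q' as where x: "x = (enc q, ss, enc q', as)" "q \<in> states" "ss \<in> words k S"
      "(q', as) \<in> trans q ss" by (auto simp: tmach_def)
    then show "case x of (q, ss, q', as) \<Rightarrow>
        q \<noteq> accept tmach \<and> length ss = tapes tmach \<and> length as = tapes tmach"
      using acc[OF x(2,4)] length_trans[OF x(3,4)] by (auto simp: tmach_def words_def)
  qed (rule fin)
qed

lemma deterministic_tmach:
  assumes "\<And>g g'. g \<in> G \<Longrightarrow> g' \<in> G \<Longrightarrow> g = g'"
  shows "deterministic tmach"
proof -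
  have uniq: "x = y" if "x \<in> trans q ss" "y \<in> trans q ss" for x y q ss
    using that assms by (auto simp: trans_def split: ctlstate.splits if_splits)
  show ?thesis
    unfolding deterministic_def
  proof (intro allI impI)
    fix q ss q1 as1 q2 as2
    assume *: "(q, ss, q1, as1) \<in> instructions tmach \<and> (q, ss, q2, as2) \<in> instructions tmach"
    then obtain p p1 where 1: "q = enc p" "q1 = enc p1" "p \<in> states" "(p1, as1) \<in> trans p ss"
      by (auto simp: tmach_def)
    from * obtain p' p2 where 2: "q = enc p'" "q2 = enc p2" "p' \<in> states" "(p2, as2) \<in> trans p' ss"
      by (auto simp: tmach_def)
    have "p' = p" using enc_eqD 1 2 by simp
    then show "q1 = q2 \<and> as1 = as2" using uniq[OF 1(4)] 2 1 by auto
  qed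
qed

lemma step_iff:
  assumes "q \<in> states" "map scanned ts \<in> words k S"
  shows "step tmach (enc q, ts) d \<longleftrightarrow>
    (\<exists>(q', as)\<in>trans q (map scanned ts). d = (enc q', map2 act ts as))"
proof -
  obtain e ts' where d: "d = (e, ts')" by force
  have *: "q'' = q" if "enc q'' = enc q" "q'' \<in> states" for q''
    using enc_eqD that assms(1) by blast
  show ?thesis
  proof
    assume "step tmach (enc q, ts) d"
    then obtain q'' q' as where "enc q'' = enc q" "q'' \<in> states" "(q', as) \<in> trans q'' (map scanned ts)"
      "e = enc q'" "ts' = map2 act ts as" by (auto simp: d tmach_def)
    with * show "\<exists>(q', as)\<in>trans q (map scanned ts). d = (enc q', map2 act ts as)"
      unfolding d by blast
  next
    assume "\<exists>(q', as)\<in>trans q (map scanned ts). d = (enc q', map2 act ts as)"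
    then show "step tmach (enc q, ts) d"
      using assms by (auto simp: d tmach_def)
  qed
qed

definition tps :: "stacks \<Rightarrow> tape list" where
  "tps \<sigma> = map (\<lambda>i. tape_of (\<sigma> i)) [0..<k]"

definition inv :: "stacks \<Rightarrow> bool" where
  "inv \<sigma> \<longleftrightarrow> (\<forall>i. set (\<sigma> i) \<subseteq> {1..<S} \<and> (k \<le> i \<longrightarrow> \<sigma> i = []))"

lemma inv_peek: "inv \<sigma> \<Longrightarrow> peek (\<sigma> i) < S"
  using S3 by (cases "\<sigma> i") (auto simp: inv_def dest!: spec[of _ i])

lemma scanned_tps: "map scanned (tps \<sigma>) = map (\<lambda>i. peek (\<sigma> i)) [0..<k]"
  by (simp add: tps_def)

lemma tps_words: "inv \<sigma> \<Longrightarrow> map scanned (tps \<sigma>) \<in> words k S"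
  using inv_peek by (auto simp: scanned_tps words_def)

lemma tops_of_tps: "inv \<sigma> \<Longrightarrow> tops_of k (map scanned (tps \<sigma>)) = peeks \<sigma>"
  by (auto simp: tops_of_def scanned_tps inv_def)

lemma inv_app:
  assumes "inv \<sigma>" "\<And>i. okop S (p i) \<and> (k \<le> i \<longrightarrow> p i = Nop)"
  shows "inv (\<lambda>i. app_op (p i) (\<sigma> i))"
  unfolding inv_def
proof (intro allI conjI impI)
  fix i
  have "set (\<sigma> i) \<subseteq> {1..<S}" using assms by (auto simp: inv_def)
  then show "set (app_op (p i) (\<sigma> i)) \<subseteq> {1..<S}"
    using assms(2)[of i] by (cases "p i"; cases "\<sigma> i") auto
  show "app_op (p i) (\<sigma> i) = []" if "k \<le> i"
    using assms that by (auto simp: inv_def)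
qed

text \<open>One program step costs two machine steps; the intermediate \<open>Pend\<close> state
  remembers the operations chosen from the tops, since some of these have changed by then.\<close>

lemma nxt_only:
  assumes "K \<in> conts c" "inv \<sigma>" "nxt (K, \<sigma>) = (K', \<sigma>')" "only tmach (enc (Ready K'), tps \<sigma>') n cf"
  shows "only tmach (enc (Ready K), tps \<sigma>) (Suc (Suc n)) cf" "inv \<sigma>'" "K' \<in> insert [] (conts c)"
proof -
  let ?p = "ops K (peeks \<sigma>)"
  have K': "K' = ctl K (peeks \<sigma>)" and \<sigma>': "\<sigma>' = (\<lambda>i. app_op (?p i) (\<sigma> i))"
    using assms(3) by (auto simp: nxt_def)
  have p: "okop S (?p i) \<and> (k \<le> i \<longrightarrow> ?p i = Nop)" for i
    by (rule ops_conts[OF ok assms(1)]) (use inv_peek assms in simp)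
  show "inv \<sigma>'" unfolding \<sigma>' using assms(2) p by (rule inv_app)
  show "K' \<in> insert [] (conts c)" unfolding K' by (rule ctl_conts) fact
  define ts1 where "ts1 = map (\<lambda>i. act (tape_of (\<sigma> i)) (phase1 (?p i) (peek (\<sigma> i)))) [0..<k]"
  have st1: "Ready K \<in> states" using assms(1) by (simp add: states_def)
  have "Pend ?p K' = (\<lambda>(K, ss). Pend (ops K (tops_of k ss)) (ctl K (tops_of k ss))) (K, map scanned (tps \<sigma>))"
    using tops_of_tps assms(2) by (simp add: K')
  then have st2: "Pend ?p K' \<in> states"
    unfolding states_def using assms(1) tps_words[OF assms(2)]
    by (intro UnI2 image_eqI[where x = "(K, map scanned (tps \<sigma>))"]) auto
  have step1: "step tmach (enc (Ready K), tps \<sigma>) d \<longleftrightarrow> d = (enc (Pend ?p K'), ts1)" for d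
  proof -
    have "map2 act (tps \<sigma>) (map (\<lambda>i. phase1 (?p i) (map scanned (tps \<sigma>) ! i)) [0..<k]) = ts1"
      by (rule nth_equalityI) (auto simp: ts1_def tps_def)
    then show ?thesis
      using conts_nonempty[OF assms(1)]
      by (simp add: step_iff[OF st1 tps_words[OF assms(2)]] trans_def tops_of_tps[OF assms(2)] K')
  qed
  have z: "0 \<notin> set (\<sigma> i)" "set (\<sigma> i) \<subseteq> {..<S}" for i
  proof -
    have "set (\<sigma> i) \<subseteq> {1..<S}" using assms(2) by (simp add: inv_def)
    then show "0 \<notin> set (\<sigma> i)" "set (\<sigma> i) \<subseteq> {..<S}" by auto
  qed
  have w1: "map scanned ts1 \<in> words k S"
    using p z S3 by (auto simp: words_def ts1_def intro!: scanned_phase1)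
  have step2: "step tmach (enc (Pend ?p K'), ts1) d \<longleftrightarrow> d = (enc (Ready K'), tps \<sigma>')" for d
  proof -
    have "map2 act ts1 (map (\<lambda>i. phase2 (?p i) (map scanned ts1 ! i)) [0..<k]) = tps \<sigma>'"
      using act_two_phases[OF z(1)] by (intro nth_equalityI) (auto simp: ts1_def tps_def \<sigma>')
    then show ?thesis by (simp add: step_iff[OF st2 w1] trans_def)
  qed
  show "only tmach (enc (Ready K), tps \<sigma>) (Suc (Suc n)) cf"
    by (rule only.go[OF step1 only.go[OF step2 assms(4)]])
qed

lemma nxt_pow_only:
  assumes "(nxt ^^ m) (K, \<sigma>) = ([], \<sigma>')" "K \<in> insert [] (conts c)" "inv \<sigma>"
  shows "inv \<sigma>' \<and> (only tmach (enc (Ready []), tps \<sigma>') n cf \<longrightarrow>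
    (\<exists>l\<le>2 * m + n. only tmach (enc (Ready K), tps \<sigma>) l cf))"
  using assms
proof (induction m arbitrary: K \<sigma>)
  case 0
  then show ?case by auto
next
  case (Suc m)
  obtain K1 \<sigma>1 where nx: "nxt (K, \<sigma>) = (K1, \<sigma>1)" by force
  have pw: "(nxt ^^ m) (K1, \<sigma>1) = ([], \<sigma>')"
    using Suc.prems(1) nx by (simp add: funpow_swap1)
  show ?case
  proof (cases "K = []")
    case True
    then have "K1 = [] \<and> \<sigma>1 = \<sigma>" using nx by (auto simp: nxt_def)
    then have "inv \<sigma>' \<and> (only tmach (enc (Ready []), tps \<sigma>') n cf \<longrightarrow>
        (\<exists>l\<le>2 * m + n. only tmach (enc (Ready K), tps \<sigma>) l cf))"
      using Suc.IH[OF pw] Suc.prems(3) True by simp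
    moreover have "l \<le> 2 * m + n \<Longrightarrow> l \<le> 2 * Suc m + n" for l by simp
    ultimately show ?thesis by blast
  next
    case False
    then have K: "K \<in> conts c" using Suc.prems by auto
    have p: "okop S (ops K (peeks \<sigma>) i) \<and> (k \<le> i \<longrightarrow> ops K (peeks \<sigma>) i = Nop)" for i
      by (rule ops_conts[OF ok K]) (use inv_peek Suc.prems in simp)
    have K1: "K1 = ctl K (peeks \<sigma>)" and s1: "\<sigma>1 = (\<lambda>i. app_op (ops K (peeks \<sigma>) i) (\<sigma> i))"
      using nx by (auto simp: nxt_def)
    have i1: "inv \<sigma>1" unfolding s1 by (rule inv_app) (use p Suc.prems in auto)
    have "K1 \<in> insert [] (conts c)" unfolding K1 by (rule ctl_conts) fact
    note IH = Suc.IH[OF pw this i1]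
    show ?thesis
    proof (intro conjI impI)
      show "inv \<sigma>'" using IH by simp
      assume "only tmach (enc (Ready []), tps \<sigma>') n cf"
      then obtain l where "l \<le> 2 * m + n" "only tmach (enc (Ready K1), tps \<sigma>1) l cf"
        using IH by auto
      then show "\<exists>l\<le>2 * Suc m + n. only tmach (enc (Ready K), tps \<sigma>) l cf"
        using nxt_only(1)[OF K Suc.prems(3) nx, of l cf] by (intro exI[of _ "Suc (Suc l)"]) auto
    qed
  qed
qed

definition fin_conf :: "stacks \<Rightarrow> config" where
  "fin_conf \<sigma> = (if \<sigma> 0 \<noteq> [] then enc Acc else enc (Ready []), tps \<sigma>)"

lemma only_final:
  assumes "inv \<sigma>"
  shows "\<exists>l\<le>1. only tmach (enc (Ready []), tps \<sigma>) l (fin_conf \<sigma>)"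
proof -
  have st: "Ready [] \<in> states" "Acc \<in> states" by (auto simp: states_def)
  have sc: "map scanned (tps \<sigma>) ! 0 = peek (\<sigma> 0)" using k2 by (simp add: scanned_tps)
  have pk: "peek (\<sigma> 0) = 0 \<longleftrightarrow> \<sigma> 0 = []"
    using assms by (cases "\<sigma> 0") (auto simp: inv_def dest!: spec[of _ 0])
  have m2: "map2 act (tps \<sigma>) (map (\<lambda>s. (s, Stay)) (map scanned (tps \<sigma>))) = tps \<sigma>"
    by (intro nth_equalityI) (auto simp: tps_def)
  show ?thesis
  proof (cases "\<sigma> 0 = []")
    case True
    then have "halted tmach (enc (Ready []), tps \<sigma>)"
      unfolding halted_def step_iff[OF st(1) tps_words[OF assms]]
      using sc pk by (simp add: trans_def)
    then show ?thesis using True by (auto simp: fin_conf_def intro: only.stop)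
  next
    case False
    have "halted tmach (enc Acc, tps \<sigma>)"
      unfolding halted_def step_iff[OF st(2) tps_words[OF assms]] by (simp add: trans_def)
    moreover have "step tmach (enc (Ready []), tps \<sigma>) d \<longleftrightarrow> d = (enc Acc, tps \<sigma>)" for d
      unfolding step_iff[OF st(1) tps_words[OF assms]] using False sc pk m2 by (simp add: trans_def)
    ultimately have "only tmach (enc (Ready []), tps \<sigma>) (Suc 0) (enc Acc, tps \<sigma>)"
      using only.go[OF _ only.stop] by blast
    then show ?thesis using False by (auto simp: fin_conf_def)
  qed
qed

end

section \<open>The guessing phase and the behaviour of the whole machine\<close>

definition bits :: "bool list \<Rightarrow> nat list" where
  "bits w = map (\<lambda>b. if b then 2 else 1) w"

definition start_stacks :: "bool list \<Rightarrow> nat list \<Rightarrow> stacks" where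
  "start_stacks w g = (\<lambda>_. [])(0 := rev (bits w), 1 := rev g)"

lemma written_bits: "written w = fst (tape_of (rev (bits w)))"
  by (rule ext) (auto simp: written_def tape_of_def bits_def)

context machine
begin

definition init_conf :: "bool list \<Rightarrow> nat list \<Rightarrow> config" where
  "init_conf w g = (enc Init, (written w, int (length g)) # (fst (tape_of (rev g)), int (length g)) #
     replicate (k - 2) (written [], 0))"

lemma initial_conf: "initial tmach w = init_conf w []"
proof -
  have "k - 1 = Suc (k - 2)" using k2 by simp
  then show ?thesis
    by (auto simp: initial_def init_conf_def tmach_def written_def tape_of_def)
qed

lemma init_scanned:
  "map scanned (snd (init_conf w g)) = written w (int (length g)) # 0 # replicate (k - 2) 0"
  by (auto simp: init_conf_def tape_of_def written_def)

lemma init_words: "map scanned (snd (init_conf w g)) \<in> words k S"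
  unfolding init_scanned using k2 S3 by (auto simp: words_def written_def)

lemma init_state: "Init \<in> states"
  by (simp add: states_def)

lemma init_step:
  assumes "length g < length w"
  shows "step tmach (init_conf w g) d \<longleftrightarrow> (\<exists>x\<in>G. d = init_conf w (g @ [x]))"
proof -
  let ?ts = "snd (init_conf w g)"
  have nz: "written w (int (length g)) \<noteq> 0" using assms by (simp add: written_def)
  have t1: "(fst (tape_of (rev g)))(int (length g) := x) = fst (tape_of (rev (g @ [x])))" for x
    by (rule ext) (auto simp: tape_of_def nth_append)
  have rp: "(written [])(0 := 0) = written []"
    by (auto simp: written_def)
  have "map2 act ?ts ((map scanned ?ts ! 0, Right) # (x, Right) #
      map (\<lambda>s. (s, Stay)) (drop 2 (map scanned ?ts))) = snd (init_conf w (g @ [x]))" for x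
    unfolding init_scanned using rp t1[of x] by (simp add: init_conf_def numeral_2_eq_2)
  then show ?thesis
    using step_iff[OF init_state init_words, of w g d] nz
    by (auto simp: trans_def init_scanned init_conf_def)
qed

lemma init_last:
  assumes "length g = length w"
  shows "step tmach (init_conf w g) d \<longleftrightarrow> d = (enc (Ready [c]), tps (start_stacks w g))"
proof -
  let ?ts = "snd (init_conf w g)"
  have nz: "written w (int (length g)) = 0" using assms by (simp add: written_def)
  have ks: "[0..<k] = 0 # 1 # [2..<k]" using k2 by (simp add: upt_conv_Cons numeral_2_eq_2)
  have rp: "((written [])(0 := 0), - 1) = tape_of []"
    by (auto simp: written_def tape_of_def)
  have "map (\<lambda>i. tape_of (start_stacks w g i)) [2..<k] = replicate (k - 2) (tape_of [])"
    by (rule nth_equalityI) (auto simp: start_stacks_def)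
  moreover have "act (written w, int (length g)) (0, Left) = tape_of (rev (bits w))"
    using assms by (auto simp: written_bits tape_of_def bits_def fun_eq_iff)
  moreover have "act (fst (tape_of (rev g)), int (length g)) (0, Left) = tape_of (rev g)"
    by (auto simp: tape_of_def fun_eq_iff)
  ultimately have "map2 act ?ts (map (\<lambda>s. (s, Left)) (map scanned ?ts)) = tps (start_stacks w g)"
    unfolding init_scanned tps_def ks using rp nz
    by (simp add: init_conf_def start_stacks_def)
  then show ?thesis
    using step_iff[OF init_state init_words, of w g d] nz
    by (auto simp: trans_def init_scanned init_conf_def)
qed

lemma inv_start:
  assumes "set g \<subseteq> G"
  shows "inv (start_stacks w g)"
proof -
  have "set g \<subseteq> {1..<S}" using assms G by auto
  then show ?thesis using S3 k2 by (auto simp: inv_def start_stacks_def bits_def)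
qed

text \<open>Splits an arbitrary path at the moment when guessing ends. From there on the guess is
  fixed and the rest of the path is a forced run.\<close>

lemma init_path:
  assumes "(step tmach ^^ l) (init_conf w g) d" "length g \<le> length w" "set g \<subseteq> G"
  shows "\<exists>g'. set g' \<subseteq> G \<and>
    (d = init_conf w g' \<and> length g' = length g + l \<and> length g' \<le> length w \<or>
     length g' = length w \<and> l > length w - length g \<and>
     (step tmach ^^ (l - Suc (length w - length g))) (enc (Ready [c]), tps (start_stacks w g')) d)"
  using assms
proof (induction l arbitrary: g)
  case 0
  then show ?case by (intro exI[of _ g]) auto
next
  case (Suc l)
  then obtain e where e: "step tmach (init_conf w g) e" "(step tmach ^^ l) e d"
    by (blast dest: relpowp_Suc_D2)
  show ?case
  proof (cases "length g = length w")
    case True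
    then have "e = (enc (Ready [c]), tps (start_stacks w g))" using e init_last by blast
    then show ?thesis using e True Suc.prems by (intro exI[of _ g]) auto
  next
    case False
    then have lt: "length g < length w" using Suc.prems by simp
    then obtain x where x: "x \<in> G" "e = init_conf w (g @ [x])" using e init_step by blast
    have "length (g @ [x]) \<le> length w" "set (g @ [x]) \<subseteq> G" using lt x Suc.prems by auto
    from Suc.IH[OF _ this] obtain g' where g': "set g' \<subseteq> G"
      "d = init_conf w g' \<and> length g' = length (g @ [x]) + l \<and> length g' \<le> length w \<or>
       length g' = length w \<and> l > length w - length (g @ [x]) \<and>
       (step tmach ^^ (l - Suc (length w - length (g @ [x])))) (enc (Ready [c]), tps (start_stacks w g')) d"
      using e x by blast
    have "l - Suc (length w - length (g @ [x])) = Suc l - Suc (length w - length g)" using lt by simp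
    then show ?thesis using g' lt by (intro exI[of _ g']) (auto simp del: relpowp.simps)
  qed
qed

lemma init_reach:
  assumes "length g' = length w" "set g' \<subseteq> G" "n \<le> length w"
  shows "(step tmach)\<^sup>*\<^sup>* (init_conf w []) (init_conf w (take n g'))"
  using assms(3)
proof (induction n)
  case (Suc n)
  then have "step tmach (init_conf w (take n g')) (init_conf w (take (Suc n) g'))"
    using assms by (subst init_step) (auto simp: take_Suc_conv_app_nth intro!: bexI[of _ "g' ! n"])
  then show ?case using Suc by simp
qed simp

context
  fixes q :: "nat \<Rightarrow> nat" and fin :: "bool list \<Rightarrow> nat list \<Rightarrow> stacks"
  assumes fin: "\<And>w g. length g = length w \<Longrightarrow> set g \<subseteq> G \<Longrightarrow>
    runs c (start_stacks w g) (q (length w)) (fin w g)"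
begin

lemma ready_only:
  assumes "length g = length w" "set g \<subseteq> G"
  shows "inv (fin w g)"
    "\<exists>l\<le>2 * q (length w) + 1. only tmach (enc (Ready [c]), tps (start_stacks w g)) l (fin_conf (fin w g))"
proof -
  obtain m where m: "m \<le> q (length w)" "(nxt ^^ m) ([c], start_stacks w g) = ([], fin w g)"
    using fin[OF assms] unfolding runs_def by blast
  have c: "[c] \<in> insert [] (conts c)" using self_conts by auto
  note * = nxt_pow_only[OF m(2) c inv_start[OF assms(2)]]
  show i: "inv (fin w g)" using * by blast
  obtain l where l: "l \<le> 1" "only tmach (enc (Ready []), tps (fin w g)) l (fin_conf (fin w g))"
    using only_final[OF i] by blast
  with * obtain l' where "l' \<le> 2 * m + l"
    "only tmach (enc (Ready [c]), tps (start_stacks w g)) l' (fin_conf (fin w g))" by blast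
  then show "\<exists>l\<le>2 * q (length w) + 1.
      only tmach (enc (Ready [c]), tps (start_stacks w g)) l (fin_conf (fin w g))"
    using l m by (intro exI[of _ l']) auto
qed

lemma tmach_time:
  assumes "(step tmach ^^ n) (initial tmach w) d"
  shows "n \<le> length w + 2 * q (length w) + 2"
proof -
  obtain g where g: "set g \<subseteq> G" "length g = n \<and> length g \<le> length w \<or> length g = length w \<and>
     (step tmach ^^ (n - Suc (length w))) (enc (Ready [c]), tps (start_stacks w g)) d"
    using init_path[of n w "[]" d] assms unfolding initial_conf by auto
  then show ?thesis
  proof (elim disjE)
    assume *: "length g = length w \<and>
     (step tmach ^^ (n - Suc (length w))) (enc (Ready [c]), tps (start_stacks w g)) d"
    then obtain l where "l \<le> 2 * q (length w) + 1"
      "only tmach (enc (Ready [c]), tps (start_stacks w g)) l (fin_conf (fin w g))"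
      using ready_only(2)[OF _ g(1)] by blast
    then show ?thesis using only_path[of tmach _ l "fin_conf (fin w g)" "n - Suc (length w)" d] * by force
  qed simp
qed

lemma tmach_reach:
  assumes "length g = length w" "set g \<subseteq> G"
  shows "(step tmach)\<^sup>*\<^sup>* (initial tmach w) (fin_conf (fin w g))" "halted tmach (fin_conf (fin w g))"
proof -
  obtain l where l: "only tmach (enc (Ready [c]), tps (start_stacks w g)) l (fin_conf (fin w g))"
    using ready_only(2)[OF assms] by blast
  have "(step tmach)\<^sup>*\<^sup>* (initial tmach w) (init_conf w g)"
    unfolding initial_conf using init_reach[OF assms order_refl] assms by simp
  moreover have "step tmach (init_conf w g) (enc (Ready [c]), tps (start_stacks w g))"
    using init_last[OF assms(1)] by simp
  ultimately show "(step tmach)\<^sup>*\<^sup>* (initial tmach w) (fin_conf (fin w g))"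
    using only_reach[OF l] by (meson rtranclp.rtrancl_into_rtrancl rtranclp_trans)
  show "halted tmach (fin_conf (fin w g))" using only_reach[OF l] by blast
qed

lemma fst_fin_conf: "fst (fin_conf \<sigma>) = accept tmach \<longleftrightarrow> \<sigma> 0 \<noteq> []"
proof -
  have "enc (Ready []) \<noteq> enc Acc"
    using enc_eqD some_states by blast
  then show ?thesis by (auto simp: fin_conf_def tmach_def)
qed

lemma accept_halted:
  assumes "fst d = accept tmach" shows "halted tmach d"
  using wf_tmach assms by (cases d) (auto simp: halted_def wf_tm_def)

text \<open>Accepting configurations are halted, and on a forced run the only halted configuration
  is the final one. So acceptance can be read off the final stacks of a complete guess.\<close>

lemma tmach_accepts:
  "accepts tmach w \<longleftrightarrow> (\<exists>g. length g = length w \<and> set g \<subseteq> G \<and> fin w g 0 \<noteq> [])"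
proof
  assume "accepts tmach w"
  then obtain d n where d: "(step tmach ^^ n) (initial tmach w) d" "fst d = accept tmach"
    by (auto simp: accepts_def dest: rtranclp_imp_relpowp)
  have "enc Init \<noteq> enc Acc" using enc_eqD some_states by blast
  then obtain g where g: "set g \<subseteq> G" "length g = length w"
     "(step tmach ^^ (n - Suc (length w))) (enc (Ready [c]), tps (start_stacks w g)) d"
    using init_path[of n w "[]" d] d unfolding initial_conf by (auto simp: init_conf_def tmach_def)
  then obtain l where "only tmach (enc (Ready [c]), tps (start_stacks w g)) l (fin_conf (fin w g))"
      using ready_only(2)[OF _ g(1)] by blast
  then have "only tmach d (l - (n - Suc (length w))) (fin_conf (fin w g))"
    using only_path g by blast
  then have "d = fin_conf (fin w g)" using only_halted accept_halted d by blast
  then show "\<exists>g. length g = length w \<and> set g \<subseteq> G \<and> fin w g 0 \<noteq> []"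
    using g d fst_fin_conf by metis
next
  assume "\<exists>g. length g = length w \<and> set g \<subseteq> G \<and> fin w g 0 \<noteq> []"
  then show "accepts tmach w"
    using tmach_reach fst_fin_conf unfolding accepts_def by metis
qed

lemma last_fin_conf: "last (snd (fin_conf \<sigma>)) = tape_of (\<sigma> (k - 1))"
  using k2 by (simp add: fin_conf_def tps_def last_map)

end

end

section \<open>Polynomial bounds and the passage from programs to languages\<close>

definition pbound :: "(nat \<Rightarrow> nat) \<Rightarrow> bool" where
  "pbound f \<longleftrightarrow> (\<exists>p::nat poly. \<forall>n. f n \<le> poly p n)"

lemma pbound_const [intro]: "pbound (\<lambda>n. a)"
  unfolding pbound_def by (intro exI[of _ "[:a:]"]) simp

lemma pbound_id [intro]: "pbound (\<lambda>n. n)"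
  unfolding pbound_def by (intro exI[of _ "[:0, 1:]"]) simp

lemma pbound_add [intro]: "pbound f \<Longrightarrow> pbound g \<Longrightarrow> pbound (\<lambda>n. f n + g n)"
  unfolding pbound_def by (metis add_mono poly_add)

lemma pbound_mult [intro]: "pbound f \<Longrightarrow> pbound g \<Longrightarrow> pbound (\<lambda>n. f n * g n)"
  unfolding pbound_def by (metis mult_le_mono poly_mult)

lemma pbound_power [intro]: "pbound f \<Longrightarrow> pbound (\<lambda>n. f n ^ d)"
  by (induction d) auto

theorem NP_by_program:
  assumes "okc k S c" "2 \<le> k" "3 \<le> S" "G \<subseteq> {1..<S}" "pbound q"
    and "\<And>w g. length g = length w \<Longrightarrow> set g \<subseteq> G \<Longrightarrow>
      runs c (start_stacks w g) (q (length w)) (fin w g)"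
  shows "{w. \<exists>g. length g = length w \<and> set g \<subseteq> G \<and> fin w g 0 \<noteq> []} \<in> NP"
proof -
  interpret machine c k S G by unfold_locales fact+
  have "pbound (\<lambda>n. n + 2 * q n + 2)" by (intro pbound_add pbound_mult pbound_const pbound_id assms)
  then obtain p where p: "\<And>n. n + 2 * q n + 2 \<le> poly p n" by (auto simp: pbound_def)
  have "runs_in_time tmach p"
    unfolding runs_in_time_def using tmach_time[of q fin] assms(6) p order_trans by blast
  then show ?thesis
    unfolding NP_def using wf_tmach tmach_accepts[of q fin] assms(6) by blast
qed

text \<open>A tape shows its stack from the bottom to the top, so a program has to leave the output
  with its last bit on top, that is, reversed.\<close>

theorem polytime_by_program:
  assumes "okc k S c" "2 \<le> k" "3 \<le> S" "pbound q"
    and "\<And>w. runs c (start_stacks w (replicate (length w) 1)) (q (length w)) (fin w)"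
    and "\<And>w. fin w (k - 1) = rev (bits (f w))"
  shows "polytime_computable f"
proof -
  interpret machine c k S "{1}" by unfold_locales (use assms in auto)
  have fin: "runs c (start_stacks w g) (q (length w)) (fin w)"
    if "length g = length w" "set g \<subseteq> {1}" for w and g :: "nat list"
  proof -
    have "g = replicate (length w) 1"
      using that by (metis replicate_length_same singletonD subset_iff)
    then show ?thesis using assms(5) by simp
  qed
  have "pbound (\<lambda>n. n + 2 * q n + 2)" by (intro pbound_add pbound_mult pbound_const pbound_id assms)
  then obtain p where p: "\<And>n. n + 2 * q n + 2 \<le> poly p n" by (auto simp: pbound_def)
  have "runs_in_time tmach p"
    unfolding runs_in_time_def using tmach_time[of q "\<lambda>w g. fin w"] fin p order_trans by blast
  moreover have "computes tmach f"
    unfolding computes_def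
  proof
    fix w
    let ?d = "fin_conf (fin w)"
    have "(step tmach)\<^sup>*\<^sup>* (initial tmach w) ?d \<and> halted tmach ?d"
      using tmach_reach[of q "\<lambda>w g. fin w", OF fin, of "replicate (length w) 1" w]
      by (simp add: set_replicate_conv_if)
    moreover have "fst (last (snd ?d)) = written (f w)"
      using last_fin_conf[of q "\<lambda>w g. fin w", OF fin] assms(6)[of w] by (simp add: written_bits)
    ultimately show "\<exists>d. (step tmach)\<^sup>*\<^sup>* (initial tmach w) d \<and> halted tmach d \<and>
        fst (last (snd d)) = written (f w)" by blast
  qed
  ultimately show ?thesis
    unfolding polytime_computable_def using wf_tmach deterministic_tmach by blast
qed

section \<open>Programming with stacks\<close>

definition apps :: "(nat \<Rightarrow> stack_op) \<Rightarrow> stacks \<Rightarrow> stacks" where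
  "apps p \<sigma> = (\<lambda>i. app_op (p i) (\<sigma> i))"

lemma apps_simps [simp]:
  "apps (\<lambda>_. Nop) \<sigma> = \<sigma>"
  "apps (p(i := x)) \<sigma> = (apps p \<sigma>)(i := app_op x (\<sigma> i))"
  by (auto simp: apps_def)

lemma runs_mono: "runs c \<sigma> n \<sigma>' \<Longrightarrow> n \<le> m \<Longrightarrow> runs c \<sigma> m \<sigma>'"
  unfolding runs_def by (meson order_trans)

lemma runs_eq: "runs c \<sigma> n \<sigma>1 \<Longrightarrow> \<sigma>1 = \<sigma>2 \<Longrightarrow> n \<le> m \<Longrightarrow> runs c \<sigma> m \<sigma>2"
  using runs_mono by simp

lemma runs_Basic: "runs (Basic f) \<sigma> 1 (apps (f (peeks \<sigma>)) \<sigma>)"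
  unfolding runs_def by (intro exI[of _ 1]) (simp add: nxt_def apps_def)

lemma funpow_nxt_Suc: "(nxt ^^ Suc m) x = (nxt ^^ m) (nxt x)"
  by (simp add: funpow_swap1)

lemma runs_Seq:
  assumes "runs c \<sigma> n \<sigma>1" "runs d \<sigma>1 m \<sigma>2"
  shows "runs (Seq c d) \<sigma> (n + m + 1) \<sigma>2"
proof -
  obtain a b where a: "a \<le> n" "\<And>K. (nxt ^^ a) (c # K, \<sigma>) = (K, \<sigma>1)"
    and b: "b \<le> m" "\<And>K. (nxt ^^ b) (d # K, \<sigma>1) = (K, \<sigma>2)"
    using assms unfolding runs_def by blast
  have "(nxt ^^ Suc (b + a)) (Seq c d # K, \<sigma>) = (K, \<sigma>2)" for K
    unfolding funpow_nxt_Suc funpow_add using a(2)[of "d # K"] b(2)[of K] by (simp add: nxt_def)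
  then show ?thesis unfolding runs_def using a b by (intro exI[of _ "Suc (b + a)"]) auto
qed

lemma runs_Cond:
  assumes "runs (if P (peeks \<sigma>) then c else d) \<sigma> n \<sigma>1"
  shows "runs (Cond P c d) \<sigma> (n + 1) \<sigma>1"
proof -
  obtain a where a: "a \<le> n" "\<And>K. (nxt ^^ a) ((if P (peeks \<sigma>) then c else d) # K, \<sigma>) = (K, \<sigma>1)"
    using assms unfolding runs_def by blast
  have "(nxt ^^ Suc a) (Cond P c d # K, \<sigma>) = (K, \<sigma>1)" for K
    unfolding funpow_nxt_Suc using a(2)[of K] by (simp add: nxt_def)
  then show ?thesis unfolding runs_def using a by (intro exI[of _ "Suc a"]) auto
qed

lemma runs_While_stop: "\<not> P (peeks \<sigma>) \<Longrightarrow> runs (While P c) \<sigma> 1 \<sigma>"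
  unfolding runs_def by (intro exI[of _ 1]) (simp add: nxt_def)

lemma runs_While_step:
  assumes "P (peeks \<sigma>)" "runs c \<sigma> n \<sigma>1" "runs (While P c) \<sigma>1 m \<sigma>2"
  shows "runs (While P c) \<sigma> (n + m + 1) \<sigma>2"
proof -
  obtain a b where a: "a \<le> n" "\<And>K. (nxt ^^ a) (c # K, \<sigma>) = (K, \<sigma>1)"
    and b: "b \<le> m" "\<And>K. (nxt ^^ b) (While P c # K, \<sigma>1) = (K, \<sigma>2)"
    using assms unfolding runs_def by blast
  have "(nxt ^^ Suc (b + a)) (While P c # K, \<sigma>) = (K, \<sigma>2)" for K
    unfolding funpow_nxt_Suc funpow_add using a(2)[of "While P c # K"] b(2)[of K] assms(1)
    by (simp add: nxt_def)
  then show ?thesis unfolding runs_def using a b by (intro exI[of _ "Suc (b + a)"]) auto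
qed

lemma runs_loop:
  assumes "\<And>i. i < n \<Longrightarrow> P (peeks (s i))" "\<not> P (peeks (s n))"
    and "\<And>i. i < n \<Longrightarrow> runs c (s i) t (s (Suc i))"
  shows "runs (While P c) (s 0) (n * (t + 1) + 1) (s n)"
  using assms
proof (induction n arbitrary: s)
  case 0
  show ?case using runs_While_stop[of P "s 0" c, OF 0(2)] by simp
next
  case (Suc n)
  have "runs (While P c) (s (Suc 0)) (n * (t + 1) + 1) (s (Suc n))"
    using Suc.IH[of "\<lambda>i. s (Suc i)"] Suc.prems by auto
  then have "runs (While P c) (s 0) (t + (n * (t + 1) + 1) + 1) (s (Suc n))"
    by (rule runs_While_step[where P = P, OF Suc.prems(1)[of 0] Suc.prems(3)[of 0], OF zero_less_Suc zero_less_Suc])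
  then show ?case by (rule runs_mono) simp
qed

fun seqs :: "com list \<Rightarrow> com" where
  "seqs [] = Basic (\<lambda>_ _. Nop)"
| "seqs (c # cs) = Seq c (seqs cs)"

lemma runs_seqs_Nil: "runs (seqs []) \<sigma> 1 \<sigma>"
  using runs_Basic[of "\<lambda>_ _. Nop" \<sigma>] by simp

lemma runs_seqs_Cons:
  "runs c \<sigma> n \<sigma>1 \<Longrightarrow> runs (seqs cs) \<sigma>1 m \<sigma>2 \<Longrightarrow> runs (seqs (c # cs)) \<sigma> (n + m + 1) \<sigma>2"
  using runs_Seq by simp

lemma runs_seqs:
  assumes "\<And>i. i < length cs \<Longrightarrow> runs (cs ! i) (s i) t (s (Suc i))"
  shows "runs (seqs cs) (s 0) (length cs * (t + 1) + 1) (s (length cs))"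
  using assms
proof (induction cs arbitrary: s)
  case Nil
  then show ?case using runs_seqs_Nil by simp
next
  case (Cons c cs)
  have "runs (seqs cs) (s (Suc 0)) (length cs * (t + 1) + 1) (s (Suc (length cs)))"
    using Cons.IH[of "\<lambda>i. s (Suc i)"] Cons.prems by force
  moreover have "runs c (s 0) t (s (Suc 0))" using Cons.prems[of 0] by simp
  ultimately have "runs (seqs (c # cs)) (s 0) (t + (length cs * (t + 1) + 1) + 1) (s (Suc (length cs)))"
    by (rule runs_seqs_Cons[rotated])
  then show ?case by (rule runs_eq) auto
qed

lemma okc_seqs [simp]: "okc k S (seqs cs) \<longleftrightarrow> (\<forall>c\<in>set cs. okc k S c)"
  by (induction cs) auto

definition push :: "nat \<Rightarrow> nat \<Rightarrow> com" where
  "push i s = Basic (\<lambda>_. (\<lambda>_. Nop)(i := Push s))"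

definition pop :: "nat \<Rightarrow> com" where
  "pop i = Basic (\<lambda>_. (\<lambda>_. Nop)(i := Pop))"

definition move :: "(nat \<Rightarrow> nat) \<Rightarrow> nat \<Rightarrow> nat \<Rightarrow> com" where
  "move g i j = While (\<lambda>a. a i \<noteq> 0) (Basic (\<lambda>a. (\<lambda>_. Nop)(i := Pop, j := Push (g (a i)))))"

text \<open>The source passes through the scratch stack \<open>t\<close> and comes back, so it is
  preserved and the target receives its symbols in the original order, whereas \<open>move\<close>
  reverses them.\<close>

definition copy :: "(nat \<Rightarrow> nat) \<Rightarrow> nat \<Rightarrow> nat \<Rightarrow> nat \<Rightarrow> com" where
  "copy g i j t = Seq (move id i t)
     (While (\<lambda>a. a t \<noteq> 0) (Basic (\<lambda>a. (\<lambda>_. Nop)(t := Pop, i := Push (a t), j := Push (g (a t))))))"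

definition clear :: "nat \<Rightarrow> com" where
  "clear i = While (\<lambda>a. a i \<noteq> 0) (pop i)"

lemma okc_push [simp]: "i < k \<Longrightarrow> s < S \<Longrightarrow> okc k S (push i s)"
  by (auto simp: push_def)

lemma okc_pop [simp]: "i < k \<Longrightarrow> okc k S (pop i)"
  by (auto simp: pop_def)

lemma okc_clear [simp]: "i < k \<Longrightarrow> okc k S (clear i)"
  by (auto simp: clear_def)

lemma okc_move [simp]: "i < k \<Longrightarrow> j < k \<Longrightarrow> (\<And>x. x < S \<Longrightarrow> g x < S) \<Longrightarrow> okc k S (move g i j)"
  by (auto simp: move_def)

lemma okc_copy [simp]:
  "i < k \<Longrightarrow> j < k \<Longrightarrow> t < k \<Longrightarrow> (\<And>x. x < S \<Longrightarrow> g x < S) \<Longrightarrow> okc k S (copy g i j t)"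
  by (auto simp: copy_def)

lemma runs_push: "s \<noteq> 0 \<Longrightarrow> runs (push i s) \<sigma> 1 (\<sigma>(i := s # \<sigma> i))"
  unfolding push_def using runs_Basic[of "\<lambda>_. (\<lambda>_. Nop)(i := Push s)" \<sigma>] by simp

lemma runs_pop: "runs (pop i) \<sigma> 1 (\<sigma>(i := tl (\<sigma> i)))"
  unfolding pop_def using runs_Basic[of "\<lambda>_. (\<lambda>_. Nop)(i := Pop)" \<sigma>] by simp

lemma runs_clear:
  assumes "0 \<notin> set (\<sigma> i)"
  shows "runs (clear i) \<sigma> (2 * length (\<sigma> i) + 1) (\<sigma>(i := []))"
  using assms
proof (induction "\<sigma> i" arbitrary: \<sigma>)
  case Nil
  have "\<sigma> = \<sigma>(i := [])" using Nil(1)[symmetric] by (intro ext) auto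
  show ?case unfolding clear_def
    by (rule runs_eq[OF runs_While_stop \<open>\<sigma> = _\<close>]) (use Nil(1)[symmetric] in simp_all)
next
  case (Cons x xs)
  have "runs (clear i) (\<sigma>(i := xs)) (2 * length xs + 1) (\<sigma>(i := []))"
    using Cons(1)[of "\<sigma>(i := xs)"] Cons(2)[symmetric] Cons.prems by simp
  then have "runs (clear i) \<sigma> (1 + (2 * length xs + 1) + 1) (\<sigma>(i := []))"
    using runs_pop[of i \<sigma>] Cons(2)[symmetric] Cons.prems unfolding clear_def
    by (intro runs_While_step[where c = "pop i"]) auto
  then show ?case by (rule runs_mono) (simp add: Cons(2)[symmetric])
qed

lemma runs_move:
  assumes "0 \<notin> set (\<sigma> i)" "\<And>x. x \<in> set (\<sigma> i) \<Longrightarrow> g x \<noteq> 0" "i \<noteq> j"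
  shows "runs (move g i j) \<sigma> (2 * length (\<sigma> i) + 1) (\<sigma>(i := [], j := rev (map g (\<sigma> i)) @ \<sigma> j))"
  using assms
proof (induction "\<sigma> i" arbitrary: \<sigma>)
  case Nil
  have "\<sigma> = \<sigma>(i := [], j := rev (map g (\<sigma> i)) @ \<sigma> j)" using Nil(1)[symmetric] by (intro ext) auto
  show ?case unfolding move_def
    by (rule runs_eq[OF runs_While_stop \<open>\<sigma> = _\<close>]) (use Nil(1)[symmetric] in simp_all)
next
  case (Cons x xs)
  let ?\<sigma> = "\<sigma>(i := xs, j := g x # \<sigma> j)"
  let ?c = "Basic (\<lambda>a. (\<lambda>_. Nop)(i := Pop, j := Push (g (a i))))"
  have s: "\<sigma> i = x # xs" using Cons by simp
  have "runs (move g i j) ?\<sigma> (2 * length xs + 1) (\<sigma>(i := [], j := rev (map g (\<sigma> i)) @ \<sigma> j))"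
  proof (rule runs_eq[OF Cons(1)[of ?\<sigma>]])
    show "?\<sigma>(i := [], j := rev (map g (?\<sigma> i)) @ ?\<sigma> j) = \<sigma>(i := [], j := rev (map g (\<sigma> i)) @ \<sigma> j)"
      using s Cons.prems(3) by (intro ext) auto
  qed (use s Cons.prems in auto)
  moreover have "runs ?c \<sigma> 1 ?\<sigma>"
    by (rule runs_eq[OF runs_Basic]) (use s Cons.prems(2)[of x] Cons.prems(3) in \<open>auto intro!: ext\<close>)
  ultimately have "runs (move g i j) \<sigma> (1 + (2 * length xs + 1) + 1)
      (\<sigma>(i := [], j := rev (map g (\<sigma> i)) @ \<sigma> j))"
    unfolding move_def using s Cons.prems by (intro runs_While_step[where c = ?c]) auto
  then show ?case by (rule runs_mono) (simp add: s)
qed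

lemma runs_copy:
  assumes "0 \<notin> set (\<sigma> i)" "\<And>x. x \<in> set (\<sigma> i) \<Longrightarrow> g x \<noteq> 0" "i \<noteq> j" "i \<noteq> t" "j \<noteq> t" "\<sigma> t = []"
  shows "runs (copy g i j t) \<sigma> (4 * length (\<sigma> i) + 3) (\<sigma>(j := map g (\<sigma> i) @ \<sigma> j))"
proof -
  let ?w = "While (\<lambda>a. a t \<noteq> 0) (Basic (\<lambda>a. (\<lambda>_. Nop)(t := Pop, i := Push (a t), j := Push (g (a t)))))"
  \<comment> \<open>The state after \<open>n\<close> symbols have returned from the scratch
    stack.\<close>
  define s where "s = (\<lambda>n. \<sigma>(i := drop (length (\<sigma> i) - n) (\<sigma> i), t := rev (take (length (\<sigma> i) - n) (\<sigma> i)),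
     j := map g (drop (length (\<sigma> i) - n) (\<sigma> i)) @ \<sigma> j))"
  have nz: "x \<in> set (\<sigma> i) \<Longrightarrow> x \<noteq> 0" for x using assms(1) by metis
  have tk: "\<sigma> i ! (length (\<sigma> i) - Suc n) \<in> set (\<sigma> i)"
     "rev (take (length (\<sigma> i) - n) (\<sigma> i)) =
      \<sigma> i ! (length (\<sigma> i) - Suc n) # rev (take (length (\<sigma> i) - Suc n) (\<sigma> i))"
     "drop (length (\<sigma> i) - Suc n) (\<sigma> i) =
      \<sigma> i ! (length (\<sigma> i) - Suc n) # drop (length (\<sigma> i) - n) (\<sigma> i)"
    if "n < length (\<sigma> i)" for n
  proof -
    have e: "length (\<sigma> i) - n = Suc (length (\<sigma> i) - Suc n)" using that by simp
    show "\<sigma> i ! (length (\<sigma> i) - Suc n) \<in> set (\<sigma> i)" using that by auto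
    show "rev (take (length (\<sigma> i) - n) (\<sigma> i)) =
      \<sigma> i ! (length (\<sigma> i) - Suc n) # rev (take (length (\<sigma> i) - Suc n) (\<sigma> i))"
      unfolding e using that by (subst take_Suc_conv_app_nth) auto
    show "drop (length (\<sigma> i) - Suc n) (\<sigma> i) =
      \<sigma> i ! (length (\<sigma> i) - Suc n) # drop (length (\<sigma> i) - n) (\<sigma> i)"
      unfolding e using that by (subst Cons_nth_drop_Suc) auto
  qed
  have st: "s 0 = \<sigma>(i := [], t := rev (\<sigma> i))" "s (length (\<sigma> i)) = \<sigma>(j := map g (\<sigma> i) @ \<sigma> j)"
    using assms(3-6) by (auto simp: s_def intro!: ext)
  have "runs ?w (s 0) (length (\<sigma> i) * (1 + 1) + 1) (s (length (\<sigma> i)))"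
  proof (rule runs_loop)
    show "\<not> peeks (s (length (\<sigma> i))) t \<noteq> 0" using assms by (simp add: s_def)
  next
    fix n assume n: "n < length (\<sigma> i)"
    show "peeks (s n) t \<noteq> 0" using tk[OF n] nz assms by (simp add: s_def)
    show "runs (Basic (\<lambda>a. (\<lambda>_. Nop)(t := Pop, i := Push (a t), j := Push (g (a t))))) (s n) 1 (s (Suc n))"
    proof (rule runs_eq[OF runs_Basic])
      have p: "peeks (s n) t = \<sigma> i ! (length (\<sigma> i) - Suc n)"
        using tk(2)[OF n] assms(3-6) by (simp add: s_def)
      show "apps ((\<lambda>_. Nop)(t := Pop, i := Push (peeks (s n) t), j := Push (g (peeks (s n) t)))) (s n) = s (Suc n)"
        unfolding p using tk(2,3)[OF n] nz[OF tk(1)[OF n]] assms(2)[OF tk(1)[OF n]] assms(3-6)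
        by (intro ext) (simp add: s_def)
    qed simp
  qed
  moreover have "runs (move id i t) \<sigma> (2 * length (\<sigma> i) + 1) (s 0)"
    using runs_move[of \<sigma> i id t] assms nz unfolding st by simp
  ultimately have "runs (copy g i j t) \<sigma> (2 * length (\<sigma> i) + 1 + (length (\<sigma> i) * (1 + 1) + 1) + 1)
      (\<sigma>(j := map g (\<sigma> i) @ \<sigma> j))"
    unfolding copy_def st(2)[symmetric] by (intro runs_Seq)
  then show ?thesis by (rule runs_mono) simp
qed

section \<open>Tilings as labellings\<close>

fun box :: "cube \<Rightarrow> cube \<Rightarrow> cube set" where
  "box (x, y, z) (dx, dy, dz) = {x, x + dx} \<times> {y, y + dy} \<times> {z, z + dz}"

text \<open>A slab that contains a given cube is determined by the vector to the opposite corner: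
  the thin axis gives the entry 0, and the signs on the other two axes give four choices.\<close>

definition dirs :: "cube set" where
  "dirs = (\<Union>p\<in>{-1, 1}. \<Union>q\<in>{-1, 1}. {(p, q, 0), (p, 0, q), (0, p, q)})"

lemma dirs_iff:
  "(dx, dy, dz) \<in> dirs \<longleftrightarrow> dx = 0 \<and> dy \<in> {-1, 1} \<and> dz \<in> {-1, 1} \<or>
     dx \<in> {-1, 1} \<and> dy = 0 \<and> dz \<in> {-1, 1} \<or> dx \<in> {-1, 1} \<and> dy \<in> {-1, 1} \<and> dz = 0"
  unfolding dirs_def by blast

fun sqd :: "cube \<Rightarrow> cube \<Rightarrow> int" where
  "sqd (x, y, z) (x', y', z') = (x - x')\<^sup>2 + (y - y')\<^sup>2 + (z - z')\<^sup>2"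

lemma dist_centre: "dist (centre u) (centre v) = sqrt (of_int (sqd u v))"
proof -
  obtain x y z x' y' z' where uv: "u = (x, y, z)" "v = (x', y', z')"
    by (metis prod_cases3)
  have "dist (real_of_int a) (real_of_int b) ^ 2 = real_of_int ((a - b)\<^sup>2)" for a b
    by (simp add: dist_real_def)
  then show ?thesis by (simp add: uv centre_def dist_Pair_Pair)
qed

lemma isometry_sqd: "lattice_isometry \<phi> \<Longrightarrow> sqd (\<phi> u) (\<phi> v) = sqd u v"
  by (simp add: lattice_isometry_def dist_centre del: sqd.simps split_paired_All)

lemma int_sq_le_one: "(x::int)\<^sup>2 \<le> 1 \<Longrightarrow> x = -1 \<or> x = 0 \<or> x = 1"
proof -
  assume "x\<^sup>2 \<le> 1"
  then have "\<bar>x\<bar> \<le> 1" using abs_square_le_1 by blast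
  then show ?thesis by linarith
qed

lemma unit_vectors:
  assumes "(x::int)\<^sup>2 + y\<^sup>2 + z\<^sup>2 = 1"
  shows "(x, y, z) \<in> {(1, 0, 0), (-1, 0, 0), (0, 1, 0), (0, -1, 0), (0, 0, 1), (0, 0, -1)}"
proof -
  have "x\<^sup>2 \<le> 1" "y\<^sup>2 \<le> 1" "z\<^sup>2 \<le> 1"
    using assms zero_le_power2[of x] zero_le_power2[of y] zero_le_power2[of z] by linarith+
  then have "x = -1 \<or> x = 0 \<or> x = 1" "y = -1 \<or> y = 0 \<or> y = 1" "z = -1 \<or> z = 0 \<or> z = 1"
    by (simp_all add: int_sq_le_one)
  then show ?thesis using assms by (elim disjE) simp_all
qed

text \<open>Distances alone determine the image. The images of the two unit vectors are unit lattice
  vectors at squared distance 2, hence orthogonal. The image of the far corner has squared length 2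
  and scalar product 1 with both of them, which leaves only their sum.\<close>

lemma slab_image_box:
  assumes "lattice_isometry \<phi>"
  shows "\<exists>a. \<exists>d\<in>dirs. \<phi> ` slab = box a d"
proof -
  obtain ax ay az where A: "\<phi> (0, 0, 0) = (ax, ay, az)" by (metis prod_cases3)
  obtain bx by' bz where B: "\<phi> (1, 0, 0) = (ax + bx, ay + by', az + bz)"
    by (metis add.commute diff_add_cancel prod_cases3)
  obtain cx cy cz where C: "\<phi> (0, 1, 0) = (ax + cx, ay + cy, az + cz)"
    by (metis add.commute diff_add_cancel prod_cases3)
  obtain dx dy dz where D: "\<phi> (1, 1, 0) = (ax + dx, ay + dy, az + dz)"
    by (metis add.commute diff_add_cancel prod_cases3)
  note iso = isometry_sqd[OF assms]
  have 1: "bx\<^sup>2 + by'\<^sup>2 + bz\<^sup>2 = 1" using iso[of "(1, 0, 0)" "(0, 0, 0)"] by (simp add: A B)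
  have 2: "cx\<^sup>2 + cy\<^sup>2 + cz\<^sup>2 = 1" using iso[of "(0, 1, 0)" "(0, 0, 0)"] by (simp add: A C)
  have 3: "(bx - cx)\<^sup>2 + (by' - cy)\<^sup>2 + (bz - cz)\<^sup>2 = 2"
    using iso[of "(1, 0, 0)" "(0, 1, 0)"] by (simp add: B C)
  have 4: "dx\<^sup>2 + dy\<^sup>2 + dz\<^sup>2 = 2" using iso[of "(1, 1, 0)" "(0, 0, 0)"] by (simp add: A D)
  have 5: "(dx - bx)\<^sup>2 + (dy - by')\<^sup>2 + (dz - bz)\<^sup>2 = 1"
    using iso[of "(1, 1, 0)" "(1, 0, 0)"] by (simp add: B D)
  have 6: "(dx - cx)\<^sup>2 + (dy - cy)\<^sup>2 + (dz - cz)\<^sup>2 = 1"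
    using iso[of "(1, 1, 0)" "(0, 1, 0)"] by (simp add: C D)
  have sl: "slab = {(0, 0, 0), (1, 0, 0), (0, 1, 0), (1, 1, 0)}" by (auto simp: slab_def)
  have im: "\<phi> ` slab = {(ax, ay, az), (ax + bx, ay + by', az + bz), (ax + cx, ay + cy, az + cz),
      (ax + dx, ay + dy, az + dz)}"
    unfolding sl image_insert image_empty A B C D by (rule refl)
  have e: "dx * bx + dy * by' + dz * bz = 1" using 1 4 5 by (simp add: power2_eq_square algebra_simps)
  have f: "dx * cx + dy * cy + dz * cz = 1" using 2 4 6 by (simp add: power2_eq_square algebra_simps)
  have b: "(bx, by', bz) \<in> {(1, 0, 0), (-1, 0, 0), (0, 1, 0), (0, -1, 0), (0, 0, 1), (0, 0, -1)}"
    using unit_vectors[OF 1] .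
  have c: "(cx, cy, cz) \<in> {(1, 0, 0), (-1, 0, 0), (0, 1, 0), (0, -1, 0), (0, 0, 1), (0, 0, -1)}"
    using unit_vectors[OF 2] .
  have orth: "bx * cx = 0" "by' * cy = 0" "bz * cz = 0" by (insert b c 3, (elim insertE emptyE; simp)+)
  have "(dx, dy, dz) = (bx + cx, by' + cy, bz + cz)" 
    by (insert b c orth e f 4, elim insertE emptyE) (simp_all, (simp add: eq_neg_iff_add_eq_0 minus_equation_iff; fail)?)
  then have d: "dx = bx + cx" "dy = by' + cy" "dz = bz + cz" by simp_all
  have "(dx, dy, dz) \<in> dirs" unfolding d
    by (insert b c orth, elim insertE emptyE) (simp_all add: dirs_def)
  moreover have "\<phi> ` slab = box (ax, ay, az) (dx, dy, dz)"
    unfolding im d by (insert b c orth, elim insertE emptyE) (simp_all, auto)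
  ultimately show ?thesis by blast
qed

lemma box_slab_image:
  assumes "d \<in> dirs"
  shows "\<exists>\<phi>. lattice_isometry \<phi> \<and> box a d = \<phi> ` slab"
proof -
  obtain x y z where a: "a = (x, y, z)" by (metis prod_cases3)
  have sl: "slab = {(0, 0, 0), (1, 0, 0), (0, 1, 0), (1, 1, 0)}" by (auto simp: slab_def)
  have iso: "lattice_isometry \<phi>" if "bij \<phi>" "\<And>u v. sqd (\<phi> u) (\<phi> v) = sqd u v" for \<phi>
    using that by (simp add: lattice_isometry_def dist_centre del: sqd.simps split_paired_All)
  obtain p q :: int where pq: "p \<in> {-1, 1}" "q \<in> {-1, 1}" "d = (p, q, 0) \<or> d = (p, 0, q) \<or> d = (0, p, q)"
    using assms by (auto simp: dirs_def)
  have pp: "p * p = 1" "q * q = 1" "p * (p * t) = t" "q * (q * t) = t" for t using pq by auto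
  have sq: "(p * s - p * t)\<^sup>2 = (s - t)\<^sup>2" "(q * s - q * t)\<^sup>2 = (s - t)\<^sup>2" for s t
    using pq by (auto simp: power2_commute)
  from pq(3) show ?thesis
  proof (elim disjE)
    assume d: "d = (p, q, 0)"
    let ?\<phi> = "\<lambda>(s, t, r). (x + p * s, y + q * t, z + r)"
    have "bij ?\<phi>"
      by (rule o_bij[of "\<lambda>(s, t, r). (p * (s - x), q * (t - y), r - z)"])
        (auto simp: fun_eq_iff pp algebra_simps)
    moreover have "sqd (?\<phi> u) (?\<phi> v) = sqd u v" for u v
      by (cases u rule: prod_cases3; cases v rule: prod_cases3) (simp add: sq)
    ultimately show ?thesis using iso by (intro exI[of _ ?\<phi>]) (auto simp: a d sl)
  next
    assume d: "d = (p, 0, q)"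
    let ?\<phi> = "\<lambda>(s, t, r). (x + p * s, y + r, z + q * t)"
    have "bij ?\<phi>"
      by (rule o_bij[of "\<lambda>(s, t, r). (p * (s - x), q * (r - z), t - y)"])
        (auto simp: fun_eq_iff pp algebra_simps)
    moreover have "sqd (?\<phi> u) (?\<phi> v) = sqd u v" for u v
      by (cases u rule: prod_cases3; cases v rule: prod_cases3) (simp add: sq)
    ultimately show ?thesis using iso by (intro exI[of _ ?\<phi>]) (auto simp: a d sl)
  next
    assume d: "d = (0, p, q)"
    let ?\<phi> = "\<lambda>(s, t, r). (x + r, y + p * s, z + q * t)"
    have "bij ?\<phi>"
      by (rule o_bij[of "\<lambda>(s, t, r). (p * (t - y), q * (r - z), s - x)"])
        (auto simp: fun_eq_iff pp algebra_simps)
    moreover have "sqd (?\<phi> u) (?\<phi> v) = sqd u v" for u v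
      by (cases u rule: prod_cases3; cases v rule: prod_cases3) (simp add: sq)
    ultimately show ?thesis using iso by (intro exI[of _ ?\<phi>]) (auto simp: a d sl)
  qed
qed

lemma box_self: "c \<in> box c d"
  by (cases c rule: prod_cases3; cases d rule: prod_cases3) simp

text \<open>Seen from another of its cubes, a box is described by the same vector with the signs
  flipped along the axes on which the two cubes differ.\<close>

lemma box_reanchor:
  assumes "d \<in> dirs" "c \<in> box a d"
  shows "\<exists>d'\<in>dirs. box c d' = box a d"
proof -
  obtain x y z where a: "a = (x, y, z)" by (metis prod_cases3)
  obtain dx dy dz where d: "d = (dx, dy, dz)" by (metis prod_cases3)
  obtain cx cy cz where c: "c = (cx, cy, cz)" by (metis prod_cases3)
  let ?d = "(if cx = x then dx else - dx, if cy = y then dy else - dy, if cz = z then dz else - dz)"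
  have f: "(if b then t else - t) \<in> {-1, 1} \<longleftrightarrow> t \<in> {-1, 1}" "(if b then t else - t) = 0 \<longleftrightarrow> t = 0"
    for t :: int and b by auto
  have "?d \<in> dirs" using assms(1) unfolding d dirs_iff f .
  moreover have "{cx, cx + (if cx = x then dx else - dx)} = {x, x + dx}"
    "{cy, cy + (if cy = y then dy else - dy)} = {y, y + dy}"
    "{cz, cz + (if cz = z then dz else - dz)} = {z, z + dz}"
    using assms(2) unfolding a d c by auto
  then have "box c ?d = box a d" unfolding a c d box.simps by simp
  ultimately show ?thesis by blast
qed

text \<open>A tiling in functional form: each cube names the opposite corner of its slab, and all
  cubes of that slab have to name the same box. In this form a tiling can be guessed symbol by
  symbol and analysed locally.\<close>

definition labelling :: "cube set \<Rightarrow> (cube \<Rightarrow> cube) \<Rightarrow> bool" where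
  "labelling \<Gamma> \<delta> \<longleftrightarrow> (\<forall>c\<in>\<Gamma>. \<delta> c \<in> dirs \<and> box c (\<delta> c) \<subseteq> \<Gamma> \<and>
     (\<forall>c'\<in>box c (\<delta> c). box c' (\<delta> c') = box c (\<delta> c)))"

theorem admits_tiling_iff_labelling: "admits_tiling \<Gamma> slab \<longleftrightarrow> (\<exists>\<delta>. labelling \<Gamma> \<delta>)"
proof
  assume "admits_tiling \<Gamma> slab"
  then obtain P where P: "partition_on \<Gamma> P" "\<And>B. B \<in> P \<Longrightarrow> \<exists>\<phi>. lattice_isometry \<phi> \<and> B = \<phi> ` slab"
    by (auto simp: admits_tiling_def is_tiling_def)
  have "\<exists>d. d \<in> dirs \<and> box c d \<in> P" if c: "c \<in> \<Gamma>" for c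
  proof -
    obtain B where B: "B \<in> P" "c \<in> B" using partition_onD1[OF P(1)] c by auto
    then obtain a d where "d \<in> dirs" "B = box a d" using P(2) slab_image_box by metis
    then show ?thesis using box_reanchor B by metis
  qed
  then obtain \<delta> where \<delta>: "\<And>c. c \<in> \<Gamma> \<Longrightarrow> \<delta> c \<in> dirs \<and> box c (\<delta> c) \<in> P" by metis
  have "box c' (\<delta> c') = box c (\<delta> c)" if "c \<in> \<Gamma>" "c' \<in> box c (\<delta> c)" for c c'
  proof -
    have "c' \<in> \<Gamma>" using P(1) \<delta>[OF that(1)] that by (auto simp: partition_on_def)
    then have "box c' (\<delta> c') \<inter> box c (\<delta> c) \<noteq> {}" "box c' (\<delta> c') \<in> P" "box c (\<delta> c) \<in> P"
      using \<delta>[of c'] \<delta>[OF that(1)] that(2) box_self[of c' "\<delta> c'"] by blast+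
    then show ?thesis using P(1) unfolding partition_on_def disjoint_def by blast
  qed
  moreover have "box c (\<delta> c) \<subseteq> \<Gamma>" if "c \<in> \<Gamma>" for c
    using \<delta>[OF that] P(1) by (auto simp: partition_on_def)
  ultimately show "\<exists>\<delta>. labelling \<Gamma> \<delta>" using \<delta> unfolding labelling_def by blast
next
  assume "\<exists>\<delta>. labelling \<Gamma> \<delta>"
  then obtain \<delta> where \<delta>: "labelling \<Gamma> \<delta>" by blast
  let ?P = "(\<lambda>c. box c (\<delta> c)) ` \<Gamma>"
  have sub: "box c (\<delta> c) \<subseteq> \<Gamma>" and eq: "c' \<in> box c (\<delta> c) \<Longrightarrow> box c' (\<delta> c') = box c (\<delta> c)"
    and dr: "\<delta> c \<in> dirs" if "c \<in> \<Gamma>" for c c'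
    using \<delta> that unfolding labelling_def by simp_all
  have "partition_on \<Gamma> ?P"
    unfolding partition_on_def disjoint_def
  proof (intro conjI ballI impI)
    show "\<Union> ?P = \<Gamma>"
    proof
      show "\<Union> ?P \<subseteq> \<Gamma>" using sub by (rule UN_least)
      show "\<Gamma> \<subseteq> \<Union> ?P" by (rule subsetI, rule UN_I, assumption, rule box_self)
    qed
    show "{} \<notin> ?P"
    proof
      assume "{} \<in> ?P"
      then obtain c where "{} = box c (\<delta> c)" by (rule imageE)
      then show False using box_self[of c "\<delta> c"] by simp
    qed
    fix A B assume "A \<in> ?P" "B \<in> ?P" and ne: "A \<noteq> B"
    then obtain a b where ab: "A = box a (\<delta> a)" "a \<in> \<Gamma>" "B = box b (\<delta> b)" "b \<in> \<Gamma>" by (elim imageE) metis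
    show "A \<inter> B = {}"
    proof (rule ccontr)
      assume "A \<inter> B \<noteq> {}"
      then obtain x where "x \<in> A" "x \<in> B" by blast
      then show False using eq[OF ab(2), of x] eq[OF ab(4), of x] ab ne by simp
    qed
  qed
  moreover have "\<exists>\<phi>. lattice_isometry \<phi> \<and> B = \<phi> ` slab" if "B \<in> ?P" for B
    using that
  proof (rule imageE)
    fix c assume "B = box c (\<delta> c)" "c \<in> \<Gamma>"
    then show ?thesis using box_slab_image[OF dr] by simp
  qed
  ultimately show "admits_tiling \<Gamma> slab"
    unfolding admits_tiling_def is_tiling_def by blast
qed

section \<open>Wires, rings and crossings\<close>

lemma pair_set_eqs:
  fixes x d e :: int
  shows "{x + d, x + d + e} = {x, x + d} \<longleftrightarrow> e = - d" "{x, x + e} = {x, x + d} \<longleftrightarrow> e = d"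
    "{x + d, x} = {x, x + d}"
  by (auto simp: doubleton_eq_iff)

lemma box_eq_iff:
  "box (x, y, z) (dx, dy, dz) = box (x', y', z') (dx', dy', dz') \<longleftrightarrow>
   {x, x + dx} = {x', x' + dx'} \<and> {y, y + dy} = {y', y' + dy'} \<and> {z, z + dz} = {z', z' + dz'}"
  unfolding box.simps times_eq_iff by blast

text \<open>Two descriptions of one box whose anchors differ along a single axis agree except for
  the sign on that axis.\<close>

lemma labelling_flip:
  assumes "labelling \<Gamma> \<delta>" "(x, y, z) \<in> \<Gamma>" "\<delta> (x, y, z) = (dx, dy, dz)"
  shows "(x + dx, y, z) \<in> \<Gamma> \<and> \<delta> (x + dx, y, z) = (- dx, dy, dz)"
    "(x, y + dy, z) \<in> \<Gamma> \<and> \<delta> (x, y + dy, z) = (dx, - dy, dz)"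
    "(x, y, z + dz) \<in> \<Gamma> \<and> \<delta> (x, y, z + dz) = (dx, dy, - dz)"
proof -
  have *: "c' \<in> \<Gamma> \<and> box c' (\<delta> c') = box (x, y, z) (dx, dy, dz)" if "c' \<in> box (x, y, z) (dx, dy, dz)" for c'
    using assms that unfolding labelling_def by (metis subsetD)
  obtain a b c where 1: "\<delta> (x + dx, y, z) = (a, b, c)" by (metis prod_cases3)
  have "(x + dx, y, z) \<in> box (x, y, z) (dx, dy, dz)" by simp
  from *[OF this] show "(x + dx, y, z) \<in> \<Gamma> \<and> \<delta> (x + dx, y, z) = (- dx, dy, dz)"
    unfolding 1 box_eq_iff pair_set_eqs by simp
  obtain a b c where 2: "\<delta> (x, y + dy, z) = (a, b, c)" by (metis prod_cases3)
  have "(x, y + dy, z) \<in> box (x, y, z) (dx, dy, dz)" by simp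
  from *[OF this] show "(x, y + dy, z) \<in> \<Gamma> \<and> \<delta> (x, y + dy, z) = (dx, - dy, dz)"
    unfolding 2 box_eq_iff pair_set_eqs by simp
  obtain a b c where 3: "\<delta> (x, y, z + dz) = (a, b, c)" by (metis prod_cases3)
  have "(x, y, z + dz) \<in> box (x, y, z) (dx, dy, dz)" by simp
  from *[OF this] show "(x, y, z + dz) \<in> \<Gamma> \<and> \<delta> (x, y, z + dz) = (dx, dy, - dz)"
    unfolding 3 box_eq_iff pair_set_eqs by simp
qed

lemma labelling_dirs: "labelling \<Gamma> \<delta> \<Longrightarrow> c \<in> \<Gamma> \<Longrightarrow> \<delta> c \<in> dirs"
  by (simp add: labelling_def)

lemma labelling_sub: "labelling \<Gamma> \<delta> \<Longrightarrow> c \<in> \<Gamma> \<Longrightarrow> c' \<in> box c (\<delta> c) \<Longrightarrow> c' \<in> \<Gamma>"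
  unfolding labelling_def by (metis subsetD)

text \<open>Any cube of a box is reached from any other by changing one coordinate at a time, so
  agreement across single axes is enough.\<close>

lemma labellingI:
  assumes "\<And>c. c \<in> \<Gamma> \<Longrightarrow> \<delta> c \<in> dirs"
    and X: "\<And>x y z dx dy dz. (x, y, z) \<in> \<Gamma> \<Longrightarrow> \<delta> (x, y, z) = (dx, dy, dz) \<Longrightarrow> dx \<noteq> 0 \<Longrightarrow>
      (x + dx, y, z) \<in> \<Gamma> \<and> \<delta> (x + dx, y, z) = (- dx, dy, dz)"
    and Y: "\<And>x y z dx dy dz. (x, y, z) \<in> \<Gamma> \<Longrightarrow> \<delta> (x, y, z) = (dx, dy, dz) \<Longrightarrow> dy \<noteq> 0 \<Longrightarrow>
      (x, y + dy, z) \<in> \<Gamma> \<and> \<delta> (x, y + dy, z) = (dx, - dy, dz)"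
    and Z: "\<And>x y z dx dy dz. (x, y, z) \<in> \<Gamma> \<Longrightarrow> \<delta> (x, y, z) = (dx, dy, dz) \<Longrightarrow> dz \<noteq> 0 \<Longrightarrow>
      (x, y, z + dz) \<in> \<Gamma> \<and> \<delta> (x, y, z + dz) = (dx, dy, - dz)"
  shows "labelling \<Gamma> \<delta>"
proof -
  have X': "(x + dx, y, z) \<in> \<Gamma> \<and> \<delta> (x + dx, y, z) = (- dx, dy, dz)"
    if "(x, y, z) \<in> \<Gamma>" "\<delta> (x, y, z) = (dx, dy, dz)" for x y z dx dy dz
    using X[OF that] that by (cases "dx = 0") auto
  have Y': "(x, y + dy, z) \<in> \<Gamma> \<and> \<delta> (x, y + dy, z) = (dx, - dy, dz)"
    if "(x, y, z) \<in> \<Gamma>" "\<delta> (x, y, z) = (dx, dy, dz)" for x y z dx dy dz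
    using Y[OF that] that by (cases "dy = 0") auto
  have Z': "(x, y, z + dz) \<in> \<Gamma> \<and> \<delta> (x, y, z + dz) = (dx, dy, - dz)"
    if "(x, y, z) \<in> \<Gamma>" "\<delta> (x, y, z) = (dx, dy, dz)" for x y z dx dy dz
    using Z[OF that] that by (cases "dz = 0") auto
  have "c' \<in> \<Gamma> \<and> box c' (\<delta> c') = box c (\<delta> c)" if c: "c \<in> \<Gamma>" "c' \<in> box c (\<delta> c)" for c c'
  proof -
    obtain x y z where xyz: "c = (x, y, z)" by (metis prod_cases3)
    obtain dx dy dz where d: "\<delta> (x, y, z) = (dx, dy, dz)" by (metis prod_cases3)
    obtain x' y' z' where c': "c' = (x', y', z')" by (metis prod_cases3)
    have m: "x' = x \<or> x' = x + dx" "y' = y \<or> y' = y + dy" "z' = z \<or> z' = z + dz"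
      using c(2) unfolding xyz d c' by auto
    obtain dx' where 1: "(x', y, z) \<in> \<Gamma>" "\<delta> (x', y, z) = (dx', dy, dz)" "{x', x' + dx'} = {x, x + dx}"
      using m(1) c(1) d X'[of x y z dx dy dz] unfolding xyz by (elim disjE) (auto simp: pair_set_eqs)
    obtain dy' where 2: "(x', y', z) \<in> \<Gamma>" "\<delta> (x', y', z) = (dx', dy', dz)" "{y', y' + dy'} = {y, y + dy}"
      using m(2) 1 Y'[of x' y z dx' dy dz] by (elim disjE) (auto simp: pair_set_eqs)
    obtain dz' where 3: "(x', y', z') \<in> \<Gamma>" "\<delta> (x', y', z') = (dx', dy', dz')" "{z', z' + dz'} = {z, z + dz}"
      using m(3) 2 Z'[of x' y' z dx' dy' dz] by (elim disjE) (auto simp: pair_set_eqs)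
    show ?thesis unfolding c' xyz d 3(2) box_eq_iff using 1 2 3 by simp
  qed
  then show ?thesis using assms(1) unfolding labelling_def by blast
qed

text \<open>One symbol for each block of 4 by 8 positions in the \<open>x\<close>-\<open>y\<close>
  plane: pieces of the two side walls with flags for the first and the last row of a group, the two
  ends of a column, and the crossing of a column and a row. The number in \<open>Cell\<close> is 1
  or 2 for the two dips; otherwise column and wire do not touch.\<close>

datatype sym = Blank | LeftP bool bool | RightP bool bool | Cap0 | Cap1 | Cell nat

text \<open>A column path descends at the first leg and climbs at the second; a dip of type 2 is that of
  type 1 shifted by two, so that the row wire meets its ascending instead of its descending leg.\<close>

definition leg :: "nat \<Rightarrow> int \<Rightarrow> int" where
  "leg t b = (if t = 1 then b else if t = 2 then b + 2 else 0)"

text \<open>The trace of a column in the \<open>y\<close>-\<open>z\<close> plane. It consists of an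
  upper run at height 3 and a return run at height -3, joined by the caps. Between them there is
  room for the wires at heights 0 and 1; only the upper run ever dips, and its legs reach down to
  height -1, past the wire.\<close>

fun colp :: "sym \<Rightarrow> int \<Rightarrow> int \<Rightarrow> bool" where
  "colp Cap0 b z \<longleftrightarrow> b = 7 \<and> -3 \<le> z \<and> z \<le> 3"
| "colp Cap1 b z \<longleftrightarrow> b = 0 \<and> -3 \<le> z \<and> z \<le> 3"
| "colp (Cell t) b z \<longleftrightarrow> z = -3 \<or> z = 3 \<and> leg t b \<noteq> 4 \<or>
     -1 \<le> z \<and> z \<le> 3 \<and> (leg t b = 3 \<or> leg t b = 5) \<or> z = -1 \<and> leg t b = 4"
| "colp _ b z \<longleftrightarrow> False"

text \<open>Columns are two cubes thick in the \<open>x\<close> direction. A wall lacks the part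
  below \<open>b = 3\<close> in the first row of its group and the part above it in the last row, so
  it runs from junction to junction and has odd length.\<close>

fun shape :: "sym \<Rightarrow> int \<Rightarrow> int \<Rightarrow> int \<Rightarrow> bool" where
  "shape Blank a b z \<longleftrightarrow> False"
| "shape (LeftP f l) a b z \<longleftrightarrow> (z = 0 \<or> z = 1) \<and>
     (a = 1 \<and> (b = 3 \<or> b < 3 \<and> \<not> f \<or> b > 3 \<and> \<not> l) \<or> (a = 2 \<or> a = 3) \<and> b = 3)"
| "shape (RightP f l) a b z \<longleftrightarrow> (z = 0 \<or> z = 1) \<and>
     (a = 2 \<and> (b = 3 \<or> b < 3 \<and> \<not> f \<or> b > 3 \<and> \<not> l) \<or> (a = 0 \<or> a = 1) \<and> b = 3)"
| "shape (Cell t) a b z \<longleftrightarrow> b = 3 \<and> (z = 0 \<or> z = 1) \<or> (a = 0 \<or> a = 1) \<and> colp (Cell t) b z"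
| "shape s a b z \<longleftrightarrow> (a = 0 \<or> a = 1) \<and> colp s b z"

text \<open>The successor on the closed band, oriented upwards in \<open>Cap0\<close>, along
  increasing \<open>y\<close> on the upper run, downwards in \<open>Cap1\<close> and back along the
  lower run; \<open>pdir\<close> gives the predecessor.\<close>

fun sdir :: "sym \<Rightarrow> int \<Rightarrow> int \<Rightarrow> int \<times> int" where
  "sdir Cap0 b z = (if z < 3 then (0, 1) else (1, 0))"
| "sdir Cap1 b z = (if z > -3 then (0, -1) else (-1, 0))"
| "sdir (Cell t) b z = (if z = -3 then (-1, 0)
     else if leg t b = 3 \<and> z > -1 then (0, -1) else if leg t b = 5 \<and> z < 3 then (0, 1) else (1, 0))"
| "sdir _ b z = (0, 0)"

fun pdir :: "sym \<Rightarrow> int \<Rightarrow> int \<Rightarrow> int \<times> int" where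
  "pdir Cap0 b z = (if z > -3 then (0, -1) else (1, 0))"
| "pdir Cap1 b z = (if z < 3 then (0, 1) else (-1, 0))"
| "pdir (Cell t) b z = (if z = -3 then (1, 0)
     else if leg t b = 3 \<and> z < 3 then (0, 1) else if leg t b = 5 \<and> z > -1 then (0, -1) else (-1, 0))"
| "pdir _ b z = (0, 0)"

definition is_col :: "sym \<Rightarrow> bool" where
  "is_col s \<longleftrightarrow> s = Cap0 \<or> s = Cap1 \<or> (\<exists>t. s = Cell t)"

lemma leg_cases:
  obtains "\<And>b. leg t b = 0" | "\<And>b. leg t b = b" | "\<And>b. leg t b = b + 2"
  by (cases "t = 1"; cases "t = 2") (auto simp: leg_def)

lemma block_range: "0 \<le> b \<Longrightarrow> b < 8 \<Longrightarrow> b \<in> {0, 1, 2, 3, 4, 5, 6, 7::int}"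
  by auto

lemma colp_range: "colp s b z \<Longrightarrow> z \<in> {-3, -2, -1, 0, 1, 2, 3}"
  by (cases s) auto

text \<open>A path leaves a block only through the ports at heights 3 and -3, which are common to
  all crossings. That is why blocks of different types can be put next to each other.\<close>

lemma sdir_inside:
  assumes "is_col s" "colp s b z" "0 \<le> b" "b < 8" "sdir s b z = (p, q)"
  shows "(p, q) \<in> {(1, 0), (-1, 0), (0, 1), (0, -1)} \<and>
    (if 0 \<le> b + p \<and> b + p < 8 then colp s (b + p) (z + q) \<and> pdir s (b + p) (z + q) = (- p, - q)
     else b = 7 \<and> (p, q) = (1, 0) \<and> z = 3 \<and> s \<noteq> Cap1 \<or> b = 0 \<and> (p, q) = (-1, 0) \<and> z = -3 \<and> s \<noteq> Cap0)"
proof (cases s)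
  case (Cell t)
  show ?thesis
    by (rule leg_cases[of t]; insert assms(2,5) block_range[OF assms(3,4)] colp_range[OF assms(2)] Cell;
        elim insertE emptyE; hypsubst; simp split: if_splits)
qed (insert assms(1,2,5) colp_range[OF assms(2)]; elim insertE emptyE; hypsubst; simp add: is_col_def split: if_splits)+

lemma pdir_inside:
  assumes "is_col s" "colp s b z" "0 \<le> b" "b < 8" "pdir s b z = (p, q)"
  shows "(p, q) \<in> {(1, 0), (-1, 0), (0, 1), (0, -1)} \<and>
    (if 0 \<le> b + p \<and> b + p < 8 then colp s (b + p) (z + q) \<and> sdir s (b + p) (z + q) = (- p, - q)
     else b = 7 \<and> (p, q) = (1, 0) \<and> z = -3 \<and> s \<noteq> Cap1 \<or> b = 0 \<and> (p, q) = (-1, 0) \<and> z = 3 \<and> s \<noteq> Cap0)"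
proof (cases s)
  case (Cell t)
  show ?thesis
    by (rule leg_cases[of t]; insert assms(2,5) block_range[OF assms(3,4)] colp_range[OF assms(2)] Cell;
        elim insertE emptyE; hypsubst; simp split: if_splits)
qed (insert assms(1,2,5) colp_range[OF assms(2)]; elim insertE emptyE; hypsubst; simp add: is_col_def split: if_splits)+

lemma sdir_pdir_neq:
  assumes "is_col s" "colp s b z"
  shows "sdir s b z \<noteq> pdir s b z"
proof (cases s)
  case (Cell t)
  then show ?thesis using assms(2) colp_range[OF assms(2)] by (elim insertE emptyE) (auto split: if_splits)
qed (use assms in \<open>auto simp: is_col_def\<close>)

text \<open>In the plane of the column the wire contributes no further neighbours: at a dip its
  cubes already lie on the path, and without a dip it keeps away from both runs.\<close>

lemma colp_neighbours:
  assumes "is_col s" "colp s b z" "0 \<le> b" "b < 8" "0 \<le> b + p" "b + p < 8" "shape s 0 (b + p) (z + q)"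
    "(p, q) \<in> {(1, 0), (-1, 0), (0, 1), (0, -1)}"
  shows "(p, q) = sdir s b z \<or> (p, q) = pdir s b z"
proof (cases s)
  case (Cell t)
  show ?thesis
    by (rule leg_cases[of t]; insert assms(2,5-8) block_range[OF assms(3,4)] colp_range[OF assms(2)] Cell;
        elim insertE emptyE; clarify?; hypsubst?; simp)
qed (insert assms(1,2,5-8) colp_range[OF assms(2)]; elim insertE emptyE; clarify?; hypsubst?; simp add: is_col_def)+

text \<open>The trace contains no full square of the \<open>y\<close>-\<open>z\<close> plane. This
  is what forces the slabs on a column to extend in the \<open>x\<close> direction.\<close>

lemma colp_corners:
  assumes "is_col s" "colp s b z" "0 \<le> b" "b < 8" "0 \<le> b + p" "b + p < 8" "p \<in> {-1, 1}" "q \<in> {-1, 1}"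
    "shape s 0 (b + p) z" "shape s 0 b (z + q)"
  shows "\<not> shape s 0 (b + p) (z + q)"
proof (cases s)
  case (Cell t)
  show ?thesis
    by (rule leg_cases[of t]; insert assms(2,5-10) block_range[OF assms(3,4)] colp_range[OF assms(2)] Cell;
        elim insertE emptyE; hypsubst?; simp)
qed (insert assms(1,2,5-10) colp_range[OF assms(2)]; elim insertE emptyE; hypsubst?; simp add: is_col_def)+

section \<open>Arrangement of the blocks into one region\<close>

lemma block4: "0 \<le> a \<Longrightarrow> a < 4 \<Longrightarrow> (4 * J + a) div 4 = J \<and> (4 * J + a) mod 4 = (a::int)"
  by auto

lemma block8: "0 \<le> b \<Longrightarrow> b < 8 \<Longrightarrow> (8 * I + b) div 8 = I \<and> (8 * I + b) mod 8 = (b::int)"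
  by auto

lemma col_bottom:
  "is_col s \<Longrightarrow> s \<noteq> Cap0 \<Longrightarrow>
    colp s 0 3 \<and> pdir s 0 3 = (-1, 0) \<and> colp s 0 (-3) \<and> sdir s 0 (-3) = (-1, 0)"
  by (auto simp: is_col_def leg_def)

lemma col_top:
  "is_col s \<Longrightarrow> s \<noteq> Cap1 \<Longrightarrow>
    colp s 7 3 \<and> sdir s 7 3 = (1, 0) \<and> colp s 7 (-3) \<and> pdir s 7 (-3) = (1, 0)"
  by (auto simp: is_col_def leg_def)

lemma cell_border: "shape (Cell t) 0 0 z \<Longrightarrow> z = 3 \<or> z = -3" "shape (Cell t) 0 7 z \<Longrightarrow> z = 3 \<or> z = -3"
  by (auto simp: leg_def split: if_splits)

lemma colp_shape: "is_col s \<Longrightarrow> colp s b z \<Longrightarrow> shape s 0 b z \<and> shape s 1 b z"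
  by (auto simp: is_col_def)

text \<open>There are \<open>R\<close> rows and \<open>m\<close> columns, both numbered from 2 in
  units of blocks; the caps occupy the block rows 1 and \<open>R + 2\<close>, the walls the block
  columns 1 and \<open>m + 2\<close>. \<open>k I J\<close> is the type of a crossing and
  \<open>gr I\<close> the group of a row. Monotonicity makes the groups intervals, so that each can
  have a connected wall.\<close>

locale wiring =
  fixes R m :: int and k :: "int \<Rightarrow> int \<Rightarrow> nat" and gr :: "int \<Rightarrow> int"
  assumes R1: "1 \<le> R" and m0: "0 \<le> m"
    and gr_mono: "2 \<le> I \<Longrightarrow> I \<le> I' \<Longrightarrow> I' < R + 2 \<Longrightarrow> gr I \<le> gr I'"
begin

definition fr :: "int \<Rightarrow> bool" where "fr I \<longleftrightarrow> I = 2 \<or> gr (I - 1) \<noteq> gr I"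
definition la :: "int \<Rightarrow> bool" where "la I \<longleftrightarrow> I = R + 1 \<or> gr (I + 1) \<noteq> gr I"

definition pic :: "int \<Rightarrow> int \<Rightarrow> sym" where
  "pic I J =
    (if 2 \<le> I \<and> I < R + 2 then
       if J = 1 then LeftP (fr I) (la I) else if J = m + 2 then RightP (fr I) (la I)
       else if 2 \<le> J \<and> J < m + 2 then Cell (k I J) else Blank
     else if 2 \<le> J \<and> J < m + 2 then (if I = 1 then Cap0 else if I = R + 2 then Cap1 else Blank)
     else Blank)"

definition region :: "cube set" where
  "region = {(x, y, z). shape (pic (y div 8) (x div 4)) (x mod 4) (y mod 8) z}"

lemma mem_region: "(x, y, z) \<in> region \<longleftrightarrow> shape (pic (y div 8) (x div 4)) (x mod 4) (y mod 8) z"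
  by (simp add: region_def)

lemma mem_block:
  assumes "0 \<le> a" "a < 4" "0 \<le> b" "b < 8"
  shows "(4 * J + a, 8 * I + b, z) \<in> region \<longleftrightarrow> shape (pic I J) a b z"
  using assms by (simp add: mem_region block4 block8)

definition PT :: "int \<Rightarrow> int \<Rightarrow> int \<Rightarrow> bool" where
  "PT J y z \<longleftrightarrow> is_col (pic (y div 8) J) \<and> colp (pic (y div 8) J) (y mod 8) z"

definition sd :: "int \<Rightarrow> int \<Rightarrow> int \<Rightarrow> int \<times> int" where
  "sd J y z = sdir (pic (y div 8) J) (y mod 8) z"

definition pd :: "int \<Rightarrow> int \<Rightarrow> int \<Rightarrow> int \<times> int" where
  "pd J y z = pdir (pic (y div 8) J) (y mod 8) z"

lemma PT_block: "0 \<le> b \<Longrightarrow> b < 8 \<Longrightarrow> PT J (8 * I + b) z \<longleftrightarrow> is_col (pic I J) \<and> colp (pic I J) b z"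
  by (simp add: PT_def block8)

lemma sd_block: "0 \<le> b \<Longrightarrow> b < 8 \<Longrightarrow> sd J (8 * I + b) z = sdir (pic I J) b z"
  by (simp add: sd_def block8)

lemma pd_block: "0 \<le> b \<Longrightarrow> b < 8 \<Longrightarrow> pd J (8 * I + b) z = pdir (pic I J) b z"
  by (simp add: pd_def block8)

lemma pic_up:
  assumes "is_col (pic I J)" "pic I J \<noteq> Cap1"
  shows "is_col (pic (I + 1) J)" "pic (I + 1) J \<noteq> Cap0" "pic I J = Cap0 \<Longrightarrow> \<exists>t. pic (I + 1) J = Cell t"
  using assms R1 by (auto simp: pic_def is_col_def split: if_splits)

lemma pic_down:
  assumes "is_col (pic I J)" "pic I J \<noteq> Cap0"
  shows "is_col (pic (I - 1) J)" "pic (I - 1) J \<noteq> Cap1" "pic I J = Cap1 \<Longrightarrow> \<exists>t. pic (I - 1) J = Cell t"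
  using assms R1 by (auto simp: pic_def is_col_def split: if_splits)

lemma yb: obtains I b where "y = 8 * I + b" "0 \<le> b" "b < (8::int)"
  by (rule that[of "y div 8" "y mod 8"]) auto

lemma shift_block:
  "8 * I + 7 + 1 = 8 * (I + 1) + (0::int)" "8 * I + 0 + - 1 = 8 * (I - 1) + (7::int)"
  by auto

lemma PT_next:
  assumes "PT J y z" "sd J y z = (p, q)"
  shows "(p, q) \<in> {(1, 0), (-1, 0), (0, 1), (0, -1)}" "PT J (y + p) (z + q)" "pd J (y + p) (z + q) = (- p, - q)"
proof -
  obtain I b where y: "y = 8 * I + b" "0 \<le> b" "b < 8" by (rule yb)
  let ?s = "pic I J"
  have s: "is_col ?s" "colp ?s b z" "sdir ?s b z = (p, q)"
    using assms y by (auto simp: PT_block sd_block)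
  note * = sdir_inside[OF s(1,2) y(2,3) s(3)]
  show "(p, q) \<in> {(1, 0), (-1, 0), (0, 1), (0, -1)}" using * by blast
  have "PT J (y + p) (z + q) \<and> pd J (y + p) (z + q) = (- p, - q)"
  proof (cases "0 \<le> b + p \<and> b + p < 8")
    case True
    then show ?thesis using * s y by (simp add: PT_block pd_block add.assoc)
  next
    case False
    then consider "b = 7" "p = 1" "q = 0" "z = 3" "?s \<noteq> Cap1" | "b = 0" "p = -1" "q = 0" "z = -3" "?s \<noteq> Cap0"
      using * by auto
    then show ?thesis
    proof cases
      case 1
      show ?thesis unfolding y(1) 1 shift_block
        using col_bottom[OF pic_up(1,2)[OF s(1) 1(5)]] pic_up(1)[OF s(1) 1(5)]
        by (simp only: PT_block pd_block) simp
    next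
      case 2
      show ?thesis unfolding y(1) 2 shift_block
        using col_top[OF pic_down(1,2)[OF s(1) 2(5)]] pic_down(1)[OF s(1) 2(5)]
        by (simp only: PT_block pd_block) simp
    qed
  qed
  then show "PT J (y + p) (z + q)" "pd J (y + p) (z + q) = (- p, - q)" by auto
qed

lemma PT_prev:
  assumes "PT J y z" "pd J y z = (p, q)"
  shows "(p, q) \<in> {(1, 0), (-1, 0), (0, 1), (0, -1)}" "PT J (y + p) (z + q)" "sd J (y + p) (z + q) = (- p, - q)"
proof -
  obtain I b where y: "y = 8 * I + b" "0 \<le> b" "b < 8" by (rule yb)
  let ?s = "pic I J"
  have s: "is_col ?s" "colp ?s b z" "pdir ?s b z = (p, q)"
    using assms y by (auto simp: PT_block pd_block)
  note * = pdir_inside[OF s(1,2) y(2,3) s(3)]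
  show "(p, q) \<in> {(1, 0), (-1, 0), (0, 1), (0, -1)}" using * by blast
  have "PT J (y + p) (z + q) \<and> sd J (y + p) (z + q) = (- p, - q)"
  proof (cases "0 \<le> b + p \<and> b + p < 8")
    case True
    then show ?thesis using * s y by (simp add: PT_block sd_block add.assoc)
  next
    case False
    then consider "b = 7" "p = 1" "q = 0" "z = -3" "?s \<noteq> Cap1" | "b = 0" "p = -1" "q = 0" "z = 3" "?s \<noteq> Cap0"
      using * by auto
    then show ?thesis
    proof cases
      case 1
      show ?thesis unfolding y(1) 1 shift_block
        using col_bottom[OF pic_up(1,2)[OF s(1) 1(5)]] pic_up(1)[OF s(1) 1(5)]
        by (simp only: PT_block sd_block) simp
    next
      case 2
      show ?thesis unfolding y(1) 2 shift_block
        using col_top[OF pic_down(1,2)[OF s(1) 2(5)]] pic_down(1)[OF s(1) 2(5)]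
        by (simp only: PT_block sd_block) simp
    qed
  qed
  then show "PT J (y + p) (z + q)" "sd J (y + p) (z + q) = (- p, - q)" by auto
qed

lemma sd_neq_pd: "PT J y z \<Longrightarrow> sd J y z \<noteq> pd J y z"
  by (simp add: PT_def sd_def pd_def sdir_pdir_neq)

lemma region0: "(4 * J, y, z) \<in> region \<longleftrightarrow> shape (pic (y div 8) J) 0 (y mod 8) z"
  by (simp add: mem_region)

lemma region0_block: "0 \<le> b \<Longrightarrow> b < 8 \<Longrightarrow> (4 * J, 8 * I + b, z) \<in> region \<longleftrightarrow> shape (pic I J) 0 b z"
  by (simp add: region0 block8)

lemma border_z:
  assumes "is_col (pic I J)" "shape (pic (I + 1) J) 0 0 z" "shape (pic I J) 0 7 z"
  shows "z = 3 \<or> z = -3" "pic I J \<noteq> Cap1" "pic (I + 1) J \<noteq> Cap0"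
proof -
  show "pic I J \<noteq> Cap1" using assms(3) by auto
  show "pic (I + 1) J \<noteq> Cap0" using assms(2) by auto
  show "z = 3 \<or> z = -3"
  proof (cases "pic I J")
    case Cap0
    then obtain t where "pic (I + 1) J = Cell t" using pic_up(3)[OF assms(1)] by auto
    then show ?thesis using cell_border(1) assms(2) by metis
  next
    case (Cell t)
    then show ?thesis using cell_border(2) assms(3) by metis
  qed (use assms in \<open>auto simp: is_col_def\<close>)
qed

lemma col_neighbours:
  assumes "PT J y z" "(4 * J, y + p, z + q) \<in> region" "(p, q) \<in> {(1, 0), (-1, 0), (0, 1), (0, -1)}"
  shows "(p, q) = sd J y z \<or> (p, q) = pd J y z"
proof -
  obtain I b where y: "y = 8 * I + b" "0 \<le> b" "b < 8" by (rule yb)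
  let ?s = "pic I J"
  have s: "is_col ?s" "colp ?s b z" using assms y by (auto simp: PT_block)
  note sh = colp_shape[OF s]
  show ?thesis
  proof (cases "0 \<le> b + p \<and> b + p < 8")
    case True
    then have "shape ?s 0 (b + p) (z + q)" using assms(2) y region0_block[of "b + p" J I] by (simp add: add.assoc)
    then show ?thesis using colp_neighbours[OF s y(2,3) _ _ _ assms(3)] True y by (simp add: sd_block pd_block)
  next
    case False
    then consider "b = 7" "p = 1" "q = 0" | "b = 0" "p = -1" "q = 0" using assms(3) y by auto
    then show ?thesis
    proof cases
      case 1
      have "shape (pic (I + 1) J) 0 0 z"
        using assms(2) unfolding y(1) 1 shift_block by (simp only: region0_block) simp
      from border_z[OF s(1) this] sh 1 have "z = 3 \<or> z = -3" "?s \<noteq> Cap1" by auto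
      then show ?thesis using col_top[OF s(1)] unfolding y(1) 1 by (auto simp: sd_block pd_block)
    next
      case 2
      have s7: "shape (pic (I - 1) J) 0 7 z"
        using assms(2) unfolding y(1) 2 shift_block by (simp only: region0_block) simp
      have n0: "?s \<noteq> Cap0" using s(2) 2 by auto
      from border_z[of "I - 1" J z] s7 sh 2 pic_down(1)[OF s(1) n0] have "z = 3 \<or> z = -3" by auto
      then show ?thesis using col_bottom[OF s(1) n0] sd_block[of 0 J I z] pd_block[of 0 J I z]
        unfolding y(1) 2 by auto
    qed
  qed
qed

lemma col_corners:
  assumes "PT J y z" "p \<in> {-1, 1}" "q \<in> {-1, 1}" "(4 * J, y + p, z) \<in> region"
    "(4 * J, y, z + q) \<in> region" "(4 * J, y + p, z + q) \<in> region"
  shows False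
proof -
  obtain I b where y: "y = 8 * I + b" "0 \<le> b" "b < 8" by (rule yb)
  let ?s = "pic I J"
  have s: "is_col ?s" "colp ?s b z" using assms y by (auto simp: PT_block)
  note sh = colp_shape[OF s]
  have shq: "shape ?s 0 b (z + q)" using assms(5) y by (simp add: region0_block)
  show False
  proof (cases "0 \<le> b + p \<and> b + p < 8")
    case True
    then have "shape ?s 0 (b + p) z" "shape ?s 0 (b + p) (z + q)"
      using assms(4,6) y region0_block[of "b + p" J I] by (simp_all add: add.assoc)
    then show False using colp_corners[OF s y(2,3) _ _ assms(2,3) _ shq] True by simp
  next
    case False
    then consider "b = 7" "p = 1" | "b = 0" "p = -1" using assms(2) y by auto
    then show ?thesis
    proof cases
      case 1
      have "shape (pic (I + 1) J) 0 0 z" "shape (pic (I + 1) J) 0 0 (z + q)"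
        using assms(4,6) unfolding y(1) 1 shift_block by (simp_all only: region0_block)
      then have "z = 3 \<or> z = -3" "z + q = 3 \<or> z + q = -3"
        using border_z[OF s(1)] sh shq 1 by blast+
      then show False using assms(3) by auto
    next
      case 2
      have s7: "shape (pic (I - 1) J) 0 7 z" "shape (pic (I - 1) J) 0 7 (z + q)"
        using assms(4,6) unfolding y(1) 2 shift_block by (simp_all only: region0_block)
      have n0: "?s \<noteq> Cap0" using s(2) 2 by auto
      have "z = 3 \<or> z = -3" "z + q = 3 \<or> z + q = -3"
        using border_z(1)[of "I - 1" J] s7 sh shq 2 pic_down(1)[OF s(1) n0] by auto
      then show False using assms(3) by auto
    qed
  qed
qed

section \<open>Reading a solution off a tiling\<close>

context
  fixes \<delta> assumes lab: "labelling region \<delta>"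
begin

lemma PT_region: "PT J y z \<Longrightarrow> (4 * J, y, z) \<in> region"
  by (simp add: PT_def region0 colp_shape)

text \<open>A label with \<open>dx = 0\<close> would need a full square in the plane of the column.
  With \<open>dx\<close> nonzero, the other nonzero coordinate points to a region cube next to the
  path, hence to the successor or the predecessor.\<close>

lemma col_label:
  assumes "PT J y z" "\<delta> (4 * J, y, z) = (dx, dy, dz)"
  shows "dx \<noteq> 0 \<and> ((dy, dz) = sd J y z \<or> (dy, dz) = pd J y z)"
proof -
  have d: "(dx, dy, dz) \<in> dirs" using labelling_dirs[OF lab PT_region[OF assms(1)]] assms(2) by simp
  have sub: "c' \<in> region" if "c' \<in> box (4 * J, y, z) (dx, dy, dz)" for c'
    using labelling_sub[OF lab PT_region[OF assms(1)]] assms(2) that by simp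
  have m: "(4 * J, y + dy, z) \<in> region" "(4 * J, y, z + dz) \<in> region" "(4 * J, y + dy, z + dz) \<in> region"
    by (rule sub; simp)+
  have dx: "dx \<noteq> 0"
    using d col_corners[OF assms(1) _ _ m] by (auto simp: dirs_iff)
  then have "(dy, dz) \<in> {(1, 0), (-1, 0), (0, 1), (0, -1)}" using d by (auto simp: dirs_iff)
  from col_neighbours[OF assms(1) m(3) this] dx show ?thesis by simp
qed

text \<open>Tells which of the two matchings the ring has: whether the positions with even
  \<open>y + z\<close> are matched with their successors. As \<open>y + z\<close> changes parity at
  each step of the path, this bit is constant along the ring.\<close>

definition U :: "int \<Rightarrow> int \<Rightarrow> int \<Rightarrow> bool" where
  "U J y z \<longleftrightarrow> (snd (\<delta> (4 * J, y, z)) = sd J y z \<longleftrightarrow> even (y + z))"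

text \<open>A cube is matched forwards exactly when its successor is matched backwards, and the
  parity of the position alternates as well; the two changes cancel.\<close>

lemma U_next:
  assumes "PT J y z" "sd J y z = (p, q)"
  shows "U J (y + p) (z + q) = U J y z"
proof -
  note n = PT_next[OF assms]
  obtain dx dy dz where d: "\<delta> (4 * J, y, z) = (dx, dy, dz)" by (metis prod_cases3)
  obtain ex ey ez where e: "\<delta> (4 * J, y + p, z + q) = (ex, ey, ez)" by (metis prod_cases3)
  note cd = col_label[OF assms(1) d] and ce = col_label[OF n(2) e]
  have "(dy, dz) = (p, q) \<longleftrightarrow> (ey, ez) = (- p, - q)"
  proof
    assume "(dy, dz) = (p, q)"
    then have dp: "dy = p" "dz = q" by auto
    have "p = 0 \<or> q = 0" using n(1) by auto
    then show "(ey, ez) = (- p, - q)"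
      using labelling_flip(2,3)[OF lab PT_region[OF assms(1)] d] dp e by auto
  next
    assume "(ey, ez) = (- p, - q)"
    then have ep: "ey = - p" "ez = - q" by auto
    have "p = 0 \<or> q = 0" using n(1) by auto
    then show "(dy, dz) = (p, q)"
      using labelling_flip(2,3)[OF lab PT_region[OF n(2)] e] ep d by auto
  qed
  moreover have "(ey, ez) = (- p, - q) \<longleftrightarrow> (ey, ez) \<noteq> sd J (y + p) (z + q)"
    using ce n(3) sd_neq_pd[OF n(2)] by metis
  moreover have "even (y + p + (z + q)) \<longleftrightarrow> odd (y + z)"
    using n(1) by auto
  ultimately show ?thesis unfolding U_def d e snd_conv assms(2) by blast
qed

text \<open>Explicit pieces of a path, along which the simplifier can carry the ring bit through a
  crossing.\<close>

fun chain :: "sym \<Rightarrow> (int \<times> int) list \<Rightarrow> bool" where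
  "chain s ((b, z) # (b', z') # ps) \<longleftrightarrow> 0 \<le> b \<and> b < 8 \<and> colp s b z \<and>
     sdir s b z = (b' - b, z' - z) \<and> chain s ((b', z') # ps)"
| "chain s ps \<longleftrightarrow> True"

lemma chain_U:
  assumes "chain (pic I J) ps" "is_col (pic I J)" "(b, z) \<in> set ps"
  shows "U J (8 * I + b) z = U J (8 * I + fst (hd ps)) (snd (hd ps))"
  using assms(1,3)
proof (induction "pic I J" ps rule: chain.induct)
  case (1 b0 z0 b' z' ps)
  have "U J (8 * I + b0 + (b' - b0)) (z0 + (z' - z0)) = U J (8 * I + b0) z0"
    using 1(2) assms(2) by (intro U_next) (auto simp: PT_block sd_block)
  then have "U J (8 * I + b') z' = U J (8 * I + b0) z0" by simp
  then show ?case using 1 by auto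
qed auto

lemma U_cell:
  assumes "2 \<le> I" "I < R + 2" "2 \<le> J" "J < m + 2"
  shows "U J (8 * I + 8) 3 = U J (8 * I) 3"
    "k I J = 1 \<or> k I J = 2 \<Longrightarrow> U J (8 * I + 3) 0 = U J (8 * I) 3"
proof -
  have p: "pic I J = Cell (k I J)" using assms by (simp add: pic_def)
  then have c: "is_col (pic I J)" by (simp add: is_col_def)
  have "U J (8 * I + 7) 3 = U J (8 * I) 3 \<and> (k I J = 1 \<or> k I J = 2 \<longrightarrow> U J (8 * I + 3) 0 = U J (8 * I) 3)"
  proof -
    consider "k I J = 1" | "k I J = 2" | "k I J \<noteq> 1" "k I J \<noteq> 2" by blast
    then show ?thesis
    proof cases
      case 1
      let ?ps = "[(0,3),(1,3),(2,3),(3,3),(3,2),(3,1),(3,0),(3,-1),(4,-1),(5,-1),(5,0),(5,1),(5,2),(5,3),(6,3),(7,3)]"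
      have "chain (pic I J) ?ps" by (simp add: p 1 leg_def)
      from chain_U[OF this c, of 7 3] chain_U[OF this c, of 3 0] show ?thesis by simp
    next
      case 2
      let ?ps = "[(0,3),(1,3),(1,2),(1,1),(1,0),(1,-1),(2,-1),(3,-1),(3,0),(3,1),(3,2),(3,3),(4,3),(5,3),(6,3),(7,3)]"
      have "chain (pic I J) ?ps" by (simp add: p 2 leg_def)
      from chain_U[OF this c, of 7 3] chain_U[OF this c, of 3 0] show ?thesis by simp
    next
      case 3
      let ?ps = "[(0,3),(1,3),(2,3),(3,3),(4,3),(5,3),(6,3),(7,3)]"
      have "chain (pic I J) ?ps" using 3 by (simp add: p leg_def)
      from chain_U[OF this c, of 7 3] 3 show ?thesis by simp
    qed
  qed
  moreover have "U J (8 * I + 7 + 1) (3 + 0) = U J (8 * I + 7) 3"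
    using col_top[OF c] c p by (intro U_next) (auto simp: PT_block sd_block)
  then have "U J (8 * I + 8) 3 = U J (8 * I + 7) 3" unfolding add.assoc by simp
  ultimately show "U J (8 * I + 8) 3 = U J (8 * I) 3"
    "k I J = 1 \<or> k I J = 2 \<Longrightarrow> U J (8 * I + 3) 0 = U J (8 * I) 3" by simp_all
qed

lemma U_const:
  assumes "2 \<le> J" "J < m + 2" "2 \<le> I" "I < R + 2"
  shows "U J (8 * I) 3 = U J 16 3"
  using assms(3,4)
proof (induction I rule: int_ge_induct)
  case (step I)
  then show ?case using U_cell(1)[of I J] assms(1,2) by (simp add: algebra_simps)
qed simp

text \<open>The label joins the heights 0 and 1 of the wire. On the descending leg of type 1 this
  points to the predecessor, on the climbing leg of type 2 to the successor. The position is odd, so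
  the ring bit is true in the one case and false in the other.\<close>

lemma wire_start_or:
  assumes "2 \<le> I" "I < R + 2" "2 \<le> J" "J < m + 2" "\<delta> (4 * J, 8 * I + 3, 0) = (dx, 0, 1)"
  shows "k I J = 1 \<Longrightarrow> U J 16 3" "k I J = 2 \<Longrightarrow> \<not> U J 16 3"
proof -
  have p: "pic I J = Cell (k I J)" using assms by (simp add: pic_def)
  have o: "odd (8 * I + 3 + 0)" by simp
  show "U J 16 3" if "k I J = 1"
  proof -
    have "\<not> snd (\<delta> (4 * J, 8 * I + 3, 0)) = sd J (8 * I + 3) 0"
      by (simp add: assms(5) sd_block p that leg_def)
    then have "U J (8 * I + 3) 0" using o unfolding U_def by blast
    then show ?thesis using U_cell(2) U_const assms(1-4) that by simp
  qed
  show "\<not> U J 16 3" if "k I J = 2"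
  proof -
    have "snd (\<delta> (4 * J, 8 * I + 3, 0)) = sd J (8 * I + 3) 0"
      by (simp add: assms(5) sd_block p that leg_def)
    then have "\<not> U J (8 * I + 3) 0" using o unfolding U_def by blast
    then show ?thesis using U_cell(2) U_const assms(1-4) that by simp
  qed
qed

text \<open>A wire is one cube wide in \<open>y\<close>, so its slabs lie in the
  \<open>x\<close>-\<open>z\<close> plane, and behind a slab that ends at \<open>x\<close> the next
  one has to begin at \<open>x + 1\<close>. The last premise excludes a slab that hangs down to
  height -1: it would need both lower cubes.\<close>

lemma wire_step:
  assumes "\<delta> (x, 8 * I + 3, 0) = (-1, 0, 1)" "(x + 1, 8 * I + 3, 0) \<in> region"
    "(x + 1, 8 * I + 4, 0) \<notin> region" "(x + 1, 8 * I + 2, 0) \<notin> region"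
    "(x + 1, 8 * I + 3, -1) \<notin> region \<or> (x + 2, 8 * I + 3, -1) \<notin> region"
  shows "\<delta> (x + 2, 8 * I + 3, 0) = (-1, 0, 1)"
proof -
  obtain dx dy dz where d: "\<delta> (x + 1, 8 * I + 3, 0) = (dx, dy, dz)" by (metis prod_cases3)
  have dd: "(dx, dy, dz) \<in> dirs" using labelling_dirs[OF lab assms(2)] d by simp
  note f = labelling_flip[OF lab assms(2) d]
  have "dy \<noteq> 1" "dy \<noteq> -1" using f(2) assms(3,4) by (auto simp: add.assoc)
  then have dy: "dy = 0" "dx = 1 \<or> dx = -1" "dz = 1 \<or> dz = -1" using dd by (auto simp: dirs_iff)
  have "dx \<noteq> -1" using f(1) assms(1) by auto
  then have dx: "dx = 1" using dy by simp
  then have g: "(x + 2, 8 * I + 3, 0) \<in> region" "\<delta> (x + 2, 8 * I + 3, 0) = (-1, 0, dz)"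
    using f(1) dy by (auto simp: add.assoc)
  have "dz \<noteq> -1" using f(3) labelling_flip(3)[OF lab g] assms(5) by auto
  then show ?thesis using g dy by auto
qed

text \<open>Once a slab reaches from the wall at \<open>x = 5\<close> into the wire, the slabs of
  the wire are shifted by one against the columns all the way, and each column is met by a slab that
  comes from outside it.\<close>

lemma wire_all:
  assumes "2 \<le> I" "I < R + 2" "\<delta> (6, 8 * I + 3, 0) = (-1, 0, 1)" "2 \<le> J" "J < m + 2"
  shows "\<delta> (4 * J, 8 * I + 3, 0) = (-1, 0, 1)"
  using assms(4,5)
proof (induction J rule: int_ge_induct)
  case base
  have p: "pic I 1 = LeftP (fr I) (la I)" using assms(1,2) by (simp add: pic_def)
  show ?case
    using wire_step[OF assms(3)] mem_block[of 3 3 1 I 0] mem_block[of 3 4 1 I 0] mem_block[of 3 2 1 I 0]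
      mem_block[of 3 3 1 I "-1"] p by simp
next
  case (step J)
  have p: "pic I J = Cell (k I J)" using assms(1,2) step by (simp add: pic_def)
  have 1: "\<delta> (4 * J + 2, 8 * I + 3, 0) = (-1, 0, 1)"
    using step by (intro wire_step) (auto simp: mem_block p leg_def)
  have "\<delta> (4 * J + 2 + 2, 8 * I + 3, 0) = (-1, 0, 1)"
    using mem_block[of 3 3 J I 0] mem_block[of 3 4 J I 0] mem_block[of 3 2 J I 0] mem_block[of 3 3 J I "-1"] p
    by (intro wire_step[OF 1]) (auto simp: add.assoc)
  then show ?case by (simp add: algebra_simps)
qed

text \<open>A parity argument. The wall has an odd number of positions in the \<open>y\<close>
  direction. If no slab reached from the wall into a wire, the slabs of the wall would match its
  positions in consecutive pairs from the lower end on, and the last position would remain without a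
  partner.\<close>

lemma left_path:
  assumes "2 \<le> s" "s \<le> e" "e < R + 2" "\<And>I. s \<le> I \<Longrightarrow> I \<le> e \<Longrightarrow> gr I = gr s" "fr s" "la e"
  shows "\<exists>I. s \<le> I \<and> I \<le> e \<and> \<delta> (6, 8 * I + 3, 0) = (-1, 0, 1)"
proof (rule ccontr)
  assume no: "\<nexists>I. s \<le> I \<and> I \<le> e \<and> \<delta> (6, 8 * I + 3, 0) = (-1, 0, 1)"
  have m5: "(5, 8 * I + b, z) \<in> region \<longleftrightarrow> shape (pic I 1) 1 b z" if "0 \<le> b" "b < 8" for I b z
    using mem_block[of 1 b 1 I z] that by simp
  have pI: "pic I 1 = LeftP (fr I) (la I)" if "s \<le> I" "I \<le> e" for I
    using assms that by (simp add: pic_def)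
  have seg: "(5, y, 0) \<in> region \<and> (\<exists>dy. \<delta> (5, y, 0) = (0, dy, 1) \<and> (dy = 1 \<or> dy = -1))"
    if y3: "8 * s + 3 \<le> y" "y \<le> 8 * e + 3" for y
  proof -
    obtain I b where y: "y = 8 * I + b" "0 \<le> b" "b < 8" by (rule yb)
    have I: "s \<le> I" "I \<le> e" using y3 y by auto
    have "b < 3 \<Longrightarrow> \<not> fr I"
    proof -
      assume "b < 3"
      then have "s < I" using y3 y by auto
      then show "\<not> fr I" using assms(4)[of "I - 1"] assms(4)[of I] I assms(1) by (auto simp: fr_def)
    qed
    moreover have "b > 3 \<Longrightarrow> \<not> la I"
    proof -
      assume "b > 3"
      then have "I < e" using y3 y by auto
      then show "\<not> la I" using assms(4)[of "I + 1"] assms(4)[of I] I assms(3) by (auto simp: la_def)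
    qed
    ultimately have mem: "(5, y, 0) \<in> region" using y I pI
      by (cases b "3::int" rule: linorder_cases) (simp_all add: m5)
    obtain dx dy dz where d: "\<delta> (5, y, 0) = (dx, dy, dz)" by (metis prod_cases3)
    have dd: "(dx, dy, dz) \<in> dirs" using labelling_dirs[OF lab mem] d by simp
    note f = labelling_flip[OF lab mem d]
    have n4: "(4, y, z) \<notin> region" for z using mem_block[of 0 b 1 I z] y I pI by simp
    have "dx \<noteq> -1" using f(1) n4 by auto
    moreover have "dz \<noteq> -1" using f(3) m5[of b I "-1"] y I pI by auto
    moreover have "dx \<noteq> 1"
    proof
      assume dx: "dx = 1"
      then have f6: "(6, y, 0) \<in> region" "\<delta> (6, y, 0) = (-1, dy, dz)" using f(1) by auto
      then have b: "b = 3" using mem_block[of 2 b 1 I 0] y I pI by simp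
      \<comment> \<open>The wire at \<open>x = 6\<close> is a single cube wide, so a slab that
        reaches into it cannot extend along the wall.\<close>
      have "(6, 8 * I + (3 + dy), 0) \<in> region"
        using labelling_flip(2)[OF lab f6] unfolding y(1) b add.assoc by blast
      then have "dy \<noteq> 1 \<and> dy \<noteq> -1"
        using mem_block[of 2 4 1 I 0] mem_block[of 2 2 1 I 0] y b I pI by auto
      then have "dy = 0" "dz = 1" using dd dx \<open>dz \<noteq> -1\<close> by (auto simp: dirs_iff)
      then show False using no I f6 y b by auto
    qed
    ultimately show ?thesis using mem d dd by (auto simp: dirs_iff)
  qed
  \<comment> \<open>Matching is forced from the lower end: the position there has no partner below,
    and each later position at even distance finds its lower neighbour already taken.\<close>
  have L: "\<delta> (5, 8 * s + 3 + 2 * int n, 0) = (0, 1, 1)" if "2 * int n \<le> 8 * (e - s)" for n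
    using that
  proof (induction n)
    case 0
    obtain dy where d: "\<delta> (5, 8 * s + 3, 0) = (0, dy, 1)" "dy = 1 \<or> dy = -1" "(5, 8 * s + 3, 0) \<in> region"
      using seg[of "8 * s + 3"] assms(2) by auto
    have "(5, 8 * s + (3 + dy), 0) \<in> region"
      using labelling_flip(2)[OF lab d(3,1)] unfolding add.assoc by blast
    then have "dy \<noteq> -1" using m5[of 2 s 0] pI[of s] assms(2,5) by auto
    then show ?case using d by auto
  next
    case (Suc n)
    let ?y = "8 * s + 3 + 2 * int n"
    have y: "?y + 2 \<le> 8 * e + 3" using Suc.prems by simp
    have IH: "\<delta> (5, ?y, 0) = (0, 1, 1)" using Suc by simp
    have n1: "\<delta> (5, ?y + 1, 0) = (0, -1, 1)"
      using labelling_flip(2)[OF lab _ IH] seg[of ?y] y by simp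
    obtain dy where d: "\<delta> (5, ?y + 2, 0) = (0, dy, 1)" "dy = 1 \<or> dy = -1" "(5, ?y + 2, 0) \<in> region"
      using seg[of "?y + 2"] y by auto
    have "dy \<noteq> -1"
    proof
      assume dy: "dy = -1"
      have "?y + 2 + -1 = ?y + 1" by simp
      then show False using labelling_flip(2)[OF lab d(3,1)] n1 unfolding dy by simp
    qed
    then have "\<delta> (5, ?y + 2, 0) = (0, 1, 1)" using d by auto
    moreover have "8 * s + 3 + 2 * int (Suc n) = ?y + 2" by simp
    ultimately show ?case by (simp only:)
  qed
  have e: "8 * s + 3 + 2 * int (nat (4 * (e - s))) = 8 * e + 3" using assms(2) by simp
  have "2 * int (nat (4 * (e - s))) \<le> 8 * (e - s)" using assms(2) by simp
  then have "\<delta> (5, 8 * e + 3, 0) = (0, 1, 1)" unfolding e[symmetric] by (rule L)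
  \<comment> \<open>The upper end lies at even distance from the lower one, so its forced partner
    falls beyond the end of the wall.\<close>
  then have "(5, 8 * e + (3 + 1), 0) \<in> region"
    using labelling_flip(2)[OF lab, of 5 "8 * e + 3" 0 0 1 1] seg[of "8 * e + 3"] assms(2)
    unfolding add.assoc by simp
  then show False using m5[of 4 e 0] pI[of e] assms(2,6) by auto
qed

lemma labelling_imp_solution:
  "\<exists>u. \<forall>I. 2 \<le> I \<and> I < R + 2 \<longrightarrow> (\<exists>I'. 2 \<le> I' \<and> I' < R + 2 \<and> gr I' = gr I \<and>
     (\<forall>J. 2 \<le> J \<and> J < m + 2 \<longrightarrow> (k I' J = 1 \<longrightarrow> u J) \<and> (k I' J = 2 \<longrightarrow> \<not> u J)))"
\<comment> \<open>The truth value of a column is its ring bit, read where the upper run enters the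
  first row: \<open>16 = 8 * 2\<close> is the start of block row 2.\<close>
proof (intro exI[of _ "\<lambda>J. U J 16 3"] allI impI)
  fix I assume I: "2 \<le> I \<and> I < R + 2"
  let ?G = "{I'. 2 \<le> I' \<and> I' < R + 2 \<and> gr I' = gr I}"
  have G: "finite ?G" "?G \<noteq> {}" using I by (auto intro: finite_subset[of _ "{2..R + 2}"])
  obtain s e where se: "s = Min ?G" "e = Max ?G" by blast
  have s: "2 \<le> s" "s < R + 2" "gr s = gr I" and e: "2 \<le> e" "e < R + 2" "gr e = gr I"
    using Min_in[OF G] Max_in[OF G] unfolding se by auto
  have le: "s \<le> e" unfolding se using Max_ge[OF G(1) Min_in[OF G]] .
  \<comment> \<open>Here the groups are used as intervals: all rows between the extreme rows of a
    group belong to it.\<close>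
  have gs: "gr I' = gr s" if "s \<le> I'" "I' \<le> e" for I'
    using gr_mono[of s I'] gr_mono[of I' e] s e that by auto
  have "s \<le> I'" "I' \<le> e" if "I' \<in> ?G" for I' using that G unfolding se by (blast intro: Min_le Max_ge)+
  from this[of "s - 1"] this[of "e + 1"] have "fr s" "la e"
    unfolding fr_def la_def using s e by auto
  then obtain I' where I': "s \<le> I'" "I' \<le> e" "\<delta> (6, 8 * I' + 3, 0) = (-1, 0, 1)"
    using left_path[OF s(1) le e(2) gs] by blast
  have g: "gr I' = gr I" using gs[OF I'(1,2)] s(3) by simp
  have r: "2 \<le> I'" "I' < R + 2" using s e I' by auto
  show "\<exists>I'. 2 \<le> I' \<and> I' < R + 2 \<and> gr I' = gr I \<and>
     (\<forall>J. 2 \<le> J \<and> J < m + 2 \<longrightarrow> (k I' J = 1 \<longrightarrow> U J 16 3) \<and> (k I' J = 2 \<longrightarrow> \<not> U J 16 3))"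
    using r g wire_start_or[OF r _ _ wire_all[OF r I'(3)]] by (intro exI[of _ I']) simp
qed

end

end

section \<open>A tiling from a solution\<close>

context wiring
begin

text \<open>\<open>ch\<close> selects one row from each group whose requirements hold under
  \<open>u\<close>. The tiling switches on the wires of the selected rows only.\<close>

context
  fixes u :: "int \<Rightarrow> bool" and ch :: "int \<Rightarrow> int"
  assumes ch: "2 \<le> I \<Longrightarrow> I < R + 2 \<Longrightarrow> 2 \<le> ch I \<and> ch I < R + 2 \<and> gr (ch I) = gr I"
    and ch_eq: "gr I = gr I' \<Longrightarrow> ch I = ch I'"
    and ok: "2 \<le> I \<Longrightarrow> I < R + 2 \<Longrightarrow> ch I = I \<Longrightarrow> 2 \<le> J \<Longrightarrow> J < m + 2 \<Longrightarrow>
      (k I J = 1 \<longrightarrow> u J) \<and> (k I J = 2 \<longrightarrow> \<not> u J)"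
begin

definition wr :: "int \<Rightarrow> int \<Rightarrow> bool" where
  "wr y z \<longleftrightarrow> 2 \<le> y div 8 \<and> y div 8 < R + 2 \<and> y mod 8 = 3 \<and> (z = 0 \<or> z = 1)"

text \<open>Within the pair of heights 0 and 1 this points from either one to the other.\<close>

definition inw :: "int \<Rightarrow> int" where "inw z = 1 - 2 * z"

definition cdir :: "int \<Rightarrow> int \<Rightarrow> int \<Rightarrow> int \<times> int" where
  "cdir J y z = (if u J \<longleftrightarrow> even (y + z) then sd J y z else pd J y z)"

text \<open>The junction of the chosen row lies at an odd position and is left to its wire. Below it
  an odd position is matched with the even one above, beyond it an even position with the odd one
  above; both remaining pieces of the wall are used up exactly.\<close>

definition pdy :: "int \<Rightarrow> int" where
  "pdy y = (if (y < 8 * ch (y div 8) + 3) = odd y then 1 else -1)"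

definition chosen :: "int \<Rightarrow> bool" where
  "chosen y \<longleftrightarrow> ch (y div 8) = y div 8"

text \<open>On a chosen wire slabs begin at odd \<open>x\<close>, so they connect the walls at
  \<open>5\<close> and \<open>4 * m + 10\<close> and straddle the faces of the columns. On all other
  wires they begin at even \<open>x\<close>; there a slab inside a column coincides with the
  thickness of the column.\<close>

definition wdx :: "int \<Rightarrow> int \<Rightarrow> int" where
  "wdx x y = (if even x = chosen y then -1 else 1)"

definition colpoint :: "int \<Rightarrow> int \<Rightarrow> int \<Rightarrow> bool" where
  "colpoint x y z \<longleftrightarrow> (x mod 4 = 0 \<or> x mod 4 = 1) \<and> PT (x div 4) y z"

definition pathp :: "int \<Rightarrow> int \<Rightarrow> bool" where
  "pathp y z \<longleftrightarrow> (z = 0 \<or> z = 1) \<and> 2 \<le> y div 8 \<and> y div 8 < R + 2 \<and>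
     (y mod 8 = 3 \<or> y mod 8 < 3 \<and> \<not> fr (y div 8) \<or> y mod 8 > 3 \<and> \<not> la (y div 8))"

fun lab :: "cube \<Rightarrow> cube" where
  "lab (x, y, z) =
    (if colpoint x y z then (if wr y z then wdx x y else if even x then 1 else -1, cdir (x div 4) y z)
     else if (x = 5 \<or> x = 4 * m + 10) \<and> \<not> (wr y z \<and> chosen y) then (0, pdy y, inw z)
     else (wdx x y, 0, inw z))"

lemma cdir_flip:
  assumes "PT J y z" "cdir J y z = (p, q)"
  shows "(p, q) \<in> {(1, 0), (-1, 0), (0, 1), (0, -1)}" "PT J (y + p) (z + q)"
    "cdir J (y + p) (z + q) = (- p, - q)"
proof -
  have *: "(p, q) \<in> {(1, 0), (-1, 0), (0, 1), (0, -1)} \<and> PT J (y + p) (z + q) \<and>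
      cdir J (y + p) (z + q) = (- p, - q)"
  proof (cases "u J \<longleftrightarrow> even (y + z)")
    case True
    have "sd J y z = (p, q)" using assms(2) unfolding cdir_def if_P[OF True] .
    note n = PT_next[OF assms(1) this]
    have c: "\<not> (u J \<longleftrightarrow> even (y + p + (z + q)))" using True n(1) by auto
    show ?thesis unfolding cdir_def if_not_P[OF c] using n by blast
  next
    case False
    have "pd J y z = (p, q)" using assms(2) unfolding cdir_def if_not_P[OF False] .
    note n = PT_prev[OF assms(1) this]
    have c: "u J \<longleftrightarrow> even (y + p + (z + q))" using False n(1) by auto
    show ?thesis unfolding cdir_def if_P[OF c] using n by blast
  qed
  show "(p, q) \<in> {(1, 0), (-1, 0), (0, 1), (0, -1)}" using * by (rule conjunct1)
  show "PT J (y + p) (z + q)" "cdir J (y + p) (z + q) = (- p, - q)" using * by (blast dest: conjunct2)+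
qed

lemma PT_cols: "PT J y z \<Longrightarrow> 2 \<le> J \<and> J < m + 2"
  by (auto simp: PT_def is_col_def pic_def split: if_splits)

lemma pic_wr: "wr y z \<Longrightarrow> PT J y z \<Longrightarrow> pic (y div 8) J = Cell (k (y div 8) J) \<and> (k (y div 8) J = 1 \<or> k (y div 8) J = 2)"
  using PT_cols[of J y z] by (auto simp: PT_def pic_def wr_def leg_def split: if_splits)

text \<open>The requirements of a chosen row hold, so the matching of any column with a dip there
  joins the heights 0 and 1 at the wire. The wire can then shift these slabs in the \<open>x\<close>
  direction without disturbing the ring.\<close>

lemma wire_chosen:
  assumes "wr y z" "chosen y" "PT J y z"
  shows "cdir J y z = (0, inw z)"
proof -
  note p = pic_wr[OF assms(1,3)]
  have y: "y mod 8 = 3" "2 \<le> y div 8" "y div 8 < R + 2" "z = 0 \<or> z = 1" using assms(1) by (auto simp: wr_def)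
  have o: "odd y" using y(1) by presburger
  have "(k (y div 8) J = 1 \<longrightarrow> u J) \<and> (k (y div 8) J = 2 \<longrightarrow> \<not> u J)"
    using ok[OF y(2,3), of J] assms(2) PT_cols[OF assms(3)] by (simp add: chosen_def)
  then show ?thesis using p y o
    by (elim disjE conjE) (simp_all add: cdir_def sd_def pd_def leg_def inw_def)
qed

lemma region_iff:
  "(x, y, z) \<in> region \<longleftrightarrow> colpoint x y z \<or> wr y z \<and> 6 \<le> x \<and> x \<le> 4 * m + 9 \<or>
     (x = 5 \<or> x = 4 * m + 10) \<and> pathp y z"
proof -
  let ?J = "x div 4" and ?a = "x mod 4" and ?I = "y div 8" and ?b = "y mod 8"
  have x: "x = 4 * ?J + ?a" "0 \<le> ?a" "?a < 4" by auto
  show ?thesis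
  proof (cases "2 \<le> ?I \<and> ?I < R + 2")
    case I: True
    consider "?J = 1" | "?J = m + 2" | "2 \<le> ?J" "?J < m + 2" | "?J < 1 \<or> ?J > m + 2" by linarith
    then show ?thesis
    proof cases
      case 1
      then have p: "pic ?I ?J = LeftP (fr ?I) (la ?I)" using I by (simp add: pic_def)
      then have "\<not> colpoint x y z" by (simp add: colpoint_def PT_def is_col_def)
      moreover have "x = 4 + ?a" using x(1) 1 by linarith
      ultimately show ?thesis unfolding mem_region p shape.simps wr_def pathp_def using I x m0 by auto
    next
      case 2
      then have p: "pic ?I ?J = RightP (fr ?I) (la ?I)" using I m0 by (simp add: pic_def)
      then have "\<not> colpoint x y z" by (simp add: colpoint_def PT_def is_col_def)
      moreover have "x = 4 * m + 8 + ?a" using x(1) 2 by linarith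
      ultimately show ?thesis unfolding mem_region p shape.simps wr_def pathp_def using I x m0 by auto
    next
      case 3
      then have p: "pic ?I ?J = Cell (k ?I ?J)" using I by (simp add: pic_def)
      have "6 \<le> x" "x \<le> 4 * m + 9" "x \<noteq> 5" "x \<noteq> 4 * m + 10" using x 3 by linarith+
      then show ?thesis unfolding mem_region p shape.simps(4) colpoint_def PT_def wr_def
        using I by (auto simp: is_col_def)
    next
      case 4
      then have p: "pic ?I ?J = Blank" using I m0 by (auto simp: pic_def)
      then have "\<not> colpoint x y z" by (simp add: colpoint_def PT_def is_col_def)
      moreover have "x < 4 \<or> x > 4 * m + 11" using x 4 by linarith
      ultimately show ?thesis unfolding mem_region p shape.simps using m0 by auto
    qed
  next
    case I: False
    then have "\<not> wr y z" "\<not> pathp y z" by (auto simp: wr_def pathp_def)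
    moreover have "(x, y, z) \<in> region \<longleftrightarrow> colpoint x y z"
      using I by (auto simp: mem_region colpoint_def PT_def is_col_def pic_def)
    ultimately show ?thesis by blast
  qed
qed

lemma wdx_flip: "odd d \<Longrightarrow> wdx (x + d) y = - wdx x y"
  by (auto simp: wdx_def)

lemma wdx_odd: "odd (wdx x y)"
  by (auto simp: wdx_def)

lemma lab_wire_chosen:
  assumes "wr y z" "chosen y" "5 \<le> x" "x \<le> 4 * m + 10"
  shows "(x, y, z) \<in> region \<and> lab (x, y, z) = (wdx x y, 0, inw z)"
proof
  have "pathp y z" using assms(1) by (auto simp: wr_def pathp_def)
  then show "(x, y, z) \<in> region" unfolding region_iff using assms by auto
  show "lab (x, y, z) = (wdx x y, 0, inw z)"
    using assms(1,2) wire_chosen by (simp add: colpoint_def)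
qed

lemma lab_not_chosen:
  assumes "\<not> (wr y z \<and> chosen y)" "colpoint x y z"
  shows "lab (x, y, z) = (if even x then 1 else -1, cdir (x div 4) y z)"
  using assms by (auto simp: wdx_def)

lemma colpoint_flip:
  assumes "colpoint x y z" "lab (x, y, z) = (d, p, q)"
  shows "colpoint x (y + p) (z + q) \<and> lab (x, y + p, z + q) = (d, - p, - q) \<and>
    (p, q) \<in> {(1, 0), (-1, 0), (0, 1), (0, -1)}"
proof -
  let ?J = "x div 4"
  have P: "PT ?J y z" using assms by (simp add: colpoint_def)
  have c: "cdir ?J y z = (p, q)" using assms by (simp split: if_splits)
  note f = cdir_flip[OF P c]
  have col: "colpoint x (y + p) (z + q)" using assms(1) f(2) by (simp add: colpoint_def)
  show ?thesis
  proof (cases "wr y z \<and> chosen y")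
    case True
    then have pq: "p = 0" "q = inw z" using wire_chosen[OF _ _ P] c by auto
    have w: "wr (y + p) (z + q)" using True pq by (auto simp: wr_def inw_def)
    have "lab (x, y + p, z + q) = (wdx x y, - p, - q)"
      using col w f(3) pq by (simp add: w)
    moreover have "d = wdx x y" using assms True by simp
    ultimately show ?thesis using col f by simp
  next
    case False
    have "\<not> (wr (y + p) (z + q) \<and> chosen (y + p))"
    proof
      assume *: "wr (y + p) (z + q) \<and> chosen (y + p)"
      then have "(- p, - q) = (0, inw (z + q))" using wire_chosen[OF _ _ f(2)] f(3) by simp
      then have "p = 0" "z = z + q + inw (z + q)" by auto
      then have "wr y z \<and> chosen y" using * by (auto simp: wr_def inw_def)
      then show False using False by blast
    qed
    then show ?thesis
      using lab_not_chosen[OF _ col] lab_not_chosen[OF False assms(1)] assms(2) f col by simp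
  qed
qed

lemma PT_swap: "wr y z \<Longrightarrow> PT J y (z + inw z) = PT J y z"
  by (auto simp: wr_def inw_def PT_def is_col_def)

text \<open>Below the chosen row of a group the wall continues upwards, because the group is an
  interval that contains both rows.\<close>

lemma not_la:
  assumes "2 \<le> I" "I < R + 2" "I < ch I"
  shows "\<not> la I" "\<not> fr (I + 1)" "ch (I + 1) = ch I" "I + 1 < R + 2"
proof -
  have "gr (I + 1) = gr I" using gr_mono[of I "I + 1"] gr_mono[of "I + 1" "ch I"] ch[OF assms(1,2)] assms by auto
  then show "\<not> la I" "\<not> fr (I + 1)" "ch (I + 1) = ch I" "I + 1 < R + 2"
    using ch_eq[of "I + 1" I] ch[OF assms(1,2)] assms by (auto simp: la_def fr_def)
qed

lemma not_fr:
  assumes "2 \<le> I" "I < R + 2" "ch I < I"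
  shows "\<not> fr I"
proof -
  have "gr (I - 1) = gr I" using gr_mono[of "I - 1" I] gr_mono[of "ch I" "I - 1"] ch[OF assms(1,2)] assms by auto
  then show "\<not> fr I" using ch[OF assms(1,2)] assms by (auto simp: fr_def)
qed

lemma not_fr_prev:
  assumes "2 \<le> I" "I < R + 2" "\<not> fr I"
  shows "2 \<le> I - 1" "\<not> la (I - 1)" "ch (I - 1) = ch I"
  using assms ch_eq[of "I - 1" I] by (auto simp: fr_def la_def)

text \<open>The partner of a wall position lies in the wall of the same group and on the same side
  of the chosen junction. The cases are the side, the parity, and whether the step crosses a block
  boundary.\<close>

lemma path_flip:
  assumes "pathp y z" "\<not> (wr y z \<and> chosen y)"
  shows "pathp (y + pdy y) z \<and> \<not> (wr (y + pdy y) z \<and> chosen (y + pdy y)) \<and> pdy (y + pdy y) = - pdy y"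
proof -
  obtain I b where y: "y = 8 * I + b" "0 \<le> b" "b < 8" by (rule yb)
  have dm: "y div 8 = I" "y mod 8 = b" using y by auto
  let ?Y = "8 * ch I + 3"
  have z: "z = 0 \<or> z = 1" and I: "2 \<le> I" "I < R + 2"
    and pb: "b < 3 \<Longrightarrow> \<not> fr I" "b > 3 \<Longrightarrow> \<not> la I"
    using assms(1) by (auto simp: pathp_def dm)
  have ne: "y \<noteq> ?Y"
  proof
    assume "y = ?Y"
    then have "I = ch I" "b = 3" using y by presburger+
    then show False using assms(2) z I by (simp add: wr_def chosen_def dm)
  qed
  \<comment> \<open>The conclusion common to all cases: it remains to give the block
    \<open>I'\<close> and the offset \<open>b'\<close> of the partner, to see that it lies in the
    wall, and that the junction is not passed.\<close>
  have finish: ?thesis if p: "pdy y = p" "p = 1 \<or> p = -1" and y': "y + p = 8 * I' + b'" "0 \<le> b'" "b' < 8"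
    and I': "2 \<le> I'" "I' < R + 2" "ch I' = ch I"
    and b': "b' = 3 \<or> b' < 3 \<and> \<not> fr I' \<or> b' > 3 \<and> \<not> la I'"
    and side: "y < ?Y \<longleftrightarrow> y + p < ?Y" "y + p \<noteq> ?Y" for p I' b'
  proof -
    have dm': "(y + p) div 8 = I'" "(y + p) mod 8 = b'" using y' by auto
    have "pathp (y + p) z" using z I' b' by (simp add: pathp_def dm')
    moreover have "\<not> (wr (y + p) z \<and> chosen (y + p))"
      using side(2) y' I'(3) by (auto simp: wr_def chosen_def dm')
    moreover have "pdy (y + p) = - p"
    proof -
      have "odd (y + p) \<longleftrightarrow> even y" using p(2) by auto
      then show ?thesis using p(1) side(1) I'(3) unfolding pdy_def dm dm' by (auto split: if_splits)
    qed
    ultimately show ?thesis using p(1) by simp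
  qed
  have par: "odd y \<longleftrightarrow> odd b" using y by simp
  show ?thesis
  proof (cases "y < ?Y")
    case lt: True
    show ?thesis
    proof (cases "odd y")
      case True
      have p: "pdy y = 1" using lt True by (simp add: pdy_def dm)
      have s: "y + 1 < ?Y" using lt True by presburger
      have Ic: "b \<ge> 3 \<Longrightarrow> I < ch I" using s y by linarith
      show ?thesis
      proof (cases "b = 7")
        case b: True
        show ?thesis
          by (rule finish[OF p, of "I + 1" 0]) (use y b not_la[OF I Ic] I s lt in auto)
      next
        case False
        have "b + 1 = 3 \<or> b + 1 < 3 \<and> \<not> fr I \<or> b + 1 > 3 \<and> \<not> la I"
        proof (cases "b < 3")
          case True
          then show ?thesis using pb(1) by linarith
        next
          case F: False
          then show ?thesis using not_la(1)[OF I Ic] by auto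
        qed
        then show ?thesis
          by (intro finish[OF p, of I "b + 1"]) (use y False I s lt in auto)
      qed
    next
      case False
      have p: "pdy y = -1" using lt False by (simp add: pdy_def dm)
      show ?thesis
      proof (cases "b = 0")
        case b: True
        then have "\<not> fr I" using pb by simp
        from not_fr_prev[OF I this] show ?thesis
          by (intro finish[OF p, of "I - 1" 7]) (use y b I lt in auto)
      next
        case b: False
        have "even b" using par False by simp
        then have "b = 2 \<or> b = 4 \<or> b = 6" using y b by presburger
        then have "b - 1 = 3 \<or> b - 1 < 3 \<and> \<not> fr I \<or> b - 1 > 3 \<and> \<not> la I" using pb by auto
        then show ?thesis
          by (intro finish[OF p, of I "b - 1"]) (use y b I lt in auto)
      qed
    qed
  next
    case gt: False
    show ?thesis
    proof (cases "odd y")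
      case False
      have p: "pdy y = 1" using gt False by (simp add: pdy_def dm)
      have "even b" using par False by simp
      then have b: "b = 0 \<or> b = 2 \<or> b = 4 \<or> b = 6" using y by presburger
      then have "b + 1 = 3 \<or> b + 1 < 3 \<and> \<not> fr I \<or> b + 1 > 3 \<and> \<not> la I" using pb by auto
      then show ?thesis
        by (intro finish[OF p, of I "b + 1"]) (use y b I gt ne in auto)
    next
      case True
      have p: "pdy y = -1" using gt True by (simp add: pdy_def dm)
      have s: "y - 1 > ?Y" using gt True ne by presburger
      have "odd b" using par True by simp
      then have b: "b = 1 \<or> b = 3 \<or> b = 5 \<or> b = 7" using y by presburger
      have "b = 3 \<Longrightarrow> \<not> fr I" using not_fr[OF I] s y by auto
      then have "b - 1 = 3 \<or> b - 1 < 3 \<and> \<not> fr I \<or> b - 1 > 3 \<and> \<not> la I" using pb b by auto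
      then show ?thesis
        by (intro finish[OF p, of I "b - 1"]) (use y b I gt s in auto)
    qed
  qed
qed

lemma chosen_solution_labelling: "labelling region lab"
proof (rule labellingI)
  fix c assume "c \<in> region"
  obtain x y z where c: "c = (x, y, z)" by (metis prod_cases3)
  show "lab c \<in> dirs"
  proof (cases "colpoint x y z")
    case True
    obtain d p q where l: "lab (x, y, z) = (d, p, q)" by (metis prod_cases3)
    have "d = 1 \<or> d = -1" using True l by (auto simp: wdx_def split: if_splits)
    then show ?thesis unfolding c l using colpoint_flip[OF True l] by (auto simp: dirs_iff)
  next
    case False
    then have "z = 0 \<or> z = 1" using \<open>c \<in> region\<close> unfolding c region_iff by (auto simp: wr_def pathp_def)
    then have "inw z = 1 \<or> inw z = -1" by (auto simp: inw_def)
    moreover have "pdy y = 1 \<or> pdy y = -1" "wdx x y = 1 \<or> wdx x y = -1" by (auto simp: pdy_def wdx_def)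
    ultimately show ?thesis using False unfolding c by (auto simp: dirs_iff)
  qed
next
  fix x y z dx dy dz
  assume c: "(x, y, z) \<in> region" and l: "lab (x, y, z) = (dx, dy, dz)" and nz: "dx \<noteq> 0"
  show "(x + dx, y, z) \<in> region \<and> lab (x + dx, y, z) = (- dx, dy, dz)"
  proof (cases "wr y z \<and> chosen y")
    case True
    have r: "5 \<le> x" "x \<le> 4 * m + 10"
    proof -
      have "colpoint x y z \<Longrightarrow> 2 \<le> x div 4 \<and> x div 4 < m + 2" using PT_cols[of "x div 4" y z] by (simp add: colpoint_def)
      then show "5 \<le> x" "x \<le> 4 * m + 10" using c m0 unfolding region_iff by auto
    qed
    have d: "(dx, dy, dz) = (wdx x y, 0, inw z)" using lab_wire_chosen[of y z x] True r l by simp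
    have "5 \<le> x + dx" "x + dx \<le> 4 * m + 10"
      using r d True m0 by (auto simp: wdx_def split: if_splits) presburger+
    then show ?thesis
      using lab_wire_chosen[of y z "x + dx"] True d wdx_flip[OF wdx_odd, of x x y y]
      by (simp del: lab.simps)
  next
    case nc: False
    show ?thesis
    proof (cases "colpoint x y z")
      case True
      have x: "x mod 4 = 0 \<or> x mod 4 = 1" using True by (simp add: colpoint_def)
      have d: "dx = (if even x then 1 else -1)" "(dy, dz) = cdir (x div 4) y z"
        using lab_not_chosen[OF nc True] l by auto
      have ev: "even x \<longleftrightarrow> x mod 4 = 0" using x by presburger
      have x': "(x + dx) div 4 = x div 4" "(x + dx) mod 4 = 0 \<or> (x + dx) mod 4 = 1" "even (x + dx) \<longleftrightarrow> odd x"
        using x ev d(1) by (auto simp: even_add) presburger+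
      then have "colpoint (x + dx) y z" using True by (simp add: colpoint_def)
      then show ?thesis using lab_not_chosen[OF nc] region_iff d x' by simp
    next
      case F: False
      have np: "\<not> (x = 5 \<or> x = 4 * m + 10)" using l nz F nc by auto
      then have w: "wr y z" "6 \<le> x" "x \<le> 4 * m + 9" using c F unfolding region_iff by auto
      have d: "dx = (if even x then 1 else -1)" "dy = 0" "dz = inw z"
        using l F np nc w by (auto simp: wdx_def)
      have x': "(x + dx) div 4 = x div 4" "even (x + dx) \<longleftrightarrow> odd x" "6 \<le> x + dx" "x + dx \<le> 4 * m + 9"
        "(x + dx) mod 4 = 0 \<or> (x + dx) mod 4 = 1 \<longleftrightarrow> x mod 4 = 0 \<or> x mod 4 = 1"
        using d(1) w by (auto split: if_splits) presburger+
      then have "\<not> colpoint (x + dx) y z" using F by (simp add: colpoint_def)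
      then show ?thesis using x' w nc d unfolding region_iff by (auto simp: wdx_def)
    qed
  qed
next
  fix x y z dx dy dz
  assume c: "(x, y, z) \<in> region" and l: "lab (x, y, z) = (dx, dy, dz)" and nz: "dy \<noteq> 0"
  show "(x, y + dy, z) \<in> region \<and> lab (x, y + dy, z) = (dx, - dy, dz)"
  proof (cases "colpoint x y z")
    case True
    then show ?thesis using colpoint_flip[OF True l] nz region_iff by auto
  next
    case False
    then have p: "x = 5 \<or> x = 4 * m + 10" "\<not> (wr y z \<and> chosen y)" "dx = 0" "dy = pdy y" "dz = inw z"
      using l nz by (auto split: if_splits)
    then have pp: "pathp y z" using c False unfolding region_iff by (auto simp: wr_def pathp_def)
    note f = path_flip[OF pp p(2)]
    have "\<not> colpoint x (y + dy) z"
    proof -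
      have "x div 4 < 2 \<or> x div 4 \<ge> m + 2" using p(1) by auto
      then show ?thesis using PT_cols by (fastforce simp: colpoint_def)
    qed
    then show ?thesis using f p unfolding region_iff by auto
  qed
next
  fix x y z dx dy dz
  assume c: "(x, y, z) \<in> region" and l: "lab (x, y, z) = (dx, dy, dz)" and nz: "dz \<noteq> 0"
  show "(x, y, z + dz) \<in> region \<and> lab (x, y, z + dz) = (dx, dy, - dz)"
  proof (cases "colpoint x y z")
    case True
    then show ?thesis using colpoint_flip[OF True l] nz region_iff by auto
  next
    case False
    then have dz: "dz = inw z" using l by (auto split: if_splits)
    have z: "z = 0 \<or> z = 1" using c False unfolding region_iff by (auto simp: wr_def pathp_def)
    have w: "wr y (z + dz) = wr y z" "pathp y (z + dz) = pathp y z" "inw (z + dz) = - inw z"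
      using z dz by (auto simp: wr_def pathp_def inw_def)
    have "\<not> colpoint x y (z + dz)"
    proof (cases "wr y z")
      case True
      then show ?thesis using False PT_swap[OF True] dz by (simp add: colpoint_def)
    next
      case nw: False
      then have "x = 5 \<or> x = 4 * m + 10" using c False unfolding region_iff by auto
      then have "x div 4 < 2 \<or> x div 4 \<ge> m + 2" by auto
      then show ?thesis using PT_cols by (fastforce simp: colpoint_def)
    qed
    then show ?thesis using c l False w dz unfolding region_iff by auto
  qed
qed

end

definition solvable :: bool where
  "solvable \<longleftrightarrow> (\<exists>u. \<forall>I. 2 \<le> I \<and> I < R + 2 \<longrightarrow> (\<exists>I'. 2 \<le> I' \<and> I' < R + 2 \<and> gr I' = gr I \<and>
     (\<forall>J. 2 \<le> J \<and> J < m + 2 \<longrightarrow> (k I' J = 1 \<longrightarrow> u J) \<and> (k I' J = 2 \<longrightarrow> \<not> u J))))"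

theorem admits_tiling_iff_solvable: "admits_tiling region slab \<longleftrightarrow> solvable"
proof
  assume "admits_tiling region slab"
  then show solvable
    unfolding admits_tiling_iff_labelling solvable_def using labelling_imp_solution by blast
next
  assume solvable
  then obtain u where u: "\<And>I. 2 \<le> I \<Longrightarrow> I < R + 2 \<Longrightarrow> \<exists>I'. 2 \<le> I' \<and> I' < R + 2 \<and> gr I' = gr I \<and>
     (\<forall>J. 2 \<le> J \<and> J < m + 2 \<longrightarrow> (k I' J = 1 \<longrightarrow> u J) \<and> (k I' J = 2 \<longrightarrow> \<not> u J))"
    unfolding solvable_def by blast
  \<comment> \<open>The choice depends on \<open>I\<close> only through \<open>gr I\<close>, so all
    rows of a group agree on the chosen one.\<close>
  define ch where "ch I = (SOME I'. 2 \<le> I' \<and> I' < R + 2 \<and> gr I' = gr I \<and>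
     (\<forall>J. 2 \<le> J \<and> J < m + 2 \<longrightarrow> (k I' J = 1 \<longrightarrow> u J) \<and> (k I' J = 2 \<longrightarrow> \<not> u J)))" for I
  have c: "2 \<le> ch I \<and> ch I < R + 2 \<and> gr (ch I) = gr I \<and>
     (\<forall>J. 2 \<le> J \<and> J < m + 2 \<longrightarrow> (k (ch I) J = 1 \<longrightarrow> u J) \<and> (k (ch I) J = 2 \<longrightarrow> \<not> u J))"
    if "2 \<le> I" "I < R + 2" for I
    unfolding ch_def by (rule someI_ex[OF u[OF that]])
  have "labelling region (lab u ch)"
  proof (rule chosen_solution_labelling)
    show "gr I = gr I' \<Longrightarrow> ch I = ch I'" for I I' by (simp add: ch_def)
    show "2 \<le> I \<Longrightarrow> I < R + 2 \<Longrightarrow> 2 \<le> ch I \<and> ch I < R + 2 \<and> gr (ch I) = gr I" for I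
      using c by blast
    show "(k I J = 1 \<longrightarrow> u J) \<and> (k I J = 2 \<longrightarrow> \<not> u J)"
      if "2 \<le> I" "I < R + 2" "ch I = I" "2 \<le> J" "J < m + 2" for I J
      using c[OF that(1,2)] that by simp
  qed
  then show "admits_tiling region slab" unfolding admits_tiling_iff_labelling by blast
qed

end

section \<open>Computation tableaux\<close>

type_synonym instr = "nat \<times> nat list \<times> nat \<times> (nat \<times> move) list"
type_synonym site = "(bool \<times> instr \<times> nat list) option"

text \<open>Tableau cells lie on one line, row after row.  Terms refer to the left neighbour, the cell
  itself, the right neighbour and the cell of the next row by the marks 1, 2, 3, 4.\<close>

definition spos :: "nat \<Rightarrow> nat \<Rightarrow> nat \<Rightarrow> nat" where
  "spos W p mk = (if mk = 1 then p - 1 else if mk = 3 then p + 1 else if mk = 4 then p + W else p)"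

definition site_sat :: "nat list \<Rightarrow> nat \<Rightarrow> (nat \<Rightarrow> (nat \<Rightarrow> 'v option) list) \<Rightarrow> bool" where
  "site_sat ls W Ts \<longleftrightarrow> (\<exists>X. \<forall>p<length ls. \<exists>\<tau>\<in>set (Ts (ls ! p)). \<forall>mk v. \<tau> mk = Some v \<longrightarrow> X (spos W p mk) = v)"

fun flagged :: "nat list \<Rightarrow> nat list" where
  "flagged [] = []"
| "flagged (x # xs) = (x + 3) # xs"

text \<open>The margins of \<open>2 * B\<close> blanks keep the unconstrained ends of a row away
  from the head: their influence spreads by one cell per step. The flag is set after padding on the
  right, so that an empty word has a head cell as well.\<close>

definition line0 :: "nat \<Rightarrow> bool list \<Rightarrow> nat list" where
  "line0 B w = 7 # replicate (2 * B) 1 @ flagged (map (\<lambda>b. if b then 3 else 2) w @ replicate (2 * B) 1)"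

text \<open>There are \<open>B + 2\<close> rows for \<open>B + 1\<close> steps; the last row is
  tested only for the accepting state.\<close>

definition labels :: "nat \<Rightarrow> bool list \<Rightarrow> nat list" where
  "labels B w = line0 B w @ concat (replicate B (map (\<lambda>x. if x = 7 then 7 else 8) (line0 B w))) @
     map (\<lambda>x. if x = 7 then 7 else 9) (line0 B w)"

lemma length_flagged [simp]: "length (flagged xs) = length xs"
  by (cases xs) auto

lemma length_line0: "length (line0 B w) = 4 * B + length w + 1"
  by (simp add: line0_def)

lemma flagged_nth: "j < length xs \<Longrightarrow> flagged xs ! j = (if j = 0 then xs ! j + 3 else xs ! j)"
  by (cases xs) (auto simp: nth_Cons split: nat.splits)

lemma line0_nth:
  assumes "1 \<le> j" "j < length (line0 B w)"
  shows "line0 B w ! j = written w (int j - int (2 * B + 1)) + 1 + (if j = 2 * B + 1 then 3 else 0)"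
proof (cases "j < 2 * B + 1")
  case True
  then show ?thesis using assms by (auto simp: line0_def nth_Cons nth_append written_def split: nat.splits)
next
  case False
  define i where "i = j - (2 * B + 1)"
  have j: "j = Suc (2 * B + i)" using False by (simp add: i_def)
  have i: "i < length w + 2 * B" using assms j by (simp add: length_line0)
  have "line0 B w ! j = flagged (map (\<lambda>b. if b then 3 else 2) w @ replicate (2 * B) 1) ! i"
    unfolding j by (simp add: line0_def nth_append)
  also have "\<dots> = written w (int i) + 1 + (if i = 0 then 3 else 0)"
    using i by (auto simp: flagged_nth nth_append written_def)
  finally show ?thesis using j by simp
qed

lemma line0_neq: "j < length (line0 B w) \<Longrightarrow> line0 B w ! j = 7 \<longleftrightarrow> j = 0"
  using line0_nth[of j B w] by (cases j) (auto simp: line0_def written_def)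

lemma nth_concat_uniform:
  assumes "\<And>xs. xs \<in> set xss \<Longrightarrow> length xs = W" "t < length xss" "j < W"
  shows "concat xss ! (t * W + j) = xss ! t ! j"
  using assms
proof (induction xss arbitrary: t)
  case (Cons xs xss)
  then have [simp]: "length xs = W" by simp
  show ?case
  proof (cases t)
    case (Suc t')
    then show ?thesis using Cons by (simp add: nth_append)
  qed (use Cons in \<open>simp add: nth_append\<close>)
qed simp

lemma labels_nth:
  fixes B w defines "W \<equiv> length (line0 B w)"
  assumes "t < B + 2" "j < W"
  shows "labels B w ! (t * W + j) = (if j = 0 then 7 else if t = 0 then line0 B w ! j else if t \<le> B then 8 else 9)"
proof -
  let ?xss = "line0 B w # replicate B (map (\<lambda>x. if x = 7 then 7 else 8) (line0 B w)) @
     [map (\<lambda>x. if x = 7 then 7 else 9) (line0 B w)]"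
  have c: "labels B w = concat ?xss" by (simp add: labels_def)
  have "labels B w ! (t * W + j) = ?xss ! t ! j"
    unfolding c by (rule nth_concat_uniform) (use assms(2,3) in \<open>auto simp: W_def\<close>)
  also have "\<dots> = (if j = 0 then 7 else if t = 0 then line0 B w ! j else if t \<le> B then 8 else 9)"
  proof -
    have j: "j < length (line0 B w)" using assms(3) by (simp add: W_def)
    note z = line0_neq[OF j]
    consider "t = 0" | t' where "t = Suc t'" "t' < B" | "t = Suc B" using assms(2) by (cases t) force+
    then show ?thesis
    proof cases
      case 1
      have "line0 B w ! 0 = 7" by (simp add: line0_def)
      then show ?thesis using 1 by simp
    next
      case 2
      then show ?thesis using z j by (simp add: nth_append)
    next
      case 3
      then show ?thesis using z j by (simp add: nth_append)
    qed
  qed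
  finally show ?thesis .
qed

lemma length_labels: "length (labels B w) = (B + 2) * length (line0 B w)"
  by (simp add: labels_def length_concat sum_list_replicate)

lemma window_iff:
  "(\<forall>mk v. [1 \<mapsto> a, 2 \<mapsto> b, 3 \<mapsto> c, 4 \<mapsto> d] mk = Some v \<longrightarrow> Y mk = v) \<longleftrightarrow>
    Y (1::nat) = a \<and> Y 2 = b \<and> Y 3 = c \<and> Y 4 = (d::'v)"
proof
  assume A: "\<forall>mk v. [1 \<mapsto> a, 2 \<mapsto> b, 3 \<mapsto> c, 4 \<mapsto> d] mk = Some v \<longrightarrow> Y mk = v"
  show "Y 1 = a \<and> Y 2 = b \<and> Y 3 = c \<and> Y 4 = d"
    using A[rule_format, of 1 a] A[rule_format, of 2 b] A[rule_format, of 3 c] A[rule_format, of 4 d] by simp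
qed (auto split: if_splits)

lemma window_range:
  "[1 \<mapsto> a, 2 \<mapsto> b, 3 \<mapsto> c, 4 \<mapsto> d] (mk::nat) = Some (v::'v) \<Longrightarrow> mk \<in> {1, 2, 3, 4} \<and> v \<in> {a, b, c, d}"
  by (auto split: if_splits)

section \<open>Windows for the steps of a fixed machine\<close>

locale tableau =
  fixes M :: tm and S :: nat
  assumes wf: "wf_tm M" and S3: "3 \<le> S"
    and bounded: "(q, ss, q', as) \<in> instructions M \<Longrightarrow> set ss \<subseteq> {..<S} \<and> fst ` set as \<subseteq> {..<S}"
begin

abbreviation k :: nat where "k \<equiv> tapes M"

text \<open>Loops in the accepting state, which turn acceptance within a time bound into acceptance
  after exactly that many steps.\<close>

definition idle :: "nat list \<Rightarrow> instr" where
  "idle ss = (accept M, ss, accept M, map (\<lambda>s. (s, Stay)) ss)"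

text \<open>The instructions into the fresh state \<open>qd\<close> guarantee that every cell has a consistent window.\<close>

definition qd :: nat where
  "qd = (SOME q. q \<notin> insert (accept M) (fst ` instructions M))"

definition dead :: "nat \<Rightarrow> nat list \<Rightarrow> instr" where
  "dead q ss = (q, ss, qd, map (\<lambda>s. (s, Stay)) ss)"

definition instrs :: "instr set" where
  "instrs = instructions M \<union> idle ` words k S \<union> dead (start M) ` words k S \<union> dead qd ` words k S"

lemma qd: "qd \<noteq> accept M" "(qd, x) \<notin> instructions M"
proof -
  have "finite (insert (accept M) (fst ` instructions M))" using wf by (simp add: wf_tm_def)
  then have "\<exists>q. q \<notin> insert (accept M) (fst ` instructions M)" by (rule ex_new_if_finite[OF infinite_UNIV_nat])
  then have "qd \<notin> insert (accept M) (fst ` instructions M)" unfolding qd_def by (rule someI_ex)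
  then show "qd \<noteq> accept M" "(qd, x) \<notin> instructions M" using imageI[of "(qd, x)" "instructions M" fst] by auto
qed

definition M' :: tm where "M' = M\<lparr>instructions := instrs\<rparr>"

lemma finite_instrs: "finite instrs"
  using wf finite_words by (auto simp: instrs_def wf_tm_def)

lemma instrs_wf:
  assumes "(q, ss, q', as) \<in> instrs"
  shows "length ss = k" "length as = k" "set ss \<subseteq> {..<S}" "fst ` set as \<subseteq> {..<S}"
  using assms wf bounded[of q ss q' as] by (auto simp: instrs_def idle_def dead_def words_def wf_tm_def)

definition okconf :: "config \<Rightarrow> bool" where
  "okconf c \<longleftrightarrow> length (snd c) = k \<and> (\<forall>i<k. \<forall>p. fst (snd c ! i) p < S)"

lemma okconf_step: "okconf c \<Longrightarrow> step M' c d \<Longrightarrow> okconf d"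
proof -
  assume ok: "okconf c" and st: "step M' c d"
  obtain q ts q' ts' where c: "c = (q, ts)" "d = (q', ts')" by (metis surj_pair)
  from st obtain as where as: "(q, map scanned ts, q', as) \<in> instrs" "ts' = map2 act ts as"
    unfolding c by (auto simp: M'_def)
  note w = instrs_wf[OF as(1)]
  have len: "length ts = k" using ok by (simp add: okconf_def c)
  have "fst (act (ts ! i) (as ! i)) p < S" if "i < k" for i p
  proof -
    obtain f h u mv where *: "ts ! i = (f, h)" "as ! i = (u, mv)" by (metis surj_pair)
    have "as ! i \<in> set as" using that w(2) by simp
    then have "u < S" using w(4) * by force
    moreover have "f p < S" using ok that * by (auto simp: okconf_def c dest!: spec[of _ i])
    ultimately show ?thesis by (simp add: *)
  qed
  then show "okconf d" using len w(2) by (simp add: okconf_def c as(2))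
qed

lemma okconf_initial: "okconf (initial M w)"
proof -
  have "written v p < S" for v p using S3 by (auto simp: written_def)
  moreover have "1 \<le> k" using wf by (simp add: wf_tm_def)
  ultimately show ?thesis by (auto simp: okconf_def initial_def nth_Cons split: nat.splits)
qed

lemma okconf_reach: "(step M' ^^ t) (initial M w) c \<Longrightarrow> okconf c"
  by (induction t arbitrary: c) (auto intro: okconf_initial okconf_step)

lemma step_M': "step M c d \<Longrightarrow> step M' c d"
  by (cases c; cases d) (auto simp: M'_def instrs_def)

lemma M'_step: "step M' c d \<Longrightarrow> fst c \<noteq> accept M \<Longrightarrow> fst d \<noteq> qd \<Longrightarrow> step M c d"
  by (cases c; cases d) (auto simp: M'_def instrs_def idle_def dead_def)

lemma qd_stuck: "(step M' ^^ n) c d \<Longrightarrow> fst c = qd \<Longrightarrow> fst d = qd"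
proof (induction n arbitrary: d)
  case (Suc n)
  then obtain e where e: "(step M' ^^ n) c e" "step M' e d" by auto
  then have "fst e = qd" using Suc by blast
  then show ?case using e(2) qd by (cases e; cases d) (auto simp: M'_def instrs_def idle_def dead_def)
qed auto

lemma idle_step:
  assumes "okconf c" "fst c = accept M"
  shows "\<exists>d. step M' c d \<and> fst d = accept M"
proof -
  obtain q ts where c: "c = (q, ts)" by force
  have "fst (ts ! i) (snd (ts ! i)) < S" if "i < k" for i using assms that by (simp add: okconf_def c)
  moreover have sc: "scanned x = fst x (snd x)" for x by (cases x) simp
  ultimately have "scanned x < S" if "x \<in> set ts" for x
    using assms(1) that unfolding okconf_def c by (metis in_set_conv_nth snd_conv)
  then have "map scanned ts \<in> words k S"
    using assms(1) by (auto simp: words_def okconf_def c simp del: scanned.simps)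
  then have "(q, map scanned ts, accept M, map (\<lambda>s. (s, Stay)) (map scanned ts)) \<in> instrs"
    using assms(2) by (auto simp: instrs_def idle_def c)
  then have "step M' c (accept M, map2 act ts (map (\<lambda>s. (s, Stay)) (map scanned ts)))"
    unfolding c by (auto simp: M'_def)
  then show ?thesis by (intro exI[of _ "(accept M, map2 act ts (map (\<lambda>s. (s, Stay)) (map scanned ts)))"]) simp
qed

text \<open>One direction pads an accepting run with idle steps. In the other, the run is cut at its
  first accepting configuration; before that it cannot have used an added instruction into
  \<open>qd\<close>, because that state is never left again.\<close>

lemma accepts_iff:
  assumes "\<And>n c. (step M ^^ n) (initial M w) c \<Longrightarrow> n \<le> T"
  shows "accepts M w \<longleftrightarrow> (\<exists>c. (step M' ^^ T) (initial M w) c \<and> fst c = accept M)"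
proof
  assume "accepts M w"
  then obtain n c where c: "(step M ^^ n) (initial M w) c" "fst c = accept M"
    by (auto simp: accepts_def dest: rtranclp_imp_relpowp)
  have "(step M' ^^ n) (initial M w) c"
    using c(1) by (induction n arbitrary: c) (auto intro: step_M')
  have "\<exists>d. (step M' ^^ (n + l)) (initial M w) d \<and> fst d = accept M" for l
  proof (induction l)
    case 0
    then show ?case using \<open>(step M' ^^ n) (initial M w) c\<close> c by (intro exI[of _ c]) simp
  next
    case (Suc l)
    then obtain d where d: "(step M' ^^ (n + l)) (initial M w) d" "fst d = accept M" by blast
    obtain e where "step M' d e" "fst e = accept M" using idle_step[OF okconf_reach[OF d(1)] d(2)] by blast
    then show ?case using d relpowp_Suc_I[of "n + l" "step M'"] by (metis add_Suc_right)
  qed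
  from this[of "T - n"] show "\<exists>c. (step M' ^^ T) (initial M w) c \<and> fst c = accept M"
    using assms[OF c(1)] by simp
next
  have *: "(step M' ^^ n) c d \<Longrightarrow> fst d = accept M \<Longrightarrow> \<exists>e. (step M)\<^sup>*\<^sup>* c e \<and> fst e = accept M" for n c d
  proof (induction n arbitrary: c)
    case (Suc n)
    show ?case
    proof (cases "fst c = accept M")
      case False
      obtain c1 where "step M' c c1" "(step M' ^^ n) c1 d" using Suc.prems by (blast dest: relpowp_Suc_D2)
      moreover from this have "fst c1 \<noteq> qd" using qd_stuck Suc.prems(2) qd(1) by metis
      ultimately show ?thesis using Suc False M'_step by (meson converse_rtranclp_into_rtranclp)
    next
      case True
      then show ?thesis by (intro exI[of _ c]) simp
    qed
  next
    case (0 c)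
    then show ?case by (intro exI[of _ c]) simp
  qed
  assume "\<exists>c. (step M' ^^ T) (initial M w) c \<and> fst c = accept M"
  then show "accepts M w" unfolding accepts_def using * by blast
qed

text \<open>\<open>None\<close> is meant for the separators. A proper cell records whether it is the
  head cell, the instruction executed in its row, and one symbol from each tape.\<close>

definition vals :: "site set" where
  "vals = insert None (Some ` (UNIV \<times> instrs \<times> words k S))"

lemma finite_vals: "finite vals"
  by (simp add: vals_def finite_instrs finite_words)

abbreviation src :: "instr \<Rightarrow> nat" where "src I \<equiv> fst I"
abbreviation rd :: "instr \<Rightarrow> nat list" where "rd I \<equiv> fst (snd I)"
abbreviation tgt :: "instr \<Rightarrow> nat" where "tgt I \<equiv> fst (snd (snd I))"
abbreviation wrt :: "instr \<Rightarrow> (nat \<times> move) list" where "wrt I \<equiv> snd (snd (snd I))"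

text \<open>What the cell \<open>x\<close> holds on tape \<open>i\<close> after the write and before
  the move: only the head cell changes.\<close>

definition adj :: "instr \<Rightarrow> bool \<times> instr \<times> nat list \<Rightarrow> nat \<Rightarrow> nat" where
  "adj I x i = (if fst x then fst (wrt I ! i) else snd (snd x) ! i)"

text \<open>For each tape a cell holds the symbol at its fixed distance from the head of that tape.
  When a head moves to the left, the contents relative to it shift to the right, so the new symbol
  comes from the left neighbour \<open>a\<close>. The neighbours agree on the instruction, which
  makes it common to the whole row; a neighbour \<open>None\<close> imposes nothing.\<close>

definition good :: "site \<Rightarrow> site \<Rightarrow> site \<Rightarrow> site \<Rightarrow> bool" where
  "good a b c d \<longleftrightarrow> (\<exists>f I s I' s'. b = Some (f, I, s) \<and> d = Some (f, I', s') \<and>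
     (f \<longrightarrow> rd I = s) \<and> src I' = tgt I \<and>
     (\<forall>x. a = Some x \<longrightarrow> fst (snd x) = I) \<and> (\<forall>x. c = Some x \<longrightarrow> fst (snd x) = I) \<and>
     (\<forall>i<k. \<forall>x. (case snd (wrt I ! i) of Left \<Rightarrow> a | Stay \<Rightarrow> b | Right \<Rightarrow> c) = Some x \<longrightarrow> s' ! i = adj I x i))"

lemma goodD:
  assumes "good a (Some (f, I, s)) c (Some (f', I', s'))"
  shows "f' = f" "f \<Longrightarrow> rd I = s" "src I' = tgt I" "a = Some x \<Longrightarrow> fst (snd x) = I"
    "c = Some x \<Longrightarrow> fst (snd x) = I"
    "i < k \<Longrightarrow> snd (wrt I ! i) = Left \<Longrightarrow> a = Some x \<Longrightarrow> s' ! i = adj I x i"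
    "i < k \<Longrightarrow> snd (wrt I ! i) = Stay \<Longrightarrow> s' ! i = adj I (f, I, s) i"
    "i < k \<Longrightarrow> snd (wrt I ! i) = Right \<Longrightarrow> c = Some x \<Longrightarrow> s' ! i = adj I x i"
proof -
  have *: "f' = f" "f \<longrightarrow> rd I = s" "src I' = tgt I" "\<forall>x. a = Some x \<longrightarrow> fst (snd x) = I"
    "\<forall>x. c = Some x \<longrightarrow> fst (snd x) = I"
    "\<forall>i<k. \<forall>x. (case snd (wrt I ! i) of Left \<Rightarrow> a | Stay \<Rightarrow> Some (f, I, s) | Right \<Rightarrow> c) = Some x \<longrightarrow>
      s' ! i = adj I x i"
    using assms by (auto simp: good_def simp del: split_paired_All)
  show "f' = f" "f \<Longrightarrow> rd I = s" "src I' = tgt I" "a = Some x \<Longrightarrow> fst (snd x) = I"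
    "c = Some x \<Longrightarrow> fst (snd x) = I" using * by blast+
  show "i < k \<Longrightarrow> snd (wrt I ! i) = Left \<Longrightarrow> a = Some x \<Longrightarrow> s' ! i = adj I x i"
    "i < k \<Longrightarrow> snd (wrt I ! i) = Stay \<Longrightarrow> s' ! i = adj I (f, I, s) i"
    "i < k \<Longrightarrow> snd (wrt I ! i) = Right \<Longrightarrow> c = Some x \<Longrightarrow> s' ! i = adj I x i"
    using *(6)[rule_format, of i] by (simp_all del: split_paired_All)
qed

text \<open>Labels: 1, 2, 3 are initial cells holding the symbol \<open>l - 1\<close>, 4, 5, 6 the same under the
  heads, 7 separates the rows, 8 is an intermediate and 9 a final cell.\<close>

definition init :: "nat \<Rightarrow> site \<Rightarrow> bool" where
  "init l b \<longleftrightarrow> l = 8 \<or> (\<exists>I. src I = start M \<and>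
     b = Some (l > 3, I, (if l > 3 then l - 4 else l - 1) # replicate (k - 1) 0))"

definition win :: "site \<Rightarrow> site \<Rightarrow> site \<Rightarrow> site \<Rightarrow> nat \<Rightarrow> site option" where
  "win a b c d = [1 \<mapsto> a, 2 \<mapsto> b, 3 \<mapsto> c, 4 \<mapsto> d]"

text \<open>A constraint on four cells is represented by the list of all windows that satisfy it,
  and a cell has to match one of them. A separator always matches, through the empty term.\<close>

definition terms :: "site list \<Rightarrow> nat \<Rightarrow> (nat \<Rightarrow> site option) list" where
  "terms vs l = (if l = 7 then [Map.empty]
     else if l = 9 then map (\<lambda>b. [2 \<mapsto> b]) (filter (\<lambda>b. \<exists>f I s. b = Some (f, I, s) \<and> src I = accept M) vs)
     else map (\<lambda>(a, b, c, d). win a b c d)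
       (filter (\<lambda>(a, b, c, d). good a b c d \<and> init l b)
         (List.product vs (List.product vs (List.product vs vs)))))"

section \<open>Satisfiable tableaux and accepting runs\<close>

context
  fixes vs :: "site list" and B :: nat and w :: "bool list"
  assumes vs: "set vs = vals" and B1: "1 \<le> B"
begin

abbreviation W :: nat where "W \<equiv> length (line0 B w)"
abbreviation j0 :: nat where "j0 \<equiv> 2 * B + 1"

definition sat :: "(nat \<Rightarrow> site) \<Rightarrow> bool" where
  "sat X \<longleftrightarrow> (\<forall>p<length (labels B w). \<exists>\<tau>\<in>set (terms vs (labels B w ! p)). \<forall>mk v. \<tau> mk = Some v \<longrightarrow> X (spos W p mk) = v)"

lemma W: "W = 4 * B + length w + 1"
  by (rule length_line0)

definition lbl :: "nat \<Rightarrow> nat \<Rightarrow> nat" where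
  "lbl t j = (if j = 0 then 7 else if t = 0 then line0 B w ! j else if t \<le> B then 8 else 9)"

lemma sat_iff:
  "sat X \<longleftrightarrow> (\<forall>t<B + 2. \<forall>j<W. \<exists>\<tau>\<in>set (terms vs (lbl t j)). \<forall>mk v. \<tau> mk = Some v \<longrightarrow> X (spos W (t * W + j) mk) = v)"
proof -
  have "(\<forall>p<(B + 2) * W. P p) \<longleftrightarrow> (\<forall>t<B + 2. \<forall>j<W. P (t * W + j))" for P
  proof (intro iffI allI impI)
    fix t j assume "\<forall>p<(B + 2) * W. P p" and tj: "t < B + 2" "j < W"
    moreover have "t * W + j < (B + 2) * W"
    proof -
      have "t * W + j < Suc t * W" using tj by simp
      also have "\<dots> \<le> (B + 2) * W" using tj by (intro mult_le_mono1) simp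
      finally show ?thesis .
    qed
    ultimately show "P (t * W + j)" by blast
  next
    fix p assume *: "\<forall>t<B + 2. \<forall>j<W. P (t * W + j)" and p: "p < (B + 2) * W"
    have "p div W < B + 2" using p by (simp add: less_mult_imp_div_less)
    moreover have "p mod W < W" using W by simp
    ultimately have "P (p div W * W + p mod W)" using * by blast
    then show "P p" by simp
  qed
  moreover have "labels B w ! (t * W + j) = lbl t j" if "t < B + 2" "j < W" for t j
    using labels_nth[of t B j w] that by (simp add: lbl_def)
  ultimately show ?thesis unfolding sat_def length_labels by (simp cong: conj_cong imp_cong)
qed

lemma lbl_window: "1 \<le> j \<Longrightarrow> j < W \<Longrightarrow> t \<le> B \<Longrightarrow> lbl t j \<noteq> 7 \<and> lbl t j \<noteq> 9"
  using line0_neq[of j B w] line0_nth[of j B w] by (auto simp: lbl_def written_def)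

lemma set_terms_window:
  assumes "l \<noteq> 7" "l \<noteq> 9"
  shows "\<tau> \<in> set (terms vs l) \<longleftrightarrow> (\<exists>a b c d. \<tau> = win a b c d \<and> {a, b, c, d} \<subseteq> vals \<and> good a b c d \<and> init l b)"
  using assms vs by (auto simp: terms_def image_iff)

lemma ex4: "(\<exists>a b c d. P a b c d \<and> x1 = a \<and> x2 = b \<and> x3 = c \<and> x4 = d) \<longleftrightarrow> P x1 x2 x3 x4"
  by blast

lemma win_iff: "(\<forall>mk v. win a b c d mk = Some v \<longrightarrow> Y mk = v) \<longleftrightarrow> Y 1 = a \<and> Y 2 = b \<and> Y 3 = c \<and> Y 4 = d"
  unfolding win_def by (rule window_iff)

lemma sat_window:
  assumes "1 \<le> j" "j < W" "t \<le> B"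
  shows "(\<exists>\<tau>\<in>set (terms vs (lbl t j)). \<forall>mk v. \<tau> mk = Some v \<longrightarrow> X (spos W (t * W + j) mk) = v) \<longleftrightarrow>
    {X (t * W + (j - 1)), X (t * W + j), X (t * W + (j + 1)), X (Suc t * W + j)} \<subseteq> vals \<and>
    good (X (t * W + (j - 1))) (X (t * W + j)) (X (t * W + (j + 1))) (X (Suc t * W + j)) \<and>
    init (lbl t j) (X (t * W + j))"
proof -
  have sp: "spos W (t * W + j) 1 = t * W + (j - 1)" "spos W (t * W + j) 2 = t * W + j"
    "spos W (t * W + j) 3 = t * W + (j + 1)" "spos W (t * W + j) 4 = Suc t * W + j"
    using assms by (auto simp: spos_def)
  have "(\<forall>mk v. win a b c d mk = Some v \<longrightarrow> X (spos W (t * W + j) mk) = v) \<longleftrightarrow>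
    X (t * W + (j - 1)) = a \<and> X (t * W + j) = b \<and> X (t * W + (j + 1)) = c \<and> X (Suc t * W + j) = d" for a b c d
    unfolding win_iff[of a b c d "\<lambda>mk. X (spos W (t * W + j) mk)"] sp ..
  note Q = this
  note l = lbl_window[OF assms]
  have "(\<exists>\<tau>\<in>set (terms vs (lbl t j)). P \<tau>) \<longleftrightarrow>
      (\<exists>a b c d. ({a, b, c, d} \<subseteq> vals \<and> good a b c d \<and> init (lbl t j) b) \<and> P (win a b c d))" for P
    unfolding Bex_def set_terms_window[OF conjunct1[OF l] conjunct2[OF l]] by blast
  from this[of "\<lambda>\<tau>. \<forall>mk v. \<tau> mk = Some v \<longrightarrow> X (spos W (t * W + j) mk) = v"] show ?thesis
    unfolding Q ex4 .
qed

text \<open>Flags are inherited from row to row, so the head cell stays at \<open>j0\<close>.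
  Neighbours agree on the instruction, so each row has a single one. What remains is that the stored
  symbols are those of an actual run near the head cell.\<close>

lemma sound:
  assumes "sat X"
  shows "\<exists>c. (step M' ^^ (B + 1)) (initial M w) c \<and> fst c = accept M"
proof -
  let ?x = "\<lambda>t j. X (t * W + j)"
  have win: "?x t j \<in> vals" "good (?x t (j - 1)) (?x t j) (?x t (j + 1)) (?x (Suc t) j)" "init (lbl t j) (?x t j)"
    if "1 \<le> j" "j < W" "t \<le> B" for t j
  proof -
    have "\<exists>\<tau>\<in>set (terms vs (lbl t j)). \<forall>mk v. \<tau> mk = Some v \<longrightarrow> X (spos W (t * W + j) mk) = v"
      using assms that unfolding sat_iff by simp
    note * = this[unfolded sat_window[OF that]]
    show "?x t j \<in> vals" using * by blast
    show "good (?x t (j - 1)) (?x t j) (?x t (j + 1)) (?x (Suc t) j)" using * by blast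
    show "init (lbl t j) (?x t j)" using * by blast
  qed
  have "\<exists>y. ?x t j = Some y" if "1 \<le> j" "j < W" "t \<le> B + 1" for t j
  proof (cases t)
    case 0
    then show ?thesis using win(2)[of j t] that by (auto simp: good_def)
  next
    case (Suc t')
    then show ?thesis using win(2)[of j t'] that by (auto simp: good_def)
  qed
  note ex = this
  define Y where "Y = (\<lambda>t j. the (?x t j))"
  have Y: "?x t j = Some (Y t j)" if "1 \<le> j" "j < W" "t \<le> B + 1" for t j
    using ex[OF that] by (auto simp: Y_def)
  define F where "F = (\<lambda>t j. fst (Y t j))"
  define Ins where "Ins = (\<lambda>t j. fst (snd (Y t j)))"
  define Sy where "Sy = (\<lambda>t j. snd (snd (Y t j)))"
  have g: "F (Suc t) j = F t j" "F t j \<Longrightarrow> rd (Ins t j) = Sy t j" "src (Ins (Suc t) j) = tgt (Ins t j)"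
    "j + 1 < W \<Longrightarrow> Ins t (j + 1) = Ins t j"
    "\<And>i. i < k \<Longrightarrow> 1 < j \<Longrightarrow> snd (wrt (Ins t j) ! i) = Left \<Longrightarrow> Sy (Suc t) j ! i = adj (Ins t j) (Y t (j - 1)) i"
    "\<And>i. i < k \<Longrightarrow> snd (wrt (Ins t j) ! i) = Stay \<Longrightarrow> Sy (Suc t) j ! i = adj (Ins t j) (Y t j) i"
    "\<And>i. i < k \<Longrightarrow> j + 1 < W \<Longrightarrow> snd (wrt (Ins t j) ! i) = Right \<Longrightarrow> Sy (Suc t) j ! i = adj (Ins t j) (Y t (j + 1)) i"
    "Ins t j \<in> instrs"
    if j: "1 \<le> j" "j < W" "t \<le> B" for t j
  proof -
    obtain f I s where y: "Y t j = (f, I, s)" by (metis prod_cases3)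
    obtain f' I' s' where y': "Y (Suc t) j = (f', I', s')" by (metis prod_cases3)
    have G: "good (?x t (j - 1)) (Some (f, I, s)) (?x t (j + 1)) (Some (f', I', s'))"
      using win(2)[OF j] Y[of j t] Y[of j "Suc t"] j y y' by simp
    have val: "Some (f, I, s) \<in> vals" using win(1)[OF j] Y[of j t] j y by simp
    have L: "1 < j \<Longrightarrow> ?x t (j - 1) = Some (Y t (j - 1))" using Y[of "j - 1" t] j by auto
    have Rr: "j + 1 < W \<Longrightarrow> ?x t (j + 1) = Some (Y t (j + 1))" using Y[of "j + 1" t] j by auto
    note d = goodD[OF G]
    show "F (Suc t) j = F t j" "F t j \<Longrightarrow> rd (Ins t j) = Sy t j" "src (Ins (Suc t) j) = tgt (Ins t j)"
      using d(1-3) by (simp_all add: F_def Ins_def Sy_def y y')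
    show "Ins t j \<in> instrs" using val by (auto simp: Ins_def y vals_def)
    show "j + 1 < W \<Longrightarrow> Ins t (j + 1) = Ins t j"
      using d(5)[OF Rr] by (simp add: Ins_def y)
    fix i assume i: "i < k"
    show "snd (wrt (Ins t j) ! i) = Stay \<Longrightarrow> Sy (Suc t) j ! i = adj (Ins t j) (Y t j) i"
      using d(7)[OF i] by (simp add: Ins_def Sy_def y y')
    show "1 < j \<Longrightarrow> snd (wrt (Ins t j) ! i) = Left \<Longrightarrow> Sy (Suc t) j ! i = adj (Ins t j) (Y t (j - 1)) i"
      using d(6)[OF i _ L] by (simp add: Ins_def Sy_def y y')
    show "j + 1 < W \<Longrightarrow> snd (wrt (Ins t j) ! i) = Right \<Longrightarrow> Sy (Suc t) j ! i = adj (Ins t j) (Y t (j + 1)) i"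
      using d(8)[OF i _ Rr] by (simp add: Ins_def Sy_def y y')
  qed
  have ini: "F 0 j = (j = j0)" "src (Ins 0 j) = start M"
    "Sy 0 j = written w (int j - int j0) # replicate (k - 1) 0" if j: "1 \<le> j" "j < W" for j
  proof -
    have l: "lbl 0 j = written w (int j - int j0) + 1 + (if j = j0 then 3 else 0)"
      using line0_nth[OF j] j by (simp add: lbl_def)
    have le: "written w (int j - int j0) \<le> 2" by (simp add: written_def)
    have "init (lbl 0 j) (Some (Y 0 j))" using win(3)[OF j, of 0] Y[OF j, of 0] by simp
    then show "F 0 j = (j = j0)" "src (Ins 0 j) = start M"
      "Sy 0 j = written w (int j - int j0) # replicate (k - 1) 0"
      using le unfolding l init_def F_def Ins_def Sy_def by (auto split: if_splits)
  qed
  have F: "F t j = (j = j0)" if j: "1 \<le> j" "j < W" "t \<le> B + 1" for t j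
    using j(3) by (induction t) (use ini(1) g(1) j in auto)
  have const: "Ins t j = Ins t j0" if "1 \<le> j" "j < W" "t \<le> B" for t j
  proof -
    have "Ins t (1 + i) = Ins t 1" if "1 + i < W" for i
      using that
    proof (induction i)
      case (Suc i)
      then show ?case using g(4)[of "1 + i" t] \<open>t \<le> B\<close> by simp
    qed simp
    from this[of "j - 1"] this[of "j0 - 1"] show ?thesis using that W B1 by simp
  qed
  have k1: "1 \<le> k" using wf by (simp add: wf_tm_def)
  \<comment> \<open>The symbols are claimed correct only in an interval around \<open>j0\<close>
    that loses one cell on each side per step, since a shift may bring in a symbol from outside. The
    initial radius \<open>2 * B - 1\<close> keeps both neighbours of every cell in question inside
    the row.\<close>
  have main: "\<exists>q ts. (step M' ^^ t) (initial M w) (q, ts) \<and> length ts = k \<and> src (Ins t j0) = q \<and>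
     (\<forall>j i. i < k \<and> \<bar>int j - int j0\<bar> \<le> int (2 * B - 1) - int t \<longrightarrow>
        Sy t j ! i = fst (ts ! i) (snd (ts ! i) + int j - int j0))" if "t \<le> B + 1" for t
    using that
  proof (induction t)
    case 0
    let ?ts = "(written w, 0) # replicate (k - 1) (written [], 0)"
    have "Sy 0 j ! i = fst (?ts ! i) (snd (?ts ! i) + int j - int j0)"
      if "i < k" "\<bar>int j - int j0\<bar> \<le> int (2 * B - 1) - int 0" for i j
    proof -
      have "1 \<le> j" "j < W" using that(2) W B1 by linarith+
      then show ?thesis using ini(3)[of j] that(1) by (cases i) (auto simp: written_def)
    qed
    moreover have "src (Ins 0 j0) = start M" using ini(2)[of j0] W B1 by simp
    moreover have "length ?ts = k" using k1 by simp
    ultimately show ?case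
      by (intro exI[of _ "start M"] exI[of _ ?ts]) (auto simp: initial_def)
  next
    case (Suc t)
    then obtain q ts where IH: "(step M' ^^ t) (initial M w) (q, ts)" "length ts = k" "src (Ins t j0) = q"
      "\<And>j i. i < k \<Longrightarrow> \<bar>int j - int j0\<bar> \<le> int (2 * B - 1) - int t \<Longrightarrow>
        Sy t j ! i = fst (ts ! i) (snd (ts ! i) + int j - int j0)" by auto
    have t: "t \<le> B" using Suc by simp
    have c: "1 \<le> j0" "j0 < W" using W B1 by auto
    obtain q0 ss q' as where I: "Ins t j0 = (q0, ss, q', as)" by (metis prod_cases4)
    note G = g[OF c t]
    have q0: "q0 = q" using IH(3) I by simp
    have iw: "length ss = k" "length as = k" using instrs_wf[of q0 ss q' as] G(8) I by auto
    have "ss = map scanned ts"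
    proof (rule nth_equalityI)
      show "length ss = length (map scanned ts)" using iw IH(2) by simp
      fix i assume "i < length ss"
      then have i: "i < k" using iw by simp
      have "ss ! i = Sy t j0 ! i" using G(2) F[OF c] t I by simp
      also have "\<dots> = fst (ts ! i) (snd (ts ! i))" using IH(4)[OF i, of j0] t B1 by simp
      finally show "ss ! i = map scanned ts ! i" using i IH(2) by (cases "ts ! i") simp
    qed
    then have st: "step M' (q, ts) (q', map2 act ts as)" using G(8) I q0 by (auto simp: M'_def)
    have "Sy (Suc t) j ! i = fst (map2 act ts as ! i) (snd (map2 act ts as ! i) + int j - int j0)"
      if i: "i < k" and r: "\<bar>int j - int j0\<bar> \<le> int (2 * B - 1) - int (Suc t)" for i j
    proof -
      obtain f h where ti: "ts ! i = (f, h)" by force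
      obtain u mv where ai: "as ! i = (u, mv)" by force
      have rhs: "fst (map2 act ts as ! i) (snd (map2 act ts as ! i) + int j - int j0) =
         (if int j + offset mv = int j0 then u else f (h + (int j + offset mv) - int j0))"
        using i iw IH(2) ti ai by (auto simp: algebra_simps)
      have j: "1 < j" "j + 1 < W" using r W B1 by linarith+
      have Ij: "Ins t j = (q0, ss, q', as)" using const[of j t] j t I by simp
      have adj: "adj (Ins t j) (Y t j') i = (if j' = j0 then u else f (h + int j' - int j0))"
        if "1 \<le> j'" "j' < W" "\<bar>int j' - int j0\<bar> \<le> int (2 * B - 1) - int t" for j'
        using F[of j' t] that t IH(4)[OF i that(3)] ti ai Ij
        by (auto simp: adj_def F_def Sy_def)
      show ?thesis
      proof (cases mv)
        case Left
        have "Sy (Suc t) j ! i = adj (Ins t j) (Y t (j - 1)) i"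
          using g(5)[of j t i] j t i Ij ai Left by simp
        also have "\<dots> = (if j - 1 = j0 then u else f (h + int (j - 1) - int j0))"
          using j r by (intro adj) auto
        finally show ?thesis unfolding rhs using Left j by auto
      next
        case Stay
        have "Sy (Suc t) j ! i = adj (Ins t j) (Y t j) i"
          using g(6)[of j t i] j t i Ij ai Stay by simp
        also have "\<dots> = (if j = j0 then u else f (h + int j - int j0))"
          using j r by (intro adj) auto
        finally show ?thesis unfolding rhs using Stay by auto
      next
        case Right
        have "Sy (Suc t) j ! i = adj (Ins t j) (Y t (j + 1)) i"
          using g(7)[of j t i] j t i Ij ai Right by simp
        also have "\<dots> = (if j + 1 = j0 then u else f (h + int (j + 1) - int j0))"
          using j r by (intro adj) auto
        finally show ?thesis unfolding rhs using Right by auto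
      qed
    qed
    moreover have "src (Ins (Suc t) j0) = q'" using G(3) I by simp
    moreover have "(step M' ^^ Suc t) (initial M w) (q', map2 act ts as)" using relpowp_Suc_I[OF IH(1) st] .
    ultimately show ?case using iw IH(2) by (intro exI[of _ q'] exI[of _ "map2 act ts as"]) auto
  qed
  obtain q ts where "(step M' ^^ (B + 1)) (initial M w) (q, ts)" "src (Ins (B + 1) j0) = q"
    using main[of "B + 1"] by blast
  moreover have "src (Ins (B + 1) j0) = accept M"
  proof -
    have c: "1 \<le> j0" "j0 < W" using W B1 by auto
    have "\<exists>\<tau>\<in>set (terms vs 9). \<forall>mk v. \<tau> mk = Some v \<longrightarrow> X (spos W ((B + 1) * W + j0) mk) = v"
    proof -
      have "lbl (B + 1) j0 = 9" by (simp add: lbl_def)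
      then show ?thesis using assms[unfolded sat_iff, rule_format, of "B + 1" j0] c by simp
    qed
    then obtain \<tau> where \<tau>: "\<tau> \<in> set (terms vs 9)"
      "\<And>mk v. \<tau> mk = Some v \<Longrightarrow> X (spos W ((B + 1) * W + j0) mk) = v" by blast
    obtain b where b: "\<tau> = [2 \<mapsto> b]" "\<exists>f I s. b = Some (f, I, s) \<and> src I = accept M"
      using \<tau>(1) unfolding terms_def by auto
    then have "X (spos W ((B + 1) * W + j0) 2) = b" using \<tau>(2)[of 2 b] by simp
    moreover have "spos W ((B + 1) * W + j0) 2 = (B + 1) * W + j0" by (simp add: spos_def)
    ultimately obtain f I s where "X ((B + 1) * W + j0) = Some (f, I, s)" "src I = accept M"
      using b(2) by (metis (no_types))
    then have "Y (B + 1) j0 = (f, I, s)" "src I = accept M" using Y[OF c, of "B + 1"] by simp_all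
    then show ?thesis by (simp add: Ins_def)
  qed
  ultimately show ?thesis by auto
qed

lemma complete:
  assumes "(step M' ^^ (B + 1)) (initial M w) c" "fst c = accept M"
  shows "\<exists>X. sat X"
proof -
  obtain cf where cf: "cf 0 = initial M w" "cf (B + 1) = c" "\<And>t. t < B + 1 \<Longrightarrow> step M' (cf t) (cf (Suc t))"
    using assms(1) unfolding relpowp_fun_conv by blast
  define qf where "qf = (\<lambda>t. fst (cf t))"
  define tf where "tf = (\<lambda>t. snd (cf t))"
  have ok: "okconf (cf t)" if "t \<le> B + 1" for t
    using that by (induction t) (use cf okconf_initial okconf_step in auto)
  have len: "length (tf t) = k" and bnd: "i < k \<Longrightarrow> fst (tf t ! i) p < S" if "t \<le> B + 1" for t i p
    using ok[OF that] by (auto simp: okconf_def tf_def)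
  have "\<exists>as. (qf t, map scanned (tf t), qf (Suc t), as) \<in> instrs \<and> tf (Suc t) = map2 act (tf t) as"
    if "t \<le> B" for t
    using cf(3)[of t] that by (cases "cf t"; cases "cf (Suc t)") (auto simp: M'_def qf_def tf_def)
  then obtain asf where asf: "\<And>t. t \<le> B \<Longrightarrow> (qf t, map scanned (tf t), qf (Suc t), asf t) \<in> instrs \<and>
     tf (Suc t) = map2 act (tf t) (asf t)" by metis
  \<comment> \<open>The last row has no further step; an idle instruction supplies the accepting
    state as its source.\<close>
  define In where "In = (\<lambda>t. if t \<le> B then (qf t, map scanned (tf t), qf (Suc t), asf t) else idle (replicate k 0))"
  have InI: "In t \<in> instrs" for t
    using asf[of t] S3 by (auto simp: In_def instrs_def words_def)
  have Isrc: "src (In t) = qf t" if "t \<le> B + 1" for t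
  proof (cases "t \<le> B")
    case False
    then have "t = B + 1" using that by simp
    then show ?thesis using cf(2) assms(2) by (simp add: In_def idle_def qf_def)
  qed (simp add: In_def)
  define sy where "sy = (\<lambda>t j i. fst (tf t ! i) (snd (tf t ! i) + int j - int j0))"
  define x :: "nat \<Rightarrow> nat \<Rightarrow> site" where
    "x = (\<lambda>t j. if j = 0 then None else Some (j = j0, In t, map (sy t j) [0..<k]))"
  define X where "X = (\<lambda>p. x (p div W) (p mod W))"
  have X: "X (t * W + j) = x t j" if "j < W" for t j
  proof -
    have "(t * W + j) div W = t" using that by (intro div_nat_eqI) simp_all
    then show ?thesis using that by (simp add: X_def)
  qed
  \<comment> \<open>The cell to the right of the end of a row is the separator of the next row,
    which holds \<open>None\<close>.\<close>
  have Xr: "X (t * W + (j + 1)) = (if j + 1 < W then x t (j + 1) else None)" if "j < W" for t j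
  proof (cases "j + 1 < W")
    case False
    then have "t * W + (j + 1) = Suc t * W + 0" using that by simp
    moreover have "X (Suc t * W + 0) = x (Suc t) 0" using that by (intro X) linarith
    ultimately have "X (t * W + (j + 1)) = x (Suc t) 0" by (simp only:)
    then show ?thesis using False by (simp add: x_def)
  next
    case True
    then show ?thesis using X[of "j + 1" t] by simp
  qed
  have xv: "x t j \<in> vals" if "t \<le> B + 1" for t j
  proof -
    have "map (sy t j) [0..<k] \<in> words k S" using bnd[OF that] by (auto simp: words_def sy_def)
    then show ?thesis using InI by (cases "j = 0") (simp_all add: x_def vals_def)
  qed
  have sy_step: "sy (Suc t) j i = (if int j + offset (snd (asf t ! i)) = int j0 then fst (asf t ! i)
      else fst (tf t ! i) (snd (tf t ! i) + (int j + offset (snd (asf t ! i))) - int j0))"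
    if "t \<le> B" "i < k" for t j i
  proof -
    have "length (asf t) = k" using instrs_wf(2) asf[OF that(1)] by blast
    moreover obtain f h u mv where "tf t ! i = (f, h)" "asf t ! i = (u, mv)" by (metis surj_pair)
    ultimately show ?thesis using asf[OF that(1)] that len[of t]
      by (auto simp: sy_def algebra_simps)
  qed
  have adj: "adj (In t) (j' = j0, In t, map (sy t j') [0..<k]) i =
      (if j' = j0 then fst (asf t ! i) else fst (tf t ! i) (snd (tf t ! i) + int j' - int j0))"
    if "t \<le> B" "i < k" for t j' i
    using that by (simp add: adj_def In_def sy_def)
  have gd: "good (x t (j - 1)) (x t j) (if j + 1 < W then x t (j + 1) else None) (x (Suc t) j)"
    if j: "1 \<le> j" "j < W" "t \<le> B" for t j
    unfolding good_def
  proof (intro exI conjI allI impI)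
    show "x t j = Some (j = j0, In t, map (sy t j) [0..<k])" using j by (simp add: x_def)
    show "x (Suc t) j = Some (j = j0, In (Suc t), map (sy (Suc t) j) [0..<k])" using j by (simp add: x_def)
    show "rd (In t) = map (sy t j) [0..<k]" if "j = j0"
    proof (rule nth_equalityI)
      show "length (rd (In t)) = length (map (sy t j) [0..<k])" using j len[of t] by (simp add: In_def)
      fix i assume "i < length (rd (In t))"
      then have "i < k" using j len[of t] by (simp add: In_def)
      then show "rd (In t) ! i = map (sy t j) [0..<k] ! i"
        using j len[of t] that by (cases "tf t ! i") (simp add: In_def sy_def)
    qed
    show "src (In (Suc t)) = tgt (In t)" using Isrc[of "Suc t"] j by (simp add: In_def)
    show "fst (snd y) = In t" if "x t (j - 1) = Some y" for y using that by (auto simp: x_def split: if_splits)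
    show "fst (snd y) = In t" if "(if j + 1 < W then x t (j + 1) else None) = Some y" for y
      using that by (auto simp: x_def split: if_splits)
    fix i y assume i: "i < k" and y: "(case snd (wrt (In t) ! i) of Left \<Rightarrow> x t (j - 1) | Stay \<Rightarrow> x t j
        | Right \<Rightarrow> if j + 1 < W then x t (j + 1) else None) = Some y"
    have w: "wrt (In t) = asf t" using j by (simp add: In_def)
    have l: "map (sy (Suc t) j) [0..<k] ! i = sy (Suc t) j i" using i by simp
    show "map (sy (Suc t) j) [0..<k] ! i = adj (In t) y i"
    proof (cases "snd (asf t ! i)")
      case Left
      then have "x t (j - 1) = Some y" "j - 1 \<noteq> 0" using y w by (auto simp: x_def split: if_splits)
      then have yy: "y = (j - 1 = j0, In t, map (sy t (j - 1)) [0..<k])" by (simp add: x_def)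
      have "int (j - 1) = int j - 1" using j by simp
      then show ?thesis unfolding l yy adj[OF j(3) i] sy_step[OF j(3) i] Left
        using j by auto
    next
      case Stay
      then have "x t j = Some y" using y w by simp
      then have yy: "y = (j = j0, In t, map (sy t j) [0..<k])" using j by (simp add: x_def)
      show ?thesis unfolding l yy adj[OF j(3) i] sy_step[OF j(3) i] Stay by auto
    next
      case Right
      then have "x t (j + 1) = Some y" using y w by (auto split: if_splits)
      then have yy: "y = (j + 1 = j0, In t, map (sy t (j + 1)) [0..<k])" by (simp add: x_def)
      have "int (j + 1) = int j + 1" by simp
      then show ?thesis unfolding l yy adj[OF j(3) i] sy_step[OF j(3) i] Right by auto
    qed
  qed
  have k1: "1 \<le> k" using wf by (simp add: wf_tm_def)
  have ini: "init (lbl t j) (x t j)" if j: "1 \<le> j" "j < W" "t \<le> B" for t j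
  proof (cases "t = 0")
    case True
    have tf0: "tf 0 = (written w, 0) # replicate (k - 1) (written [], 0)" "qf 0 = start M"
      by (auto simp: tf_def qf_def cf initial_def)
    have "map (sy 0 j) [0..<k] = written w (int j - int j0) # replicate (k - 1) 0"
    proof (rule nth_equalityI)
      fix i assume "i < length (map (sy 0 j) [0..<k])"
      then show "map (sy 0 j) [0..<k] ! i = (written w (int j - int j0) # replicate (k - 1) 0) ! i"
        by (cases i) (auto simp: sy_def tf0 written_def)
    qed (use k1 in simp)
    moreover have l: "lbl 0 j = written w (int j - int j0) + 1 + (if j = j0 then 3 else 0)"
      using line0_nth[OF j(1,2)] j by (simp add: lbl_def)
    moreover have le: "written w (int j - int j0) \<le> 2" by (simp add: written_def)
    moreover have "src (In 0) = start M" using Isrc[of 0] tf0 by simp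
    ultimately show ?thesis using j unfolding True x_def init_def l
      by (cases "j = j0") (intro disjI2 exI[of _ "In 0"], simp)+
  next
    case False
    then show ?thesis using j by (simp add: init_def lbl_def)
  qed
  have "sat X"
    unfolding sat_iff
  proof (intro allI impI)
    fix t j assume t: "t < B + 2" and j: "j < W"
    consider "j = 0" | "1 \<le> j" "t \<le> B" | "1 \<le> j" "t = B + 1" using t by linarith
    then show "\<exists>\<tau>\<in>set (terms vs (lbl t j)). \<forall>mk v. \<tau> mk = Some v \<longrightarrow> X (spos W (t * W + j) mk) = v"
    proof cases
      case 1
      then show ?thesis by (simp add: lbl_def terms_def)
    next
      case 2
      have XX: "X (t * W + (j - 1)) = x t (j - 1)" "X (t * W + j) = x t j" "X (Suc t * W + j) = x (Suc t) j"
        using X[of "j - 1" t] X[of j t] X[of j "Suc t"] j by simp_all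
      have "{x t (j - 1), x t j, if j + 1 < W then x t (j + 1) else None, x (Suc t) j} \<subseteq> vals"
        using xv 2 by (auto simp: vals_def)
      then show ?thesis unfolding sat_window[OF 2(1) j 2(2)] XX Xr[OF j]
        using gd[OF 2(1) j 2(2)] ini[OF 2(1) j 2(2)] by blast
    next
      case 3
      have "x t j = Some (j = j0, In t, map (sy t j) [0..<k])" using 3 by (simp add: x_def)
      moreover have "src (In t) = accept M" using 3 by (simp add: In_def idle_def)
      moreover have "x t j \<in> set vs" using xv[of t j] vs 3 by simp
      ultimately have A: "x t j \<in> {b \<in> set vs. \<exists>f I s. b = Some (f, I, s) \<and> src I = accept M}" by blast
      have e: "set (terms vs 9) = (\<lambda>b. [2 \<mapsto> b]) ` {b \<in> set vs. \<exists>f I s. b = Some (f, I, s) \<and> src I = accept M}"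
        by (simp add: terms_def)
      have "[2 \<mapsto> x t j] \<in> set (terms vs 9)" unfolding e by (rule imageI[OF A])
      moreover have "lbl t j = 9" using 3 by (simp add: lbl_def)
      ultimately show ?thesis using X[OF j, of t] by (intro bexI[of _ "[2 \<mapsto> x t j]"]) (auto simp: spos_def)
    qed
  qed
  then show ?thesis by blast
qed

lemma site_sat_iff: "site_sat (labels B w) W (terms vs) \<longleftrightarrow>
    (\<exists>c. (step M' ^^ (B + 1)) (initial M w) c \<and> fst c = accept M)"
  using sound complete unfolding site_sat_def sat_def by blast

end

text \<open>A cell with an empty list of terms would contribute no rows to the region: its
  constraint would disappear instead of being violated. So each label has to allow some window,
  whatever the machine does.\<close>

lemma terms_nonempty:
  assumes "set vs = vals" "1 \<le> l" "l \<le> 9"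
  shows "terms vs l \<noteq> []"
proof -
  have k1: "1 \<le> k" using wf by (simp add: wf_tm_def)
  consider "l = 7" | "l = 9" | "l \<noteq> 7" "l \<noteq> 9" by blast
  then show ?thesis
  proof cases
    case 1
    then show ?thesis by (simp add: terms_def)
  next
    case 2
    let ?z = "replicate k 0"
    have z: "?z \<in> words k S" using S3 by (auto simp: words_def)
    then have "Some (False, idle ?z, ?z) \<in> set vs" using assms(1) by (simp add: vals_def instrs_def)
    moreover have "src (idle ?z) = accept M" by (simp add: idle_def)
    ultimately have "Some (False, idle ?z, ?z) \<in>
        set (filter (\<lambda>b. \<exists>f I s. b = Some (f, I, s) \<and> src I = accept M) vs)"
      unfolding set_filter by blast
    then have "filter (\<lambda>b. \<exists>f I s. b = Some (f, I, s) \<and> src I = accept M) vs \<noteq> []"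
      by (metis empty_iff list.set(1))
    then show ?thesis using 2 by (simp add: terms_def)
  next
    case 3
    \<comment> \<open>The symbols prescribed by the label; for label 8, which prescribes none,
      blanks are taken.\<close>
    define y where "y = (if l = 8 then 0 else if l > 3 then l - 4 else l - 1) # replicate (k - 1) (0::nat)"
    have y: "y \<in> words k S" using assms(2,3) 3 S3 k1 by (auto simp: y_def words_def)
    \<comment> \<open>A dead instruction rewrites what it reads and does not move, so the cell below
      repeats \<open>y\<close>, and the neighbours can be left empty.\<close>
    let ?b = "Some (l > 3, dead (start M) y, y)" and ?d = "Some (l > 3, dead qd y, y)"
    have "{None, ?b, None, ?d} \<subseteq> vals" using y by (simp add: vals_def instrs_def)
    moreover have "init l ?b" 
      unfolding init_def by (cases "l = 8") (simp, intro disjI2 exI[of _ "dead (start M) y"], simp add: dead_def y_def)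
    moreover have "good None ?b None ?d"
      unfolding good_def
    proof (intro exI conjI allI impI)
      show "?b = Some (l > 3, dead (start M) y, y)" "?d = Some (l > 3, dead qd y, y)" by (rule refl)+
      fix i x assume i: "i < k" and "(case snd (wrt (dead (start M) y) ! i) of Left \<Rightarrow> None | Stay \<Rightarrow> ?b | Right \<Rightarrow> None) = Some x"
      then have "x = (l > 3, dead (start M) y, y)" using y by (simp add: dead_def words_def)
      then show "y ! i = adj (dead (start M) y) x i" using i y by (simp add: adj_def dead_def words_def)
    qed (simp_all add: dead_def)
    ultimately have "win None ?b None ?d \<in> set (terms vs l)"
      unfolding set_terms_window[OF assms(1) order_refl 3]
      by (intro exI[of _ None] exI[of _ ?b] exI[of _ ?d] conjI refl)
    then show ?thesis by (metis empty_iff list.set(1))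
  qed
qed

lemma terms_marks:
  assumes "set vs = vals" "\<tau> \<in> set (terms vs l)" "\<tau> mk = Some v"
  shows "v \<in> set vs \<and> mk \<in> {1, 2, 3, 4} \<and> l \<noteq> 7 \<and> (l = 9 \<longrightarrow> mk = 2)"
proof -
  consider "l = 7" | "l = 9" | "l \<noteq> 7" "l \<noteq> 9" by blast
  then show ?thesis
  proof cases
    case 1
    then show ?thesis using assms by (simp add: terms_def)
  next
    case 2
    then obtain b where "b \<in> set vs" "\<tau> = [2 \<mapsto> b]" using assms(2) unfolding terms_def by auto
    then show ?thesis using assms(3) 2 by (auto split: if_splits simp del: split_paired_All)
  next
    case 3
    then obtain a b c d where t: "\<tau> = win a b c d" "{a, b, c, d} \<subseteq> vals"
      using set_terms_window[OF assms(1) order_refl 3] assms(2) by blast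
    then have "mk \<in> {1, 2, 3, 4} \<and> v \<in> {a, b, c, d}"
      using window_range[of a b c d mk v] assms(3) unfolding win_def by blast
    then show ?thesis using t(2) assms(1) 3 by blast
  qed
qed

end

text \<open>A bound of this form can be computed in unary by the reduction: \<open>d\<close>
  multiplications by \<open>n + c\<close>.\<close>

lemma poly_le_power: "\<exists>c d. 1 \<le> c \<and> (\<forall>n. poly (p :: nat poly) n \<le> (n + c) ^ d)"
proof (induction p)
  case 0
  then show ?case by (intro exI[of _ 1] exI[of _ 0]) simp
next
  case (pCons a p)
  then obtain c d where cd: "1 \<le> c" "\<And>n. poly p n \<le> (n + c) ^ d" by blast
  have "a + n * poly p n \<le> (n + (c + a)) ^ Suc d" for n
  proof -
    have one: "1 \<le> (n + (c + a)) ^ d" using cd(1) by simp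
    have "poly p n \<le> (n + (c + a)) ^ d"
      using cd(2)[of n] power_mono[of "n + c" "n + (c + a)" d] by linarith
    then have "a * 1 + n * poly p n \<le> a * (n + (c + a)) ^ d + n * (n + (c + a)) ^ d"
      using one by (intro add_mono mult_le_mono) auto
    also have "\<dots> \<le> (n + (c + a)) ^ Suc d" by (simp add: algebra_simps)
    finally show ?thesis by simp
  qed
  then show ?case using cd(1) by (intro exI[of _ "c + a"] exI[of _ "Suc d"]) auto
qed

text \<open>The interface to the geometry. The values, the term lists and the two numbers of the
  clock depend on the language only; the word enters through the labels alone. The conditions on
  marks ensure that no term looks past the ends of the list of cells.\<close>

theorem NP_site_sat:
  assumes "L \<in> NP"
  shows "\<exists>(vs :: site list) Ts c d. distinct vs \<and> 1 \<le> c \<and> (\<forall>l. 1 \<le> l \<and> l \<le> 9 \<longrightarrow> Ts l \<noteq> []) \<and>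
    (\<forall>l \<tau> mk v. \<tau> \<in> set (Ts l) \<longrightarrow> \<tau> mk = Some v \<longrightarrow>
       v \<in> set vs \<and> mk \<in> {1, 2, 3, 4} \<and> l \<noteq> 7 \<and> (l = 9 \<longrightarrow> mk = 2)) \<and>
    (\<forall>w. w \<in> L \<longleftrightarrow> site_sat (labels ((length w + c) ^ d) w) (length (line0 ((length w + c) ^ d) w)) Ts)"
proof -
  obtain M p where M: "wf_tm M" "runs_in_time M p" "\<And>w. w \<in> L \<longleftrightarrow> accepts M w"
    using assms by (auto simp: NP_def)
  let ?A = "\<Union>(q, ss, q', as)\<in>instructions M. set ss \<union> fst ` set as"
  have "finite ?A" using M(1) unfolding wf_tm_def by (intro finite_UN_I) auto
  then obtain S where S: "\<And>x. x \<in> ?A \<Longrightarrow> x < S" unfolding finite_nat_set_iff_bounded by blast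
  interpret tableau M "S + 3"
    by unfold_locales (use M(1) S in \<open>fastforce+\<close>)
  obtain vs where vs: "set vs = vals" "distinct vs" using finite_distinct_list[OF finite_vals] by blast
  obtain c d where cd: "1 \<le> c" "\<And>n. poly p n \<le> (n + c) ^ d" using poly_le_power by blast
  have "w \<in> L \<longleftrightarrow> site_sat (labels ((length w + c) ^ d) w) (length (line0 ((length w + c) ^ d) w)) (terms vs)" for w
  proof -
    let ?B = "(length w + c) ^ d"
    have "n \<le> ?B + 1" if "(step M ^^ n) (initial M w) e" for n e
    proof -
      have "n \<le> poly p (length w)" using M(2) that unfolding runs_in_time_def by blast
      then show ?thesis using cd(2)[of "length w"] by linarith
    qed
    then have "accepts M w \<longleftrightarrow> (\<exists>c. (step M' ^^ (?B + 1)) (initial M w) c \<and> fst c = accept M)"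
      by (rule accepts_iff)
    moreover have "1 \<le> ?B" using cd(1) by simp
    ultimately show ?thesis using M(3) site_sat_iff[OF vs(1)] by simp
  qed
  note L = this
  show ?thesis
  proof (rule exI[of _ vs], rule exI[of _ "terms vs"], rule exI[of _ c], rule exI[of _ d], intro conjI)
    show "\<forall>l. 1 \<le> l \<and> l \<le> 9 \<longrightarrow> terms vs l \<noteq> []" using terms_nonempty[OF vs(1)] by blast
    show "\<forall>l \<tau> mk v. \<tau> \<in> set (terms vs l) \<longrightarrow> \<tau> mk = Some v \<longrightarrow>
       v \<in> set vs \<and> mk \<in> {1, 2, 3, 4} \<and> l \<noteq> 7 \<and> (l = 9 \<longrightarrow> mk = 2)"
      by (intro allI impI terms_marks[OF vs(1)])
    show "\<forall>w. w \<in> L \<longleftrightarrow> site_sat (labels ((length w + c) ^ d) w) (length (line0 ((length w + c) ^ d) w)) (terms vs)"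
      by (intro allI L)
  qed (rule vs(2), rule cd(1))
qed

section \<open>Printing regions\<close>

fun binc :: "bool list \<Rightarrow> bool list" where
  "binc [] = [True]"
| "binc (False # xs) = True # xs"
| "binc (True # xs) = False # binc xs"

lemma nat_bits_0 [simp]: "nat_bits 0 = []"
  by (simp add: nat_bits.simps)

lemma nat_bits_1 [simp]: "nat_bits (Suc 0) = [True]"
  by (simp add: nat_bits.simps)

lemma nat_bits_pos: "0 < n \<Longrightarrow> nat_bits n = odd n # nat_bits (n div 2)"
  by (subst nat_bits.simps) simp

lemma binc_nat_bits: "binc (nat_bits n) = nat_bits (Suc n)"
proof (induction n rule: less_induct)
  case (less n)
  show ?case
  proof (cases "n = 0")
    case False
    show ?thesis
    proof (cases "even n")
      case True
      then have "Suc n div 2 = n div 2" by presburger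
      then show ?thesis using False True by (simp add: nat_bits_pos)
    next
      case odd: False
      then have "Suc n div 2 = Suc (n div 2)" by presburger
      then show ?thesis using False odd less[of "n div 2"] by (simp add: nat_bits_pos)
    qed
  qed simp
qed

lemma length_nat_bits: "length (nat_bits n) \<le> n"
proof (induction n rule: less_induct)
  case (less n)
  show ?case
  proof (cases "n = 0")
    case False
    then show ?thesis using less[of "n div 2"] by (simp add: nat_bits_pos)
  qed simp
qed

lemma bits_simps [simp]:
  "bits [] = []" "bits (b # bs) = (if b then 2 else 1) # bits bs" "bits (xs @ ys) = bits xs @ bits ys"
  "rev (bits xs) = bits (rev xs)" "length (bits xs) = length xs" "bits xs = [] \<longleftrightarrow> xs = []"
  by (simp_all add: bits_def rev_map)

lemma bits_set: "x \<in> set (bits xs) \<Longrightarrow> x = 1 \<or> x = 2" "0 \<notin> set (bits xs)"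
  by (auto simp: bits_def)

text \<open>The least significant bit is on top. Leading ones turn into zeros that wait on
  \<open>t\<close> while the carry passes; the carry ends in the first zero or in a new top
  digit.\<close>

definition incr :: "nat \<Rightarrow> nat \<Rightarrow> com" where
  "incr i t = seqs [While (\<lambda>a. a i = 2) (Basic (\<lambda>a. (\<lambda>_. Nop)(i := Pop, t := Push 1))),
     Cond (\<lambda>a. a i = 0) (push i 2) (Basic (\<lambda>a. (\<lambda>_. Nop)(i := Repl 2))),
     move id t i]"

lemma okc_incr [simp]: "i < k \<Longrightarrow> t < k \<Longrightarrow> 3 \<le> S \<Longrightarrow> okc k S (incr i t)"
  by (auto simp: incr_def)

lemma runs_incr:
  assumes "\<sigma> i = bits (nat_bits n)" "\<sigma> t = []" "i \<noteq> t"
  shows "runs (incr i t) \<sigma> (4 * n + 10) (\<sigma>(i := bits (nat_bits (Suc n))))"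
proof -
  define xs where "xs = nat_bits n"
  define c where "c = length (takeWhile id xs)"
  define ys where "ys = dropWhile id xs"
  have tw: "takeWhile id xs = replicate c True"
    unfolding c_def by (induction xs) auto
  have xs: "xs = replicate c True @ ys" unfolding ys_def using takeWhile_dropWhile_id[of id xs] tw by simp
  have ys: "ys = [] \<or> (\<exists>zs. ys = False # zs)"
    unfolding ys_def by (induction xs) auto
  have "binc (replicate c True @ ys) = replicate c False @ (True # tl ys)"
    using ys by (induction c) auto
  then have inc: "nat_bits (Suc n) = replicate c False @ (True # tl ys)"
    using binc_nat_bits[of n] xs by (simp add: xs_def)
  have cn: "c \<le> n" using length_nat_bits[of n] xs by (simp add: xs_def[symmetric])
  let ?b1 = "Basic (\<lambda>a. (\<lambda>_. Nop)(i := Pop, t := Push 1))"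
  define s where "s = (\<lambda>j. \<sigma>(i := replicate (c - j) 2 @ bits ys, t := replicate j 1))"
  have bits_rep: "bits (replicate c b) = replicate c (if b then 2 else 1)" for c b
    by (simp add: bits_def)
  have s0: "s 0 = \<sigma>" using assms xs by (auto simp: s_def xs_def[symmetric] bits_rep intro!: ext)
  have 1: "runs (While (\<lambda>a. a i = 2) ?b1) (s 0) (c * (1 + 1) + 1) (s c)"
  proof (rule runs_loop)
    show "\<not> peeks (s c) i = 2" using ys assms(3) by (auto simp: s_def)
    fix j assume j: "j < c"
    then obtain d where d: "c - j = Suc d" "c - Suc j = d" by (metis Suc_diff_Suc)
    show "peeks (s j) i = 2" using d assms(3) by (simp add: s_def)
    show "runs ?b1 (s j) 1 (s (Suc j))"
      by (rule runs_eq[OF runs_Basic]) (use d assms(3) in \<open>auto simp: s_def intro!: ext\<close>)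
  qed
  let ?s2 = "\<sigma>(i := bits (True # tl ys), t := replicate c 1)"
  have 2: "runs (Cond (\<lambda>a. a i = 0) (push i 2) (Basic (\<lambda>a. (\<lambda>_. Nop)(i := Repl 2)))) (s c) (1 + 1) ?s2"
  proof (rule runs_Cond)
    show "runs (if peeks (s c) i = 0 then push i 2 else Basic (\<lambda>a. (\<lambda>_. Nop)(i := Repl 2))) (s c) 1 ?s2"
    proof (cases "ys = []")
      case True
      have "runs (push i 2) (s c) 1 ?s2"
        by (rule runs_eq[OF runs_push]) (use True assms(3) in \<open>auto simp: s_def intro!: ext\<close>)
      then show ?thesis using True assms(3) by (simp add: s_def)
    next
      case False
      then obtain zs where z: "ys = False # zs" using ys by blast
      have "runs (Basic (\<lambda>a. (\<lambda>_. Nop)(i := Repl 2))) (s c) 1 ?s2"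
        by (rule runs_eq[OF runs_Basic]) (use z assms(3) in \<open>auto simp: s_def intro!: ext\<close>)
      then show ?thesis using z assms(3) by (simp add: s_def)
    qed
  qed
  have 3: "runs (move id t i) ?s2 (2 * c + 1) (\<sigma>(i := bits (nat_bits (Suc n))))"
  proof (rule runs_eq[OF runs_move])
    show "?s2(t := [], i := rev (map id (?s2 t)) @ ?s2 i) = \<sigma>(i := bits (nat_bits (Suc n)))"
      using assms(2,3) inc by (auto simp: bits_rep intro!: ext)
  qed (use assms(3) in auto)
  have "runs (incr i t) \<sigma> (c * (1 + 1) + 1 + (1 + 1 + (2 * c + 1 + 1 + 1) + 1) + 1) (\<sigma>(i := bits (nat_bits (Suc n))))"
    unfolding incr_def
    using runs_seqs_Cons[OF 1 runs_seqs_Cons[OF 2 runs_seqs_Cons[OF 3 runs_seqs_Nil]]] unfolding s0 .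
  then show ?thesis by (rule runs_mono) (use cn in simp)
qed

text \<open>The coordinate counters live on stacks 10 and 11, the output on stack 14.\<close>

definition prints :: "nat \<Rightarrow> nat \<Rightarrow> com \<Rightarrow> bool list \<Rightarrow> nat \<Rightarrow> bool" where
  "prints J I c xs t \<longleftrightarrow> (\<forall>\<sigma>. \<sigma> 10 = bits (nat_bits J) \<and> \<sigma> 11 = bits (nat_bits I) \<and> \<sigma> 13 = [] \<longrightarrow>
     runs c \<sigma> t (\<sigma>(14 := rev (bits xs) @ \<sigma> 14)))"

lemma printsD:
  "prints J I c xs t \<Longrightarrow> \<sigma> 10 = bits (nat_bits J) \<Longrightarrow> \<sigma> 11 = bits (nat_bits I) \<Longrightarrow> \<sigma> 13 = [] \<Longrightarrow>
    runs c \<sigma> t (\<sigma>(14 := rev (bits xs) @ \<sigma> 14))"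
  unfolding prints_def by blast

lemma prints_mono: "prints J I c xs t \<Longrightarrow> t \<le> t' \<Longrightarrow> prints J I c xs t'"
  unfolding prints_def using runs_mono by blast

lemma prints_Seq:
  assumes "prints J I c xs t" "prints J I d ys t'"
  shows "prints J I (Seq c d) (xs @ ys) (t + t' + 1)"
  unfolding prints_def
proof (intro allI impI)
  fix \<sigma> :: stacks assume s: "\<sigma> 10 = bits (nat_bits J) \<and> \<sigma> 11 = bits (nat_bits I) \<and> \<sigma> 13 = []"
  let ?s = "\<sigma>(14 := rev (bits xs) @ \<sigma> 14)"
  have 1: "runs c \<sigma> t ?s" using printsD[OF assms(1)] s by blast
  have "runs d ?s t' (?s(14 := rev (bits ys) @ ?s 14))" using printsD[OF assms(2), of ?s] s by simp
  from runs_Seq[OF 1 this] show "runs (Seq c d) \<sigma> (t + t' + 1) (\<sigma>(14 := rev (bits (xs @ ys)) @ \<sigma> 14))"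
    by simp
qed

lemma prints_Nil: "prints J I (seqs []) [] 1"
  unfolding prints_def
proof (intro allI impI)
  fix \<sigma> :: stacks
  have "\<sigma>(14 := rev (bits []) @ \<sigma> 14) = \<sigma>" by simp
  then show "runs (seqs []) \<sigma> 1 (\<sigma>(14 := rev (bits []) @ \<sigma> 14))" using runs_seqs_Nil by metis
qed

lemma prints_seqs:
  "(\<And>x. x \<in> set L \<Longrightarrow> prints J I (f x) (g x) t) \<Longrightarrow>
    prints J I (seqs (map f L)) (concat (map g L)) (length L * (t + 1) + 1)"
proof (induction L)
  case (Cons x L)
  have "prints J I (Seq (f x) (seqs (map f L))) (g x @ concat (map g L)) (t + (length L * (t + 1) + 1) + 1)"
    using Cons by (intro prints_Seq) auto
  then show ?case by (auto elim: prints_mono)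
qed (use prints_Nil in simp)

definition printc :: "bool list \<Rightarrow> com" where
  "printc bs = seqs (map (\<lambda>b. push 14 (if b then 2 else 1)) bs)"

lemma prints_printc: "prints J I (printc bs) bs (length bs * 2 + 1)"
proof -
  have "prints J I (push 14 (if b then 2 else 1)) [b] 1" for b
    unfolding prints_def using runs_push[of "if b then 2 else 1" 14] by simp
  from prints_seqs[of bs J I "\<lambda>b. push 14 (if b then 2 else 1)" "\<lambda>b. [b]" 1, OF this] show ?thesis
    unfolding printc_def by (simp add: mult_2_right)
qed

text \<open>Each digit is printed behind a \<open>True\<close>, and the stack is restored. The
  closing \<open>False\<close> is left out, and so is the sign: both are printed around it, together
  with the constant low bits.\<close>

definition printn :: "nat \<Rightarrow> com" where
  "printn i = Seq (While (\<lambda>a. a i \<noteq> 0) (Seq (push 14 2) (Basic (\<lambda>a. (\<lambda>_. Nop)(i := Pop, 13 := Push (a i), 14 := Push (a i))))))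
     (move id 13 i)"

abbreviation doubled :: "bool list \<Rightarrow> bool list" where
  "doubled bs \<equiv> concat (map (\<lambda>b. [True, b]) bs)"

lemma runs_printn:
  assumes "\<sigma> i = bits xs" "\<sigma> 13 = []" "i \<noteq> 13" "i \<noteq> 14"
  shows "runs (printn i) \<sigma> (6 * length xs + 3) (\<sigma>(14 := rev (bits (doubled xs)) @ \<sigma> 14))"
proof -
  let ?b = "Basic (\<lambda>a. (\<lambda>_. Nop)(i := Pop, 13 := Push (a i), 14 := Push (a i)))"
  define s where "s = (\<lambda>j. \<sigma>(i := bits (drop j xs), 13 := rev (bits (take j xs)), 14 := rev (bits (doubled (take j xs))) @ \<sigma> 14))"
  have s0: "s 0 = \<sigma>" using assms by (auto simp: s_def intro!: ext)
  have 1: "runs (While (\<lambda>a. a i \<noteq> 0) (Seq (push 14 2) ?b)) (s 0) (length xs * (3 + 1) + 1) (s (length xs))"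
  proof (rule runs_loop)
    show "\<not> peeks (s (length xs)) i \<noteq> 0" using assms by (simp add: s_def)
    fix j assume j: "j < length xs"
    have d: "drop j xs = xs ! j # drop (Suc j) xs" using Cons_nth_drop_Suc[OF j] by simp
    have t: "take (Suc j) xs = take j xs @ [xs ! j]" using take_Suc_conv_app_nth[OF j] .
    show "peeks (s j) i \<noteq> 0" using assms d by (simp add: s_def)
    let ?s1 = "(s j)(14 := 2 # s j 14)"
    have "runs (push 14 2) (s j) 1 ?s1" by (rule runs_push) simp
    moreover have "runs ?b ?s1 1 (s (Suc j))"
      by (rule runs_eq[OF runs_Basic]) (use d t assms in \<open>auto simp: s_def intro!: ext\<close>)
    ultimately have "runs (Seq (push 14 2) ?b) (s j) (1 + 1 + 1) (s (Suc j))" by (rule runs_Seq)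
    then show "runs (Seq (push 14 2) ?b) (s j) 3 (s (Suc j))" by (rule runs_mono) simp
  qed
  have 2: "runs (move id 13 i) (s (length xs)) (2 * length xs + 1) (\<sigma>(14 := rev (bits (doubled xs)) @ \<sigma> 14))"
  proof (rule runs_eq[OF runs_move])
    show "(s (length xs))(13 := [], i := rev (map id (s (length xs) 13)) @ s (length xs) i) =
        \<sigma>(14 := rev (bits (doubled xs)) @ \<sigma> 14)"
      using assms by (auto simp: s_def intro!: ext)
  qed (use assms bits_set(2) in \<open>auto simp: s_def dest!: bits_set(1)\<close>)
  have "runs (printn i) \<sigma> (length xs * (3 + 1) + 1 + (2 * length xs + 1) + 1) (\<sigma>(14 := rev (bits (doubled xs)) @ \<sigma> 14))"
    unfolding printn_def using 1 2 unfolding s0 by (rule runs_Seq)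
  then show ?thesis by (rule runs_mono) simp
qed

lemma prints_printn:
  "prints J I (printn 10) (doubled (nat_bits J)) (6 * J + 3)"
  "prints J I (printn 11) (doubled (nat_bits I)) (6 * I + 3)"
  unfolding prints_def
  by (intro allI impI; rule runs_mono[OF runs_printn]; simp add: length_nat_bits)+

lemma okc_printc [simp]: "14 < k \<Longrightarrow> 3 \<le> S \<Longrightarrow> okc k S (printc bs)"
  by (auto simp: printc_def)

lemma okc_printn [simp]: "14 < k \<Longrightarrow> i < k \<Longrightarrow> 3 \<le> S \<Longrightarrow> okc k S (printn i)"
  by (auto simp: printn_def)

definition offsets :: "sym \<Rightarrow> (nat \<times> nat \<times> int) list" where
  "offsets s = filter (\<lambda>(a, b, z). shape s (int a) (int b) z)
     (List.product [0..<4] (List.product [0..<8] [-3, -2, -1, 0, 1, 2, 3]))"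

definition place :: "nat \<Rightarrow> nat \<Rightarrow> sym \<Rightarrow> cube list" where
  "place I J s = map (\<lambda>(a, b, z). (4 * int J + int a, 8 * int I + int b, z)) (offsets s)"

text \<open>In the two horizontal coordinates the sign and the low two or three bits are constants
  known at compile time; only the block numbers are copied from the counters. The third coordinate
  is a constant altogether.\<close>

definition print_cube :: "nat \<times> nat \<times> int \<Rightarrow> com" where
  "print_cube = (\<lambda>(a, b, z). Seq (printc [True, False, True, odd a, True, odd (a div 2)]) (Seq (printn 10)
     (Seq (printc ([False] @ [True, False, True, odd b, True, odd (b div 2), True, odd (b div 4)])) (Seq (printn 11)
       (printc ([False] @ delimited (int_bits z)))))))"

definition emit :: "sym \<Rightarrow> com" where
  "emit s = seqs (map print_cube (offsets s))"

lemma okc_emit [simp]: "14 < k \<Longrightarrow> 3 \<le> S \<Longrightarrow> okc k S (emit s)"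
  by (auto simp: emit_def print_cube_def split: prod.splits)

text \<open>The offset in a block of size 4 or 8 occupies exactly the lowest two or three bits. A
  block number 0 would turn some of these into leading zeros, which the encoding omits; hence blocks
  are numbered from 1.\<close>

lemma nat_bits_shift:
  assumes "0 < J"
  shows "a < 4 \<Longrightarrow> nat_bits (4 * J + a) = [odd a, odd (a div 2)] @ nat_bits J"
    "b < 8 \<Longrightarrow> nat_bits (8 * J + b) = [odd b, odd (b div 2), odd (b div 4)] @ nat_bits J"
proof -
  assume a: "a < 4"
  have "(4 * J + a) div 2 = 2 * J + a div 2" "(2 * J + a div 2) div 2 = J" using a by presburger+
  then show "nat_bits (4 * J + a) = [odd a, odd (a div 2)] @ nat_bits J"
    using assms by (simp add: nat_bits_pos)
next
  assume b: "b < 8"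
  have "(8 * J + b) div 2 = 4 * J + b div 2" "(4 * J + b div 2) div 2 = 2 * J + b div 4" "(2 * J + b div 4) div 2 = J"
    using b by presburger+
  then show "nat_bits (8 * J + b) = [odd b, odd (b div 2), odd (b div 4)] @ nat_bits J"
    using assms by (simp add: nat_bits_pos)
qed

lemma prints_cube:
  assumes "0 < J" "0 < I" "a < 4" "b < 8" "-3 \<le> z" "z \<le> 3"
  shows "prints J I (print_cube (a, b, z)) (cube_code (4 * int J + int a, 8 * int I + int b, z)) (6 * (J + I) + 80)"
proof -
  have n: "nat (4 * int J + int a) = 4 * J + a" "nat (8 * int I + int b) = 8 * I + b" by auto
  have e: "cube_code (4 * int J + int a, 8 * int I + int b, z) =
    [True, False, True, odd a, True, odd (a div 2)] @ doubled (nat_bits J) @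
    ([False] @ [True, False, True, odd b, True, odd (b div 2), True, odd (b div 4)]) @ doubled (nat_bits I) @
    ([False] @ delimited (int_bits z))"
    using nat_bits_shift(1)[OF assms(1,3)] nat_bits_shift(2)[OF assms(2,4)]
    by (simp add: cube_code_def delimited_def int_bits_def n)
  have "length (nat_bits (nat \<bar>z\<bar>)) \<le> 3" using length_nat_bits[of "nat \<bar>z\<bar>"] assms(5,6) by linarith
  then have "length (delimited (int_bits z)) \<le> 9"
    by (simp add: delimited_def int_bits_def length_concat comp_def sum_list_triv)
  then have l: "length ([False] @ delimited (int_bits z)) * 2 + 1 \<le> 21" by simp
  show ?thesis unfolding e print_cube_def prod.case
    by (rule prints_mono[OF prints_Seq[OF prints_printc prints_Seq[OF prints_printn(1)
      prints_Seq[OF prints_printc prints_Seq[OF prints_printn(2) prints_mono[OF prints_printc l]]]]]]) simp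
qed

lemma offsets_bounds: "(a, b, z) \<in> set (offsets s) \<Longrightarrow> a < 4 \<and> b < 8 \<and> -3 \<le> z \<and> z \<le> 3"
  by (auto simp: offsets_def)

lemma length_offsets: "length (offsets s) \<le> 224"
  unfolding offsets_def by (rule order_trans[OF length_filter_le]) simp

lemma prints_emit:
  assumes "0 < J" "0 < I"
  shows "prints J I (emit s) (concat (map cube_code (place I J s))) (224 * (6 * (J + I) + 81) + 1)"
proof -
  have p: "prints J I (seqs (map print_cube (offsets s)))
     (concat (map (\<lambda>(a, b, z). cube_code (4 * int J + int a, 8 * int I + int b, z)) (offsets s)))
     (length (offsets s) * (6 * (J + I) + 80 + 1) + 1)"
    using prints_cube[OF assms] offsets_bounds by (intro prints_seqs) auto
  have e: "map cube_code (place I J s) =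
      map (\<lambda>(a, b, z). cube_code (4 * int J + int a, 8 * int I + int b, z)) (offsets s)"
    by (auto simp: place_def)
  have l: "length (offsets s) * (6 * (J + I) + 80 + 1) + 1 \<le> 224 * (6 * (J + I) + 81) + 1"
  proof -
    have "6 * (J + I) + 80 + 1 = 6 * (J + I) + (81::nat)" by simp
    then show ?thesis using mult_le_mono1[OF length_offsets[of s], of "6 * (J + I) + 81"] by (simp only: add_le_cancel_right)
  qed
  show ?thesis unfolding emit_def e by (rule prints_mono[OF p l])
qed

section \<open>From tableaux to regions\<close>

text \<open>The inverse of \<open>spos\<close>: the mark under which the cell \<open>p\<close>
  refers to \<open>p'\<close>, and 0 if \<open>p'\<close> is outside its window.\<close>

definition mark :: "nat \<Rightarrow> nat \<Rightarrow> nat \<Rightarrow> nat" where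
  "mark W p p' = (if p' = p then 2 else if Suc p' = p then 1 else if p' = Suc p then 3 else if p' = p + W then 4 else 0)"

text \<open>The crossing of a row and a column: the term demands this value (1), demands another
  value in the same cell (2), or does not mention the cell (0).\<close>

definition ktype :: "(nat \<Rightarrow> 'v option) \<Rightarrow> nat \<Rightarrow> 'v \<Rightarrow> nat" where
  "ktype \<tau> mk v = (case \<tau> mk of None \<Rightarrow> 0 | Some v' \<Rightarrow> if v = v' then 1 else 2)"

definition grp_rows :: "nat \<Rightarrow> 'a list \<Rightarrow> (nat \<times> 'a \<times> bool \<times> bool) list" where
  "grp_rows p xs = map (\<lambda>i. (p, xs ! i, i = 0, Suc i = length xs)) [0..<length xs]"

definition all_rows :: "(nat \<Rightarrow> 'a list) \<Rightarrow> nat \<Rightarrow> (nat \<times> 'a \<times> bool \<times> bool) list" where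
  "all_rows F N = concat (map (\<lambda>p. grp_rows p (F p)) [0..<N])"

lemma all_rows_Suc: "all_rows F (Suc N) = all_rows F N @ grp_rows N (F N)"
  by (simp add: all_rows_def)

lemma grp_rows_nth: "i < length xs \<Longrightarrow> grp_rows p xs ! i = (p, xs ! i, i = 0, Suc i = length xs)"
  by (simp add: grp_rows_def)

lemma length_grp_rows [simp]: "length (grp_rows p xs) = length xs"
  by (simp add: grp_rows_def)

text \<open>Matches the flags attached to the rows of one cell with \<open>fr\<close> and
  \<open>la\<close>, which compare the groups of neighbouring rows.\<close>

lemma all_rows_props:
  assumes "\<And>p. p < N \<Longrightarrow> F p \<noteq> []" "r < length (all_rows F N)"
  defines "RL \<equiv> all_rows F N"
  shows "fst (RL ! r) < N" "fst (snd (RL ! r)) \<in> set (F (fst (RL ! r)))"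
    "fst (snd (snd (RL ! r))) \<longleftrightarrow> r = 0 \<or> fst (RL ! (r - 1)) \<noteq> fst (RL ! r)"
    "snd (snd (snd (RL ! r))) \<longleftrightarrow> Suc r = length RL \<or> fst (RL ! Suc r) \<noteq> fst (RL ! r)"
    "r' \<le> r \<Longrightarrow> fst (RL ! r') \<le> fst (RL ! r)"
proof -
  have "fst (RL ! r) < N \<and> fst (snd (RL ! r)) \<in> set (F (fst (RL ! r))) \<and>
    (fst (snd (snd (RL ! r))) \<longleftrightarrow> r = 0 \<or> fst (RL ! (r - 1)) \<noteq> fst (RL ! r)) \<and>
    (snd (snd (snd (RL ! r))) \<longleftrightarrow> Suc r = length RL \<or> fst (RL ! Suc r) \<noteq> fst (RL ! r)) \<and>
    (\<forall>r'\<le>r. fst (RL ! r') \<le> fst (RL ! r))"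
    unfolding RL_def using assms(1,2)
  proof (induction N arbitrary: r)
    case 0
    then show ?case by (simp add: all_rows_def)
  next
    case (Suc N)
    let ?O = "all_rows F N" and ?n = "F N"
    have n: "?n \<noteq> []" using Suc.prems by simp
    have IH: "fst (?O ! r) < N \<and> fst (snd (?O ! r)) \<in> set (F (fst (?O ! r))) \<and>
      (fst (snd (snd (?O ! r))) \<longleftrightarrow> r = 0 \<or> fst (?O ! (r - 1)) \<noteq> fst (?O ! r)) \<and>
      (snd (snd (snd (?O ! r))) \<longleftrightarrow> Suc r = length ?O \<or> fst (?O ! Suc r) \<noteq> fst (?O ! r)) \<and>
      (\<forall>r'\<le>r. fst (?O ! r') \<le> fst (?O ! r))" if "r < length ?O" for r
      using Suc.IH[of r] Suc.prems(1) that by simp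
    show ?case
    proof (cases "r < length ?O")
      case True
      note I = IH[OF True]
      have o: "all_rows F (Suc N) ! r = ?O ! r" "all_rows F (Suc N) ! (r - 1) = ?O ! (r - 1)"
        using True by (simp_all add: all_rows_Suc nth_append less_imp_diff_less)
      have o': "all_rows F (Suc N) ! r' = ?O ! r'" if "r' \<le> r" for r'
        using True that by (simp add: all_rows_Suc nth_append)
      have "snd (snd (snd (?O ! r))) \<longleftrightarrow>
          Suc r = length (all_rows F (Suc N)) \<or> fst (all_rows F (Suc N) ! Suc r) \<noteq> fst (?O ! r)"
      proof (cases "Suc r < length ?O")
        case True
        then show ?thesis using I by (simp add: all_rows_Suc nth_append)
      next
        case False
        then have e: "Suc r = length ?O" using True by simp
        then have "all_rows F (Suc N) ! Suc r = grp_rows N ?n ! 0" by (simp add: all_rows_Suc nth_append)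
        then have "fst (all_rows F (Suc N) ! Suc r) = N" using n by (simp add: grp_rows_nth)
        then show ?thesis using I e by auto
      qed
      then show ?thesis using I unfolding o using o' by auto
    next
      case False
      define i where "i = r - length ?O"
      have r: "r = length ?O + i" and i: "i < length ?n"
        using False Suc.prems(2) by (simp_all add: i_def all_rows_Suc)
      have nw: "all_rows F (Suc N) ! (length ?O + j) = (N, ?n ! j, j = 0, Suc j = length ?n)" if "j < length ?n" for j
        using that by (simp add: all_rows_Suc nth_append grp_rows_nth)
      note c = nw[OF i, folded r]
      have f: "i = 0 \<longleftrightarrow> r = 0 \<or> fst (all_rows F (Suc N) ! (r - 1)) \<noteq> N"
      proof (cases "i = 0")
        case True
        show ?thesis
        proof (cases "r = 0")
          case nz: False
          then have lt: "r - 1 < length ?O" using r True by simp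
          then have "all_rows F (Suc N) ! (r - 1) = ?O ! (r - 1)" by (simp add: all_rows_Suc nth_append)
          then show ?thesis using IH[OF lt] True by simp
        qed (use True in simp)
      next
        case nz: False
        then have "r - 1 = length ?O + (i - 1)" using r by simp
        then show ?thesis using nw[of "i - 1"] i nz r by simp
      qed
      have l: "Suc i = length ?n \<longleftrightarrow> Suc r = length (all_rows F (Suc N)) \<or> fst (all_rows F (Suc N) ! Suc r) \<noteq> N"
      proof (cases "Suc i = length ?n")
        case True
        then show ?thesis using r by (simp add: all_rows_Suc)
      next
        case nl: False
        then show ?thesis using nw[of "Suc i"] i r by (simp add: all_rows_Suc)
      qed
      have m: "fst (all_rows F (Suc N) ! r') \<le> N" if "r' \<le> r" for r'
      proof (cases "r' < length ?O")
        case True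
        then show ?thesis using IH[OF True] by (simp add: all_rows_Suc nth_append)
      next
        case F: False
        then show ?thesis using nw[of "r' - length ?O"] that r i by simp
      qed
      show ?thesis using i f l m unfolding c by simp
    qed
  qed
  then show "fst (RL ! r) < N" "fst (snd (RL ! r)) \<in> set (F (fst (RL ! r)))"
    "fst (snd (snd (RL ! r))) \<longleftrightarrow> r = 0 \<or> fst (RL ! (r - 1)) \<noteq> fst (RL ! r)"
    "snd (snd (snd (RL ! r))) \<longleftrightarrow> Suc r = length RL \<or> fst (RL ! Suc r) \<noteq> fst (RL ! r)"
    "r' \<le> r \<Longrightarrow> fst (RL ! r') \<le> fst (RL ! r)" by auto
qed

lemma all_rows_ex:
  assumes "p < N" "\<tau> \<in> set (F p)"
  shows "\<exists>r<length (all_rows F N). fst (all_rows F N ! r) = p \<and> fst (snd (all_rows F N ! r)) = \<tau>"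
proof -
  obtain i where i: "i < length (F p)" "F p ! i = \<tau>" using assms(2) by (metis in_set_conv_nth)
  have "(p, \<tau>, i = 0, Suc i = length (F p)) \<in> set (grp_rows p (F p))"
    using i by (force simp: grp_rows_def)
  then have "(p, \<tau>, i = 0, Suc i = length (F p)) \<in> set (all_rows F N)"
    using assms(1) by (auto simp: all_rows_def)
  then show ?thesis by (metis fst_conv snd_conv in_set_conv_nth)
qed

lemma shape_range: "shape s a b z \<Longrightarrow> z \<in> {-3, -2, -1, 0, 1, 2, 3}"
  by (cases s) (auto dest: colp_range)

lemma set_place:
  "(x, y, z) \<in> set (place I J s) \<longleftrightarrow> x div 4 = int J \<and> y div 8 = int I \<and> shape s (x mod 4) (y mod 8) z"
proof
  assume "(x, y, z) \<in> set (place I J s)"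
  then obtain a b where ab: "x = 4 * int J + int a" "y = 8 * int I + int b" "(a, b, z) \<in> set (offsets s)"
    by (auto simp: place_def)
  have "a < 4" "b < 8" "shape s (int a) (int b) z" using ab(3) by (auto simp: offsets_def)
  then show "x div 4 = int J \<and> y div 8 = int I \<and> shape s (x mod 4) (y mod 8) z" unfolding ab by simp
next
  assume *: "x div 4 = int J \<and> y div 8 = int I \<and> shape s (x mod 4) (y mod 8) z"
  have x: "x = 4 * int J + int (nat (x mod 4))" "y = 8 * int I + int (nat (y mod 8))"
    using * by (metis mult_div_mod_eq nat_0_le pos_mod_sign zero_less_numeral)+
  have "nat (x mod 4) < 4" "nat (y mod 8) < 8" by (simp_all add: nat_less_iff)
  moreover have "shape s (int (nat (x mod 4))) (int (nat (y mod 8))) z" using * by simp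
  ultimately have "(nat (x mod 4), nat (y mod 8), z) \<in> set (offsets s)"
    using shape_range[of s] by (auto simp: offsets_def)
  then have "(\<lambda>(a, b, z). (4 * int J + int a, 8 * int I + int b, z)) (nat (x mod 4), nat (y mod 8), z) \<in> set (place I J s)"
    unfolding place_def set_map by (rule imageI)
  then show "(x, y, z) \<in> set (place I J s)" using x by simp
qed

definition cap_cubes :: "nat \<Rightarrow> nat \<Rightarrow> sym \<Rightarrow> cube list" where
  "cap_cubes m I s = concat (map (\<lambda>j. place I (j + 2) s) [0..<m])"

definition row_cubes :: "nat \<Rightarrow> (nat \<Rightarrow> nat) \<Rightarrow> bool \<Rightarrow> bool \<Rightarrow> nat \<Rightarrow> cube list" where
  "row_cubes m kf f l I = place I 1 (LeftP f l) @ concat (map (\<lambda>j. place I (j + 2) (Cell (kf j))) [0..<m]) @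
     place I (m + 2) (RightP f l)"

text \<open>The columns are ordered by cell, and within a cell by value, so quotient and remainder
  by the number of values recover the pair.\<close>

definition kfun :: "nat \<Rightarrow> 'v list \<Rightarrow> nat \<Rightarrow> (nat \<Rightarrow> 'v option) \<Rightarrow> nat \<Rightarrow> nat" where
  "kfun W vs p \<tau> j = ktype \<tau> (mark W p (j div length vs)) (vs ! (j mod length vs))"

definition picture :: "nat \<Rightarrow> nat \<Rightarrow> 'v list \<Rightarrow> (nat \<times> (nat \<Rightarrow> 'v option) \<times> bool \<times> bool) list \<Rightarrow> cube list" where
  "picture W m vs RL = cap_cubes m 1 Cap0 @
     concat (map (\<lambda>r. case RL ! r of (p, \<tau>, f, l) \<Rightarrow> row_cubes m (kfun W vs p \<tau>) f l (r + 2)) [0..<length RL]) @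
     cap_cubes m (length RL + 2) Cap1"

lemma (in wiring) shape_pic_row:
  assumes "2 \<le> I" "I < R + 2"
  shows "shape (pic I J) a b z \<longleftrightarrow> J = 1 \<and> shape (LeftP (fr I) (la I)) a b z \<or>
    2 \<le> J \<and> J < m + 2 \<and> shape (Cell (k I J)) a b z \<or> J = m + 2 \<and> shape (RightP (fr I) (la I)) a b z"
proof -
  consider "J = 1" | "J = m + 2" | "2 \<le> J" "J < m + 2" | "J \<noteq> 1" "J \<noteq> m + 2" "\<not> (2 \<le> J \<and> J < m + 2)" by blast
  then show ?thesis
  proof cases
    case 1
    then show ?thesis using assms m0 by (simp add: pic_def del: shape.simps)
  next
    case 2
    then show ?thesis using assms m0 by (simp add: pic_def del: shape.simps)
  next
    case 3
    then show ?thesis using assms by (simp add: pic_def del: shape.simps)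
  next
    case 4
    then have "pic I J = Blank" using assms by (auto simp: pic_def)
    then show ?thesis using 4 by auto
  qed
qed

lemma (in wiring) shape_pic_cap:
  assumes "\<not> (2 \<le> I \<and> I < R + 2)"
  shows "shape (pic I J) a b z \<longleftrightarrow> I = 1 \<and> 2 \<le> J \<and> J < m + 2 \<and> shape Cap0 a b z \<or>
    I = R + 2 \<and> 2 \<le> J \<and> J < m + 2 \<and> shape Cap1 a b z"
  using assms R1 by (cases "I = 1"; cases "I = R + 2"; cases "2 \<le> J \<and> J < m + 2") (auto simp: pic_def)

lemma ex_block:
  "(\<exists>j<m. J = int (j + 2) \<and> Q j) \<longleftrightarrow> 2 \<le> J \<and> J < int m + 2 \<and> Q (nat (J - 2))"
  by (auto intro!: exI[of _ "nat (J - 2)"])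

text \<open>The groups of rows are the cells, so one satisfied row per group means one satisfied
  term per cell. A satisfied term switches on the column of the value that it demands and switches
  off all columns of other values in that cell, so the value can be read off the columns.\<close>

theorem picture_tileable_iff:
  fixes ls :: "nat list" and Ts :: "nat \<Rightarrow> (nat \<Rightarrow> 'v option) list" and vs :: "'v list"
  defines "N \<equiv> length ls" and "RL \<equiv> all_rows (\<lambda>p. Ts (ls ! p)) (length ls)"
  assumes dist: "distinct vs" and N1: "0 < N" and ne: "\<And>p. p < N \<Longrightarrow> Ts (ls ! p) \<noteq> []"
    and mk: "\<And>p \<tau> mk v. p < N \<Longrightarrow> \<tau> \<in> set (Ts (ls ! p)) \<Longrightarrow> \<tau> mk = Some v \<Longrightarrow>
      v \<in> set vs \<and> spos W p mk < N \<and> mark W p (spos W p mk) = mk"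
    and mk0: "\<And>p p'. mark W p p' \<noteq> 0 \<Longrightarrow> p' = spos W p (mark W p p')"
    and \<tau>0: "\<And>p \<tau>. p < N \<Longrightarrow> \<tau> \<in> set (Ts (ls ! p)) \<Longrightarrow> \<tau> 0 = None"
  shows "admits_tiling (set (picture W (N * length vs) vs RL)) slab \<longleftrightarrow> site_sat ls W Ts"
proof -
  let ?nv = "length vs" and ?R = "length RL"
  obtain mm where mm: "mm = N * ?nv" by blast
  have P: "r < ?R \<Longrightarrow> fst (RL ! r) < N" "r < ?R \<Longrightarrow> fst (snd (RL ! r)) \<in> set (Ts (ls ! fst (RL ! r)))"
    "r < ?R \<Longrightarrow> fst (snd (snd (RL ! r))) \<longleftrightarrow> r = 0 \<or> fst (RL ! (r - 1)) \<noteq> fst (RL ! r)"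
    "r < ?R \<Longrightarrow> snd (snd (snd (RL ! r))) \<longleftrightarrow> Suc r = ?R \<or> fst (RL ! Suc r) \<noteq> fst (RL ! r)"
    "r < ?R \<Longrightarrow> r' \<le> r \<Longrightarrow> fst (RL ! r') \<le> fst (RL ! r)" for r r'
    using all_rows_props[of N "\<lambda>p. Ts (ls ! p)" r] ne unfolding RL_def N_def by blast+
  have ex: "\<exists>r<?R. fst (RL ! r) = p \<and> fst (snd (RL ! r)) = \<tau>" if "p < N" "\<tau> \<in> set (Ts (ls ! p))" for p \<tau>
    using all_rows_ex[of p N \<tau> "\<lambda>p. Ts (ls ! p)"] that unfolding RL_def N_def by blast
  have R1: "1 \<le> ?R" using ex[OF N1] ne[OF N1] by (metis list.set_intros(1) neq_Nil_conv One_nat_def Suc_leI neq0_conv not_less0)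
  define ri where "ri = (\<lambda>I::int. RL ! nat (I - 2))"
  define k where "k = (\<lambda>I J. kfun W vs (fst (ri I)) (fst (snd (ri I))) (nat (J - 2)))"
  define gr where "gr = (\<lambda>I. int (fst (ri I)))"
  interpret wiring "int ?R" "int mm" k gr
  proof
    show "1 \<le> int ?R" using R1 by simp
    show "0 \<le> int mm" by simp
    fix I I' :: int assume "2 \<le> I" "I \<le> I'" "I' < int ?R + 2"
    then show "gr I \<le> gr I'" using P(5)[of "nat (I' - 2)" "nat (I - 2)"] by (simp add: gr_def ri_def)
  qed
  have flags: "fr (int r + 2) = fst (snd (snd (RL ! r)))" "la (int r + 2) = snd (snd (snd (RL ! r)))" if "r < ?R" for r
  proof -
    have "nat (int r + 2 - 1 - 2) = r - 1" "nat (int r + 2 + 1 - 2) = Suc r" by auto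
    then show "fr (int r + 2) = fst (snd (snd (RL ! r)))" "la (int r + 2) = snd (snd (snd (RL ! r)))"
      unfolding fr_def la_def unfolding gr_def ri_def using P(3,4)[OF that] by auto
  qed
  have reg: "set (picture W mm vs RL) = region"
  proof (rule set_eqI)
    fix c :: cube
    obtain x y z where c: "c = (x, y, z)" by (metis prod_cases3)
    let ?I = "y div 8" and ?J = "x div 4"
    have cap: "c \<in> set (cap_cubes mm I s) \<longleftrightarrow> ?I = int I \<and> 2 \<le> ?J \<and> ?J < int mm + 2 \<and>
        shape s (x mod 4) (y mod 8) z" for I s
    proof -
      have "c \<in> set (cap_cubes mm I s) \<longleftrightarrow>
          (\<exists>j<mm. ?J = int (j + 2) \<and> ?I = int I \<and> shape s (x mod 4) (y mod 8) z)"
        unfolding c cap_cubes_def by (auto simp: set_place simp del: shape.simps)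
      then show ?thesis unfolding ex_block by blast
    qed
    have row: "c \<in> set (row_cubes mm kf f l I) \<longleftrightarrow> ?I = int I \<and>
       (?J = 1 \<and> shape (LeftP f l) (x mod 4) (y mod 8) z \<or>
        2 \<le> ?J \<and> ?J < int mm + 2 \<and> shape (Cell (kf (nat (?J - 2)))) (x mod 4) (y mod 8) z \<or>
        ?J = int mm + 2 \<and> shape (RightP f l) (x mod 4) (y mod 8) z)" for kf f l I
    proof -
      have "c \<in> set (row_cubes mm kf f l I) \<longleftrightarrow>
          c \<in> set (place I 1 (LeftP f l)) \<or>
          (\<exists>j<mm. c \<in> set (place I (j + 2) (Cell (kf j)))) \<or> c \<in> set (place I (mm + 2) (RightP f l))"
        unfolding row_cubes_def by auto
      also have "\<dots> \<longleftrightarrow> (?J = int 1 \<and> ?I = int I \<and> shape (LeftP f l) (x mod 4) (y mod 8) z) \<or>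
          (\<exists>j<mm. ?J = int (j + 2) \<and> ?I = int I \<and> shape (Cell (kf j)) (x mod 4) (y mod 8) z) \<or>
          (?J = int (mm + 2) \<and> ?I = int I \<and> shape (RightP f l) (x mod 4) (y mod 8) z)"
        unfolding c set_place ..
      finally have e: "c \<in> set (row_cubes mm kf f l I) \<longleftrightarrow> \<dots>" .
      have i: "int 1 = 1" "int (mm + 2) = int mm + 2" by simp_all
      show ?thesis unfolding e ex_block i by blast
    qed
    have "c \<in> set (picture W mm vs RL) \<longleftrightarrow> c \<in> set (cap_cubes mm 1 Cap0) \<or>
      (\<exists>r<?R. c \<in> set (row_cubes mm (kfun W vs (fst (RL ! r)) (fst (snd (RL ! r))))
          (fst (snd (snd (RL ! r)))) (snd (snd (snd (RL ! r)))) (r + 2))) \<or>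
      c \<in> set (cap_cubes mm (?R + 2) Cap1)"
      unfolding picture_def by (auto simp: case_prod_beta simp del: split_paired_Ex)
    also have "\<dots> \<longleftrightarrow> shape (pic ?I ?J) (x mod 4) (y mod 8) z"
    proof (cases "2 \<le> ?I \<and> ?I < int ?R + 2")
      case True
      define r where "r = nat (?I - 2)"
      have r: "r < ?R" "?I = int r + 2" using True by (auto simp: r_def)
      have ri: "ri ?I = RL ! r" by (simp add: ri_def r_def)
      have ncap: "\<not> c \<in> set (cap_cubes mm 1 Cap0)" "\<not> c \<in> set (cap_cubes mm (?R + 2) Cap1)"
        unfolding cap using True by auto
      have uniq: "?I = int (r' + 2) \<longleftrightarrow> r' = r" for r' using r(2) by auto
      have kIJ: "k ?I ?J = kfun W vs (fst (RL ! r)) (fst (snd (RL ! r))) (nat (?J - 2))"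
        unfolding k_def ri ..
      have one: "(\<exists>r'<?R. r' = r \<and> Q r') \<longleftrightarrow> Q r" for Q using r(1) by blast
      have "(\<exists>r<?R. c \<in> set (row_cubes mm (kfun W vs (fst (RL ! r)) (fst (snd (RL ! r))))
          (fst (snd (snd (RL ! r)))) (snd (snd (snd (RL ! r)))) (r + 2))) \<longleftrightarrow> shape (pic ?I ?J) (x mod 4) (y mod 8) z"
        unfolding row uniq one shape_pic_row[OF conjunct1[OF True] conjunct2[OF True]] kIJ
        unfolding flags[OF r(1), folded r(2)] ..
      then show ?thesis using ncap by blast
    next
      case False
      have nr: "\<not> (\<exists>r<?R. c \<in> set (row_cubes mm (kfun W vs (fst (RL ! r)) (fst (snd (RL ! r))))
          (fst (snd (snd (RL ! r)))) (snd (snd (snd (RL ! r)))) (r + 2)))"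
      proof
        assume "\<exists>r<?R. c \<in> set (row_cubes mm (kfun W vs (fst (RL ! r)) (fst (snd (RL ! r))))
          (fst (snd (snd (RL ! r)))) (snd (snd (snd (RL ! r)))) (r + 2))"
        then obtain r where "r < ?R" "?I = int (r + 2)" unfolding row by blast
        then show False using False by simp
      qed
      have i: "int 1 = 1" "int (?R + 2) = int ?R + 2" by simp_all
      show ?thesis unfolding cap shape_pic_cap[OF False] i using nr by blast
    qed
    finally show "c \<in> set (picture W mm vs RL) \<longleftrightarrow> c \<in> region" unfolding c mem_region .
  qed
  have "solvable \<longleftrightarrow> site_sat ls W Ts"
  proof
    assume solvable
    then obtain u where u: "\<And>I. 2 \<le> I \<Longrightarrow> I < int ?R + 2 \<Longrightarrow> \<exists>I'. 2 \<le> I' \<and> I' < int ?R + 2 \<and> gr I' = gr I \<and>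
     (\<forall>J. 2 \<le> J \<and> J < int mm + 2 \<longrightarrow> (k I' J = 1 \<longrightarrow> u J) \<and> (k I' J = 2 \<longrightarrow> \<not> u J))"
      unfolding solvable_def by blast
    define uu where "uu = (\<lambda>p' i. u (int (p' * ?nv + i) + 2))"
    \<comment> \<open>For a cell mentioned by a satisfied term exactly one value qualifies;
      elsewhere the choice is arbitrary.\<close>
    define X where "X = (\<lambda>p'. SOME v. \<exists>i<?nv. v = vs ! i \<and> uu p' i)"
    show "site_sat ls W Ts"
      unfolding site_sat_def
    proof (intro exI[of _ X] allI impI)
      fix p assume "p < length ls"
      then have p: "p < N" by (simp add: N_def)
      obtain r0 where r0: "r0 < ?R" "fst (RL ! r0) = p" using ex[OF p] ne[OF p] by (metis list.set_intros(1) neq_Nil_conv)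
      obtain I' where I': "2 \<le> I'" "I' < int ?R + 2" "gr I' = gr (int r0 + 2)"
        "\<And>J. 2 \<le> J \<Longrightarrow> J < int mm + 2 \<Longrightarrow> (k I' J = 1 \<longrightarrow> u J) \<and> (k I' J = 2 \<longrightarrow> \<not> u J)"
        using u[of "int r0 + 2"] r0 by auto
      define r where "r = nat (I' - 2)"
      have r: "r < ?R" using I' by (auto simp: r_def)
      have rp: "fst (RL ! r) = p" using I'(3) r0 by (simp add: gr_def ri_def r_def)
      let ?\<tau> = "fst (snd (RL ! r))"
      have \<tau>: "?\<tau> \<in> set (Ts (ls ! p))" using P(2)[OF r] rp by simp
      have kk: "(ktype ?\<tau> (mark W p p') (vs ! i) = 1 \<longrightarrow> uu p' i) \<and> (ktype ?\<tau> (mark W p p') (vs ! i) = 2 \<longrightarrow> \<not> uu p' i)"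
        if "p' < N" "i < ?nv" for p' i
      proof -
        have "p' * ?nv + i < Suc p' * ?nv" using that by simp
        also have "\<dots> \<le> mm" unfolding mm using that(1) by (intro mult_le_mono1) simp
        finally have lt: "p' * ?nv + i < mm" .
        have "(p' * ?nv + i) div ?nv = p'" "(p' * ?nv + i) mod ?nv = i" using that(2) by (auto intro: div_nat_eqI)
        then have "k I' (int (p' * ?nv + i) + 2) = ktype ?\<tau> (mark W p p') (vs ! i)"
          using rp by (simp add: k_def ri_def r_def kfun_def del: of_nat_add of_nat_mult)
        then show ?thesis using I'(4)[of "int (p' * ?nv + i) + 2"] lt by (simp add: uu_def del: of_nat_add of_nat_mult)
      qed
      show "\<exists>\<tau>\<in>set (Ts (ls ! p)). \<forall>mk v. \<tau> mk = Some v \<longrightarrow> X (spos W p mk) = v"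
      proof (intro bexI[OF _ \<tau>] allI impI)
        fix mk v assume m: "?\<tau> mk = Some v"
        note M = mk[OF p \<tau> m]
        let ?p' = "spos W p mk"
        have kt: "ktype ?\<tau> (mark W p ?p') v' = (if v' = v then 1 else 2)" for v' using M m by (simp add: ktype_def)
        obtain i where i: "i < ?nv" "vs ! i = v" using M by (metis in_set_conv_nth)
        have "uu ?p' i" using kk[of ?p' i] M i kt[of v] by simp
        moreover have "\<not> uu ?p' j" if "j < ?nv" "vs ! j \<noteq> v" for j using kk[of ?p' j] M that kt[of "vs ! j"] by simp
        ultimately have "(\<exists>i<?nv. v' = vs ! i \<and> uu ?p' i) \<longleftrightarrow> v' = v" for v' using i by metis
        then show "X ?p' = v" by (simp add: X_def)
      qed
    qed
  next
    assume "site_sat ls W Ts"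
    then obtain X where X: "\<And>p. p < N \<Longrightarrow> \<exists>\<tau>\<in>set (Ts (ls ! p)). \<forall>mk v. \<tau> mk = Some v \<longrightarrow> X (spos W p mk) = v"
      unfolding site_sat_def N_def by blast
    show solvable
      unfolding solvable_def
    proof (intro exI[of _ "\<lambda>J. X (nat (J - 2) div ?nv) = vs ! (nat (J - 2) mod ?nv)"] allI impI)
      fix I assume I: "2 \<le> I \<and> I < int ?R + 2"
      define r where "r = nat (I - 2)"
      have r: "r < ?R" using I by (auto simp: r_def)
      let ?p = "fst (RL ! r)"
      have p: "?p < N" using P(1)[OF r] .
      obtain \<tau> where \<tau>: "\<tau> \<in> set (Ts (ls ! ?p))" "\<And>mk v. \<tau> mk = Some v \<Longrightarrow> X (spos W ?p mk) = v" using X[OF p] by blast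
      obtain r' where r': "r' < ?R" "fst (RL ! r') = ?p" "fst (snd (RL ! r')) = \<tau>" using ex[OF p \<tau>(1)] by blast
      let ?I = "int r' + 2"
      have "(k ?I J = 1 \<longrightarrow> X (nat (J - 2) div ?nv) = vs ! (nat (J - 2) mod ?nv)) \<and>
          (k ?I J = 2 \<longrightarrow> X (nat (J - 2) div ?nv) \<noteq> vs ! (nat (J - 2) mod ?nv))" for J
      proof -
        let ?p' = "nat (J - 2) div ?nv" and ?v = "vs ! (nat (J - 2) mod ?nv)"
        have e: "k ?I J = ktype \<tau> (mark W ?p ?p') ?v" by (simp add: k_def ri_def r' kfun_def)
        show ?thesis
        proof (cases "\<tau> (mark W ?p ?p')")
          case None
          then show ?thesis unfolding e by (simp add: ktype_def)
        next
          case (Some v)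
          then have "mark W ?p ?p' \<noteq> 0" using \<tau>0[OF p \<tau>(1)] by (metis option.distinct(1))
          then have "?p' = spos W ?p (mark W ?p ?p')" by (rule mk0)
          then have "X ?p' = v" using \<tau>(2)[OF Some] by simp
          then show ?thesis unfolding e using Some by (auto simp: ktype_def)
        qed
      qed
      moreover have "gr ?I = gr I" using r'(2) by (simp add: gr_def ri_def r_def)
      ultimately show "\<exists>I'. 2 \<le> I' \<and> I' < int ?R + 2 \<and> gr I' = gr I \<and>
         (\<forall>J. 2 \<le> J \<and> J < int mm + 2 \<longrightarrow>
          (k I' J = 1 \<longrightarrow> X (nat (J - 2) div ?nv) = vs ! (nat (J - 2) mod ?nv)) \<and>
          (k I' J = 2 \<longrightarrow> X (nat (J - 2) div ?nv) \<noteq> vs ! (nat (J - 2) mod ?nv)))"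
        using r'(1) by (intro exI[of _ ?I]) simp
    qed
  qed
  then show ?thesis unfolding mm[symmetric] reg admits_tiling_iff_solvable .
qed

section \<open>The reduction program\<close>

text \<open>Fixes the stacks that change while cubes are printed: the two block coordinates and the
  output. Of the others, 5 holds the remaining labels, 6 the number of cells in unary, 7 the marks
  seen from the current cell, 8 and 9 working copies of these for one row; 12 and 13 are
  scratch.\<close>

definition st :: "stacks \<Rightarrow> nat \<Rightarrow> nat \<Rightarrow> bool list \<Rightarrow> stacks" where
  "st \<sigma> J I xs = \<sigma>(10 := bits (nat_bits J), 11 := bits (nat_bits I), 14 := rev (bits xs))"

lemma st_simps [simp]:
  "st \<sigma> J I xs 10 = bits (nat_bits J)" "st \<sigma> J I xs 11 = bits (nat_bits I)" "st \<sigma> J I xs 14 = rev (bits xs)"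
  "i \<noteq> 10 \<Longrightarrow> i \<noteq> 11 \<Longrightarrow> i \<noteq> 14 \<Longrightarrow> st \<sigma> J I xs i = \<sigma> i"
  by (simp_all add: st_def)

lemma st_upd: "i \<noteq> 10 \<Longrightarrow> i \<noteq> 11 \<Longrightarrow> i \<noteq> 14 \<Longrightarrow> (st \<sigma> J I xs)(i := ys) = st (\<sigma>(i := ys)) J I xs"
  by (auto simp: st_def intro!: ext)

lemma runs_prints:
  assumes "prints J I c ys t" "\<sigma> 13 = []"
  shows "runs c (st \<sigma> J I xs) t (st \<sigma> J I (xs @ ys))"
proof -
  have "runs c (st \<sigma> J I xs) t ((st \<sigma> J I xs)(14 := rev (bits ys) @ st \<sigma> J I xs 14))"
    by (rule printsD[OF assms(1)]) (use assms in simp_all)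
  moreover have "(st \<sigma> J I xs)(14 := rev (bits ys) @ st \<sigma> J I xs 14) = st \<sigma> J I (xs @ ys)"
    by (auto simp: st_def intro!: ext)
  ultimately show ?thesis by simp
qed

lemma runs_incrX:
  assumes "\<sigma> 13 = []" shows "runs (incr 10 13) (st \<sigma> J I xs) (4 * J + 10) (st \<sigma> (Suc J) I xs)"
  by (rule runs_eq[OF runs_incr[of _ 10 J 13]]) (use assms in \<open>auto simp: st_def intro!: ext\<close>)

lemma runs_incrY:
  assumes "\<sigma> 13 = []" shows "runs (incr 11 13) (st \<sigma> J I xs) (4 * I + 10) (st \<sigma> J (Suc I) xs)"
  by (rule runs_eq[OF runs_incr[of _ 11 I 13]]) (use assms in \<open>auto simp: st_def intro!: ext\<close>)

definition setx :: com where "setx = Seq (clear 10) (push 10 2)"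

lemma runs_setx: "runs setx (st \<sigma> J I xs) (2 * J + 3) (st \<sigma> 1 I xs)"
proof -
  let ?s = "(st \<sigma> J I xs)(10 := [])"
  have 1: "runs (clear 10) (st \<sigma> J I xs) (2 * length (st \<sigma> J I xs 10) + 1) ?s"
    by (rule runs_clear) (simp add: bits_set(2))
  have 2: "runs (push 10 2) ?s 1 (?s(10 := 2 # ?s 10))" by (rule runs_push) simp
  show ?thesis unfolding setx_def
    by (rule runs_eq[OF runs_Seq[OF 1 2]]) (use length_nat_bits[of J] in \<open>auto simp: st_def intro!: ext\<close>)
qed

definition codes :: "cube list \<Rightarrow> bool list" where
  "codes cs = concat (map cube_code cs)"

lemma codes_append [simp]: "codes (xs @ ys) = codes xs @ codes ys" "codes [] = []"
  by (simp_all add: codes_def)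

text \<open>All time bounds are explicit functions of one common bound \<open>H\<close> on
  coordinates and list lengths, so that polynomial growth follows from their shape.\<close>

definition tE :: "nat \<Rightarrow> nat" where "tE H = 224 * (12 * H + 81) + 1"

lemma runs_emit:
  assumes "0 < J" "0 < I" "J \<le> H" "I \<le> H" "\<sigma> 13 = []"
  shows "runs (emit s) (st \<sigma> J I xs) (tE H) (st \<sigma> J I (xs @ codes (place I J s)))"
  unfolding codes_def
  by (rule runs_mono[OF runs_prints[where \<sigma> = \<sigma>, OF prints_emit[OF assms(1,2)] assms(5)]]) (use assms in \<open>simp add: tE_def\<close>)

text \<open>A cell command prints the cell that belongs to the mark on stack 8.\<close>

definition cellok :: "('v \<Rightarrow> com) \<Rightarrow> (nat \<Rightarrow> 'v \<Rightarrow> sym) \<Rightarrow> bool" where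
  "cellok cmd cs \<longleftrightarrow> (\<forall>v J I H \<sigma> xs. 0 < J \<and> 0 < I \<and> J \<le> H \<and> I \<le> H \<and> \<sigma> 13 = [] \<longrightarrow>
     runs (cmd v) (st \<sigma> J I xs) (tE H + 2) (st \<sigma> J I (xs @ codes (place I J (cs (peek (\<sigma> 8)) v)))))"

text \<open>The crossing type depends on the mark on top of stack 8 at run time, while the term and
  the value are built into the program.\<close>

definition cell_row :: "(nat \<Rightarrow> 'v option) \<Rightarrow> 'v \<Rightarrow> com" where
  "cell_row \<tau> v = Cond (\<lambda>a. ktype \<tau> (a 8) v = 1) (emit (Cell 1))
     (Cond (\<lambda>a. ktype \<tau> (a 8) v = 2) (emit (Cell 2)) (emit (Cell 0)))"

lemma cellok_row: "cellok (cell_row \<tau>) (\<lambda>\<mu> v. Cell (ktype \<tau> \<mu> v))"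
  unfolding cellok_def
proof (intro allI impI)
  fix v xs and J I H :: nat and \<sigma> :: stacks assume a: "0 < J \<and> 0 < I \<and> J \<le> H \<and> I \<le> H \<and> \<sigma> 13 = []"
  let ?k = "ktype \<tau> (peek (\<sigma> 8)) v"
  have k: "?k = 0 \<or> ?k = 1 \<or> ?k = 2" by (auto simp: ktype_def split: option.splits)
  have e: "runs (emit (Cell n)) (st \<sigma> J I xs) (tE H) (st \<sigma> J I (xs @ codes (place I J (Cell n))))" for n
    using runs_emit a by blast
  have p: "peeks (st \<sigma> J I xs) 8 = peek (\<sigma> 8)" by simp
  have "runs (cell_row \<tau> v) (st \<sigma> J I xs) (tE H + 1 + 1) (st \<sigma> J I (xs @ codes (place I J (Cell ?k))))"
    unfolding cell_row_def
  proof (rule runs_Cond)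
    show "runs (if ktype \<tau> (peeks (st \<sigma> J I xs) 8) v = 1 then emit (Cell 1)
        else Cond (\<lambda>a. ktype \<tau> (a 8) v = 2) (emit (Cell 2)) (emit (Cell 0))) (st \<sigma> J I xs) (tE H + 1)
        (st \<sigma> J I (xs @ codes (place I J (Cell ?k))))"
    proof (cases "?k = 1")
      case True
      then show ?thesis unfolding p using runs_mono[OF e[of 1]] by simp
    next
      case False
      have "runs (Cond (\<lambda>a. ktype \<tau> (a 8) v = 2) (emit (Cell 2)) (emit (Cell 0))) (st \<sigma> J I xs) (tE H + 1)
        (st \<sigma> J I (xs @ codes (place I J (Cell ?k))))"
        by (rule runs_Cond) (use e[of 0] e[of 2] k False p in auto)
      then show ?thesis unfolding p using False by simp
    qed
  qed
  then show "runs (cell_row \<tau> v) (st \<sigma> J I xs) (tE H + 2) (st \<sigma> J I (xs @ codes (place I J (Cell ?k))))"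
    by (rule runs_mono) simp
qed

lemma cellok_emit: "cellok (\<lambda>_. emit s) (\<lambda>_ _. s)"
  unfolding cellok_def
proof (intro allI impI)
  fix v xs and J I H :: nat and \<sigma> :: stacks assume a: "0 < J \<and> 0 < I \<and> J \<le> H \<and> I \<le> H \<and> \<sigma> 13 = []"
  show "runs (emit s) (st \<sigma> J I xs) (tE H + 2) (st \<sigma> J I (xs @ codes (place I J s)))"
    by (rule runs_mono[OF runs_emit[where H = H]]) (use a in simp_all)
qed

definition site_cmd :: "('v \<Rightarrow> com) \<Rightarrow> 'v list \<Rightarrow> com" where
  "site_cmd cmd vs = seqs (map (\<lambda>v. Seq (cmd v) (incr 10 13)) vs)"

definition tS :: "nat \<Rightarrow> nat" where "tS H = H * (tE H + 4 * H + 14) + 1"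

lemma runs_site:
  assumes "cellok cmd cs" "0 < J" "0 < I" "J + length vs \<le> H" "I \<le> H" "\<sigma> 13 = []"
  shows "runs (site_cmd cmd vs) (st \<sigma> J I xs) (tS H)
    (st \<sigma> (J + length vs) I (xs @ codes (concat (map (\<lambda>i. place I (J + i) (cs (peek (\<sigma> 8)) (vs ! i))) [0..<length vs]))))"
proof -
  define s where "s = (\<lambda>n. st \<sigma> (J + n) I (xs @ codes (concat (map (\<lambda>i. place I (J + i) (cs (peek (\<sigma> 8)) (vs ! i))) [0..<n]))))"
  have "runs (site_cmd cmd vs) (s 0) (length (map (\<lambda>v. Seq (cmd v) (incr 10 13)) vs) * (tE H + 2 + (4 * H + 10) + 1 + 1) + 1)
    (s (length (map (\<lambda>v. Seq (cmd v) (incr 10 13)) vs)))"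
    unfolding site_cmd_def
  proof (rule runs_seqs)
    fix n assume "n < length (map (\<lambda>v. Seq (cmd v) (incr 10 13)) vs)"
    then have n: "n < length vs" by simp
    have 1: "runs (cmd (vs ! n)) (s n) (tE H + 2) (st \<sigma> (J + n) I
      ((xs @ codes (concat (map (\<lambda>i. place I (J + i) (cs (peek (\<sigma> 8)) (vs ! i))) [0..<n]))) @
       codes (place I (J + n) (cs (peek (\<sigma> 8)) (vs ! n)))))"
      unfolding s_def using assms n by (intro assms(1)[unfolded cellok_def, rule_format]) auto
    have 2: "runs (incr 10 13) (st \<sigma> (J + n) I
      ((xs @ codes (concat (map (\<lambda>i. place I (J + i) (cs (peek (\<sigma> 8)) (vs ! i))) [0..<n]))) @
       codes (place I (J + n) (cs (peek (\<sigma> 8)) (vs ! n))))) (4 * H + 10) (s (Suc n))"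
      by (rule runs_eq[OF runs_incrX]) (use assms n in \<open>simp_all add: s_def\<close>)
    show "runs (map (\<lambda>v. Seq (cmd v) (incr 10 13)) vs ! n) (s n) (tE H + 2 + (4 * H + 10) + 1) (s (Suc n))"
      using runs_Seq[OF 1 2] n by simp
  qed
  then have r: "runs (site_cmd cmd vs) (st \<sigma> J I xs) (length vs * (tE H + 4 * H + 14) + 1) (s (length vs))"
    by (simp add: s_def algebra_simps)
  have "length vs * (tE H + 4 * H + 14) + 1 \<le> tS H" unfolding tS_def using assms by (simp add: mult_le_mono1)
  from runs_mono[OF r this] show ?thesis by (simp add: s_def)
qed

definition row_loop :: "('v \<Rightarrow> com) \<Rightarrow> 'v list \<Rightarrow> com" where
  "row_loop cmd vs = While (\<lambda>a. a 9 \<noteq> 0) (Seq (site_cmd cmd vs) (Basic (\<lambda>a. (\<lambda>_. Nop)(8 := Pop, 9 := Pop))))"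

lemma concat_blocks:
  "concat (map f [0..<N * n]) = concat (map (\<lambda>p. concat (map (\<lambda>i. f (p * n + i)) [0..<n])) [0..<N])"
proof (induction N)
  case (Suc N)
  have e: "Suc N * n = N * n + n" by simp
  have 1: "[0..<N * n + n] = [0..<N * n] @ [N * n..<N * n + n]" by (rule upt_add_eq_append) simp
  have 2: "[N * n..<N * n + n] = map (\<lambda>i. i + N * n) [0..<n]"
    unfolding map_add_upt by (simp only: add.commute)
  have "concat (map f [0..<Suc N * n]) = concat (map f [0..<N * n]) @ concat (map (\<lambda>i. f (N * n + i)) [0..<n])"
    unfolding e 1 2 by (simp only: map_append concat_append map_map comp_def add.commute)
  then show ?case using Suc by simp
qed simp

definition row_syms :: "(nat \<Rightarrow> 'v \<Rightarrow> sym) \<Rightarrow> nat list \<Rightarrow> 'v list \<Rightarrow> nat \<Rightarrow> nat \<Rightarrow> cube list" where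
  "row_syms cs mks vs N I = concat (map (\<lambda>j. place I (j + 2) (cs (peek (drop (j div length vs) mks)) (vs ! (j mod length vs)))) [0..<N * length vs])"

lemma runs_row_loop:
  assumes "cellok cmd cs" "0 < I" "N * length vs + 2 \<le> H" "I \<le> H" "\<sigma> 13 = []" "\<sigma> 8 = mks" "\<sigma> 9 = replicate N 1"
  shows "runs (row_loop cmd vs) (st \<sigma> 2 I xs) (N * (tS H + 3) + 1)
    (st (\<sigma>(8 := drop N mks, 9 := [])) (N * length vs + 2) I (xs @ codes (row_syms cs mks vs N I)))"
proof -
  let ?n = "length vs"
  define blk where "blk = (\<lambda>p. concat (map (\<lambda>i. place I (2 + p * ?n + i) (cs (peek (drop p mks)) (vs ! i))) [0..<?n]))"
  define s where "s = (\<lambda>p. st (\<sigma>(8 := drop p mks, 9 := replicate (N - p) 1)) (2 + p * ?n) I (xs @ codes (concat (map blk [0..<p]))))"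
  let ?b = "Basic (\<lambda>a. (\<lambda>_. Nop)(8 := Pop, 9 := Pop))"
  have 1: "runs (row_loop cmd vs) (s 0) (N * (tS H + 1 + 1 + 1) + 1) (s N)"
    unfolding row_loop_def
  proof (rule runs_loop)
    show "\<not> peeks (s N) 9 \<noteq> 0" by (simp add: s_def)
    fix p assume p: "p < N"
    then obtain d where d: "N - p = Suc d" "N - Suc p = d" by (metis Suc_diff_Suc)
    show "peeks (s p) 9 \<noteq> 0" using d by (simp add: s_def)
    have "Suc p * ?n \<le> N * ?n" using p by (intro mult_le_mono1) simp
    then have le: "2 + p * ?n + ?n \<le> H" using assms(3) by simp
    have q: "2 + Suc p * ?n = 2 + p * ?n + ?n" by simp
    let ?\<sigma> = "\<sigma>(8 := drop p mks, 9 := replicate (N - p) 1)"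
    have 1: "runs (site_cmd cmd vs) (s p) (tS H) (st ?\<sigma> (2 + p * ?n + ?n) I (xs @ codes (concat (map blk [0..<Suc p]))))"
      unfolding s_def
      by (rule runs_eq[OF runs_site[where \<sigma> = ?\<sigma>, OF assms(1) _ assms(2) le assms(4)]])
        (use assms(5) in \<open>simp_all add: blk_def\<close>)
    have 2: "runs ?b (st ?\<sigma> (2 + p * ?n + ?n) I (xs @ codes (concat (map blk [0..<Suc p])))) 1 (s (Suc p))"
      unfolding s_def q
      by (rule runs_eq[OF runs_Basic]) (use d in \<open>auto simp: st_def drop_Suc tl_drop intro!: ext\<close>)
    show "runs (Seq (site_cmd cmd vs) ?b) (s p) (tS H + 1 + 1) (s (Suc p))" using runs_Seq[OF 1 2] .
  qed
  have "concat (map blk [0..<N]) = row_syms cs mks vs N I"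
  proof -
    have "row_syms cs mks vs N I = concat (map (\<lambda>p. concat (map (\<lambda>i. place I (p * ?n + i + 2)
        (cs (peek (drop ((p * ?n + i) div ?n) mks)) (vs ! ((p * ?n + i) mod ?n)))) [0..<?n])) [0..<N])"
      unfolding row_syms_def by (rule concat_blocks)
    also have "\<dots> = concat (map blk [0..<N])"
      unfolding blk_def
    proof (intro arg_cong[of _ _ concat] map_cong refl)
      fix p i assume "i \<in> set [0..<?n]"
      then have "(p * ?n + i) div ?n = p" "(p * ?n + i) mod ?n = i" by (auto intro: div_nat_eqI)
      then show "place I (p * ?n + i + 2) (cs (peek (drop ((p * ?n + i) div ?n) mks)) (vs ! ((p * ?n + i) mod ?n))) =
          place I (2 + p * ?n + i) (cs (peek (drop p mks)) (vs ! i))" by (simp add: add.commute)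
    qed
    finally show ?thesis by simp
  qed
  then have e: "s N = st (\<sigma>(8 := drop N mks, 9 := [])) (N * ?n + 2) I (xs @ codes (row_syms cs mks vs N I))"
    by (simp add: s_def add.commute)
  have e0: "s 0 = st \<sigma> 2 I xs" using assms(6,7) by (auto simp: s_def st_def numeral_2_eq_2 intro!: ext)
  show ?thesis by (rule runs_mono[OF 1[unfolded e e0]]) (simp add: algebra_simps)
qed

definition cells :: "('v \<Rightarrow> com) \<Rightarrow> 'v list \<Rightarrow> com" where
  "cells cmd vs = seqs [copy id 7 8 12, copy id 6 9 12, row_loop cmd vs, clear 8]"

definition gst :: "nat list \<Rightarrow> nat \<Rightarrow> stacks \<Rightarrow> bool" where
  "gst mks N \<sigma> \<longleftrightarrow> \<sigma> 6 = replicate N 1 \<and> \<sigma> 7 = mks \<and> 0 \<notin> set mks \<and> \<sigma> 8 = [] \<and> \<sigma> 9 = [] \<and> \<sigma> 12 = [] \<and> \<sigma> 13 = []"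

definition tC :: "nat \<Rightarrow> nat" where "tC H = H * (tS H + 3) + 10 * H + 13"

lemma runs_cells:
  assumes "cellok cmd cs" "gst mks N \<sigma>" "0 < I" "I \<le> H" "N * length vs + 2 \<le> H" "length mks \<le> H" "N \<le> H"
  shows "runs (cells cmd vs) (st \<sigma> 2 I xs) (tC H)
    (st \<sigma> (N * length vs + 2) I (xs @ codes (row_syms cs mks vs N I)))"
proof -
  have g: "\<sigma> 6 = replicate N 1" "\<sigma> 7 = mks" "0 \<notin> set mks" "\<sigma> 8 = []" "\<sigma> 9 = []" "\<sigma> 12 = []" "\<sigma> 13 = []"
    using assms(2) by (auto simp: gst_def)
  have nz: "x \<in> set mks \<Longrightarrow> x \<noteq> 0" for x using g(3) by metis
  let ?s0 = "st \<sigma> 2 I xs" and ?s1 = "st (\<sigma>(8 := mks)) 2 I xs" and ?\<sigma> = "\<sigma>(8 := mks, 9 := replicate N 1)"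
  have 1: "runs (copy id 7 8 12) ?s0 (4 * H + 3) ?s1"
    by (rule runs_eq[OF runs_copy]) (use g nz assms(6) in \<open>auto simp: st_upd\<close>)
  have 2: "runs (copy id 6 9 12) ?s1 (4 * H + 3) (st ?\<sigma> 2 I xs)"
    by (rule runs_eq[OF runs_copy]) (use g assms(7) in \<open>auto simp: st_upd\<close>)
  have 3: "runs (row_loop cmd vs) (st ?\<sigma> 2 I xs) (H * (tS H + 3) + 1)
    (st (?\<sigma>(8 := drop N mks, 9 := [])) (N * length vs + 2) I (xs @ codes (row_syms cs mks vs N I)))"
    by (rule runs_mono[OF runs_row_loop[OF assms(1,3,5,4)]]) (use g assms(7) in \<open>auto simp: mult_le_mono1\<close>)
  have 4: "runs (clear 8) (st (?\<sigma>(8 := drop N mks, 9 := [])) (N * length vs + 2) I (xs @ codes (row_syms cs mks vs N I))) (2 * H + 1)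
    (st \<sigma> (N * length vs + 2) I (xs @ codes (row_syms cs mks vs N I)))"
  proof (rule runs_eq[OF runs_clear])
    show "(st (?\<sigma>(8 := drop N mks, 9 := [])) (N * length vs + 2) I (xs @ codes (row_syms cs mks vs N I)))(8 := []) =
        st \<sigma> (N * length vs + 2) I (xs @ codes (row_syms cs mks vs N I))"
      using g(4,5) by (auto simp: st_def intro!: ext)
    show "0 \<notin> set (st (?\<sigma>(8 := drop N mks, 9 := [])) (N * length vs + 2) I (xs @ codes (row_syms cs mks vs N I)) 8)"
      using g(3) by (auto dest: in_set_dropD)
  qed (use assms(6) in simp)
  have "runs (cells cmd vs) ?s0 (4 * H + 3 + (4 * H + 3 + (H * (tS H + 3) + 1 + (2 * H + 1 + 1 + 1) + 1) + 1) + 1)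
    (st \<sigma> (N * length vs + 2) I (xs @ codes (row_syms cs mks vs N I)))"
    unfolding cells_def
    by (rule runs_seqs_Cons[OF 1 runs_seqs_Cons[OF 2 runs_seqs_Cons[OF 3 runs_seqs_Cons[OF 4 runs_seqs_Nil]]]])
  then show ?thesis by (rule runs_mono) (simp add: tC_def)
qed

definition cap_cmd :: "sym \<Rightarrow> 'v list \<Rightarrow> com" where
  "cap_cmd s vs = seqs [setx, incr 10 13, cells (\<lambda>_. emit s) vs]"

definition row_cmd :: "'v list \<Rightarrow> (nat \<Rightarrow> 'v option) \<Rightarrow> bool \<Rightarrow> bool \<Rightarrow> com" where
  "row_cmd vs \<tau> f l = seqs [setx, emit (LeftP f l), incr 10 13, cells (cell_row \<tau>) vs, emit (RightP f l), incr 11 13]"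

definition tR :: "nat \<Rightarrow> nat" where "tR H = tC H + 2 * tE H + 20 * H + 60"

lemma runs_cap:
  fixes vs :: "'v list"
  assumes "gst mks N \<sigma>" "0 < I" "I \<le> H" "N * length vs + 2 \<le> H" "length mks \<le> H" "N \<le> H" "J \<le> H"
  shows "runs (cap_cmd s vs) (st \<sigma> J I xs) (tR H)
    (st \<sigma> (N * length vs + 2) I (xs @ codes (cap_cubes (N * length vs) I s)))"
proof -
  have g: "\<sigma> 13 = []" using assms(1) by (simp add: gst_def)
  have 1: "runs setx (st \<sigma> J I xs) (2 * H + 3) (st \<sigma> 1 I xs)" by (rule runs_mono[OF runs_setx]) (use assms in simp)
  have 2: "runs (incr 10 13) (st \<sigma> 1 I xs) (4 * H + 10) (st \<sigma> 2 I xs)"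
    by (rule runs_eq[OF runs_incrX[where \<sigma> = \<sigma>, OF g]]) (use assms in \<open>simp_all add: numeral_2_eq_2\<close>)
  have "row_syms (\<lambda>_ (_ :: 'v). s) mks vs N I = cap_cubes (N * length vs) I s"
    by (simp add: row_syms_def cap_cubes_def)
  then have 3: "runs (cells (\<lambda>_ :: 'v. emit s) vs) (st \<sigma> 2 I xs) (tC H)
    (st \<sigma> (N * length vs + 2) I (xs @ codes (cap_cubes (N * length vs) I s)))"
    using runs_cells[OF cellok_emit[where s = s] assms(1-6)] by simp
  show ?thesis unfolding cap_cmd_def
    by (rule runs_mono[OF runs_seqs_Cons[OF 1 runs_seqs_Cons[OF 2 runs_seqs_Cons[OF 3 runs_seqs_Nil]]]])
      (simp add: tR_def)
qed

lemma runs_row: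
  assumes "gst mks N \<sigma>" "0 < I" "I < H" "N * length vs + 2 \<le> H" "length mks \<le> H" "N \<le> H" "J \<le> H"
    and kf: "\<And>p' v. p' < N \<Longrightarrow> ktype \<tau> (peek (drop p' mks)) v = ktype \<tau> (mark W p p') v"
  shows "runs (row_cmd vs \<tau> f l) (st \<sigma> J I xs) (tR H)
    (st \<sigma> (N * length vs + 2) (Suc I) (xs @ codes (row_cubes (N * length vs) (kfun W vs p \<tau>) f l I)))"
proof -
  have g: "\<sigma> 13 = []" using assms(1) by (simp add: gst_def)
  let ?m = "N * length vs"
  have 1: "runs setx (st \<sigma> J I xs) (2 * H + 3) (st \<sigma> 1 I xs)" by (rule runs_mono[OF runs_setx]) (use assms in simp)
  let ?x1 = "xs @ codes (place I 1 (LeftP f l))"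
  have 2: "runs (emit (LeftP f l)) (st \<sigma> 1 I xs) (tE H) (st \<sigma> 1 I ?x1)"
    by (rule runs_emit) (use assms g in simp_all)
  have 3: "runs (incr 10 13) (st \<sigma> 1 I ?x1) (4 * H + 10) (st \<sigma> 2 I ?x1)"
    by (rule runs_eq[OF runs_incrX[where \<sigma> = \<sigma>, OF g]]) (use assms in \<open>simp_all add: numeral_2_eq_2\<close>)
  have e: "row_syms (\<lambda>\<mu> v. Cell (ktype \<tau> \<mu> v)) mks vs N I = concat (map (\<lambda>j. place I (j + 2) (Cell (kfun W vs p \<tau> j))) [0..<?m])"
    unfolding row_syms_def kfun_def
  proof (intro arg_cong[of _ _ concat] map_cong refl)
    fix j assume "j \<in> set [0..<?m]"
    then have "j div length vs < N" by (simp add: less_mult_imp_div_less)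
    from kf[OF this] show "place I (j + 2) (Cell (ktype \<tau> (peek (drop (j div length vs) mks)) (vs ! (j mod length vs)))) =
      place I (j + 2) (Cell (ktype \<tau> (mark W p (j div length vs)) (vs ! (j mod length vs))))" by simp
  qed
  let ?x2 = "?x1 @ codes (concat (map (\<lambda>j. place I (j + 2) (Cell (kfun W vs p \<tau> j))) [0..<?m]))"
  have 4: "runs (cells (cell_row \<tau>) vs) (st \<sigma> 2 I ?x1) (tC H) (st \<sigma> (?m + 2) I ?x2)"
    unfolding e[symmetric] by (rule runs_cells[OF cellok_row assms(1,2) less_imp_le[OF assms(3)] assms(4-6)])
  have 5: "runs (emit (RightP f l)) (st \<sigma> (?m + 2) I ?x2) (tE H) (st \<sigma> (?m + 2) I (?x2 @ codes (place I (?m + 2) (RightP f l))))"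
    by (rule runs_emit) (use assms g in simp_all)
  have 6: "runs (incr 11 13) (st \<sigma> (?m + 2) I (?x2 @ codes (place I (?m + 2) (RightP f l)))) (4 * H + 10)
    (st \<sigma> (?m + 2) (Suc I) (xs @ codes (row_cubes ?m (kfun W vs p \<tau>) f l I)))"
    by (rule runs_eq[OF runs_incrY[where \<sigma> = \<sigma>, OF g]]) (use assms in \<open>simp_all add: row_cubes_def\<close>)
  show ?thesis unfolding row_cmd_def
    by (rule runs_mono[OF runs_seqs_Cons[OF 1 runs_seqs_Cons[OF 2 runs_seqs_Cons[OF 3 runs_seqs_Cons[OF 4
      runs_seqs_Cons[OF 5 runs_seqs_Cons[OF 6 runs_seqs_Nil]]]]]]]) (simp add: tR_def)
qed


text \<open>The marks of all cells as seen from cell \<open>p\<close>, with the filler 5 in place of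
  0, which cannot be stored. Going on to the next cell shifts the window by one, which costs a
  single push.\<close>

fun mkl :: "nat \<Rightarrow> nat \<Rightarrow> nat list" where
  "mkl W 0 = [2, 3] @ replicate (W - 2) 5 @ [4]"
| "mkl W (Suc p) = (if p = 0 then 1 else 5) # mkl W p"

lemma length_mkl: "3 \<le> W \<Longrightarrow> length (mkl W p) = W + 1 + p"
  by (induction p) auto

lemma set_mkl: "0 \<notin> set (mkl W p)"
  by (induction p) auto

lemma peek_drop: "peek (drop n xs) = (if n < length xs then xs ! n else 0)"
proof (cases "n < length xs")
  case True
  then show ?thesis using Cons_nth_drop_Suc[OF True, symmetric] by simp
qed simp

text \<open>Outside the window the stack shows 5 or is exhausted and shows 0. Terms that assign
  nothing to 5 and to 0 cannot tell these cases from the mark 0.\<close>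

lemma peek_mkl:
  assumes "3 \<le> W"
  shows "peek (drop p' (mkl W p)) =
    (if mark W p p' \<noteq> 0 then mark W p p' else if p' < length (mkl W p) then 5 else 0)"
proof (induction p arbitrary: p')
  case 0
  have len: "length (mkl W 0) = Suc W" using length_mkl[OF assms, of 0] by simp
  consider "p' = 0" | "p' = 1" | "2 \<le> p'" "p' < W" | "p' = W" | "p' > W" by linarith
  then show ?case
  proof cases
    case 3
    then have "mkl W 0 ! p' = 5" by (auto simp: nth_Cons nth_append split: nat.splits)
    moreover have "mark W 0 p' = 0" using 3 by (simp add: mark_def)
    moreover have "p' < Suc W" using 3 by simp
    ultimately show ?thesis unfolding peek_drop len by (simp only: if_True if_False simp_thms)
  next
    case 4
    define W' where "W' = W - 2"
    have W': "W = Suc (Suc W')" using assms unfolding W'_def by arith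
    have "mkl W 0 ! p' = 4" unfolding 4 W' by (simp add: nth_append)
    moreover have "mark W 0 p' = 4" using 4 assms by (simp add: mark_def)
    moreover have "p' < Suc W" using 4 by simp
    ultimately show ?thesis unfolding peek_drop len by simp
  next
    case 5
    then show ?thesis using assms unfolding peek_drop len by (simp add: mark_def)
  qed (use assms in \<open>simp_all add: mark_def\<close>)
next
  case (Suc p)
  show ?case
  proof (cases p')
    case 0
    then show ?thesis by (simp add: mark_def)
  next
    case (Suc n)
    have "mark W (Suc p) (Suc n) = mark W p n" by (simp add: mark_def)
    then show ?thesis using Suc.IH[of n] Suc by simp
  qed
qed

lemma peek_mkl_0: "peek (mkl W p) = 2 \<longleftrightarrow> p = 0"
  by (cases p) auto

section \<open>Printing the rows of all cells\<close>

definition rows_cmd :: "'v list \<Rightarrow> (nat \<Rightarrow> 'v option) list \<Rightarrow> com" where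
  "rows_cmd vs ts = seqs (map (\<lambda>i. row_cmd vs (ts ! i) (i = 0) (Suc i = length ts)) [0..<length ts])"

definition tG :: "nat \<Rightarrow> nat" where "tG H = H * (tR H + 1) + 1"

definition rc :: "nat \<Rightarrow> nat \<Rightarrow> 'v list \<Rightarrow> nat \<times> (nat \<Rightarrow> 'v option) \<times> bool \<times> bool \<Rightarrow> nat \<Rightarrow> cube list" where
  "rc W m vs x I = (case x of (p, \<tau>, f, l) \<Rightarrow> row_cubes m (kfun W vs p \<tau>) f l I)"

lemma runs_rows:
  fixes vs :: "'v list" and ts :: "(nat \<Rightarrow> 'v option) list"
  assumes "gst (mkl W p) N \<sigma>" "3 \<le> W" "0 < I" "I + length ts \<le> H" "N * length vs + 2 \<le> H" "W + 1 + p \<le> H" "N \<le> H"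
    and ts: "\<And>\<tau>. \<tau> \<in> set ts \<Longrightarrow> \<tau> 0 = None \<and> \<tau> 5 = None"
  shows "runs (rows_cmd vs ts) (st \<sigma> (N * length vs + 2) I xs) (tG H) (st \<sigma> (N * length vs + 2) (I + length ts)
    (xs @ codes (concat (map (\<lambda>i. rc W (N * length vs) vs (grp_rows p ts ! i) (I + i)) [0..<length ts]))))"
proof -
  let ?m = "N * length vs"
  define s where "s = (\<lambda>n. st \<sigma> (?m + 2) (I + n)
    (xs @ codes (concat (map (\<lambda>i. rc W ?m vs (grp_rows p ts ! i) (I + i)) [0..<n]))))"
  let ?cs = "map (\<lambda>i. row_cmd vs (ts ! i) (i = 0) (Suc i = length ts)) [0..<length ts]"
  have "runs (seqs ?cs) (s 0) (length ?cs * (tR H + 1) + 1) (s (length ?cs))"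
  proof (rule runs_seqs)
    fix n assume "n < length ?cs"
    then have n: "n < length ts" by simp
    have t: "ts ! n \<in> set ts" using n by simp
    have "runs (row_cmd vs (ts ! n) (n = 0) (Suc n = length ts)) (s n) (tR H)
      (st \<sigma> (?m + 2) (Suc (I + n)) ((xs @ codes (concat (map (\<lambda>i. rc W ?m vs (grp_rows p ts ! i) (I + i)) [0..<n]))) @
        codes (row_cubes ?m (kfun W vs p (ts ! n)) (n = 0) (Suc n = length ts) (I + n))))"
      unfolding s_def
    proof (rule runs_row[OF assms(1)])
      fix p' v
      show "ktype (ts ! n) (peek (drop p' (mkl W p))) v = ktype (ts ! n) (mark W p p') v"
        unfolding peek_mkl[OF assms(2)] using ts[OF t] by (auto simp: ktype_def)
    qed (use assms n length_mkl[OF assms(2)] in auto)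
    then show "runs (?cs ! n) (s n) (tR H) (s (Suc n))"
      using n by (simp add: s_def rc_def grp_rows_nth)
  qed
  then have r: "runs (rows_cmd vs ts) (s 0) (length ts * (tR H + 1) + 1) (s (length ts))" by (simp add: rows_cmd_def)
  have "length ts * (tR H + 1) + 1 \<le> tG H" unfolding tG_def using assms(4) by (intro add_le_mono mult_le_mono1) auto
  from runs_mono[OF r this] show ?thesis by (simp add: s_def)
qed

definition dispatch :: "(nat \<Rightarrow> com) \<Rightarrow> com" where
  "dispatch cmd = seqs (map (\<lambda>l. Cond (\<lambda>a. a 5 = l) (cmd l) (seqs [])) [1..<10])"

text \<open>All nine labels are tested in turn. The command leaves the top of stack 5 as it was, so
  the later tests fail and nothing is executed twice.\<close>

lemma runs_dispatch:
  assumes "runs (cmd l) s t s'" "peek (s 5) = l" "peek (s' 5) = l" "1 \<le> l" "l \<le> 9" "1 \<le> t"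
  shows "runs (dispatch cmd) s (9 * (t + 2) + 1) s'"
proof -
  define q where "q = (\<lambda>i. if i < l then s else s')"
  let ?cs = "map (\<lambda>l. Cond (\<lambda>a. a 5 = l) (cmd l) (seqs [])) [1..<10]"
  have "runs (seqs ?cs) (q 0) (length ?cs * (t + 1 + 1) + 1) (q (length ?cs))"
  proof (rule runs_seqs)
    fix i assume "i < length ?cs"
    then have i: "?cs ! i = Cond (\<lambda>a. a 5 = Suc i) (cmd (Suc i)) (seqs [])" by (simp del: upt_conv_Cons)
    have p: "peeks (q i) 5 = l" using assms(2,3) by (simp add: q_def)
    show "runs (?cs ! i) (q i) (t + 1) (q (Suc i))"
      unfolding i
    proof (rule runs_Cond)
      show "runs (if peeks (q i) 5 = Suc i then cmd (Suc i) else seqs []) (q i) t (q (Suc i))"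
      proof (cases "l = Suc i")
        case True
        then show ?thesis using assms(1) unfolding p by (simp add: q_def)
      next
        case False
        then have "q (Suc i) = q i" by (auto simp: q_def)
        then show ?thesis using False assms(6) runs_mono[OF runs_seqs_Nil] unfolding p by simp
      qed
    qed
  qed
  moreover have "length ?cs = 9" by simp
  ultimately show ?thesis unfolding dispatch_def using assms(4,5) by (simp add: q_def)
qed

text \<open>The push turns the marks of a cell into those of the next: the top mark is 2 only at the
  very first cell, whose successor sees it as its left neighbour.\<close>

definition main_loop :: "'v list \<Rightarrow> (nat \<Rightarrow> (nat \<Rightarrow> 'v option) list) \<Rightarrow> com" where
  "main_loop vs Ts = While (\<lambda>a. a 5 \<noteq> 0) (Seq (dispatch (\<lambda>l. rows_cmd vs (Ts l)))
     (Basic (\<lambda>a. (\<lambda>_. Nop)(5 := Pop, 7 := Push (if a 7 = 2 then 1 else 5)))))"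

definition rows_out :: "nat \<Rightarrow> nat \<Rightarrow> 'v list \<Rightarrow> (nat \<times> (nat \<Rightarrow> 'v option) \<times> bool \<times> bool) list \<Rightarrow> cube list" where
  "rows_out W m vs RL = concat (map (\<lambda>r. rc W m vs (RL ! r) (r + 2)) [0..<length RL])"

lemma rows_out_append:
  "rows_out W m vs (xs @ ys) = rows_out W m vs xs @
    concat (map (\<lambda>i. rc W m vs (ys ! i) (length xs + 2 + i)) [0..<length ys])"
proof -
  have 1: "[0..<length xs + length ys] = [0..<length xs] @ [length xs..<length xs + length ys]"
    by (rule upt_add_eq_append) simp
  have 2: "[length xs..<length xs + length ys] = map (\<lambda>i. i + length xs) [0..<length ys]"
    unfolding map_add_upt by (simp only: add.commute)
  have "map (\<lambda>r. rc W m vs ((xs @ ys) ! r) (r + 2)) [0..<length xs] = map (\<lambda>r. rc W m vs (xs ! r) (r + 2)) [0..<length xs]"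
    by (simp add: nth_append)
  moreover have "map ((\<lambda>r. rc W m vs ((xs @ ys) ! r) (r + 2)) \<circ> (\<lambda>i. i + length xs)) [0..<length ys] =
      map (\<lambda>i. rc W m vs (ys ! i) (length xs + 2 + i)) [0..<length ys]"
    by (simp add: nth_append add.commute add.left_commute)
  ultimately show ?thesis unfolding rows_out_def length_append 1 2 map_append map_map concat_append by (simp only:)
qed

definition tM :: "nat \<Rightarrow> nat" where "tM H = H * (9 * (tG H + 2) + 4) + 1"

lemma runs_main_loop:
  fixes vs :: "'v list" and Ts :: "nat \<Rightarrow> (nat \<Rightarrow> 'v option) list"
  defines "F \<equiv> \<lambda>ls p. Ts (ls ! p)"
  assumes "gst (mkl W 0) N \<sigma>" "3 \<le> W" "\<sigma> 5 = ls" "length ls = N" "set ls \<subseteq> {1..9}"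
    "length (all_rows (F ls) N) + 2 \<le> H" "N * length vs + 2 \<le> H" "W + 1 + N \<le> H"
    and ts: "\<And>l \<tau>. \<tau> \<in> set (Ts l) \<Longrightarrow> \<tau> 0 = None \<and> \<tau> 5 = None"
  shows "runs (main_loop vs Ts) (st \<sigma> (N * length vs + 2) 2 xs) (tM H)
    (st (\<sigma>(5 := [], 7 := mkl W N)) (N * length vs + 2) (length (all_rows (F ls) N) + 2)
      (xs @ codes (rows_out W (N * length vs) vs (all_rows (F ls) N))))"
proof -
  let ?m = "N * length vs" and ?A = "\<lambda>p. all_rows (F ls) p"
  have lenA: "length (?A p) \<le> length (?A N)" if "p \<le> N" for p
    using that by (induction rule: dec_induct) (auto simp: all_rows_Suc)
  define s where "s = (\<lambda>p. st (\<sigma>(5 := drop p ls, 7 := mkl W p)) (?m + 2) (length (?A p) + 2)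
     (xs @ codes (rows_out W ?m vs (?A p))))"
  let ?b = "Basic (\<lambda>a. (\<lambda>_. Nop)(5 := Pop, 7 := Push (if a 7 = 2 then 1 else 5)))"
  have tG1: "1 \<le> tG H" by (simp add: tG_def)
  have r: "runs (main_loop vs Ts) (s 0) (N * (9 * (tG H + 2) + 1 + 1 + 1 + 1) + 1) (s N)"
    unfolding main_loop_def
  proof (rule runs_loop)
    show "\<not> peeks (s N) 5 \<noteq> 0" using assms(5) by (simp add: s_def)
    fix p assume p: "p < N"
    have d: "drop p ls = ls ! p # drop (Suc p) ls" using p assms(5) by (simp add: Cons_nth_drop_Suc)
    have l: "1 \<le> ls ! p" "ls ! p \<le> 9"
      using assms(6) subsetD[OF assms(6), of "ls ! p"] p assms(5) by auto
    show "peeks (s p) 5 \<noteq> 0" using l d by (simp add: s_def)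
    let ?\<sigma> = "\<sigma>(5 := drop p ls, 7 := mkl W p)"
    let ?s' = "st ?\<sigma> (?m + 2) (length (?A (Suc p)) + 2) (xs @ codes (rows_out W ?m vs (?A (Suc p))))"
    have g: "gst (mkl W p) N ?\<sigma>" using assms(2) set_mkl by (simp add: gst_def)
    have le: "length (?A p) + 2 + length (Ts (ls ! p)) \<le> H"
      using lenA[of "Suc p"] p assms(7) by (simp add: all_rows_Suc F_def)
    have "runs (rows_cmd vs (Ts (ls ! p))) (s p) (tG H) ?s'"
      unfolding s_def
      by (rule runs_eq[OF runs_rows[OF g assms(3) _ le assms(8)]])
        (use assms p ts in \<open>auto simp: all_rows_Suc rows_out_append F_def\<close>)
    then have 1: "runs (dispatch (\<lambda>l. rows_cmd vs (Ts l))) (s p) (9 * (tG H + 2) + 1) ?s'"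
      by (rule runs_dispatch) (use l d tG1 in \<open>auto simp: s_def\<close>)
    have 2: "runs ?b ?s' 1 (s (Suc p))"
      unfolding s_def by (rule runs_eq[OF runs_Basic]) (use d peek_mkl_0[of W p] in \<open>auto simp: st_def intro!: ext\<close>)
    show "runs (Seq (dispatch (\<lambda>l. rows_cmd vs (Ts l))) ?b) (s p) (9 * (tG H + 2) + 1 + 1 + 1) (s (Suc p))"
      by (rule runs_Seq[OF 1 2])
  qed
  have s0: "s 0 = st \<sigma> (?m + 2) 2 xs"
  proof -
    have "\<sigma>(5 := drop 0 ls, 7 := mkl W 0) = \<sigma>" using assms(2,4) by (auto simp: gst_def)
    then show ?thesis by (simp add: s_def all_rows_def rows_out_def numeral_2_eq_2)
  qed
  have sN: "s N = st (\<sigma>(5 := [], 7 := mkl W N)) (?m + 2) (length (?A N) + 2) (xs @ codes (rows_out W ?m vs (?A N)))"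
    using assms(5) by (simp add: s_def)
  have "N * (9 * (tG H + 2) + 1 + 1 + 1 + 1) + 1 \<le> tM H"
  proof -
    have e: "9 * (tG H + 2) + 1 + 1 + 1 + 1 = 9 * (tG H + 2) + 4" by simp
    show ?thesis unfolding e tM_def by (intro add_le_mono1 mult_le_mono1) (use assms(9) in simp)
  qed
  from runs_mono[OF r this] show ?thesis unfolding s0 sN .
qed

definition print_cmd :: "'v list \<Rightarrow> (nat \<Rightarrow> (nat \<Rightarrow> 'v option) list) \<Rightarrow> com" where
  "print_cmd vs Ts = seqs [push 11 2, cap_cmd Cap0 vs, incr 11 13, main_loop vs Ts, cap_cmd Cap1 vs]"

definition tP :: "nat \<Rightarrow> nat" where "tP H = tM H + 2 * tR H + 4 * H + 20"

lemma runs_print: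
  fixes vs :: "'v list" and Ts :: "nat \<Rightarrow> (nat \<Rightarrow> 'v option) list"
  defines "F \<equiv> \<lambda>ls p. Ts (ls ! p)"
  assumes "gst (mkl W 0) N \<sigma>" "3 \<le> W" "\<sigma> 5 = ls" "length ls = N" "set ls \<subseteq> {1..9}"
    "length (all_rows (F ls) N) + 2 \<le> H" "N * length vs + 2 \<le> H" "W + 1 + N \<le> H"
    and ts: "\<And>l \<tau>. \<tau> \<in> set (Ts l) \<Longrightarrow> \<tau> 0 = None \<and> \<tau> 5 = None"
    and "\<sigma> 10 = []" "\<sigma> 11 = []" "\<sigma> 14 = []"
  shows "\<exists>\<sigma>'. runs (print_cmd vs Ts) \<sigma> (tP H) \<sigma>' \<and>
    \<sigma>' 14 = rev (bits (codes (picture W (N * length vs) vs (all_rows (F ls) N))))"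
proof -
  let ?m = "N * length vs" and ?R = "length (all_rows (F ls) N)"
  have g13: "\<sigma> 13 = []" using assms(2) by (simp add: gst_def)
  have s0: "st \<sigma> 0 0 [] = \<sigma>" using assms(11-13) by (auto simp: st_def intro!: ext)
  have 1: "runs (push 11 2) \<sigma> 1 (st \<sigma> 0 1 [])"
    by (rule runs_eq[OF runs_push]) (use assms(11-13) in \<open>auto simp: st_def intro!: ext\<close>)
  let ?x1 = "codes (cap_cubes ?m 1 Cap0)"
  have 2: "runs (cap_cmd Cap0 vs) (st \<sigma> 0 1 []) (tR H) (st \<sigma> (?m + 2) 1 ?x1)"
    using runs_cap[OF assms(2), of 1 H vs 0 Cap0 "[]"] assms length_mkl[OF assms(3), of 0] by simp
  have 3: "runs (incr 11 13) (st \<sigma> (?m + 2) 1 ?x1) (4 * H + 10) (st \<sigma> (?m + 2) 2 ?x1)"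
    by (rule runs_eq[OF runs_incrY[where \<sigma> = \<sigma>, OF g13]]) (use assms in \<open>simp_all add: numeral_2_eq_2\<close>)
  let ?\<sigma> = "\<sigma>(5 := [], 7 := mkl W N)" and ?x2 = "?x1 @ codes (rows_out W ?m vs (all_rows (F ls) N))"
  have 4: "runs (main_loop vs Ts) (st \<sigma> (?m + 2) 2 ?x1) (tM H) (st ?\<sigma> (?m + 2) (?R + 2) ?x2)"
    unfolding F_def by (rule runs_main_loop[OF assms(2-6) assms(7)[unfolded F_def] assms(8,9) ts])
  have g: "gst (mkl W N) N ?\<sigma>" using assms(2) set_mkl by (simp add: gst_def)
  have 5: "runs (cap_cmd Cap1 vs) (st ?\<sigma> (?m + 2) (?R + 2) ?x2) (tR H)
     (st ?\<sigma> (?m + 2) (?R + 2) (?x2 @ codes (cap_cubes ?m (?R + 2) Cap1)))"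
    by (rule runs_cap[OF g]) (use assms length_mkl[OF assms(3), of N] in auto)
  have "runs (print_cmd vs Ts) \<sigma> (tP H) (st ?\<sigma> (?m + 2) (?R + 2) (?x2 @ codes (cap_cubes ?m (?R + 2) Cap1)))"
    unfolding print_cmd_def
    by (rule runs_mono[OF runs_seqs_Cons[OF 1 runs_seqs_Cons[OF 2 runs_seqs_Cons[OF 3 runs_seqs_Cons[OF 4
      runs_seqs_Cons[OF 5 runs_seqs_Nil]]]]]]) (simp add: tP_def)
  moreover have "codes (picture W ?m vs (all_rows (F ls) N)) = ?x2 @ codes (cap_cubes ?m (?R + 2) Cap1)"
    by (simp add: picture_def rows_out_def rc_def)
  ultimately show ?thesis by (intro exI[of _ "st ?\<sigma> (?m + 2) (?R + 2) (?x2 @ codes (cap_cubes ?m (?R + 2) Cap1))"]) simp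
qed

section \<open>The clock in unary and the sequence of labels\<close>

definition pst :: "nat list \<Rightarrow> nat list \<Rightarrow> nat list \<Rightarrow> nat list \<Rightarrow> nat list \<Rightarrow> nat list \<Rightarrow> nat list \<Rightarrow> nat list \<Rightarrow> stacks" where
  "pst a0 a1 a2 a3 a4 a5 a6 a7 =
     (\<lambda>_. [])(0 := a0, 1 := a1, 2 := a2, 3 := a3, 4 := a4, 5 := a5, 6 := a6, 7 := a7)"

text \<open>Unary multiplication: stack 1 is added to an accumulator once for each unit on stack
  2.\<close>

definition times_cmd :: com where
  "times_cmd = Seq (While (\<lambda>a. a 2 \<noteq> 0) (Seq (pop 2) (copy id 1 3 12))) (move id 3 2)"

definition tmul :: "nat \<Rightarrow> nat" where "tmul K = K * (4 * K + 6) + 2 * K + 3"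

lemma runs_times:
  assumes "m \<le> K" "u \<le> K" "m * u \<le> K"
  shows "runs times_cmd (pst a0 (replicate u 1) (replicate m 1) [] a4 a5 a6 a7) (tmul K)
    (pst a0 (replicate u 1) (replicate (m * u) 1) [] a4 a5 a6 a7)"
proof -
  define s where "s = (\<lambda>i. pst a0 (replicate u 1) (replicate (m - i) 1) (replicate (i * u) 1) a4 a5 a6 a7)"
  have 1: "runs (While (\<lambda>a. a 2 \<noteq> 0) (Seq (pop 2) (copy id 1 3 12))) (s 0) (m * (1 + (4 * K + 3) + 1 + 1) + 1) (s m)"
  proof (rule runs_loop)
    show "\<not> peeks (s m) 2 \<noteq> 0" by (simp add: s_def pst_def)
    fix i assume i: "i < m"
    then have d: "m - i = Suc (m - Suc i)" by simp
    show "peeks (s i) 2 \<noteq> 0" using d by (simp add: s_def pst_def)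
    have 1: "runs (pop 2) (s i) 1 (pst a0 (replicate u 1) (replicate (m - Suc i) 1) (replicate (i * u) 1) a4 a5 a6 a7)"
      by (rule runs_eq[OF runs_pop]) (use d in \<open>auto simp: s_def pst_def intro!: ext\<close>)
    have 2: "runs (copy id 1 3 12) (pst a0 (replicate u 1) (replicate (m - Suc i) 1) (replicate (i * u) 1) a4 a5 a6 a7)
       (4 * K + 3) (s (Suc i))"
      by (rule runs_eq[OF runs_copy]) (use assms in \<open>auto simp: s_def pst_def replicate_add intro!: ext\<close>)
    show "runs (Seq (pop 2) (copy id 1 3 12)) (s i) (1 + (4 * K + 3) + 1) (s (Suc i))" by (rule runs_Seq[OF 1 2])
  qed
  have 2: "runs (move id 3 2) (s m) (2 * K + 1) (pst a0 (replicate u 1) (replicate (m * u) 1) [] a4 a5 a6 a7)"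
    by (rule runs_eq[OF runs_move]) (use assms in \<open>auto simp: s_def pst_def intro!: ext\<close>)
  have e: "1 + (4 * K + 3) + 1 + 1 = 4 * K + 6" by simp
  have "m * (4 * K + 6) \<le> K * (4 * K + 6)" using assms(1) by (rule mult_le_mono1)
  then have le: "m * (4 * K + 6) + 1 + (2 * K + 1) + 1 \<le> tmul K" unfolding tmul_def by linarith
  have s0: "s 0 = pst a0 (replicate u 1) (replicate m 1) [] a4 a5 a6 a7" by (simp add: s_def)
  show ?thesis unfolding times_cmd_def
    by (rule runs_mono[OF runs_Seq[OF 1[unfolded e s0] 2] le])
qed

text \<open>Stack 1 starts as the input length in unary and is raised to \<open>n + c\<close>; stack
  2 becomes its power \<open>(n + c) ^ d\<close>. The line is stacked from its right end. When the
  word has been moved, its first symbol is on top, so the flag is a change of the top. The default 1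
  in that step keeps the written symbol inside the alphabet.\<close>

definition line_cmd :: "nat \<Rightarrow> nat \<Rightarrow> com" where
  "line_cmd c d = seqs [seqs (replicate c (push 1 1)), push 2 1, seqs (replicate d times_cmd),
     copy id 2 4 12, copy id 2 4 12, move (\<lambda>x. if x = 1 then 2 else 3) 0 4,
     Basic (\<lambda>a. (\<lambda>_. Nop)(4 := Repl (if a 4 \<le> 3 then a 4 + 3 else 1))),
     copy id 2 4 12, copy id 2 4 12, push 4 7]"

definition tL :: "nat \<Rightarrow> nat \<Rightarrow> nat \<Rightarrow> nat" where
  "tL c d K = 2 * c + d * (tmul K + 1) + 20 * K + 50"

lemma runs_line:
  fixes w c d defines "n \<equiv> length w" defines "B \<equiv> (n + c) ^ d"
  assumes c: "1 \<le> c" and K: "n + c \<le> K" "B \<le> K"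
  shows "runs (line_cmd c d) (start_stacks w (replicate n 1)) (tL c d K)
    (pst [] (replicate (n + c) 1) (replicate B 1) [] (line0 B w) [] [] [])"
proof -
  let ?w = "rev (bits w)" and ?u = "n + c"
  have B1: "1 \<le> B" using c by (simp add: B_def)
  have s0: "start_stacks w (replicate n 1) = pst ?w (replicate n 1) [] [] [] [] [] []"
    by (auto simp: start_stacks_def pst_def intro!: ext)
  have 1: "runs (seqs (replicate c (push 1 1))) (pst ?w (replicate n 1) [] [] [] [] [] []) (2 * c + 1)
     (pst ?w (replicate ?u 1) [] [] [] [] [] [])"
  proof -
    have "runs (seqs (replicate c (push 1 1))) (pst ?w (replicate (n + 0) 1) [] [] [] [] [] [])
       (length (replicate c (push 1 1)) * (1 + 1) + 1) (pst ?w (replicate (n + length (replicate c (push 1 1))) 1) [] [] [] [] [] [])"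
    proof (rule runs_seqs[where s = "\<lambda>i. pst ?w (replicate (n + i) 1) [] [] [] [] [] []"])
      fix i assume "i < length (replicate c (push 1 1))"
      then have e: "replicate c (push 1 1) ! i = push 1 1" by simp
      show "runs (replicate c (push 1 1) ! i) (pst ?w (replicate (n + i) 1) [] [] [] [] [] []) 1
         (pst ?w (replicate (n + Suc i) 1) [] [] [] [] [] [])" unfolding e
        by (rule runs_eq[OF runs_push]) (auto simp: pst_def intro!: ext)
    qed
    then show ?thesis by (simp add: mult_2)
  qed
  have 2: "runs (push 2 1) (pst ?w (replicate ?u 1) [] [] [] [] [] []) 1 (pst ?w (replicate ?u 1) (replicate (?u ^ 0) 1) [] [] [] [] [])"
    by (rule runs_eq[OF runs_push]) (auto simp: pst_def intro!: ext)
  have 3: "runs (seqs (replicate d times_cmd)) (pst ?w (replicate ?u 1) (replicate (?u ^ 0) 1) [] [] [] [] [])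
     (d * (tmul K + 1) + 1) (pst ?w (replicate ?u 1) (replicate B 1) [] [] [] [] [])"
  proof -
    have "runs (seqs (replicate d times_cmd)) (pst ?w (replicate ?u 1) (replicate (?u ^ 0) 1) [] [] [] [] [])
       (length (replicate d times_cmd) * (tmul K + 1) + 1)
       (pst ?w (replicate ?u 1) (replicate (?u ^ length (replicate d times_cmd)) 1) [] [] [] [] [])"
    proof (rule runs_seqs[where s = "\<lambda>i. pst ?w (replicate ?u 1) (replicate (?u ^ i) 1) [] [] [] [] []"])
      fix i assume i: "i < length (replicate d times_cmd)"
      then have e: "replicate d times_cmd ! i = times_cmd" by simp
      have "?u ^ i \<le> B" "?u ^ Suc i \<le> B" unfolding B_def using i c by (intro power_increasing; simp)+
      then have "?u ^ i \<le> K" "?u ^ i * ?u \<le> K" using K by (simp_all add: mult.commute)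
      from runs_times[OF this(1) K(1) this(2)]
      show "runs (replicate d times_cmd ! i) (pst ?w (replicate ?u 1) (replicate (?u ^ i) 1) [] [] [] [] []) (tmul K)
         (pst ?w (replicate ?u 1) (replicate (?u ^ Suc i) 1) [] [] [] [] [])" unfolding e power_Suc2 .
    qed
    then show ?thesis by (simp add: B_def)
  qed
  let ?m = "map (\<lambda>b. if b then 3 else 2 :: nat) w"
  let ?p = "\<lambda>x y. pst x (replicate ?u 1) (replicate B 1) [] y [] [] []"
  let ?R = "replicate B (1 :: nat)"
  have 4: "runs (copy id 2 4 12) (?p x y) (4 * K + 3) (?p x (?R @ y))" for x y
    by (rule runs_eq[OF runs_copy]) (use K in \<open>auto simp: pst_def intro!: ext\<close>)
  have bm: "rev (map (\<lambda>x. if x = Suc 0 then 2 else 3) (bits (rev w))) = ?m" by (simp add: bits_def rev_map)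
  have nn: "n = length w" by (simp add: n_def)
  have 5: "runs (move (\<lambda>x. if x = 1 then 2 else 3) 0 4) (?p ?w (?R @ ?R @ [])) (2 * K + 1) (?p [] (?m @ ?R @ ?R))"
    by (rule runs_eq[OF runs_move]) (use K bits_set(1)[of _ "rev w"] bits_set(2)[of "rev w"] bm in \<open>auto simp: pst_def nn intro!: ext\<close>)
  have R2: "?R @ ?R = replicate (2 * B) 1" by (simp add: replicate_add[symmetric] mult_2)
  have "?m @ ?R @ ?R \<noteq> []" using B1 by simp
  then obtain z zs where z: "?m @ ?R @ ?R = z # zs" by (meson neq_Nil_conv)
  have "z \<in> set (?m @ ?R @ ?R)" unfolding z by simp
  then have z3: "z \<le> 3" by (auto split: if_splits)
  have 6: "runs (Basic (\<lambda>a. (\<lambda>_. Nop)(4 := Repl (if a 4 \<le> 3 then a 4 + 3 else 1)))) (?p [] (?m @ ?R @ ?R)) 1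
     (?p [] (flagged (?m @ ?R @ ?R)))"
    unfolding z by (rule runs_eq[OF runs_Basic]) (use z3 in \<open>auto simp: pst_def intro!: ext\<close>)
  have l0: "7 # ?R @ ?R @ flagged (?m @ ?R @ ?R) = line0 B w" by (simp only: line0_def R2[symmetric] append_assoc)
  have 7: "runs (push 4 7) (?p [] (?R @ ?R @ flagged (?m @ ?R @ ?R))) 1 (?p [] (line0 B w))"
    by (rule runs_eq[OF runs_push]) (auto simp: pst_def l0[symmetric] intro!: ext)
  show ?thesis unfolding s0 line_cmd_def
    by (rule runs_mono[OF runs_seqs_Cons[OF 1 runs_seqs_Cons[OF 2 runs_seqs_Cons[OF 3 runs_seqs_Cons[OF 4
      runs_seqs_Cons[OF 4 runs_seqs_Cons[OF 5 runs_seqs_Cons[OF 6 runs_seqs_Cons[OF 4 runs_seqs_Cons[OF 4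
      runs_seqs_Cons[OF 7 runs_seqs_Nil]]]]]]]]]]]) (simp add: tL_def)
qed

text \<open>The rows are stacked from the last to the first. The fillers of \<open>mkl W 0\<close>
  are obtained by copying a whole row of \<open>W\<close> cells and removing two of them.\<close>

definition label_cmd :: com where
  "label_cmd = seqs [copy (\<lambda>x. if x = 7 then 7 else 9) 4 5 12,
     While (\<lambda>a. a 2 \<noteq> 0) (Seq (pop 2) (copy (\<lambda>x. if x = 7 then 7 else 8) 4 5 12)),
     copy id 4 5 12, copy (\<lambda>_. 1) 5 6 12, push 7 4, copy (\<lambda>_. 5) 4 7 12, pop 7, pop 7, push 7 3, push 7 2]"

definition tB :: "nat \<Rightarrow> nat" where "tB K = K * (4 * K + 6) + 20 * K + 50"

lemma runs_label:
  fixes B w defines "W \<equiv> length (line0 B w)"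
  assumes K: "B \<le> K" "length (labels B w) \<le> K" and W: "3 \<le> W"
  shows "runs label_cmd (pst [] x (replicate B 1) [] (line0 B w) [] [] []) (tB K)
    (pst [] x [] [] (line0 B w) (labels B w) (replicate (length (labels B w)) 1) (mkl W 0))"
proof -
  let ?l = "line0 B w"
  have nz: "0 \<notin> set ?l"
  proof
    assume "0 \<in> set ?l"
    then obtain j where j: "j < length ?l" "?l ! j = 0" by (metis in_set_conv_nth)
    have "j \<noteq> 0" using line0_neq[OF j(1)] j(2) by auto
    then show False using line0_nth[of j B w] j by auto
  qed
  then have nz': "y \<in> set ?l \<Longrightarrow> y \<noteq> 0" for y by metis
  have LK: "length ?l \<le> K" using K(2) by (simp add: labels_def)
  let ?g8 = "\<lambda>x :: nat. if x = 7 then 7 else 8 :: nat" and ?g9 = "\<lambda>x :: nat. if x = 7 then 7 else 9 :: nat"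
  have 1: "runs (copy ?g9 4 5 12) (pst [] x (replicate B 1) [] ?l [] [] []) (4 * K + 3) (pst [] x (replicate B 1) [] ?l (map ?g9 ?l) [] [])"
    by (rule runs_eq[OF runs_copy]) (use nz nz' LK in \<open>auto simp: pst_def intro!: ext\<close>)
  define s where "s = (\<lambda>i. pst [] x (replicate (B - i) 1) [] ?l (concat (replicate i (map ?g8 ?l)) @ map ?g9 ?l) [] [])"
  have 2: "runs (While (\<lambda>a. a 2 \<noteq> 0) (Seq (pop 2) (copy ?g8 4 5 12))) (s 0) (B * (1 + (4 * K + 3) + 1 + 1) + 1) (s B)"
  proof (rule runs_loop)
    show "\<not> peeks (s B) 2 \<noteq> 0" by (simp add: s_def pst_def)
    fix i assume i: "i < B"
    then have d: "B - i = Suc (B - Suc i)" by simp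
    show "peeks (s i) 2 \<noteq> 0" using d by (simp add: s_def pst_def)
    let ?s = "pst [] x (replicate (B - Suc i) 1) [] ?l (concat (replicate i (map ?g8 ?l)) @ map ?g9 ?l) [] []"
    have 1: "runs (pop 2) (s i) 1 ?s"
      by (rule runs_eq[OF runs_pop]) (use d in \<open>auto simp: s_def pst_def intro!: ext\<close>)
    have 2: "runs (copy ?g8 4 5 12) ?s (4 * K + 3) (s (Suc i))"
      by (rule runs_eq[OF runs_copy]) (use nz nz' LK in \<open>auto simp: s_def pst_def intro!: ext\<close>)
    show "runs (Seq (pop 2) (copy ?g8 4 5 12)) (s i) (1 + (4 * K + 3) + 1) (s (Suc i))" by (rule runs_Seq[OF 1 2])
  qed
  have s0: "pst [] x (replicate B 1) [] ?l (map ?g9 ?l) [] [] = s 0" by (simp add: s_def)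
  let ?L = "labels B w"
  have 3: "runs (copy id 4 5 12) (s B) (4 * K + 3) (pst [] x [] [] ?l ?L [] [])"
    by (rule runs_eq[OF runs_copy]) (use nz nz' LK in \<open>auto simp: s_def pst_def labels_def intro!: ext\<close>)
  have nL: "0 \<notin> set ?L" using nz by (auto simp: labels_def)
  let ?U = "replicate (length ?L) (1 :: nat)"
  have 4: "runs (copy (\<lambda>_. 1) 5 6 12) (pst [] x [] [] ?l ?L [] []) (4 * K + 3) (pst [] x [] [] ?l ?L ?U [])"
    by (rule runs_eq[OF runs_copy]) (use nL K(2) in \<open>auto simp: pst_def map_replicate_const intro!: ext\<close>)
  have P: "runs (push 7 y) (pst [] x [] [] ?l ?L ?U ys) 1 (pst [] x [] [] ?l ?L ?U (y # ys))" if "y \<noteq> 0" for y ys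
    by (rule runs_eq[OF runs_push]) (use that in \<open>auto simp: pst_def intro!: ext\<close>)
  have Q: "runs (pop 7) (pst [] x [] [] ?l ?L ?U (y # ys)) 1 (pst [] x [] [] ?l ?L ?U ys)" for y ys
    by (rule runs_eq[OF runs_pop]) (auto simp: pst_def intro!: ext)
  define W' where "W' = W - 2"
  have W': "W = Suc (Suc W')" using W unfolding W'_def by arith
  have 5: "runs (copy (\<lambda>_. 5) 4 7 12) (pst [] x [] [] ?l ?L ?U [4]) (4 * K + 3) (pst [] x [] [] ?l ?L ?U (5 # 5 # replicate W' 5 @ [4]))"
    by (rule runs_eq[OF runs_copy]) (use nz LK W' in \<open>auto simp: pst_def map_replicate_const W_def[symmetric] intro!: ext\<close>)
  have e: "mkl W 0 = 2 # 3 # replicate W' 5 @ [4]" by (simp add: W')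
  have p4: "runs (push 7 4) (pst [] x [] [] ?l ?L ?U []) 1 (pst [] x [] [] ?l ?L ?U [4])" by (rule P) simp
  have p3: "runs (push 7 3) (pst [] x [] [] ?l ?L ?U ys) 1 (pst [] x [] [] ?l ?L ?U (3 # ys))" for ys by (rule P) simp
  have p2: "runs (push 7 2) (pst [] x [] [] ?l ?L ?U ys) 1 (pst [] x [] [] ?l ?L ?U (2 # ys))" for ys by (rule P) simp
  have ee: "1 + (4 * K + 3) + 1 + 1 = 4 * K + 6" by simp
  have "B * (4 * K + 6) \<le> K * (4 * K + 6)" using K(1) by (rule mult_le_mono1)
  then show ?thesis unfolding e label_cmd_def
    by (intro runs_mono[OF runs_seqs_Cons[OF 1[unfolded s0] runs_seqs_Cons[OF 2[unfolded ee] runs_seqs_Cons[OF 3 runs_seqs_Cons[OF 4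
      runs_seqs_Cons[OF p4 runs_seqs_Cons[OF 5 runs_seqs_Cons[OF Q runs_seqs_Cons[OF Q runs_seqs_Cons[OF p3
      runs_seqs_Cons[OF p2 runs_seqs_Nil]]]]]]]]]]]) (unfold tB_def, linarith)
qed

definition reduction_cmd :: "nat \<Rightarrow> nat \<Rightarrow> 'v list \<Rightarrow> (nat \<Rightarrow> (nat \<Rightarrow> 'v option) list) \<Rightarrow> com" where
  "reduction_cmd c d vs Ts = seqs [line_cmd c d, label_cmd, print_cmd vs Ts]"

lemma okc_reduction: "okc 15 10 (reduction_cmd c d vs Ts)"
proof -
  have 1: "okc 15 10 times_cmd" by (simp add: times_cmd_def)
  have 2: "okc 15 10 (line_cmd c d)" using 1 by (simp add: line_cmd_def del: replicate.simps)
  have 3: "okc 15 10 label_cmd" by (simp add: label_cmd_def)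
  have 4: "okc 15 10 setx" by (simp add: setx_def)
  have 5: "okc 15 10 (cell_row \<tau> v)" for \<tau> and v :: 'v by (simp add: cell_row_def)
  have 6: "okc 15 10 (cells cmd vs)" if "\<And>v. okc 15 10 (cmd v)" for cmd
    using that by (simp add: cells_def row_loop_def site_cmd_def)
  have 7: "okc 15 10 (cap_cmd s vs)" for s using 4 6 by (simp add: cap_cmd_def)
  have 8: "okc 15 10 (row_cmd vs \<tau> f l)" for \<tau> f l using 4 6[of "cell_row \<tau>", OF 5] by (simp add: row_cmd_def)
  have 9: "okc 15 10 (rows_cmd vs ts)" for ts using 8 by (simp add: rows_cmd_def)
  have 10: "okc 15 10 (dispatch (\<lambda>l. rows_cmd vs (Ts l)))" using 9 by (simp add: dispatch_def del: upt_conv_Cons)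
  have 11: "okc 15 10 (main_loop vs Ts)" using 10 by (simp add: main_loop_def)
  have 12: "okc 15 10 (print_cmd vs Ts)" using 11 7 by (simp add: print_cmd_def)
  show ?thesis using 2 3 12 by (simp add: reduction_cmd_def)
qed

text \<open>A cell whose term speaks about neighbours has a cell before it and one in the next row,
  so windows never leave the list of cells.\<close>

lemma labels_props:
  fixes B w defines "W \<equiv> length (line0 B w)" and "N \<equiv> length (labels B w)"
  assumes p: "p < N" and W: "2 \<le> W"
  shows "1 \<le> labels B w ! p" "labels B w ! p \<le> 9"
    "labels B w ! p \<noteq> 7 \<Longrightarrow> 1 \<le> p" "labels B w ! p \<noteq> 7 \<Longrightarrow> labels B w ! p \<noteq> 9 \<Longrightarrow> p + W < N"
proof -
  define t j where "t = p div W" and "j = p mod W"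
  have j: "j < W" and pe: "p = t * W + j" using W by (auto simp: t_def j_def)
  have N: "N = (B + 2) * W" by (simp add: N_def W_def length_labels)
  have t: "t < B + 2" using p W unfolding N t_def by (simp add: less_mult_imp_div_less)
  have l: "labels B w ! p = (if j = 0 then 7 else if t = 0 then line0 B w ! j else if t \<le> B then 8 else 9)"
    using labels_nth[of t B j w] t j unfolding pe W_def by simp
  have l0: "j \<noteq> 0 \<Longrightarrow> 1 \<le> line0 B w ! j \<and> line0 B w ! j \<le> 6"
    using line0_nth[of j B w] j unfolding W_def by (auto simp: written_def)
  show "1 \<le> labels B w ! p" "labels B w ! p \<le> 9" using l l0 by auto
  show "1 \<le> p" if "labels B w ! p \<noteq> 7" using that l pe by (cases "j = 0") auto
  show "p + W < N" if "labels B w ! p \<noteq> 7" "labels B w ! p \<noteq> 9"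
  proof -
    have "t \<le> B" using that l by (auto split: if_splits)
    then have "(t + 1) * W + W \<le> N" unfolding N using mult_le_mono1[of "t + 2" "B + 2" W] by simp
    then show ?thesis using j pe by simp
  qed
qed

lemma length_all_rows:
  assumes "\<And>p. p < N \<Longrightarrow> length (F p) \<le> m"
  shows "length (all_rows F N) \<le> N * m"
  using assms by (induction N) (auto simp: all_rows_def grp_rows_def add_mono add.commute)

theorem slab_tiling_NP_hard:
  "NP_hard {w. \<exists>\<Gamma>. finite \<Gamma> \<and> encodes_region w \<Gamma> \<and> admits_tiling \<Gamma> slab}"
  unfolding NP_hard_def
proof
  fix L assume "L \<in> NP"
  from NP_site_sat[OF this] obtain vs :: "site list" and Ts c d where
    V: "distinct vs" "1 \<le> c" and V3: "\<forall>l. 1 \<le> l \<and> l \<le> 9 \<longrightarrow> Ts l \<noteq> []"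
    and T: "\<forall>l \<tau> mk v. \<tau> \<in> set (Ts l) \<longrightarrow> \<tau> mk = Some v \<longrightarrow>
       v \<in> set vs \<and> mk \<in> {1, 2, 3, 4} \<and> l \<noteq> 7 \<and> (l = 9 \<longrightarrow> mk = 2)"
    and L: "\<forall>w. w \<in> L \<longleftrightarrow> site_sat (labels ((length w + c) ^ d) w) (length (line0 ((length w + c) ^ d) w)) Ts"
    by (elim exE conjE) (rule that)
  note T = T[rule_format] and L = L[rule_format]
  \<comment> \<open>Clock, width of a row and number of cells as functions of the input length; they
    do not depend on the word itself.\<close>
  define Bn where "Bn = (\<lambda>n. (n + c) ^ d)"
  define Wn where "Wn = (\<lambda>n. 4 * Bn n + n + 1)"
  define Nn where "Nn = (\<lambda>n. (Bn n + 2) * Wn n)"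
  \<comment> \<open>Bounds the number of terms of any label, hence the number of rows per
    cell.\<close>
  define q where "q = (\<Sum>l\<in>{1..9}. length (Ts l))"
  define Kn where "Kn = (\<lambda>n. n + c + Bn n + Nn n)"
  define Hn where "Hn = (\<lambda>n. Nn n * length vs + Nn n * q + Wn n + Nn n + 5)"
  define ls where "ls = (\<lambda>w. labels (Bn (length w)) w)"
  define RL where "RL = (\<lambda>w. all_rows (\<lambda>p. Ts (ls w ! p)) (Nn (length w)))"
  define pic where "pic = (\<lambda>w. picture (Wn (length w)) (Nn (length w) * length vs) vs (RL w))"
  define tq where "tq = (\<lambda>n. tL c d (Kn n) + (tB (Kn n) + (tP (Hn n) + 1 + 1) + 1) + 1)"
  have lsd: "ls w = labels (Bn (length w)) w" for w by (simp add: ls_def)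
  have W: "length (line0 (Bn (length w)) w) = Wn (length w)" for w by (simp add: length_line0 Wn_def)
  have N: "length (ls w) = Nn (length w)" for w by (simp add: ls_def length_labels W Nn_def)
  have B1: "1 \<le> Bn n" for n using V(2) by (simp add: Bn_def)
  have W3: "3 \<le> Wn n" for n using B1[of n] by (simp add: Wn_def)
  have N1: "0 < Nn n" for n using W3[of n] by (simp add: Nn_def)
  note lp = labels_props[where B = "Bn (length w)" and w = w for w, unfolded W, unfolded lsd[symmetric] N]
  have W2: "2 \<le> Wn n" for n using W3[of n] by simp
  have T05: "\<tau> 0 = None \<and> \<tau> 5 = None" if "\<tau> \<in> set (Ts l)" for l \<tau>
  proof -
    have "\<tau> 0 \<noteq> Some v" "\<tau> 5 \<noteq> Some v" for v using T[OF that, of 0 v] T[OF that, of 5 v] by auto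
    then show ?thesis by (cases "\<tau> 0"; cases "\<tau> 5") auto
  qed
  have tile: "admits_tiling (set (pic w)) slab \<longleftrightarrow> w \<in> L" for w
  proof -
    let ?n = "length w"
    have "admits_tiling (set (picture (Wn ?n) (length (ls w) * length vs) vs (all_rows (\<lambda>p. Ts (ls w ! p)) (length (ls w))))) slab
       \<longleftrightarrow> site_sat (ls w) (Wn ?n) Ts"
    proof (rule picture_tileable_iff[OF V(1)])
      show "0 < length (ls w)" using N N1 by simp
      fix p assume p: "p < length (ls w)"
      note l = lp[OF p[unfolded N] W2]
      show "Ts (ls w ! p) \<noteq> []" using V3 l(1,2) by blast
      fix \<tau> assume t: "\<tau> \<in> set (Ts (ls w ! p))"
      show "\<tau> 0 = None" using T05[OF t] by blast
      fix mk v assume m: "\<tau> mk = Some v"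
      note m = T[OF t m]
      have "1 \<le> p" using m l(3) by blast
      moreover have "mk = 2 \<or> p + Wn ?n < Nn ?n" using m l(4) by blast
      ultimately show "v \<in> set vs \<and> spos (Wn ?n) p mk < length (ls w) \<and> mark (Wn ?n) p (spos (Wn ?n) p mk) = mk"
        using m p W2[of ?n] unfolding N by (auto simp: spos_def mark_def)
    next
      fix p p' assume "mark (Wn ?n) p p' \<noteq> 0"
      then show "p' = spos (Wn ?n) p (mark (Wn ?n) p p')" by (auto simp: mark_def spos_def split: if_splits)
    qed
    moreover have "w \<in> L \<longleftrightarrow> site_sat (ls w) (Wn ?n) Ts"
      using L[of w] unfolding W[unfolded Bn_def] by (simp add: ls_def Bn_def)
    ultimately show ?thesis unfolding pic_def RL_def N by simp
  qed
  have "\<exists>\<sigma>. runs (reduction_cmd c d vs Ts) (start_stacks w (replicate (length w) 1)) (tq (length w)) \<sigma> \<and>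
     \<sigma> 14 = rev (bits (codes (pic w)))" for w
  proof -
    let ?n = "length w"
    have 1: "runs (line_cmd c d) (start_stacks w (replicate ?n 1)) (tL c d (Kn ?n))
      (pst [] (replicate (?n + c) 1) (replicate (Bn ?n) 1) [] (line0 (Bn ?n) w) [] [] [])"
      unfolding Bn_def by (rule runs_line[OF V(2)]) (simp_all add: Kn_def Bn_def)
    let ?s = "pst [] (replicate (?n + c) 1) [] [] (line0 (Bn ?n) w) (ls w) (replicate (Nn ?n) 1) (mkl (Wn ?n) 0)"
    have 2: "runs label_cmd (pst [] (replicate (?n + c) 1) (replicate (Bn ?n) 1) [] (line0 (Bn ?n) w) [] [] []) (tB (Kn ?n)) ?s"
      using runs_label[of "Bn ?n" "Kn ?n" w "replicate (?n + c) 1", unfolded W, unfolded lsd[symmetric] N] W3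
      by (simp add: Kn_def)
    have "\<exists>\<sigma>'. runs (print_cmd vs Ts) ?s (tP (Hn ?n)) \<sigma>' \<and>
       \<sigma>' 14 = rev (bits (codes (picture (Wn ?n) (Nn ?n * length vs) vs (all_rows (\<lambda>p. Ts (ls w ! p)) (Nn ?n)))))"
    proof (rule runs_print)
      show "gst (mkl (Wn ?n) 0) (Nn ?n) ?s" using set_mkl[of "Wn ?n" 0] by (simp add: gst_def pst_def)
      show "set (ls w) \<subseteq> {1..9}"
        using lp(1,2)[of _ w, OF _ W2] N[of w] by (auto simp: in_set_conv_nth)
      have "length (all_rows (\<lambda>p. Ts (ls w ! p)) (Nn ?n)) \<le> Nn ?n * q"
      proof (rule length_all_rows)
        fix p assume p: "p < Nn ?n"
        show "length (Ts (ls w ! p)) \<le> q"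
          unfolding q_def by (rule member_le_sum) (use lp(1,2)[OF p W2] in auto)
      qed
      then show "length (all_rows (\<lambda>p. Ts (ls w ! p)) (Nn ?n)) + 2 \<le> Hn ?n" by (simp add: Hn_def)
    qed (use W3 N T05 in \<open>auto simp: pst_def Hn_def\<close>)
    then obtain \<sigma>' where s: "runs (print_cmd vs Ts) ?s (tP (Hn ?n)) \<sigma>'" "\<sigma>' 14 = rev (bits (codes (pic w)))"
      unfolding pic_def RL_def by blast
    have "runs (reduction_cmd c d vs Ts) (start_stacks w (replicate ?n 1)) (tq ?n) \<sigma>'"
      unfolding reduction_cmd_def tq_def
      by (rule runs_seqs_Cons[OF 1 runs_seqs_Cons[OF 2 runs_seqs_Cons[OF s(1) runs_seqs_Nil]]])
    then show ?thesis using s(2) by blast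
  qed
  then have "\<exists>fin. \<forall>w. runs (reduction_cmd c d vs Ts) (start_stacks w (replicate (length w) 1)) (tq (length w)) (fin w) \<and>
     fin w 14 = rev (bits (codes (pic w)))" by (intro choice allI)
  then obtain fin where fin: "\<And>w. runs (reduction_cmd c d vs Ts) (start_stacks w (replicate (length w) 1)) (tq (length w)) (fin w)"
    "\<And>w. fin w 14 = rev (bits (codes (pic w)))" by blast
  have "pbound Bn" unfolding Bn_def by (intro pbound_power pbound_add pbound_id pbound_const)
  then have pW: "pbound Wn" unfolding Wn_def by (intro pbound_add pbound_mult pbound_id pbound_const)
  then have pN: "pbound Nn" unfolding Nn_def by (intro pbound_add pbound_mult pbound_const \<open>pbound Bn\<close>)
  have pK: "pbound Kn" unfolding Kn_def by (intro pbound_add pbound_id pbound_const pN \<open>pbound Bn\<close>)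
  have pH: "pbound Hn" unfolding Hn_def by (intro pbound_add pbound_mult pbound_const pN pW)
  have "pbound tq"
    unfolding tq_def tL_def tmul_def tB_def tP_def tM_def tG_def tR_def tC_def tS_def tE_def
    by (intro pbound_add pbound_mult pbound_const pK pH)
  have pc: "polytime_computable (\<lambda>w. codes (pic w))"
    by (rule polytime_by_program[where k = 15, OF okc_reduction _ _ \<open>pbound tq\<close> fin(1)]) (use fin(2) in simp_all)
  have "w \<in> L \<longleftrightarrow> codes (pic w) \<in> {w. \<exists>\<Gamma>. finite \<Gamma> \<and> encodes_region w \<Gamma> \<and> admits_tiling \<Gamma> slab}" for w
  proof -
    have e: "encodes_region (codes (pic w)) (set (pic w))" by (auto simp: encodes_region_def codes_def)
    have "codes (pic w) \<in> {w. \<exists>\<Gamma>. finite \<Gamma> \<and> encodes_region w \<Gamma> \<and> admits_tiling \<Gamma> slab} \<longleftrightarrow> admits_tiling (set (pic w)) slab"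
      using e encodes_region_unique[OF e] by blast
    then show ?thesis using tile by simp
  qed
  then show "polytime_reducible L {w. \<exists>\<Gamma>. finite \<Gamma> \<and> encodes_region w \<Gamma> \<and> admits_tiling \<Gamma> slab}"
    unfolding polytime_reducible_def using pc by blast
qed

section \<open>Verifying a tiling\<close>

text \<open>Signed digits: the symbols 1, 2, 3 stand for 0, 1, -1, and every other symbol counts as
  0. In a negative number each nonzero digit carries the sign, so differences are formed digit by
  digit without borrowing.\<close>

definition dv :: "nat \<Rightarrow> int" where
  "dv x = (if x = 2 then 1 else if x = 3 then -1 else 0)"

fun dval :: "nat list \<Rightarrow> int" where
  "dval [] = 0"
| "dval (x # xs) = dv x + 2 * dval xs"

text \<open>Cubes of one slab differ by at most 1 in each coordinate, so the exact size of a
  difference beyond 1 does not matter and it can be kept in a single symbol.\<close>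

definition clip :: "int \<Rightarrow> int" where "clip d = max (- 2) (min 2 d)"

text \<open>The shift by 3 turns -2, ..., 2 into the symbols 1, ..., 5, avoiding the blank.\<close>

definition cc :: "int \<Rightarrow> nat" where "cc d = nat (clip d + 3)"

definition ec :: "nat \<Rightarrow> nat \<Rightarrow> nat" where "ec x y = nat (dv x - dv y + 3)"

definition hc :: "nat \<Rightarrow> nat \<Rightarrow> nat" where "hc p q = cc (2 * (int p - 3) + (int q - 3))"

lemma cc_bounds [simp]: "cc d \<noteq> 0" "cc d < 32" by (auto simp: cc_def clip_def)

lemma ec_bounds [simp]: "ec x y \<noteq> 0" "ec x y < 32" by (auto simp: ec_def dv_def)

text \<open>Horner's rule from the most significant digit survives saturation: a digit difference is
  at most 2 in size, so once the partial difference has reached size 2, doubling it and adding a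
  digit cannot bring it back.\<close>

lemma hc_cc: "hc (cc d) (ec x y) = cc (2 * d + (dv x - dv y))"
proof -
  have 1: "int (cc d) - 3 = clip d" by (simp add: cc_def clip_def)
  have 2: "int (ec x y) - 3 = dv x - dv y" by (simp add: ec_def dv_def)
  have "clip (2 * clip d + e) = clip (2 * d + e)" if "- 2 \<le> e" "e \<le> 2" for e
    using that by (auto simp: clip_def max_def min_def)
  moreover have "- 2 \<le> dv x - dv y" "dv x - dv y \<le> 2" by (auto simp: dv_def)
  ultimately have "clip (2 * clip d + (dv x - dv y)) = clip (2 * d + (dv x - dv y))" by blast
  then show ?thesis unfolding hc_def 1 2 by (simp add: cc_def)
qed

fun dl :: "nat list \<Rightarrow> nat list \<Rightarrow> nat list" where
  "dl [] [] = []"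
| "dl (x # xs) ys = ec x (peek ys) # dl xs (tl ys)"
| "dl [] (y # ys) = ec 0 y # dl [] ys"

lemma dval_peek: "dval ys = dv (peek ys) + 2 * dval (tl ys)"
  by (cases ys) (auto simp: dv_def)

text \<open>The differences are collected with the least significant first and therefore consumed in
  reverse; the start symbol 3 is the code of 0.\<close>

lemma dl_val: "foldl hc 3 (rev (dl xs ys)) = cc (dval xs - dval ys)"
proof (induction xs ys rule: dl.induct)
  case 1
  show ?case by (simp add: cc_def clip_def)
next
  case (2 x xs ys)
  have "2 * (dval xs - dval (tl ys)) + (dv x - dv (peek ys)) = dval (x # xs) - dval ys"
    using dval_peek[of ys] by simp
  then show ?case using 2 by (simp only: dl.simps rev.simps foldl_append foldl_Cons foldl_Nil hc_cc)
next
  case (3 y ys)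
  have "2 * (dval [] - dval ys) + (dv 0 - dv y) = dval [] - dval (y # ys)" by (simp add: dv_def)
  then show ?case using 3 by (simp only: dl.simps rev.simps foldl_append foldl_Cons foldl_Nil hc_cc)
qed

lemma length_dl: "length (dl xs ys) \<le> length xs + length ys"
  by (induction xs ys rule: dl.induct) auto

lemma dl_nz: "0 \<notin> set (dl xs ys)"
  by (induction xs ys rule: dl.induct) (auto simp: ec_bounds(1)[symmetric] simp del: ec_bounds dest: sym)

text \<open>The number on stack 13 ends with the stack, the one on stack 19 at a terminator above 3.
  A terminator and an empty stack both have digit value 0, so the shorter number is padded without
  further cases.\<close>

definition sub_loop :: com where
  "sub_loop = While (\<lambda>a. a 13 \<noteq> 0 \<or> a 19 \<noteq> 0 \<and> a 19 \<le> 3) (Basic (\<lambda>a. (\<lambda>_. Nop)(13 := Pop,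
     19 := (if a 19 \<le> 3 then Pop else Nop), 14 := Push (ec (a 19) (a 13)))))"

lemma runs_sub:
  assumes "set xs \<subseteq> {1, 2, 3}" "set ys \<subseteq> {1, 2, 3}" "4 \<le> t" "\<sigma> 13 = ys" "\<sigma> 19 = xs @ t # rest"
  shows "runs sub_loop \<sigma> (2 * (length xs + length ys) + 1) (\<sigma>(13 := [], 19 := t # rest, 14 := rev (dl xs ys) @ \<sigma> 14))"
  using assms
proof (induction xs ys arbitrary: \<sigma> rule: dl.induct)
  case 1
  have e: "\<sigma>(13 := [], 19 := t # rest, 14 := rev (dl [] []) @ \<sigma> 14) = \<sigma>" using 1 by (auto intro!: ext)
  show ?case unfolding e unfolding sub_loop_def by (rule runs_mono[OF runs_While_stop]) (use 1 in auto)
next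
  case (2 x xs ys)
  let ?s = "\<sigma>(13 := tl ys, 19 := xs @ t # rest, 14 := ec x (peek ys) # \<sigma> 14)"
  have x: "x \<noteq> 0" "x \<le> 3" using 2(2) by auto
  have 1: "runs (Basic (\<lambda>a. (\<lambda>_. Nop)(13 := Pop, 19 := (if a 19 \<le> 3 then Pop else Nop), 14 := Push (ec (a 19) (a 13))))) \<sigma> 1 ?s"
    by (rule runs_eq[OF runs_Basic]) (use 2(5,6) x in \<open>auto intro!: ext\<close>)
  have "set (tl ys) \<subseteq> {1, 2, 3}" using 2(3) by (cases ys) auto
  then have "runs sub_loop ?s (2 * (length xs + length (tl ys)) + 1) (?s(13 := [], 19 := t # rest, 14 := rev (dl xs (tl ys)) @ ?s 14))"
    using 2(2,4) by (intro 2(1)) auto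
  note 2 = runs_While_step[OF _ 1 this[unfolded sub_loop_def]]
  show ?case unfolding sub_loop_def
    by (rule runs_eq[OF 2]) (use \<open>\<sigma> 19 = (x # xs) @ t # rest\<close> x in \<open>auto intro!: ext\<close>)
next
  case (3 y ys)
  let ?s = "\<sigma>(13 := ys, 19 := t # rest, 14 := ec 0 y # \<sigma> 14)"
  have y: "y \<noteq> 0" using 3(3) by auto
  have e: "ec t y = ec 0 y" using 3(4) by (simp add: ec_def dv_def)
  have 1: "runs (Basic (\<lambda>a. (\<lambda>_. Nop)(13 := Pop, 19 := (if a 19 \<le> 3 then Pop else Nop), 14 := Push (ec (a 19) (a 13))))) \<sigma> 1 ?s"
    by (rule runs_eq[OF runs_Basic]) (use 3(4,5,6) e in \<open>auto intro!: ext\<close>)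
  have "runs sub_loop ?s (2 * (length ([] :: nat list) + length ys) + 1) (?s(13 := [], 19 := t # rest, 14 := rev (dl [] ys) @ ?s 14))"
    by (rule 3(1)[of ?s]) (use 3(3,4) in auto)
  note 2 = runs_While_step[OF _ 1 this[unfolded sub_loop_def]]
  show ?case unfolding sub_loop_def
    by (rule runs_eq[OF 2]) (use 3(5) y in \<open>auto intro!: ext\<close>)
qed

definition horner :: "nat \<Rightarrow> com" where
  "horner m = While (\<lambda>a. a 14 \<noteq> 0) (Basic (\<lambda>a. (\<lambda>_. Nop)(14 := Pop, m := Repl (hc (a m) (a 14)))))"

lemma runs_horner:
  assumes "\<sigma> 14 = ds" "0 \<notin> set ds" "\<sigma> m = p # r" "m \<noteq> 14"
  shows "runs (horner m) \<sigma> (2 * length ds + 1) (\<sigma>(14 := [], m := foldl hc p ds # r))"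
  using assms
proof (induction ds arbitrary: \<sigma> p)
  case Nil
  have e: "\<sigma>(14 := [], m := foldl hc p [] # r) = \<sigma>" using Nil by (auto intro!: ext)
  show ?case unfolding e unfolding horner_def by (rule runs_mono[OF runs_While_stop]) (use Nil in auto)
next
  case (Cons d ds)
  let ?s = "\<sigma>(14 := ds, m := hc p d # r)"
  have 1: "runs (Basic (\<lambda>a. (\<lambda>_. Nop)(14 := Pop, m := Repl (hc (a m) (a 14))))) \<sigma> 1 ?s"
    by (rule runs_eq[OF runs_Basic]) (use Cons(2,4,5) in \<open>auto simp: hc_def intro!: ext\<close>)
  have "runs (horner m) ?s (2 * length ds + 1) (?s(14 := [], m := foldl hc (hc p d) ds # r))"
    by (rule Cons(1)) (use Cons(3,5) in auto)
  note 2 = runs_While_step[OF _ 1 this[unfolded horner_def]]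
  show ?case unfolding horner_def
    by (rule runs_eq[OF 2]) (use Cons(2,3,5) in \<open>auto intro!: ext\<close>)
qed

definition diff_cmd :: "nat \<Rightarrow> nat \<Rightarrow> com" where
  "diff_cmd j m = seqs [copy id j 13 18, sub_loop, push m 3, horner m]"

lemma runs_diff:
  assumes "j \<notin> {13, 14, 18, 19}" "m \<notin> {13, 14, 18, 19}" "\<sigma> j = ys" "\<sigma> 13 = []" "\<sigma> 14 = []" "\<sigma> 18 = []"
    and "\<sigma> 19 = xs @ t # rest" "set xs \<subseteq> {1, 2, 3}" "set ys \<subseteq> {1, 2, 3}" "4 \<le> t" "length xs \<le> K" "length ys \<le> K"
  shows "runs (diff_cmd j m) \<sigma> (12 * K + 12) (\<sigma>(19 := t # rest, m := cc (dval xs - dval ys) # \<sigma> m))"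
proof -
  have nz: "0 \<notin> set ys" "y \<in> set ys \<Longrightarrow> y \<noteq> 0" for y using assms(9) by auto
  have 1: "runs (copy id j 13 18) \<sigma> (4 * K + 3) (\<sigma>(13 := ys))"
    by (rule runs_eq[OF runs_copy]) (use assms(1-6,12) nz in auto)
  let ?s2 = "\<sigma>(13 := [], 19 := t # rest, 14 := rev (dl xs ys))"
  have 2: "runs sub_loop (\<sigma>(13 := ys)) (4 * K + 1) ?s2"
    by (rule runs_eq[OF runs_sub[OF assms(8-10)]]) (use assms(4,5,7,11,12) in \<open>auto intro!: ext\<close>)
  have 3: "runs (push m 3) ?s2 1 (?s2(m := 3 # \<sigma> m))"
    by (rule runs_eq[OF runs_push]) (use assms(2) in \<open>auto intro!: ext\<close>)
  have 4: "runs (horner m) (?s2(m := 3 # \<sigma> m)) (4 * K + 1) (\<sigma>(19 := t # rest, m := cc (dval xs - dval ys) # \<sigma> m))"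
    by (rule runs_eq[OF runs_horner[where ds = "rev (dl xs ys)" and p = 3 and r = "\<sigma> m"]])
      (use assms(2,4,5,11,12) length_dl[of xs ys] dl_nz[of xs ys] in \<open>auto simp: dl_val intro!: ext\<close>)
  show ?thesis unfolding diff_cmd_def
    by (rule runs_mono[OF runs_seqs_Cons[OF 1 runs_seqs_Cons[OF 2 runs_seqs_Cons[OF 3 runs_seqs_Cons[OF 4 runs_seqs_Nil]]]]]) simp
qed

section \<open>Entries and their pairwise comparison\<close>

definition dg :: "int \<Rightarrow> nat list" where
  "dg k = map (\<lambda>b. if b then if k < 0 then 3 else 2 else 1) (nat_bits (nat \<bar>k\<bar>))"

lemma set_dg: "set (dg k) \<subseteq> {1, 2, 3}"
  by (auto simp: dg_def)

lemma dval_nat_bits: "dval (map (\<lambda>b. if b then c else 1) (nat_bits n)) = dv c * int n"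
proof (induction n rule: less_induct)
  case (less n)
  show ?case
  proof (cases "n = 0")
    case False
    have IH: "dval (map (\<lambda>b. if b then c else 1) (nat_bits (n div 2))) = dv c * int (n div 2)" using less False by simp
    have n: "int n = 2 * int (n div 2) + (if odd n then 1 else 0)" by (auto elim!: evenE oddE)
    show ?thesis using False IH by (subst n) (simp add: nat_bits_pos algebra_simps dv_def)
  qed simp
qed

lemma dval_dg: "dval (dg k) = k"
  unfolding dg_def using dval_nat_bits[of "if k < 0 then 3 else 2" "nat \<bar>k\<bar>"] by (simp add: dv_def split: if_splits)

text \<open>A coordinate ends at the first symbol above 3; after the third one the label itself
  takes this role.\<close>

definition entry :: "cube \<times> nat \<Rightarrow> nat list" where
  "entry = (\<lambda>((x, y, z), l). dg x @ 4 # dg y @ 4 # dg z @ [l])"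

lemma entry_simp: "entry ((x, y, z), l) @ r = dg x @ 4 # dg y @ 4 # dg z @ l # r"
  by (simp add: entry_def)

lemma peek_entry: "peek (entry e @ r) \<noteq> 0"
proof -
  obtain x y z l where e: "e = ((x, y, z), l)" by (metis prod_cases3 prod.exhaust)
  show ?thesis unfolding e entry_simp using set_dg[of x] by (cases "dg x") auto
qed

text \<open>Stack 8 keeps all entries, 9 those still ahead of the outer loop and 19 those ahead of
  the inner one. The current cube is on 10 to 12 and its label on 22. Stack 20 tells by 2 that a
  partner was found, and 21 holds the verdict, 1 as long as nothing has failed.\<close>

definition vst :: "stacks \<Rightarrow> nat list \<Rightarrow> nat list \<Rightarrow> nat list \<Rightarrow> nat list \<Rightarrow> nat list \<Rightarrow> nat list \<Rightarrow> nat list \<Rightarrow> nat list \<Rightarrow> nat list \<Rightarrow> stacks" where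
  "vst \<tau> A R X Y Z I f L o' = \<tau>(8 := A, 9 := R, 10 := X, 11 := Y, 12 := Z, 13 := [], 14 := [], 15 := [], 16 := [], 17 := [],
     18 := [], 19 := I, 20 := f, 22 := L, 21 := o')"

type_synonym pair_cond = "nat \<Rightarrow> nat \<Rightarrow> nat \<Rightarrow> nat \<Rightarrow> nat \<Rightarrow> bool"

definition look :: "pair_cond \<Rightarrow> com" where
  "look C = seqs [diff_cmd 10 15, pop 19, diff_cmd 11 16, pop 19, diff_cmd 12 17,
     Basic (\<lambda>a. (\<lambda>_. Nop)(19 := Pop, 15 := Pop, 16 := Pop, 17 := Pop,
       20 := Repl (if C (a 22) (a 19) (a 15) (a 16) (a 17) then 2 else a 20)))]"

text \<open>A condition sees only the two labels and the three saturated differences, which is what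
  finite control can test in one step.\<close>

fun hit :: "pair_cond \<Rightarrow> cube \<times> nat \<Rightarrow> cube \<times> nat \<Rightarrow> bool" where
  "hit C ((x, y, z), l) ((x', y', z'), l') = C l l' (cc (x' - x)) (cc (y' - y)) (cc (z' - z))"

lemma runs_look:
  assumes "length (entry ((x, y, z), l)) \<le> K" "length (entry ((x', y', z'), l')) \<le> K" "4 \<le> l'" "4 \<le> l"
  shows "runs (look C) (vst \<tau> A R (dg x) (dg y) (dg z) (entry ((x', y', z'), l') @ I) [f] [l] o') (36 * K + 50)
    (vst \<tau> A R (dg x) (dg y) (dg z) I [if hit C ((x, y, z), l) ((x', y', z'), l') then 2 else f] [l] o')"
proof -
  let ?s = "\<lambda>I a b c. (vst \<tau> A R (dg x) (dg y) (dg z) I [f] [l] o')(15 := a, 16 := b, 17 := c)"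
  have le: "length (dg x) \<le> K" "length (dg y) \<le> K" "length (dg z) \<le> K" "length (dg x') \<le> K" "length (dg y') \<le> K" "length (dg z') \<le> K"
    using assms(1,2) by (auto simp: entry_def)
  let ?X = "[cc (x' - x)]" and ?Y = "[cc (y' - y)]" and ?Z = "[cc (z' - z)]"
  let ?I1 = "dg y' @ 4 # dg z' @ l' # I" and ?I2 = "dg z' @ l' # I"
  have s0: "vst \<tau> A R (dg x) (dg y) (dg z) (entry ((x', y', z'), l') @ I) [f] [l] o' = ?s (dg x' @ 4 # ?I1) [] [] []"
    unfolding entry_simp by (auto simp: vst_def intro!: ext)
  have 1: "runs (diff_cmd 10 15) (?s (dg x' @ 4 # ?I1) [] [] []) (12 * K + 12) (?s (4 # ?I1) ?X [] [])"
    by (rule runs_eq[OF runs_diff[where xs = "dg x'" and ys = "dg x" and t = 4 and rest = ?I1 and K = K]])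
      (use set_dg le in \<open>auto simp: vst_def dval_dg intro!: ext\<close>)
  have 2: "runs (pop 19) (?s (4 # ?I1) ?X [] []) 1 (?s ?I1 ?X [] [])"
    by (rule runs_eq[OF runs_pop]) (auto simp: vst_def intro!: ext)
  have 3: "runs (diff_cmd 11 16) (?s ?I1 ?X [] []) (12 * K + 12) (?s (4 # ?I2) ?X ?Y [])"
    by (rule runs_eq[OF runs_diff[where xs = "dg y'" and ys = "dg y" and t = 4 and rest = ?I2 and K = K]])
      (use set_dg le in \<open>auto simp: vst_def dval_dg intro!: ext\<close>)
  have 4: "runs (pop 19) (?s (4 # ?I2) ?X ?Y []) 1 (?s ?I2 ?X ?Y [])"
    by (rule runs_eq[OF runs_pop]) (auto simp: vst_def intro!: ext)
  have 5: "runs (diff_cmd 12 17) (?s ?I2 ?X ?Y []) (12 * K + 12) (?s (l' # I) ?X ?Y ?Z)"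
    by (rule runs_eq[OF runs_diff[where xs = "dg z'" and ys = "dg z" and t = l' and rest = I and K = K]])
      (use set_dg le assms(3) in \<open>auto simp: vst_def dval_dg intro!: ext\<close>)
  have 6: "runs (Basic (\<lambda>a. (\<lambda>_. Nop)(19 := Pop, 15 := Pop, 16 := Pop, 17 := Pop,
       20 := Repl (if C (a 22) (a 19) (a 15) (a 16) (a 17) then 2 else a 20)))) (?s (l' # I) ?X ?Y ?Z) 1
     (vst \<tau> A R (dg x) (dg y) (dg z) I [if hit C ((x, y, z), l) ((x', y', z'), l') then 2 else f] [l] o')"
    by (rule runs_eq[OF runs_Basic]) (auto simp: vst_def intro!: ext)
  show ?thesis unfolding s0 look_def
    by (rule runs_mono[OF runs_seqs_Cons[OF 1 runs_seqs_Cons[OF 2 runs_seqs_Cons[OF 3 runs_seqs_Cons[OF 4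
      runs_seqs_Cons[OF 5 runs_seqs_Cons[OF 6 runs_seqs_Nil]]]]]]]) simp
qed

definition inner :: "pair_cond \<Rightarrow> com" where "inner C = While (\<lambda>a. a 19 \<noteq> 0) (look C)"

lemma runs_inner:
  assumes "length (entry ((x, y, z), l)) \<le> K" "4 \<le> l" "\<And>e. e \<in> set es \<Longrightarrow> length (entry e) \<le> K \<and> 4 \<le> snd e"
  shows "runs (inner C) (vst \<tau> A R (dg x) (dg y) (dg z) (concat (map entry es)) [f] [l] o') (length es * (36 * K + 51) + 1)
    (vst \<tau> A R (dg x) (dg y) (dg z) [] [if \<exists>e\<in>set es. hit C ((x, y, z), l) e then 2 else f] [l] o')"
  using assms(3)
proof (induction es arbitrary: f)
  case Nil
  have "\<not> peeks (vst \<tau> A R (dg x) (dg y) (dg z) [] [f] [l] o') 19 \<noteq> 0" by (simp add: vst_def)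
  from runs_While_stop[of "\<lambda>a. a 19 \<noteq> 0", OF this] show ?case by (simp add: inner_def)
next
  case (Cons e es)
  obtain x' y' z' l' where e: "e = ((x', y', z'), l')" by (metis prod_cases3 prod.exhaust)
  let ?a = "((x, y, z), l)" and ?v = "\<lambda>I f. vst \<tau> A R (dg x) (dg y) (dg z) I [f] [l] o'"
  let ?f = "if hit C ?a e then 2 else f" and ?I = "concat (map entry es)"
  have 0: "peeks (?v (entry e @ ?I) f) 19 \<noteq> 0" using peek_entry[of e] by (simp add: vst_def)
  have 1: "runs (look C) (?v (entry e @ ?I) f) (36 * K + 50) (?v ?I ?f)"
    unfolding e by (rule runs_look) (use assms(1,2) Cons(2)[of e] e in auto)
  have 2: "runs (inner C) (?v ?I ?f) (length es * (36 * K + 51) + 1) (?v [] (if \<exists>e\<in>set es. hit C ?a e then 2 else ?f))"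
    by (rule Cons(1)) (use Cons(2) in auto)
  have e1: "(if \<exists>e\<in>set es. hit C ?a e then 2 else ?f) = (if \<exists>e\<in>set (e # es). hit C ?a e then 2 else f)" by auto
  show ?case unfolding inner_def list.map concat.simps
    by (rule runs_eq[OF runs_While_step[OF 0 1 2[unfolded inner_def e1]]]) simp_all
qed

definition rd :: "nat \<Rightarrow> com" where
  "rd j = Seq (While (\<lambda>a. a 9 \<noteq> 0 \<and> a 9 \<le> 3) (Basic (\<lambda>a. (\<lambda>_. Nop)(9 := Pop, 18 := Push (a 9))))) (move id 18 j)"

lemma runs_rd_loop:
  assumes "set xs \<subseteq> {1, 2, 3}" "4 \<le> t" "\<sigma> 9 = xs @ t # rest"
  shows "runs (While (\<lambda>a. a 9 \<noteq> 0 \<and> a 9 \<le> 3) (Basic (\<lambda>a. (\<lambda>_. Nop)(9 := Pop, 18 := Push (a 9))))) \<sigma>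
    (2 * length xs + 1) (\<sigma>(9 := t # rest, 18 := rev xs @ \<sigma> 18))"
  using assms
proof (induction xs arbitrary: \<sigma>)
  case Nil
  have e: "\<sigma>(9 := t # rest, 18 := rev [] @ \<sigma> 18) = \<sigma>" using Nil by (auto intro!: ext)
  show ?case unfolding e by (rule runs_mono[OF runs_While_stop]) (use Nil in auto)
next
  case (Cons x xs)
  have x: "x \<noteq> 0" "x \<le> 3" using Cons(2) by auto
  let ?s = "\<sigma>(9 := xs @ t # rest, 18 := x # \<sigma> 18)"
  have 1: "runs (Basic (\<lambda>a. (\<lambda>_. Nop)(9 := Pop, 18 := Push (a 9)))) \<sigma> 1 ?s"
    by (rule runs_eq[OF runs_Basic]) (use Cons(4) x in \<open>auto intro!: ext\<close>)
  have 2: "runs (While (\<lambda>a. a 9 \<noteq> 0 \<and> a 9 \<le> 3) (Basic (\<lambda>a. (\<lambda>_. Nop)(9 := Pop, 18 := Push (a 9))))) ?s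
    (2 * length xs + 1) (?s(9 := t # rest, 18 := rev xs @ ?s 18))"
    by (rule Cons(1)) (use Cons(2,3) in auto)
  note 3 = runs_While_step[OF _ 1 2]
  show ?case by (rule runs_eq[OF 3]) (use Cons(4) x in \<open>auto intro!: ext\<close>)
qed

lemma runs_rd:
  assumes "set xs \<subseteq> {1, 2, 3}" "4 \<le> t" "\<sigma> 9 = xs @ t # rest" "\<sigma> 18 = []" "\<sigma> j = []" "j \<notin> {9, 18}" "length xs \<le> K"
  shows "runs (rd j) \<sigma> (4 * K + 3) (\<sigma>(9 := t # rest, j := xs))"
proof -
  note 1 = runs_rd_loop[where \<sigma> = \<sigma>, OF assms(1-3)]
  have 2: "runs (move id 18 j) (\<sigma>(9 := t # rest, 18 := rev xs @ \<sigma> 18)) (2 * K + 1) (\<sigma>(9 := t # rest, j := xs))"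
    by (rule runs_eq[OF runs_move]) (use assms in \<open>auto intro!: ext\<close>)
  show ?thesis unfolding rd_def by (rule runs_mono[OF runs_Seq[OF 1 2]]) (use assms(7) in simp)
qed

text \<open>Compares one entry with all entries. \<open>v\<close> says whether a partner is required
  or forbidden; a failure sets the verdict to 2, and no later step changes it back.\<close>

definition outer_body :: "pair_cond \<Rightarrow> bool \<Rightarrow> com" where
  "outer_body C v = seqs [rd 10, pop 9, rd 11, pop 9, rd 12, Basic (\<lambda>a. (\<lambda>_. Nop)(9 := Pop, 22 := Push (a 9))),
     push 20 1, copy id 8 19 18, inner C,
     Basic (\<lambda>a. (\<lambda>_. Nop)(20 := Pop, 22 := Pop, 21 := Repl (if (a 20 = 2) = v then a 21 else 2))),
     clear 10, clear 11, clear 12]"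

definition tO :: "nat \<Rightarrow> nat" where "tO K = K * (36 * K + 51) + 30 * K + 60"

lemma runs_outer_body:
  assumes A: "A = concat (map entry es)" "length A \<le> K" "length es \<le> K"
    and es: "\<And>e. e \<in> set es \<Longrightarrow> length (entry e) \<le> K \<and> 4 \<le> snd e" and a: "a \<in> set es"
  shows "runs (outer_body C v) (vst \<tau> A (entry a @ R) [] [] [] [] [] [] [o']) (tO K)
    (vst \<tau> A R [] [] [] [] [] [] [if (\<exists>e\<in>set es. hit C a e) = v then o' else 2])"
proof -
  obtain x y z l where e: "a = ((x, y, z), l)" by (metis prod_cases3 prod.exhaust)
  have l4: "4 \<le> l" and lK: "length (entry ((x, y, z), l)) \<le> K" using es[OF a] e by auto
  then have le: "length (dg x) \<le> K" "length (dg y) \<le> K" "length (dg z) \<le> K" by (auto simp: entry_def)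
  have A0: "0 \<notin> set A"
  proof
    assume "0 \<in> set A"
    then obtain x y z l where "((x, y, z), l) \<in> set es" "0 \<in> set (entry ((x, y, z), l))" unfolding A(1) by auto
    then show False using es[of "((x, y, z), l)"] set_dg[of x] set_dg[of y] set_dg[of z] by (auto simp: entry_def)
  qed
  have A0': "x \<in> set A \<Longrightarrow> x \<noteq> 0" for x using A0 by metis
  have d0: "0 \<notin> set (dg k)" for k using set_dg[of k] by auto
  let ?v = "\<lambda>R X Y Z I f L o'. vst \<tau> A R X Y Z I f L o'"
  let ?R1 = "dg y @ 4 # dg z @ l # R" and ?R2 = "dg z @ l # R"
  have 1: "runs (rd 10) (?v (dg x @ 4 # ?R1) [] [] [] [] [] [] [o']) (4 * K + 3) (?v (4 # ?R1) (dg x) [] [] [] [] [] [o'])"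
    by (rule runs_eq[OF runs_rd[where xs = "dg x" and t = 4 and rest = ?R1 and K = K]]) (use set_dg le in \<open>auto simp: vst_def intro!: ext\<close>)
  have 2: "runs (pop 9) (?v (4 # S) X Y [] [] [] [] [o']) 1 (?v S X Y [] [] [] [] [o'])" for S X Y
    by (rule runs_eq[OF runs_pop]) (auto simp: vst_def intro!: ext)
  have 3: "runs (rd 11) (?v ?R1 (dg x) [] [] [] [] [] [o']) (4 * K + 3) (?v (4 # ?R2) (dg x) (dg y) [] [] [] [] [o'])"
    by (rule runs_eq[OF runs_rd[where xs = "dg y" and t = 4 and rest = ?R2 and K = K]]) (use set_dg le in \<open>auto simp: vst_def intro!: ext\<close>)
  have 4: "runs (rd 12) (?v ?R2 (dg x) (dg y) [] [] [] [] [o']) (4 * K + 3) (?v (l # R) (dg x) (dg y) (dg z) [] [] [] [o'])"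
    by (rule runs_eq[OF runs_rd[where xs = "dg z" and t = l and rest = R and K = K]]) (use set_dg le l4 in \<open>auto simp: vst_def intro!: ext\<close>)
  have 5: "runs (Basic (\<lambda>a. (\<lambda>_. Nop)(9 := Pop, 22 := Push (a 9)))) (?v (l # R) (dg x) (dg y) (dg z) [] [] [] [o']) 1
     (?v R (dg x) (dg y) (dg z) [] [] [l] [o'])"
    by (rule runs_eq[OF runs_Basic]) (use l4 in \<open>auto simp: vst_def intro!: ext\<close>)
  have 6: "runs (push 20 1) (?v R (dg x) (dg y) (dg z) [] [] [l] [o']) 1 (?v R (dg x) (dg y) (dg z) [] [1] [l] [o'])"
    by (rule runs_eq[OF runs_push]) (auto simp: vst_def intro!: ext)
  have 7: "runs (copy id 8 19 18) (?v R (dg x) (dg y) (dg z) [] [1] [l] [o']) (4 * K + 3) (?v R (dg x) (dg y) (dg z) A [1] [l] [o'])"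
    by (rule runs_eq[OF runs_copy]) (use A0 A0' A(2) in \<open>auto simp: vst_def intro!: ext\<close>)
  let ?f = "if \<exists>e\<in>set es. hit C ((x, y, z), l) e then 2 else 1"
  have i: "runs (inner C) (?v R (dg x) (dg y) (dg z) A [1] [l] [o']) (length es * (36 * K + 51) + 1)
     (?v R (dg x) (dg y) (dg z) [] [?f] [l] [o'])"
    unfolding A(1) by (rule runs_inner[OF lK l4]) (rule es)
  have "length es * (36 * K + 51) \<le> K * (36 * K + 51)" using A(3) by (rule mult_le_mono1)
  then have 8: "runs (inner C) (?v R (dg x) (dg y) (dg z) A [1] [l] [o']) (K * (36 * K + 51) + 1) (?v R (dg x) (dg y) (dg z) [] [?f] [l] [o'])"
    by (intro runs_mono[OF i]) simp
  let ?o = "if (\<exists>e\<in>set es. hit C ((x, y, z), l) e) = v then o' else 2"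
  have 9: "runs (Basic (\<lambda>a. (\<lambda>_. Nop)(20 := Pop, 22 := Pop, 21 := Repl (if (a 20 = 2) = v then a 21 else 2))))
     (?v R (dg x) (dg y) (dg z) [] [?f] [l] [o']) 1 (?v R (dg x) (dg y) (dg z) [] [] [] [?o])"
    by (rule runs_eq[OF runs_Basic]) (auto simp: vst_def intro!: ext)
  have 10: "runs (clear 10) (?v R (dg x) (dg y) (dg z) [] [] [] [p]) (2 * K + 1) (?v R [] (dg y) (dg z) [] [] [] [p])" for p
    by (rule runs_eq[OF runs_clear]) (use d0 le in \<open>auto simp: vst_def intro!: ext\<close>)
  have 11: "runs (clear 11) (?v R [] (dg y) (dg z) [] [] [] [p]) (2 * K + 1) (?v R [] [] (dg z) [] [] [] [p])" for p
    by (rule runs_eq[OF runs_clear]) (use d0 le in \<open>auto simp: vst_def intro!: ext\<close>)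
  have 12: "runs (clear 12) (?v R [] [] (dg z) [] [] [] [p]) (2 * K + 1) (?v R [] [] [] [] [] [] [p])" for p
    by (rule runs_eq[OF runs_clear]) (use d0 le in \<open>auto simp: vst_def intro!: ext\<close>)
  show ?thesis unfolding outer_body_def e entry_simp
    by (rule runs_mono[OF runs_seqs_Cons[OF 1 runs_seqs_Cons[OF 2 runs_seqs_Cons[OF 3 runs_seqs_Cons[OF 2
      runs_seqs_Cons[OF 4 runs_seqs_Cons[OF 5 runs_seqs_Cons[OF 6 runs_seqs_Cons[OF 7 runs_seqs_Cons[OF 8
      runs_seqs_Cons[OF 9 runs_seqs_Cons[OF 10 runs_seqs_Cons[OF 11 runs_seqs_Cons[OF 12 runs_seqs_Nil]]]]]]]]]]]]]])
      (simp add: tO_def)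
qed

definition pairs_cmd :: "pair_cond \<times> bool \<Rightarrow> com" where
  "pairs_cmd q = Seq (copy id 8 9 18) (While (\<lambda>a. a 9 \<noteq> 0) (outer_body (fst q) (snd q)))"

definition pairs_ok :: "(cube \<times> nat) list \<Rightarrow> pair_cond \<times> bool \<Rightarrow> bool" where
  "pairs_ok es q \<longleftrightarrow> (\<forall>a\<in>set es. (\<exists>e\<in>set es. hit (fst q) a e) = snd q)"

definition tA :: "nat \<Rightarrow> nat" where "tA K = K * (tO K + 1) + 4 * K + 5"

lemma runs_pairs:
  assumes A: "A = concat (map entry es)" "length A \<le> K" "length es \<le> K"
    and es: "\<And>e. e \<in> set es \<Longrightarrow> length (entry e) \<le> K \<and> 4 \<le> snd e"
  shows "runs (pairs_cmd q) (vst \<tau> A [] [] [] [] [] [] [] [o']) (tA K)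
    (vst \<tau> A [] [] [] [] [] [] [] [if pairs_ok es q then o' else 2])"
proof -
  obtain C v where q: "q = (C, v)" by fastforce
  let ?w = "While (\<lambda>a. a 9 \<noteq> 0) (outer_body C v)"
  have loop: "runs ?w (vst \<tau> A (concat (map entry as)) [] [] [] [] [] [] [p]) (length as * (tO K + 1) + 1)
    (vst \<tau> A [] [] [] [] [] [] [] [if \<forall>a\<in>set as. (\<exists>e\<in>set es. hit C a e) = v then p else 2])" if "set as \<subseteq> set es" for as p
    using that
  proof (induction as arbitrary: p)
    case Nil
    have "\<not> peeks (vst \<tau> A [] [] [] [] [] [] [] [p]) 9 \<noteq> 0" by (simp add: vst_def)
    from runs_While_stop[of "\<lambda>a. a 9 \<noteq> 0", OF this] show ?case by simp
  next
    case (Cons a as)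
    let ?R = "concat (map entry as)" and ?p = "if (\<exists>e\<in>set es. hit C a e) = v then p else 2"
    have 0: "peeks (vst \<tau> A (entry a @ ?R) [] [] [] [] [] [] [p]) 9 \<noteq> 0" using peek_entry[of a] by (simp add: vst_def)
    have a: "a \<in> set es" using Cons(2) by simp
    have 1: "runs (outer_body C v) (vst \<tau> A (entry a @ ?R) [] [] [] [] [] [] [p]) (tO K) (vst \<tau> A ?R [] [] [] [] [] [] [?p])"
      by (rule runs_outer_body[OF A es a])
    have 2: "runs ?w (vst \<tau> A ?R [] [] [] [] [] [] [?p]) (length as * (tO K + 1) + 1)
      (vst \<tau> A [] [] [] [] [] [] [] [if \<forall>a\<in>set as. (\<exists>e\<in>set es. hit C a e) = v then ?p else 2])"
      by (rule Cons(1)) (use Cons(2) in simp)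
    have e1: "(if \<forall>a\<in>set as. (\<exists>e\<in>set es. hit C a e) = v then ?p else 2) =
      (if \<forall>a\<in>set (a # as). (\<exists>e\<in>set es. hit C a e) = v then p else 2)" by auto
    show ?case unfolding list.map concat.simps
      by (rule runs_eq[OF runs_While_step[OF 0 1 2[unfolded e1]]]) simp_all
  qed
  have A0: "0 \<notin> set A"
  proof
    assume "0 \<in> set A"
    then obtain x y z l where "((x, y, z), l) \<in> set es" "0 \<in> set (entry ((x, y, z), l))" unfolding A(1) by auto
    then show False using es[of "((x, y, z), l)"] set_dg[of x] set_dg[of y] set_dg[of z] by (auto simp: entry_def)
  qed
  have A0': "x \<in> set A \<Longrightarrow> x \<noteq> 0" for x using A0 by metis
  have 1: "runs (copy id 8 9 18) (vst \<tau> A [] [] [] [] [] [] [] [o']) (4 * K + 3) (vst \<tau> A A [] [] [] [] [] [] [o'])"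
    by (rule runs_eq[OF runs_copy]) (use A0 A0' A(2) in \<open>auto simp: vst_def intro!: ext\<close>)
  have "length es * (tO K + 1) \<le> K * (tO K + 1)" using A(3) by (rule mult_le_mono1)
  then have t: "4 * K + 3 + (length es * (tO K + 1) + 1) + 1 \<le> tA K" unfolding tA_def by linarith
  have 2: "runs ?w (vst \<tau> A A [] [] [] [] [] [] [o']) (length es * (tO K + 1) + 1)
    (vst \<tau> A [] [] [] [] [] [] [] [if pairs_ok es q then o' else 2])"
    using loop[of es o'] unfolding A(1)[symmetric] pairs_ok_def q by simp
  show ?thesis unfolding pairs_cmd_def q fst_conv snd_conv
    by (rule runs_mono[OF runs_Seq[OF 1 2[unfolded q]] t])
qed

lemma runs_all_pairs:
  assumes A: "A = concat (map entry es)" "length A \<le> K" "length es \<le> K"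
    and es: "\<And>e. e \<in> set es \<Longrightarrow> length (entry e) \<le> K \<and> 4 \<le> snd e"
  shows "runs (seqs (map pairs_cmd qs)) (vst \<tau> A [] [] [] [] [] [] [] [o']) (length qs * (tA K + 1) + 1)
    (vst \<tau> A [] [] [] [] [] [] [] [if \<forall>q\<in>set qs. pairs_ok es q then o' else 2])"
proof (induction qs arbitrary: o')
  case Nil
  then show ?case using runs_seqs_Nil by simp
next
  case (Cons q qs)
  have e1: "(if \<forall>q\<in>set qs. pairs_ok es q then if pairs_ok es q then o' else 2 else 2) =
    (if \<forall>q\<in>set (q # qs). pairs_ok es q then o' else 2)" by auto
  show ?case unfolding list.map
    by (rule runs_eq[OF runs_seqs_Cons[OF runs_pairs[OF A es, of q \<tau> o'] Cons[of "if pairs_ok es q then o' else 2", unfolded e1]]]) simp_all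
qed

subsection \<open>Reading the region\<close>

type_synonym rstate = "nat \<times> nat \<times> nat \<times> nat \<times> nat list \<times> nat list"

definition nx :: "nat \<Rightarrow> nat" where "nx i = (if i = 1 then 2 else if i = 2 then 3 else 1)"

text \<open>
  The components of a reader state are the current coordinate, the phase, the sign of the current
  number, its most recent bit, the unused labels and the output.  Phase 1 expects a new number,
  phase 2 its sign, phase 3 a delimiter, phase 4 a bit; phase 5 rejects.
\<close>

fun dstep :: "rstate \<Rightarrow> bool \<Rightarrow> rstate" where
  "dstep (i, ph, s, l, g, out) b =
    (if ph = 1 then (i, if b then 2 else 5, s, l, g, out)
     else if ph = 2 then (i, 3, if b then 2 else 1, 1, g, out)
     else if ph = 3 then
       (if b then (i, 4, s, l, g, out)
        else if l = 3 \<or> l = 1 \<and> s = 1 then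
          (nx i, 1, s, l, if i = 3 then tl g else g, app_op (Push (if i = 3 then peek g else 4)) out)
        else (i, 5, s, l, g, out))
     else if ph = 4 then (i, 3, s, if b then 3 else 2, g, (if b then if s = 2 then 3 else 2 else 1) # out)
     else (i, ph, s, l, g, out))"

definition number_ends :: "(nat \<Rightarrow> nat) \<Rightarrow> bool" where
  "number_ends a \<longleftrightarrow> a 4 = 3 \<and> a 2 \<noteq> 2 \<and> (a 6 = 3 \<or> a 6 = 1 \<and> a 5 = 1)"

text \<open>One step of the reader as a simultaneous operation on the stacks: each change depends on
  the tops before the step only.\<close>

definition rops :: "(nat \<Rightarrow> nat) \<Rightarrow> nat \<Rightarrow> stack_op" where
  "rops a = (\<lambda>_. Nop)(2 := Pop,
     3 := (if number_ends a then Repl (nx (a 3)) else Nop),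
     4 := (if a 4 = 1 then Repl (if a 2 = 2 then 2 else 5) else if a 4 = 2 then Repl 3
       else if a 4 = 3 then Repl (if a 2 = 2 then 4 else if number_ends a then 1 else 5)
       else if a 4 = 4 then Repl 3 else Nop),
     5 := (if a 4 = 2 then Repl (if a 2 = 2 then 2 else 1) else Nop),
     6 := (if a 4 = 2 then Repl 1 else if a 4 = 4 then Repl (if a 2 = 2 then 3 else 2) else Nop),
     1 := (if number_ends a \<and> a 3 = 3 then Pop else Nop),
     7 := (if number_ends a then Push (if a 3 = 3 then a 1 else 4)
       else if a 4 = 4 then Push (if a 2 = 2 then if a 5 = 2 then 3 else 2 else 1) else Nop))"

definition reader :: com where "reader = While (\<lambda>a. a 2 \<noteq> 0) (Basic rops)"

fun dst :: "bool list \<Rightarrow> rstate \<Rightarrow> stacks" where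
  "dst w (i, ph, s, l, g, out) = (\<lambda>_. [])(2 := bits w, 3 := [i], 4 := [ph], 5 := [s], 6 := [l], 1 := g, 7 := out)"

lemma runs_reader_step: "runs (Basic rops) (dst (b # w) q) 1 (dst w (dstep q b))"
proof -
  obtain i ph s l g out where q: "q = (i, ph, s, l, g, out)" by (metis prod_cases6)
  consider "ph = 1" | "ph = 2" | "ph = 3" | "ph = 4" | "ph \<noteq> 1" "ph \<noteq> 2" "ph \<noteq> 3" "ph \<noteq> 4" by blast
  then show ?thesis unfolding q
    by cases (rule runs_eq[OF runs_Basic]; auto simp: rops_def number_ends_def nx_def intro!: ext)+
qed

lemma runs_reader: "runs reader (dst w q) (2 * length w + 1) (dst [] (foldl dstep q w))"
proof (induction w arbitrary: q)
  case Nil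
  obtain i ph s l g out where q: "q = (i, ph, s, l, g, out)" by (metis prod_cases6)
  have "\<not> peeks (dst [] q) 2 \<noteq> 0" unfolding q by simp
  from runs_While_stop[of "\<lambda>a. a 2 \<noteq> 0", OF this] show ?case by (simp add: reader_def)
next
  case (Cons b w)
  obtain i ph s l g out where q: "q = (i, ph, s, l, g, out)" by (metis prod_cases6)
  have 0: "peeks (dst (b # w) q) 2 \<noteq> 0" unfolding q by simp
  note r = runs_While_step[of "\<lambda>a. a 2 \<noteq> 0", OF 0 runs_reader_step Cons[unfolded reader_def]]
  show ?case unfolding reader_def by (rule runs_eq[OF r]) simp_all
qed

abbreviation marked :: "bool list \<Rightarrow> bool list" where
  "marked bs \<equiv> concat (map (\<lambda>b. [True, b]) bs)"

text \<open>The numbers that \<open>int_bits\<close> produces: the most significant bit, which comes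
  last, is a one, and zero is not negative. Here \<open>l\<close> is 1 before any bit, and 2 or 3
  after a bit \<open>False\<close> or \<open>True\<close>; \<open>s = 1\<close> is the sign of
  nonnegative numbers.\<close>

definition num_ok :: "nat \<Rightarrow> nat \<Rightarrow> bool list \<Rightarrow> bool" where
  "num_ok l s bs \<longleftrightarrow> (if bs = [] then l = 3 \<or> l = 1 \<and> s = 1 else last bs)"

lemma foldl_marked:
  "num_ok l s bs \<Longrightarrow> foldl dstep (i, 3, s, l, g, out) (marked bs @ [False]) =
    (nx i, 1, s, if bs = [] then l else 3, if i = 3 then tl g else g,
     app_op (Push (if i = 3 then peek g else 4)) (rev (map (\<lambda>b. if b then if s = 2 then 3 else 2 else 1) bs) @ out))"
proof (induction bs arbitrary: l out)
  case Nil
  then show ?case by (simp add: num_ok_def)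
next
  case (Cons b bs)
  have "num_ok (if b then 3 else 2) s bs" using Cons(2) by (auto simp: num_ok_def split: if_splits)
  from Cons(1)[OF this] Cons(2) show ?case by (auto simp: num_ok_def simp del: app_op.simps)
qed

lemma foldl_rejected: "foldl dstep (i, 5, s, l, g, out) w = (i, 5, s, l, g, out)"
  by (induction w) auto

text \<open>Phase 5 is absorbing, so a run that is back in phase 1 at the end must have closed its
  first number by an admissible delimiter. This and the next inversions show that the reader accepts
  nothing but codes.\<close>

lemma marked_of_run:
  "fst (snd (foldl dstep (i, 3, s, l, g, out) w)) = 1 \<Longrightarrow> \<exists>bs r. w = marked bs @ False # r \<and> num_ok l s bs"
proof (induction w arbitrary: l out rule: induct_list012)
  case 1
  then show ?case by simp
next
  case (2 x)
  then have "w = marked [] @ False # [] \<and> num_ok l s []" if "w = [x]" for w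
    using that by (auto simp: num_ok_def split: if_splits)
  then show ?case by blast
next
  case (3 x y zs)
  show ?case
  proof (cases x)
    case True
    then have "fst (snd (foldl dstep (i, 3, s, if y then 3 else 2, g, (if y then if s = 2 then 3 else 2 else 1) # out) zs)) = 1"
      using 3(3) by simp
    from 3(1)[OF this] obtain bs r where b: "zs = marked bs @ False # r" "num_ok (if y then 3 else 2) s bs" by blast
    have "x # y # zs = marked (y # bs) @ False # r \<and> num_ok l s (y # bs)"
      using b True by (auto simp: num_ok_def split: if_splits)
    then show ?thesis by blast
  next
    case False
    have "l = 3 \<or> l = 1 \<and> s = 1"
    proof (rule ccontr)
      assume "\<not> ?thesis"
      then have "foldl dstep (i, 3, s, l, g, out) (x # y # zs) = (i, 5, s, l, g, out)"
        using False by (auto simp: foldl_rejected)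
      then show False using 3(3) by simp
    qed
    then have "x # y # zs = marked [] @ False # y # zs \<and> num_ok l s []" using False by (simp add: num_ok_def)
    then show ?thesis by blast
  qed
qed

lemma last_nat_bits: "0 < n \<Longrightarrow> last (nat_bits n)"
proof (induction n rule: less_induct)
  case (less n)
  show ?case
  proof (cases "n = 1")
    case False
    then have "0 < n div 2" "n div 2 < n" using less(2) by auto
    moreover from this(1) have "nat_bits (n div 2) \<noteq> []" by (simp add: nat_bits_pos)
    ultimately show ?thesis using less by (simp add: nat_bits_pos[of n])
  qed simp
qed

lemma nat_bits_of_last: "bs \<noteq> [] \<Longrightarrow> last bs \<Longrightarrow> \<exists>n>0. nat_bits n = bs"
proof (induction bs)
  case (Cons b bs)
  show ?case
  proof (cases "bs = []")
    case True
    then show ?thesis using Cons(3) by (intro exI[of _ 1]) simp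
  next
    case False
    then obtain n where n: "n > 0" "nat_bits n = bs" using Cons by auto
    show ?thesis using n by (intro exI[of _ "2 * n + of_bool b"]) (cases b; simp add: nat_bits_pos)
  qed
qed simp

lemma delimited_int: "delimited (int_bits k) = True # (k < 0) # marked (nat_bits (nat \<bar>k\<bar>)) @ [False]"
  by (simp add: delimited_def int_bits_def)

lemma foldl_number:
  "\<exists>s' l'. foldl dstep (i, 1, s, l, g, out) (delimited (int_bits k)) =
    (nx i, 1, s', l', if i = 3 then tl g else g, app_op (Push (if i = 3 then peek g else 4)) (rev (dg k) @ out))"
proof -
  let ?s = "if k < 0 then 2 else 1 :: nat" and ?bs = "nat_bits (nat \<bar>k\<bar>)"
  have "num_ok 1 ?s ?bs"
  proof (cases "k = 0")
    case False
    then have "0 < nat \<bar>k\<bar>" by simp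
    then show ?thesis using last_nat_bits[of "nat \<bar>k\<bar>"] by (simp add: num_ok_def nat_bits_pos)
  qed (simp add: num_ok_def)
  from foldl_marked[OF this, of i g out]
  have "foldl dstep (i, 1, s, l, g, out) (delimited (int_bits k)) =
    (nx i, 1, ?s, if ?bs = [] then 1 else 3, if i = 3 then tl g else g,
     app_op (Push (if i = 3 then peek g else 4)) (rev (map (\<lambda>b. if b then if ?s = 2 then 3 else 2 else 1) ?bs) @ out))"
    unfolding delimited_int by (simp del: app_op.simps foldl_append)
  moreover have "map (\<lambda>b. if b then if ?s = 2 then 3 else 2 else 1) ?bs = dg k" by (simp add: dg_def)
  ultimately show ?thesis by (simp only:) blast
qed

lemma number_of_run:
  assumes "fst (snd (foldl dstep (i, 1, s, l, g, out) w)) = 1" "w \<noteq> []"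
  shows "\<exists>k r. w = delimited (int_bits k) @ r"
proof -
  obtain b w1 where w: "w = b # w1" using assms(2) by (cases w) auto
  have b: b using assms(1) unfolding w by (cases b) (auto simp: foldl_rejected)
  obtain c w2 where w1: "w1 = c # w2" using assms(1) b unfolding w by (cases w1) auto
  have "fst (snd (foldl dstep (i, 3, if c then 2 else 1, 1, g, out) w2)) = 1" using assms(1) b unfolding w w1 by simp
  from marked_of_run[OF this] obtain bs r where r: "w2 = marked bs @ False # r" "num_ok 1 (if c then 2 else 1) bs" by blast
  have "\<exists>k. (k < 0) = c \<and> nat_bits (nat \<bar>k\<bar>) = bs"
  proof (cases "bs = []")
    case True
    then have "\<not> c" using r(2) by (auto simp: num_ok_def)
    then show ?thesis using True by (intro exI[of _ 0]) simp
  next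
    case False
    then have "last bs" using r(2) by (simp add: num_ok_def)
    from nat_bits_of_last[OF False this] obtain n where "n > 0" "nat_bits n = bs" by blast
    then show ?thesis by (intro exI[of _ "if c then - int n else int n"]) simp
  qed
  then obtain k where k: "(k < 0) = c" "nat_bits (nat \<bar>k\<bar>) = bs" by blast
  have "w = delimited (int_bits k) @ r" unfolding delimited_int k w w1 r(1) using b by simp
  then show ?thesis by blast
qed

lemma cube_code_simp: "cube_code (x, y, z) = delimited (int_bits x) @ delimited (int_bits y) @ delimited (int_bits z)"
  by (simp add: cube_code_def)

lemma foldl_cube:
  assumes "g \<noteq> []" "0 \<notin> set g"
  shows "\<exists>s' l'. foldl dstep (1, 1, s, l, g, out) (cube_code c) = (1, 1, s', l', tl g, rev (entry (c, hd g)) @ out)"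
proof -
  obtain x y z where c: "c = (x, y, z)" by (metis prod_cases3)
  obtain s1 l1 where 1: "foldl dstep (1, 1, s, l, g, out) (delimited (int_bits x)) = (2, 1, s1, l1, g, 4 # rev (dg x) @ out)"
    using foldl_number[of 1 s l g out x] by (auto simp: nx_def)
  obtain s2 l2 where 2: "foldl dstep (2, 1, s1, l1, g, 4 # rev (dg x) @ out) (delimited (int_bits y)) =
      (3, 1, s2, l2, g, 4 # rev (dg y) @ 4 # rev (dg x) @ out)"
    using foldl_number[of 2 s1 l1 g "4 # rev (dg x) @ out" y] by (auto simp: nx_def)
  have h: "peek g = hd g" "hd g \<noteq> 0" using assms by (cases g; auto)+
  obtain s3 l3 where 3: "foldl dstep (3, 1, s2, l2, g, 4 # rev (dg y) @ 4 # rev (dg x) @ out) (delimited (int_bits z)) =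
      (1, 1, s3, l3, tl g, hd g # rev (dg z) @ 4 # rev (dg y) @ 4 # rev (dg x) @ out)"
    using foldl_number[of 3 s2 l2 g "4 # rev (dg y) @ 4 # rev (dg x) @ out" z] h by (auto simp: nx_def)
  show ?thesis unfolding c cube_code_simp foldl_append 1 2 3 by (simp add: entry_def)
qed

lemma foldl_codes:
  assumes "length cs \<le> length g" "0 \<notin> set g"
  shows "\<exists>s' l'. foldl dstep (1, 1, s, l, g, out) (codes cs) =
    (1, 1, s', l', drop (length cs) g, rev (concat (map entry (zip cs g))) @ out)"
  using assms
proof (induction cs arbitrary: s l g out)
  case Nil
  then show ?case by simp
next
  case (Cons c cs)
  obtain a g' where g: "g = a # g'" using Cons(2) by (cases g) auto
  obtain s1 l1 where 1: "foldl dstep (1, 1, s, l, g, out) (cube_code c) = (1, 1, s1, l1, g', rev (entry (c, a)) @ out)"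
    using foldl_cube[of g s l out c] Cons(3) g by auto
  obtain s2 l2 where 2: "foldl dstep (1, 1, s1, l1, g', rev (entry (c, a)) @ out) (codes cs) =
      (1, 1, s2, l2, drop (length cs) g', rev (concat (map entry (zip cs g'))) @ rev (entry (c, a)) @ out)"
    using Cons(1)[of g' s1 l1 "rev (entry (c, a)) @ out"] Cons(2,3) g by auto
  have e: "codes (c # cs) = cube_code c @ codes cs" by (simp add: codes_def)
  have "foldl dstep (1, 1, s, l, g, out) (codes (c # cs)) =
      (1, 1, s2, l2, drop (length (c # cs)) g, rev (concat (map entry (zip (c # cs) g))) @ out)"
    unfolding e foldl_append 1 2 by (simp add: g)
  then show ?case by blast
qed

text \<open>Ending in phase 1 at coordinate 1 means that the word stops between two cubes. Three
  numbers are removed at a time, and the rest is shorter.\<close>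

lemma codes_of_run:
  "fst (foldl dstep (1, 1, s, l, g, out) w) = 1 \<Longrightarrow> fst (snd (foldl dstep (1, 1, s, l, g, out) w)) = 1 \<Longrightarrow> \<exists>cs. w = codes cs"
proof (induction w arbitrary: s l g out rule: length_induct)
  case (1 w)
  note run = 1(2,3) and IH = 1(1)
  show ?case
  proof (cases "w = []")
    case True
    then show ?thesis by (intro exI[of _ "[]"]) simp
  next
    case False
    from number_of_run[OF run(2) False] obtain x r1 where w: "w = delimited (int_bits x) @ r1" by blast
    obtain s1 l1 g1 o1 where 1: "foldl dstep (1, 1, s, l, g, out) (delimited (int_bits x)) = (2, 1, s1, l1, g1, o1)"
      using foldl_number[of 1 s l g out x] by (auto simp: nx_def)
    have run1: "fst (foldl dstep (2, 1, s1, l1, g1, o1) r1) = 1" "fst (snd (foldl dstep (2, 1, s1, l1, g1, o1) r1)) = 1"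
      using run unfolding w foldl_append 1 by auto
    \<comment> \<open>The run cannot stop here, because the coordinate is 2 and not 1.\<close>
    then have "r1 \<noteq> []" by auto
    from number_of_run[OF run1(2) this] obtain y r2 where r1: "r1 = delimited (int_bits y) @ r2" by blast
    obtain s2 l2 g2 o2 where 2: "foldl dstep (2, 1, s1, l1, g1, o1) (delimited (int_bits y)) = (3, 1, s2, l2, g2, o2)"
      using foldl_number[of 2 s1 l1 g1 o1 y] by (auto simp: nx_def)
    have run2: "fst (foldl dstep (3, 1, s2, l2, g2, o2) r2) = 1" "fst (snd (foldl dstep (3, 1, s2, l2, g2, o2) r2)) = 1"
      using run1 unfolding r1 foldl_append 2 by auto
    then have "r2 \<noteq> []" by auto
    from number_of_run[OF run2(2) this] obtain z r3 where r2: "r2 = delimited (int_bits z) @ r3" by blast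
    obtain s3 l3 g3 o3 where 3: "foldl dstep (3, 1, s2, l2, g2, o2) (delimited (int_bits z)) = (1, 1, s3, l3, g3, o3)"
      using foldl_number[of 3 s2 l2 g2 o2 z] by (auto simp: nx_def)
    have run3: "fst (foldl dstep (1, 1, s3, l3, g3, o3) r3) = 1" "fst (snd (foldl dstep (1, 1, s3, l3, g3, o3) r3)) = 1"
      using run2 unfolding r2 foldl_append 3 by auto
    have "length r3 < length w" unfolding w r1 r2 by (simp add: delimited_def)
    then obtain cs where "r3 = codes cs" using IH run3 by blast
    then have "w = codes ((x, y, z) # cs)" unfolding w r1 r2 by (simp add: codes_def cube_code_simp)
    then show ?thesis by blast
  qed
qed

lemma length_dg: "2 * length (dg k) + 3 = length (delimited (int_bits k))"
  by (simp add: dg_def delimited_int length_concat comp_def sum_list_triv)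

text \<open>Digits take one symbol in an entry but two bits in the code, so the entry list is no
  longer than the input, and the input length bounds every loop of the check.\<close>

lemma length_entries:
  "length cs \<le> length g \<Longrightarrow> length cs \<le> length (concat (map entry (zip cs g))) \<and> length (concat (map entry (zip cs g))) \<le> length (codes cs)"
proof (induction cs arbitrary: g)
  case (Cons c cs)
  obtain a g' where g: "g = a # g'" using Cons(2) by (cases g) auto
  obtain x y z where c: "c = (x, y, z)" by (metis prod_cases3)
  have "codes (c # cs) = cube_code c @ codes cs" by (simp add: codes_def)
  moreover have "length (entry (c, a)) \<le> length (cube_code c)" "1 \<le> length (entry (c, a))"
    using length_dg[of x] length_dg[of y] length_dg[of z] unfolding c cube_code_simp by (simp_all add: entry_def)
  ultimately show ?case using Cons(1)[of g'] Cons(2) unfolding g by simp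
qed simp

subsection \<open>Membership in NP\<close>

text \<open>Directions as three digits in base 3, shifted by 5 because the symbols up to 4 serve as
  digits and separators.\<close>

definition dec :: "nat \<Rightarrow> cube" where
  "dec l = (int ((l - 5) mod 3) - 1, int ((l - 5) div 3 mod 3) - 1, int ((l - 5) div 9) - 1)"

fun enc :: "cube \<Rightarrow> nat" where
  "enc (dx, dy, dz) = nat (dx + 1) + 3 * nat (dy + 1) + 9 * nat (dz + 1) + 5"

lemma dec_enc: "d \<in> dirs \<Longrightarrow> dec (enc d) = d"
  unfolding dirs_def by (auto simp: dec_def)

lemma enc_bounds: "d \<in> dirs \<Longrightarrow> 5 \<le> enc d \<and> enc d < 32"
  unfolding dirs_def by auto

text \<open>Looks for an entry at the corner \<open>(i, j, k)\<close> of the box of the first entry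
  that names the same box. The eight triples reach the four cubes of the box, each of them twice
  because one coordinate of the direction is 0.\<close>

definition pcond :: "int \<times> int \<times> int \<Rightarrow> pair_cond" where
  "pcond = (\<lambda>(i, j, k) la lb p q r. case dec la of (dx, dy, dz) \<Rightarrow>
     p = cc (i * dx) \<and> q = cc (j * dy) \<and> r = cc (k * dz) \<and>
     box (i * dx, j * dy, k * dz) (dec lb) = box (0, 0, 0) (dec la))"

text \<open>Detects a cube with two different labels. A region may list a cube repeatedly, and the
  guess labels each occurrence separately.\<close>

definition zcond :: pair_cond where
  "zcond la lb p q r \<longleftrightarrow> p = cc 0 \<and> q = cc 0 \<and> r = cc 0 \<and> la \<noteq> lb"

definition conds :: "(pair_cond \<times> bool) list" where
  "conds = (zcond, False) # map (\<lambda>t. (pcond t, True)) (List.product [0, 1] (List.product [0, 1] [0, 1]))"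

text \<open>Saturation at 2 still separates -1, 0 and 1 from each other and from everything
  else.\<close>

lemma cc_eq_iff: "\<bar>d\<bar> \<le> 1 \<Longrightarrow> cc e = cc d \<longleftrightarrow> e = d"
  by (auto simp: cc_def clip_def max_def min_def split: if_splits)

lemma box_translate:
  "box (x + u, y + v, z + t) d = box (x + u', y + v', z + t') d' \<longleftrightarrow> box (u, v, t) d = box (u', v', t') d'"
proof -
  let ?f = "\<lambda>(p, q, r). (x + p, y + q, z + r)"
  have e: "box (x + u, y + v, z + t) d = ?f ` box (u, v, t) d" for u v t d
  proof -
    obtain dx dy dz where d: "d = (dx, dy, dz)" by (metis prod_cases3)
    have "?f ` ({u, u + dx} \<times> {v, v + dy} \<times> {t, t + dz}) = {x + u, x + (u + dx)} \<times> {y + v, y + (v + dy)} \<times> {z + t, z + (t + dz)}"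
      by force
    then show ?thesis unfolding d by (simp add: add.assoc)
  qed
  have "inj ?f" by (auto simp: inj_def)
  then show ?thesis unfolding e by (rule inj_image_eq_iff)
qed

definition verified :: "(cube \<times> nat) set \<Rightarrow> bool" where
  "verified E \<longleftrightarrow> (\<forall>c l l'. (c, l) \<in> E \<longrightarrow> (c, l') \<in> E \<longrightarrow> l = l') \<and>
     (\<forall>c l c'. (c, l) \<in> E \<longrightarrow> c' \<in> box c (dec l) \<longrightarrow> (\<exists>l'. (c', l') \<in> E \<and> box c' (dec l') = box c (dec l)))"

lemma pcond_hit:
  assumes "dec l = (dx, dy, dz)" "(dx, dy, dz) \<in> dirs" "i \<in> {0, 1}" "j \<in> {0, 1}" "k \<in> {0, 1}"
  shows "hit (pcond (i, j, k)) ((x, y, z), l) ((x', y', z'), l') \<longleftrightarrow>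
    x' = x + i * dx \<and> y' = y + j * dy \<and> z' = z + k * dz \<and> box (x', y', z') (dec l') = box (x, y, z) (dec l)"
proof -
  have b: "\<bar>i * dx\<bar> \<le> 1" "\<bar>j * dy\<bar> \<le> 1" "\<bar>k * dz\<bar> \<le> 1" using assms(2-5) by (auto simp: dirs_iff)
  have t: "box (x + i * dx, y + j * dy, z + k * dz) (dec l') = box (x, y, z) (dec l) \<longleftrightarrow>
     box (i * dx, j * dy, k * dz) (dec l') = box (0, 0, 0) (dec l)"
    using box_translate[of x "i * dx" y "j * dy" z "k * dz" "dec l'" 0 0 0 "dec l"] by simp
  have "hit (pcond (i, j, k)) ((x, y, z), l) ((x', y', z'), l') \<longleftrightarrow>
      x' - x = i * dx \<and> y' - y = j * dy \<and> z' - z = k * dz \<and> box (i * dx, j * dy, k * dz) (dec l') = box (0, 0, 0) (dec l)"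
    unfolding hit.simps pcond_def using cc_eq_iff[OF b(1)] cc_eq_iff[OF b(2)] cc_eq_iff[OF b(3)] assms(1) by simp
  also have "\<dots> \<longleftrightarrow> x' = x + i * dx \<and> y' = y + j * dy \<and> z' = z + k * dz \<and> box (x', y', z') (dec l') = box (x, y, z) (dec l)"
    unfolding t[symmetric] by (auto simp: algebra_simps simp del: box.simps)
  finally show ?thesis .
qed

lemma conds_iff:
  assumes "\<And>c l. (c, l) \<in> set es \<Longrightarrow> dec l \<in> dirs"
  shows "(\<forall>q\<in>set conds. pairs_ok es q) \<longleftrightarrow> verified (set es)"
proof -
  have 1: "pairs_ok es (zcond, False) \<longleftrightarrow> (\<forall>c l l'. (c, l) \<in> set es \<longrightarrow> (c, l') \<in> set es \<longrightarrow> l = l')"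
  proof -
    have h: "hit zcond (c, l) (c', l') \<longleftrightarrow> c = c' \<and> l \<noteq> l'" for c l c' l'
    proof -
      obtain x y z x' y' z' where c: "c = (x, y, z)" "c' = (x', y', z')" by (metis prod_cases3)
      show ?thesis unfolding c hit.simps zcond_def using cc_eq_iff[of 0] by auto
    qed
    have "pairs_ok es (zcond, False) \<longleftrightarrow> (\<forall>a\<in>set es. \<forall>e\<in>set es. \<not> hit zcond a e)" by (simp add: pairs_ok_def)
    also have "\<dots> \<longleftrightarrow> (\<forall>c l c' l'. (c, l) \<in> set es \<longrightarrow> (c', l') \<in> set es \<longrightarrow> \<not> hit zcond (c, l) (c', l'))" by fast
    finally show ?thesis unfolding h by blast
  qed
  have set: "set (List.product [0, 1] (List.product [0, 1] [0, 1])) = ({0, 1} \<times> {0, 1} \<times> {0, 1} :: (int \<times> int \<times> int) set)"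
    by auto
  have 2: "(\<forall>t\<in>{0, 1} \<times> {0, 1} \<times> {0, 1}. \<exists>e\<in>set es. hit (pcond t) (c, l) e) \<longleftrightarrow>
     (\<forall>c'\<in>box c (dec l). \<exists>l'. (c', l') \<in> set es \<and> box c' (dec l') = box c (dec l))" (is "?L \<longleftrightarrow> ?R") if cl: "(c, l) \<in> set es" for c l
  proof -
    obtain x y z where c: "c = (x, y, z)" by (metis prod_cases3)
    obtain dx dy dz where d: "dec l = (dx, dy, dz)" by (metis prod_cases3)
    have dd: "(dx, dy, dz) \<in> dirs" using assms[OF cl] d by simp
    have h: "(\<exists>e\<in>set es. hit (pcond (i, j, k)) (c, l) e) \<longleftrightarrow>
        (\<exists>l'. ((x + i * dx, y + j * dy, z + k * dz), l') \<in> set es \<and> box (x + i * dx, y + j * dy, z + k * dz) (dec l') = box c (dec l))"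
      (is "?A \<longleftrightarrow> ?B") if "i \<in> {0, 1}" "j \<in> {0, 1}" "k \<in> {0, 1}" for i j k
    proof
      assume ?A
      then obtain e where e: "e \<in> set es" "hit (pcond (i, j, k)) (c, l) e" by blast
      obtain x' y' z' l' where "e = ((x', y', z'), l')" by (metis prod_cases3 prod.exhaust)
      then show ?B using e pcond_hit[OF d dd that, of x y z x' y' z' l'] unfolding c by auto
    next
      assume ?B
      then obtain l' where l': "((x + i * dx, y + j * dy, z + k * dz), l') \<in> set es"
        "box (x + i * dx, y + j * dy, z + k * dz) (dec l') = box c (dec l)" by blast
      then have "hit (pcond (i, j, k)) (c, l) ((x + i * dx, y + j * dy, z + k * dz), l')"
        unfolding c pcond_hit[OF d dd that] by simp
      then show ?A using l'(1) by blast
    qed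
    let ?P = "\<lambda>c'. \<exists>l'. (c', l') \<in> set es \<and> box c' (dec l') = box c (dec l)"
    have "?L \<longleftrightarrow> (\<forall>i\<in>{0, 1}. \<forall>j\<in>{0, 1}. \<forall>k\<in>{0, 1}. \<exists>e\<in>set es. hit (pcond (i, j, k)) (c, l) e)" by blast
    also have "\<dots> \<longleftrightarrow> (\<forall>i\<in>{0, 1}. \<forall>j\<in>{0, 1}. \<forall>k\<in>{0, 1}. ?P (x + i * dx, y + j * dy, z + k * dz))"
      using h by (intro ball_cong refl) blast
    also have "\<dots> \<longleftrightarrow> (\<forall>c'\<in>{x, x + dx} \<times> {y, y + dy} \<times> {z, z + dz}. ?P c')"
      by (simp add: ball_Un conj_ac del: split_paired_Ex)
    also have "\<dots> \<longleftrightarrow> ?R" using d by (simp add: c)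
    finally show ?thesis .
  qed
  have 3: "(\<forall>t\<in>{0, 1} \<times> {0, 1} \<times> {0, 1}. pairs_ok es (pcond t, True)) \<longleftrightarrow>
     (\<forall>c l c'. (c, l) \<in> set es \<longrightarrow> c' \<in> box c (dec l) \<longrightarrow> (\<exists>l'. (c', l') \<in> set es \<and> box c' (dec l') = box c (dec l)))"
  proof -
    have "(\<forall>t\<in>{0, 1} \<times> {0, 1} \<times> {0, 1}. pairs_ok es (pcond t, True)) \<longleftrightarrow>
        (\<forall>a\<in>set es. \<forall>t\<in>{0, 1} \<times> {0, 1} \<times> {0, 1}. \<exists>e\<in>set es. hit (pcond t) a e)"
      unfolding pairs_ok_def by auto
    also have "\<dots> \<longleftrightarrow> (\<forall>c l. (c, l) \<in> set es \<longrightarrow> (\<forall>t\<in>{0, 1} \<times> {0, 1} \<times> {0, 1}. \<exists>e\<in>set es. hit (pcond t) (c, l) e))" by fast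
    also have "\<dots> \<longleftrightarrow> (\<forall>c l. (c, l) \<in> set es \<longrightarrow> (\<forall>c'\<in>box c (dec l). \<exists>l'. (c', l') \<in> set es \<and> box c' (dec l') = box c (dec l)))"
      using 2 by (intro all_cong1 imp_cong refl) 
    finally show ?thesis by (simp only: Ball_def) blast
  qed
  have "(\<forall>q\<in>set conds. pairs_ok es q) \<longleftrightarrow> pairs_ok es (zcond, False) \<and>
     (\<forall>t\<in>set (List.product [0, 1] (List.product [0, 1] [0, 1])). pairs_ok es (pcond t, True))"
    unfolding conds_def list.set set_map by (simp only: ball_simps(5,7,9) image_iff)
  then show ?thesis unfolding set 1 3 verified_def .
qed

text \<open>Agreement on repeated cubes makes the guessed labels a function of the cube, and the
  pair conditions are then those of a labelling.\<close>

lemma verified_iff_labelling: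
  "(\<exists>ls. length ls = length cs \<and> set ls \<subseteq> enc ` dirs \<and> verified (set (zip cs ls))) \<longleftrightarrow> admits_tiling (set cs) slab"
  unfolding admits_tiling_iff_labelling
proof
  assume "\<exists>ls. length ls = length cs \<and> set ls \<subseteq> enc ` dirs \<and> verified (set (zip cs ls))"
  then obtain ls where ls: "length ls = length cs" "set ls \<subseteq> enc ` dirs" "verified (set (zip cs ls))" by blast
  let ?E = "set (zip cs ls)"
  have v1: "l = l'" if "(c, l) \<in> ?E" "(c, l') \<in> ?E" for c l l' using ls(3) that unfolding verified_def by blast
  have v2: "\<exists>l'. (c', l') \<in> ?E \<and> box c' (dec l') = box c (dec l)" if "(c, l) \<in> ?E" "c' \<in> box c (dec l)" for c l c'
    using ls(3) that unfolding verified_def by blast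
  define \<delta> where "\<delta> = (\<lambda>c. dec (THE l. (c, l) \<in> ?E))"
  have \<delta>: "\<delta> c = dec l" if "(c, l) \<in> ?E" for c l
    unfolding \<delta>_def using that v1 by (metis (mono_tags, lifting) the_equality)
  have E: "\<exists>l. (c, l) \<in> ?E" if "c \<in> set cs" for c
    using that ls(1) by (metis in_set_conv_nth in_set_zip fst_conv snd_conv)
  have E1: "c \<in> set cs" if "(c, l) \<in> ?E" for c l using that by (rule set_zip_leftD)
  have E2: "dec l \<in> dirs" if "(c, l) \<in> ?E" for c l using set_zip_rightD[OF that] ls(2) dec_enc by auto
  have "labelling (set cs) \<delta>" unfolding labelling_def
  proof (intro ballI conjI subsetI)
    fix c assume "c \<in> set cs"
    then obtain l where l: "(c, l) \<in> ?E" using E by blast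
    show "\<delta> c \<in> dirs" using \<delta>[OF l] E2[OF l] by simp
    fix c' assume "c' \<in> box c (\<delta> c)"
    then obtain l' where l': "(c', l') \<in> ?E" "box c' (dec l') = box c (dec l)" using v2[OF l] \<delta>[OF l] by metis
    show "c' \<in> set cs" using E1[OF l'(1)] .
    show "box c' (\<delta> c') = box c (\<delta> c)" using l'(2) \<delta>[OF l] \<delta>[OF l'(1)] by simp
  qed
  then show "\<exists>\<delta>. labelling (set cs) \<delta>" by blast
next
  assume "\<exists>\<delta>. labelling (set cs) \<delta>"
  then obtain \<delta> where \<delta>: "labelling (set cs) \<delta>" by blast
  have d: "\<delta> c \<in> dirs" "c' \<in> box c (\<delta> c) \<Longrightarrow> c' \<in> set cs" "c' \<in> box c (\<delta> c) \<Longrightarrow> box c' (\<delta> c') = box c (\<delta> c)"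
    if "c \<in> set cs" for c c' using \<delta> that unfolding labelling_def by blast+
  let ?ls = "map (\<lambda>c. enc (\<delta> c)) cs"
  have z: "(c, l) \<in> set (zip cs ?ls) \<longleftrightarrow> c \<in> set cs \<and> l = enc (\<delta> c)" for c l
    by (auto simp: zip_map2 zip_same_conv_map)
  have "verified (set (zip cs ?ls))" unfolding verified_def z
  proof (intro conjI allI impI)
    fix c l c' assume c: "c \<in> set cs \<and> l = enc (\<delta> c)" "c' \<in> box c (dec l)"
    then have e: "dec l = \<delta> c" using dec_enc[OF d(1)] by simp
    have c': "c' \<in> set cs" "box c' (\<delta> c') = box c (\<delta> c)" using d(2,3)[of c c'] c e by auto
    show "\<exists>l'. (c' \<in> set cs \<and> l' = enc (\<delta> c')) \<and> box c' (dec l') = box c (dec l)"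
      using c' dec_enc[OF d(1)[OF c'(1)]] e by (intro exI[of _ "enc (\<delta> c')"]) simp
  qed auto
  moreover have "set ?ls \<subseteq> enc ` dirs" using d(1) by auto
  ultimately show "\<exists>ls. length ls = length cs \<and> set ls \<subseteq> enc ` dirs \<and> verified (set (zip cs ls))"
    by (intro exI[of _ ?ls]) simp
qed

definition check_cmd :: com where
  "check_cmd = seqs [move id 7 8, push 21 1, seqs (map pairs_cmd conds), Cond (\<lambda>a. a 21 = 1) (push 0 1) (seqs [])]"

text \<open>Moving the input to stack 2 brings its first bit to the top and empties stack 0, which
  is nonempty at the end only if the check has pushed a symbol. The final test requires that reading
  stopped between two cubes.\<close>

definition verify_cmd :: com where
  "verify_cmd = seqs [move id 0 2, push 3 1, push 4 1, push 5 1, push 6 1, reader,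
     Cond (\<lambda>a. a 3 = 1 \<and> a 4 = 1) check_cmd (seqs [])]"

lemma okc_verify: "okc 23 32 verify_cmd"
proof -
  have 1: "okc 23 32 reader" by (auto simp: reader_def rops_def nx_def)
  have h: "hc x y < 32" for x y by (simp add: hc_def)
  have 2: "okc 23 32 (diff_cmd j m)" if "j < 23" "m < 23" for j m
    using that h by (auto simp: diff_cmd_def sub_loop_def horner_def)
  have 3: "okc 23 32 (inner C)" for C using 2 by (auto simp: inner_def look_def)
  have 4: "okc 23 32 (rd j)" if "j < 23" for j using that by (auto simp: rd_def)
  have 5: "okc 23 32 (pairs_cmd q)" for q using 3 4 by (auto simp: pairs_cmd_def outer_body_def)
  have 6: "okc 23 32 check_cmd" using 5 by (auto simp: check_cmd_def)
  show ?thesis using 1 6 by (auto simp: verify_cmd_def)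
qed

definition tV :: "nat \<Rightarrow> nat" where "tV n = length conds * (tA n + 1) + 8 * n + 50"

lemma runs_check:
  assumes cs: "length cs \<le> length g" "set g \<subseteq> enc ` dirs" "length (codes cs) \<le> n"
    and \<sigma>: "\<sigma> = dst [] (1, 1, s, l, drop (length cs) g, rev (concat (map entry (zip cs g))))"
  shows "\<exists>\<sigma>'. runs check_cmd \<sigma> (length conds * (tA n + 1) + 2 * n + 20) \<sigma>' \<and> (\<sigma>' 0 \<noteq> [] \<longleftrightarrow> verified (set (zip cs g)))"
proof -
  let ?es = "zip cs g" let ?A = "concat (map entry ?es)"
  have g5: "5 \<le> a" if "a \<in> set g" for a using that cs(2) enc_bounds by auto
  have nA: "length ?A \<le> n" "length ?es \<le> n" using length_entries[OF cs(1)] cs(1,3) by auto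
  have es: "length (entry e) \<le> n \<and> 4 \<le> snd e" if "e \<in> set ?es" for e
  proof
    have "length (entry e) \<le> length ?A" unfolding length_concat using that by (intro member_le_sum_list) auto
    then show "length (entry e) \<le> n" using nA(1) by simp
    have "snd e \<in> set g" using that by (metis prod.collapse set_zip_rightD)
    then show "4 \<le> snd e" using g5 by fastforce
  qed
  have A0: "a \<noteq> 0" if "a \<in> set ?A" for a
  proof -
    obtain x y z l where "((x, y, z), l) \<in> set ?es" "a \<in> set (entry ((x, y, z), l))" using \<open>a \<in> set ?A\<close> by auto
    then show ?thesis using es[of "((x, y, z), l)"] set_dg[of x] set_dg[of y] set_dg[of z] by (auto simp: entry_def)
  qed
  have A00: "0 \<notin> set ?A" using A0 by blast
  let ?\<tau> = "\<sigma>(7 := [])"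
  let ?v = "\<lambda>p. vst ?\<tau> ?A [] [] [] [] [] [] [] p"
  have 1: "runs (move id 7 8) \<sigma> (2 * n + 1) (?v [])"
    by (rule runs_eq[OF runs_move]) (use nA(1) A0 A00 in \<open>auto simp: \<sigma> vst_def simp del: set_concat intro!: ext\<close>)
  have 2: "runs (push 21 1) (?v []) 1 (?v [1])" by (rule runs_eq[OF runs_push]) (auto simp: vst_def intro!: ext)
  define ok where "ok \<longleftrightarrow> (\<forall>q\<in>set conds. pairs_ok ?es q)"
  let ?p = "[if ok then 1 else 2]"
  define z where "z = length conds * (tA n + 1)"
  have 3: "runs (seqs (map pairs_cmd conds)) (?v [1]) (z + 1) (?v ?p)"
    unfolding ok_def z_def by (rule runs_all_pairs[OF refl nA]) (rule es)
  let ?\<sigma>' = "if ok then (?v ?p)(0 := [1]) else ?v ?p"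
  have 4: "runs (Cond (\<lambda>a. a 21 = 1) (push 0 1) (seqs [])) (?v ?p) (1 + 1) ?\<sigma>'"
  proof (rule runs_Cond)
    have p: "peeks (?v ?p) 21 = (if ok then 1 else 2)" by (simp add: vst_def)
    have "runs (push 0 1) (?v ?p) 1 ((?v ?p)(0 := [1]))" by (rule runs_eq[OF runs_push]) (auto simp: \<sigma> vst_def intro!: ext)
    then show "runs (if peeks (?v ?p) 21 = 1 then push 0 1 else seqs []) (?v ?p) 1 ?\<sigma>'"
      unfolding p using runs_seqs_Nil by (cases ok) simp_all
  qed
  have "runs check_cmd \<sigma> (z + 2 * n + 20) ?\<sigma>'" unfolding check_cmd_def
    by (rule runs_mono[OF runs_seqs_Cons[OF 1 runs_seqs_Cons[OF 2 runs_seqs_Cons[OF 3 runs_seqs_Cons[OF 4 runs_seqs_Nil]]]]]) simp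
  moreover have "?\<sigma>' 0 \<noteq> [] \<longleftrightarrow> ok" by (simp add: vst_def \<sigma>)
  moreover have "ok \<longleftrightarrow> verified (set ?es)"
    unfolding ok_def by (rule conds_iff) (use cs(2) dec_enc in \<open>auto dest!: set_zip_rightD\<close>)
  ultimately show ?thesis unfolding z_def by (intro exI[of _ ?\<sigma>']) simp
qed

lemma length_codes: "length cs \<le> length (codes cs)"
proof (induction cs)
  case (Cons c cs)
  have "1 \<le> length (cube_code c)" using cube_code_nonempty[of c] by (cases "cube_code c") auto
  then show ?case using Cons by (simp add: codes_def)
qed simp

lemma runs_verify:
  assumes "length g = length w" "set g \<subseteq> enc ` dirs"
  shows "\<exists>\<sigma>'. runs verify_cmd (start_stacks w g) (tV (length w)) \<sigma>' \<and>
    (\<sigma>' 0 \<noteq> [] \<longleftrightarrow> (\<exists>cs. w = codes cs \<and> verified (set (zip cs (rev g)))))"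
proof -
  let ?n = "length w" and ?q = "foldl dstep (1, 1, 1, 1, rev g, []) w"
  define p where "p = (\<lambda>a b c d :: nat list. (\<lambda>_. [])(1 := rev g, 2 := bits w, 3 := a, 4 := b, 5 := c, 6 := d) :: stacks)"
  have bz: "x \<noteq> 0" if "x \<in> set (bits (rev w))" for x using bits_set(1)[OF that] by auto
  have 1: "runs (move id 0 2) (start_stacks w g) (2 * ?n + 1) (p [] [] [] [])"
    by (rule runs_eq[OF runs_move]) (use bz bits_set(2)[of "rev w"] in \<open>auto simp: start_stacks_def p_def intro!: ext\<close>)
  have 2: "runs (push 3 1) (p [] [] [] []) 1 (p [1] [] [] [])" by (rule runs_eq[OF runs_push]) (auto simp: p_def intro!: ext)
  have 3: "runs (push 4 1) (p [1] [] [] []) 1 (p [1] [1] [] [])" by (rule runs_eq[OF runs_push]) (auto simp: p_def intro!: ext)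
  have 4: "runs (push 5 1) (p [1] [1] [] []) 1 (p [1] [1] [1] [])" by (rule runs_eq[OF runs_push]) (auto simp: p_def intro!: ext)
  have 5: "runs (push 6 1) (p [1] [1] [1] []) 1 (dst w (1, 1, 1, 1, rev g, []))"
    by (rule runs_eq[OF runs_push]) (auto simp: p_def intro!: ext)
  note 6 = runs_reader[of w "(1, 1, 1, 1, rev g, [])"]
  have "\<exists>\<sigma>'. runs (if peeks (dst [] ?q) 3 = 1 \<and> peeks (dst [] ?q) 4 = 1 then check_cmd else seqs []) (dst [] ?q)
      (length conds * (tA ?n + 1) + 2 * ?n + 20) \<sigma>' \<and> (\<sigma>' 0 \<noteq> [] \<longleftrightarrow> (\<exists>cs. w = codes cs \<and> verified (set (zip cs (rev g)))))"
  proof (cases "\<exists>cs. w = codes cs")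
    case True
    then obtain cs where cs: "w = codes cs" by blast
    \<comment> \<open>The list of cubes is determined by the word, so the existential claim reduces
      to the list that was read.\<close>
    have u: "w = codes cs' \<longleftrightarrow> cs' = cs" for cs'
      using concat_cube_code_inject[of cs' cs] unfolding cs codes_def by auto
    have lg: "length cs \<le> length (rev g)" using length_codes[of cs] assms(1) cs by simp
    have "0 \<notin> set (rev g)" using assms(2) enc_bounds by fastforce
    from foldl_codes[OF lg this, of 1 1 "[]"] obtain s l where
      q: "?q = (1, 1, s, l, drop (length cs) (rev g), rev (concat (map entry (zip cs (rev g)))))" unfolding cs by auto
    have dq: "dst [] ?q = dst [] (1, 1, s, l, drop (length cs) (rev g), rev (concat (map entry (zip cs (rev g)))))"
      unfolding q ..
    have "peeks (dst [] ?q) 3 = 1 \<and> peeks (dst [] ?q) 4 = 1" unfolding q by simp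
    moreover have "\<exists>\<sigma>'. runs check_cmd (dst [] ?q) (length conds * (tA ?n + 1) + 2 * ?n + 20) \<sigma>' \<and>
       (\<sigma>' 0 \<noteq> [] \<longleftrightarrow> verified (set (zip cs (rev g))))"
      by (rule runs_check[OF lg _ _ dq]) (use assms(2) cs in auto)
    ultimately show ?thesis unfolding u by simp
  next
    case False
    obtain i ph s l g' out where q: "?q = (i, ph, s, l, g', out)" by (metis prod_cases6)
    have "\<not> (i = 1 \<and> ph = 1)" using codes_of_run[of 1 1 "rev g" "[]" w] False unfolding q by auto
    then have c: "\<not> (peeks (dst [] ?q) 3 = 1 \<and> peeks (dst [] ?q) 4 = 1)" unfolding q by simp
    have "runs (seqs []) (dst [] ?q) (length conds * (tA ?n + 1) + 2 * ?n + 20) (dst [] ?q)"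
      by (rule runs_mono[OF runs_seqs_Nil]) simp
    moreover have "dst [] ?q 0 = []" unfolding q by simp
    ultimately show ?thesis unfolding if_not_P[OF c] using False by (intro exI[of _ "dst [] ?q"]) auto
  qed
  then obtain \<sigma>' where s: "runs (if peeks (dst [] ?q) 3 = 1 \<and> peeks (dst [] ?q) 4 = 1 then check_cmd else seqs []) (dst [] ?q)
      (length conds * (tA ?n + 1) + 2 * ?n + 20) \<sigma>'" "\<sigma>' 0 \<noteq> [] \<longleftrightarrow> (\<exists>cs. w = codes cs \<and> verified (set (zip cs (rev g))))" by blast
  note 7 = runs_Cond[of "\<lambda>a. a 3 = 1 \<and> a 4 = 1", OF s(1)]
  have "runs verify_cmd (start_stacks w g) (tV ?n) \<sigma>'" unfolding verify_cmd_def
    by (rule runs_mono[OF runs_seqs_Cons[OF 1 runs_seqs_Cons[OF 2 runs_seqs_Cons[OF 3 runs_seqs_Cons[OF 4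
      runs_seqs_Cons[OF 5 runs_seqs_Cons[OF 6 runs_seqs_Cons[OF 7 runs_seqs_Nil]]]]]]]]) (simp add: tV_def)
  then show ?thesis using s(2) by blast
qed

theorem slab_tiling_in_NP: "{w. \<exists>\<Gamma>. finite \<Gamma> \<and> encodes_region w \<Gamma> \<and> admits_tiling \<Gamma> slab} \<in> NP"
proof -
  let ?G = "enc ` dirs"
  have "\<forall>x. \<exists>\<sigma>'. length (snd x) = length (fst x) \<and> set (snd x) \<subseteq> ?G \<longrightarrow>
     runs verify_cmd (start_stacks (fst x) (snd x)) (tV (length (fst x))) \<sigma>' \<and>
     (\<sigma>' 0 \<noteq> [] \<longleftrightarrow> (\<exists>cs. fst x = codes cs \<and> verified (set (zip cs (rev (snd x))))))"
    using runs_verify by blast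
  from choice[OF this] obtain F where F0: "\<forall>x. length (snd x) = length (fst x) \<and> set (snd x) \<subseteq> ?G \<longrightarrow>
     runs verify_cmd (start_stacks (fst x) (snd x)) (tV (length (fst x))) (F x) \<and>
     (F x 0 \<noteq> [] \<longleftrightarrow> (\<exists>cs. fst x = codes cs \<and> verified (set (zip cs (rev (snd x))))))"
    by (elim exE) (rule that)
  have F: "runs verify_cmd (start_stacks w g) (tV (length w)) (F (w, g)) \<and>
     (F (w, g) 0 \<noteq> [] \<longleftrightarrow> (\<exists>cs. w = codes cs \<and> verified (set (zip cs (rev g)))))"
    if "length g = length w" "set g \<subseteq> ?G" for w g
    using F0[rule_format, of "(w, g)"] that by simp
  have G: "?G \<subseteq> {1..<32}" using enc_bounds by fastforce
  have tV: "pbound tV" unfolding tV_def tA_def tO_def by (intro pbound_add pbound_mult pbound_const pbound_id)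
  have "{w. \<exists>g. length g = length w \<and> set g \<subseteq> ?G \<and> F (w, g) 0 \<noteq> []} \<in> NP"
    by (rule NP_by_program[OF okc_verify _ _ G tV]) (use F in simp_all)
  moreover have "(\<exists>g. length g = length w \<and> set g \<subseteq> ?G \<and> F (w, g) 0 \<noteq> []) \<longleftrightarrow>
     (\<exists>\<Gamma>. finite \<Gamma> \<and> encodes_region w \<Gamma> \<and> admits_tiling \<Gamma> slab)" (is "?L \<longleftrightarrow> ?R") for w
  proof
    assume ?L
    then obtain g where g: "length g = length w" "set g \<subseteq> ?G" "F (w, g) 0 \<noteq> []" by blast
    then obtain cs where cs: "w = codes cs" "verified (set (zip cs (rev g)))" using F by blast
    let ?ls = "take (length cs) (rev g)"
    have l: "length ?ls = length cs" using length_codes[of cs] g(1) cs(1) by simp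
    \<comment> \<open>The guess is as long as the word and so has at least one label per listed
      cube; surplus labels are cut off.\<close>
    have z: "zip cs (rev g) = zip cs ?ls" using take_zip[of "length cs" cs "rev g"] by simp
    have "set ?ls \<subseteq> ?G" using g(2) set_take_subset[of "length cs" "rev g"] by auto
    then have "admits_tiling (set cs) slab" using verified_iff_labelling[of cs] l cs(2) z by metis
    then show ?R using cs(1) unfolding encodes_region_def codes_def by blast
  next
    assume ?R
    then obtain cs where cs: "w = codes cs" "admits_tiling (set cs) slab" unfolding encodes_region_def codes_def by blast
    then obtain ls where ls: "length ls = length cs" "set ls \<subseteq> ?G" "verified (set (zip cs ls))"
      using verified_iff_labelling[of cs] by blast
    have d: "(1, 1, 0) \<in> dirs" by (simp add: dirs_iff)
    \<comment> \<open>A guess must have the length of the word, so the labels are padded by an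
      arbitrary direction; the reversal undoes the one on the stack.\<close>
    let ?g = "rev (ls @ replicate (length w - length cs) (enc (1, 1, 0)))"
    have 1: "length ?g = length w" using ls(1) length_codes[of cs] cs(1) by simp
    have "set ?g \<subseteq> set ls \<union> {enc (1, 1, 0)}" by (auto simp del: enc.simps)
    then have 2: "set ?g \<subseteq> ?G" using ls(2) imageI[OF d, of enc] by blast
    have "zip cs (rev ?g) = zip cs ls" using ls(1) by (simp add: zip_append2)
    then have "F (w, ?g) 0 \<noteq> []" using F[OF 1 2] cs(1) ls(3) by auto
    then show ?L using 1 2 by blast
  qed
  ultimately show ?thesis by simp
qed

theorem theorem1p1: "NP_complete {w. \<exists>\<Gamma>. finite \<Gamma> \<and> encodes_region w \<Gamma> \<and> admits_tiling \<Gamma> slab}"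
  unfolding NP_complete_def using slab_tiling_in_NP slab_tiling_NP_hard by blast

end
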